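(* Let $\mu_+,\mu_-\in\mathcal{M}_+(\partial\Omega)$ have equal mass, and let $M$, $\mathcal{C}$, $\tilde{\mathcal{K}}$, $\tilde{\mathcal{G}}$ be the associated objects defined in the context. Then $\tilde{\mathcal{G}}$ has a minimizer on $\mathcal{C}$, and we have the strong duality $$\min_{v\in\mathcal{C}}\tilde{\mathcal{G}}(v)=\min_{v\in\mathcal{C}}\sup_{\phi\in\tilde{\mathcal{K}}}\int_{\overline\Omega\times[0,M]}\phi\cdot dDv=\sup_{\phi\in\tilde{\mathcal{K}}}\inf_{v\in\mathcal{C}}\int_{\overline\Omega\times[0,M]}\phi\cdot dDv=\sup_{\phi\in\tilde{\mathcal{K}}\cap C^1(\overline\Omega\times[0,M];\mathbb{R}^2\times\mathbb{R})}\mathcal{D}(\phi),$$ where $$\mathcal{D}(\phi)=\int_{\partial(\Omega\times(0,M))}1_{u(\mu_+,\mu_-)}\,\phi\cdot n\,d\mathcal{H}^2-\int_{\Omega\times(0,M)}\max\{0,\operatorname{div}\phi\}\,dx\,ds.$$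
   Context: Notation: $\mathcal{M}_+(A)$ denotes nonnegative finite Radon measures on $A$, $\mathcal{H}^k$ the $k$-dimensional Hausdorff measure, $n$ the outward unit normal. $\Omega\subset\mathbb{R}^2$ is a bounded, open, convex domain and $V=B_1(\Omega)$ is its open $1$-neighbourhood. Points of $V\times\mathbb{R}$ are written $(x,s)$. A transportation cost is a non-decreasing, concave, lower semi-continuous function $\tau:[0,\infty)\to[0,\infty)$ with $\tau(0)=0$; $\tau'(0)\in(0,\infty]$ denotes its right derivative at $0$. A transportation cost $\tau$ is fixed. Let $\gamma:[0,\mathcal{H}^1(\partial\Omega))\to\partial\Omega$ be a counterclockwise arclength parameterization of $\partial\Omega$, $\partial\Omega_t=\gamma([0,t))$, and let $\pi_{\partial\Omega}(x)$ be the closest point of $\partial\Omega$ to $x\in V\setminus\Omega$. Define $u(\mu_+,\mu_-):V\setminus\Omega\to\mathbb{R}$, $u(\mu_+,\mu_-)(x)=(\mu_+-\mu_-)\big(\partial\Omega_{\gamma^{-1}(\pi_{\partial\Omega}(x))}\big)$. It is assumed (without loss of generality) that $u(\mu_+,\mu_-)$ takes minimum value $0$ and maximum value $M\le\|\mu_+\|_{\mathcal{M}}$. $1_{u(\mu_+,\mu_-)}(x,s)=1$ if $u(\mu_+,\mu_-)(x)>s$ and $0$ otherwise, for $x\in V\setminus\Omega$; it is extended by $1$ to $V\times(-\infty,0)$ and by $0$ to $V\times(M,\infty)$ (so in the boundary integral its value is $1$ on $\Omega\times\{0\}$ and $0$ on $\Omega\times\{M\}$). Set $$\mathcal{C}=\{v\in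 BV_{\mathrm{loc}}(V\times\mathbb{R};[0,1])\mid v=1_{u(\mu_+,\mu_-)}\text{ on }(V\times\mathbb{R})\setminus(\overline\Omega\times[0,M])\},$$ $$\tilde{\mathcal{K}}=\Big\{\phi=(\phi^x,\phi^s)\in C^0(\overline\Omega\times[0,M];\mathbb{R}^2\times[0,\infty))\ \Big|\ |\phi^x(x,s)|\le\tau'(0),\ \phi^s(x,s)\ge0\ \forall(x,s)\in\overline\Omega\times[0,M],\ \Big|\int_{s_1}^{s_2}\phi^x(x,s)\,ds\Big|\le\tau(s_2-s_1)\ \forall x\in\overline\Omega,\ 0\le s_1<s_2\le M\Big\},$$ and for $v\in\mathcal{C}$, with values in $\mathbb{R}\cup\{\infty\}$, $$\tilde{\mathcal{G}}(v)=\sup_{\phi\in\tilde{\mathcal{K}}}\int_{\overline\Omega\times[0,M]}\phi\cdot dDv.$$ *)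

theory Defs
  imports "HOL-Analysis.Analysis"
begin

type_synonym plane = "real^2"

text \<open>Normalised by the volume of the \<open>k\<close>-dimensional unit ball, so that the
  \<open>n\<close>-dimensional Hausdorff measure on an \<open>n\<close>-dimensional space is Lebesgue measure.\<close>

definition hausdorff_pre :: "nat \<Rightarrow> real \<Rightarrow> 'a::euclidean_space set \<Rightarrow> ennreal" where
  "hausdorff_pre k \<delta> A =
    Inf {\<Sum>i. (if C i = {} then 0
               else ennreal (unit_ball_vol (real k) * (diameter (C i) / 2) ^ k)) | C :: nat \<Rightarrow> 'a set.
          A \<subseteq> (\<Union>i. C i) \<and> (\<forall>i. bounded (C i) \<and> diameter (C i) \<le> \<delta>)}"

definition hausdorff_outer :: "nat \<Rightarrow> 'a::euclidean_space set \<Rightarrow> ennreal" where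
  "hausdorff_outer k A = (SUP \<delta>\<in>{0<..}. hausdorff_pre k \<delta> A)"

text \<open>\<open>hausdorff_outer k\<close> is a metric outer measure, hence countably additive on the Borel
  sets, so \<open>measure_of\<close> does not fall back to the zero measure.\<close>

definition hausdorff_measure :: "nat \<Rightarrow> 'a::euclidean_space measure" where
  "hausdorff_measure k = measure_of UNIV (sets borel) (hausdorff_outer k)"

text \<open>Functions that are \<open>C\<^sup>1\<close> up to the boundary of the open set \<open>U\<close>: continuous on the
  closure, differentiable in \<open>U\<close>, the derivative extending continuously to the closure.
  For \<open>U = UNIV\<close> these are the ordinary \<open>C\<^sup>1\<close> functions.\<close>

definition C1_upto :: "'a::euclidean_space set \<Rightarrow> ('a \<Rightarrow> 'b::euclidean_space) set" where
  "C1_upto U = {f. continuous_on (closure U) f \<and>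
    (\<exists>f' :: 'a \<Rightarrow> 'a \<Rightarrow>\<^sub>L 'b. continuous_on (closure U) f' \<and>
      (\<forall>z\<in>U. (f has_derivative blinfun_apply (f' z)) (at z)))}"

definition C1_compact_support :: "'a::euclidean_space set \<Rightarrow> ('a \<Rightarrow> 'b::euclidean_space) set" where
  "C1_compact_support U =
    {f \<in> C1_upto UNIV. \<exists>K. compact K \<and> K \<subseteq> U \<and> (\<forall>z. z \<notin> K \<longrightarrow> f z = 0)}"

definition divergence :: "('a::euclidean_space \<Rightarrow> 'a) \<Rightarrow> 'a \<Rightarrow> real" where
  "divergence f z = (\<Sum>b\<in>Basis. frechet_derivative f (at z) b \<bullet> b)"

text \<open>The distributional gradient \<open>Dv\<close> on the open set \<open>U\<close> is the vector-valued Radon measure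
  \<open>\<sigma> m\<close>, given in polar form: \<open>m\<close> is the total variation measure \<open>|Dv|\<close> (regarded as a Borel
  measure on the whole space without mass outside \<open>U\<close>) and \<open>\<sigma>\<close> a field of unit vectors.
  The pair is unique up to \<open>m\<close>-null sets.\<close>

definition is_gradient ::
  "'a::euclidean_space set \<Rightarrow> ('a \<Rightarrow> real) \<Rightarrow> 'a measure \<Rightarrow> ('a \<Rightarrow> 'a) \<Rightarrow> bool" where
  "is_gradient U v m \<sigma> \<longleftrightarrow>
     sets m = sets borel \<and> emeasure m (- U) = 0 \<and>
     (\<forall>K. compact K \<and> K \<subseteq> U \<longrightarrow> emeasure m K < \<infinity>) \<and>
     \<sigma> \<in> borel_measurable borel \<and> (AE z in m. norm (\<sigma> z) = 1) \<and>
     (\<forall>\<psi>\<in>C1_compact_support U.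
        (LINT z|lebesgue. v z * divergence \<psi> z) = - (LINT z|m. \<psi> z \<bullet> \<sigma> z))"

text \<open>Elements are representatives of the almost-everywhere equivalence classes; their values
  outside \<open>U\<close> are irrelevant.\<close>

definition BV_loc :: "'a::euclidean_space set \<Rightarrow> ('a \<Rightarrow> real) set" where
  "BV_loc U = {v. (\<forall>K. compact K \<and> K \<subseteq> U \<longrightarrow> set_integrable lebesgue K v) \<and>
                  (\<exists>m \<sigma>. is_gradient U v m \<sigma>)}"

text \<open>The integral of \<open>\<phi> \<cdot> dDv\<close> over \<open>A\<close>, where \<open>Dv\<close> is the gradient of \<open>v\<close> on \<open>U\<close>; it does not
  depend on the polar pair chosen.\<close>

definition gradient_integral ::
  "'a::euclidean_space set \<Rightarrow> 'a set \<Rightarrow> ('a \<Rightarrow> 'a) \<Rightarrow> ('a \<Rightarrow> real) \<Rightarrow> real" where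
  "gradient_integral U A \<phi> v =
    (case (SOME (m, \<sigma>). is_gradient U v m \<sigma>) of (m, \<sigma>) \<Rightarrow> (LINT z:A|m. \<phi> z \<bullet> \<sigma> z))"

text \<open>Outward unit normal of a convex set, at the boundary points where the normal cone is a
  single ray (almost all of them); \<open>0\<close> elsewhere.\<close>

definition outward_normal :: "'a::euclidean_space set \<Rightarrow> 'a \<Rightarrow> 'a" where
  "outward_normal S p =
    (if \<exists>!\<nu>. norm \<nu> = 1 \<and> (\<forall>y\<in>S. (y - p) \<bullet> \<nu> \<le> 0)
     then THE \<nu>. norm \<nu> = 1 \<and> (\<forall>y\<in>S. (y - p) \<bullet> \<nu> \<le> 0) else 0)"

definition curve_length :: "(real \<Rightarrow> 'a::metric_space) \<Rightarrow> real \<Rightarrow> real \<Rightarrow> ennreal" where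
  "curve_length \<gamma> a b =
    (SUP ts\<in>{ts. sorted ts \<and> set ts \<subseteq> {a..b}}.
       ennreal (\<Sum>i<length ts - 1. dist (\<gamma> (ts ! i)) (\<gamma> (ts ! Suc i))))"

definition perimeter :: "plane set \<Rightarrow> real" where
  "perimeter \<Omega> = measure (hausdorff_measure 1) (frontier \<Omega>)"

text \<open>Counterclockwise means that \<open>\<Omega>\<close> lies to the left of every tangent. An arclength
  parameterization is Lipschitz, so tangents exist at almost all parameters.\<close>

definition ccw_arclength_param :: "plane set \<Rightarrow> (real \<Rightarrow> plane) \<Rightarrow> bool" where
  "ccw_arclength_param \<Omega> \<gamma> \<longleftrightarrow>
     bij_betw \<gamma> {0..<perimeter \<Omega>} (frontier \<Omega>) \<and>
     (\<forall>s t. 0 \<le> s \<and> s \<le> t \<and> t < perimeter \<Omega> \<longrightarrow> curve_length \<gamma> s t = ennreal (t - s)) \<and>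
     (\<forall>t d y. 0 < t \<and> t < perimeter \<Omega> \<and> (\<gamma> has_vector_derivative d) (at t) \<and> y \<in> \<Omega> \<longrightarrow>
        d $ 1 * (y - \<gamma> t) $ 2 - d $ 2 * (y - \<gamma> t) $ 1 > 0)"

definition nbhd1 :: "plane set \<Rightarrow> plane set" where
  "nbhd1 \<Omega> = (\<Union>y\<in>\<Omega>. ball y 1)"

text \<open>Finite Borel measures on a closed subset of a Euclidean space are automatically Radon.\<close>

definition finite_radon_on :: "'a::euclidean_space set \<Rightarrow> 'a measure \<Rightarrow> bool" where
  "finite_radon_on A \<mu> \<longleftrightarrow> finite_measure \<mu> \<and> sets \<mu> = sets (restrict_space borel A)"

definition transportation_cost :: "(real \<Rightarrow> real) \<Rightarrow> bool" where
  "transportation_cost \<tau> \<longleftrightarrow>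
     (\<forall>t\<ge>0. 0 \<le> \<tau> t) \<and> \<tau> 0 = 0 \<and> mono_on {0..} \<tau> \<and> concave_on {0..} \<tau> \<and>
     (\<forall>t\<ge>0. ereal (\<tau> t) \<le> Liminf (at t within {0..}) (\<lambda>s. ereal (\<tau> s)))"

definition right_deriv0 :: "(real \<Rightarrow> real) \<Rightarrow> ereal" where
  "right_deriv0 \<tau> = Lim (at_right 0) (\<lambda>h. ereal ((\<tau> h - \<tau> 0) / h))"

definition bdry_u ::
  "plane set \<Rightarrow> (real \<Rightarrow> plane) \<Rightarrow> plane measure \<Rightarrow> plane measure \<Rightarrow> plane \<Rightarrow> real" where
  "bdry_u \<Omega> \<gamma> \<mu>p \<mu>m x =
    (let arc = \<gamma> ` {0..<the_inv_into {0..<perimeter \<Omega>} \<gamma> (closest_point (frontier \<Omega>) x)}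
     in measure \<mu>p arc - measure \<mu>m arc)"

text \<open>The last case only matters on the bottom and the top of the cylinder over \<open>\<Omega>\<close>; the value
  in its interior is never used.\<close>

definition ind_u :: "plane set \<Rightarrow> real \<Rightarrow> (plane \<Rightarrow> real) \<Rightarrow> plane \<times> real \<Rightarrow> real" where
  "ind_u \<Omega> M u = (\<lambda>(x, s).
     if s < 0 then 1 else if s > M then 0
     else if x \<notin> \<Omega> then (if u x > s then 1 else 0)
     else (if s = 0 then 1 else 0))"

definition C_set :: "plane set \<Rightarrow> real \<Rightarrow> (plane \<Rightarrow> real) \<Rightarrow> (plane \<times> real \<Rightarrow> real) set" where
  "C_set \<Omega> M u = {v \<in> BV_loc (nbhd1 \<Omega> \<times> UNIV).
     (AE z in lebesgue. z \<in> nbhd1 \<Omega> \<times> UNIV \<longrightarrow> v z \<in> {0..1}) \<and>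
     (AE z in lebesgue. z \<in> (nbhd1 \<Omega> \<times> UNIV) - (closure \<Omega> \<times> {0..M}) \<longrightarrow> v z = ind_u \<Omega> M u z)}"

definition K_set ::
  "plane set \<Rightarrow> real \<Rightarrow> (real \<Rightarrow> real) \<Rightarrow> (plane \<times> real \<Rightarrow> plane \<times> real) set" where
  "K_set \<Omega> M \<tau> = {\<phi>. continuous_on (closure \<Omega> \<times> {0..M}) \<phi> \<and>
     (\<forall>z \<in> closure \<Omega> \<times> {0..M}.
        ereal (norm (fst (\<phi> z))) \<le> right_deriv0 \<tau> \<and> 0 \<le> snd (\<phi> z)) \<and>
     (\<forall>x \<in> closure \<Omega>. \<forall>s1 s2. 0 \<le> s1 \<and> s1 < s2 \<and> s2 \<le> M \<longrightarrow>
        norm (integral {s1..s2} (\<lambda>s. fst (\<phi> (x, s)))) \<le> \<tau> (s2 - s1))}"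

definition pairing ::
  "plane set \<Rightarrow> real \<Rightarrow> (plane \<times> real \<Rightarrow> plane \<times> real) \<Rightarrow> (plane \<times> real \<Rightarrow> real) \<Rightarrow> real" where
  "pairing \<Omega> M \<phi> v = gradient_integral (nbhd1 \<Omega> \<times> UNIV) (closure \<Omega> \<times> {0..M}) \<phi> v"

definition G_fun :: "plane set \<Rightarrow> real \<Rightarrow> (real \<Rightarrow> real) \<Rightarrow> (plane \<times> real \<Rightarrow> real) \<Rightarrow> ereal" where
  "G_fun \<Omega> M \<tau> v = (SUP \<phi>\<in>K_set \<Omega> M \<tau>. ereal (pairing \<Omega> M \<phi> v))"

definition D_fun ::
  "plane set \<Rightarrow> real \<Rightarrow> (plane \<Rightarrow> real) \<Rightarrow> (plane \<times> real \<Rightarrow> plane \<times> real) \<Rightarrow> real" where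
  "D_fun \<Omega> M u \<phi> =
     (LINT z:frontier (\<Omega> \<times> {0<..<M})|hausdorff_measure 2.
        ind_u \<Omega> M u z * (\<phi> z \<bullet> outward_normal (\<Omega> \<times> {0<..<M}) z))
     - (LINT z:\<Omega> \<times> {0<..<M}|lborel. max 0 (divergence \<phi> z))"

end

theory Submission
  imports Defs "HOL-Analysis.Analysis"
begin

text \<open>Integration by parts turns the pairing of a \<open>C\<^sup>1\<close> field \<open>\<phi>\<close> with \<open>v\<close> into a boundary flux minus
 \<open>\<integral> v div \<phi>\<close>, which is bilinear and depends only on \<open>v\<close> inside the cylinder. Pointwise minimisation over
 \<open>0 \<le> v \<le> 1\<close> yields \<open>D \<phi>\<close>, so \<open>D\<close> is bounded by the pairing. A finite minimax theorem gives profiles that nearly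
 satisfy finitely many constraints \<open>\<dots> \<le> sup D\<close>; their \<open>L\<^sup>2\<close>-minimal elements converge strongly along an
 exhausting sequence of constraints to one profile satisfying all of them. These constraints bound its distributional
 gradient, which is therefore a vector measure by the Riesz theorem; by density of \<open>C\<^sup>1\<close> fields in the constraint set
 the profile is the minimiser. The trace of \<open>1\<^sub>u\<close> is only of bounded variation along the boundary, so the flux is
 obtained from one-dimensional estimates on lines, whose error is the mass of \<open>\<mu>\<^sub>+ + \<mu>\<^sub>-\<close> on thin strips.\<close>

text \<open>For a merely continuous field the pairing has no formula in terms of \<open>v\<close>.
  All decisions are therefore taken on \<open>fields \<tau>\<close>, where \<open>dual_value\<close>
  makes sense for every profile, whether or not it has a gradient. The supremum of
  \<open>D_fun\<close> is finite although \<open>right_deriv0 \<tau>\<close> may be infinite,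
  because the integral constraint bounds the flux by \<open>2 * \<tau> M * len\<close>. The gradient
  bound of the limit profile is possible because the vertical component of a constraint field has no
  upper bound: a constant vertical field may be added to any small test field, and it then becomes a
  constraint field, provided that the cost has positive slope at 0. A convex boundary has corners,
  so \<open>hausdorff_measure 2\<close> on the side is not computed by a smooth area formula. The
  parameterization is 1-Lipschitz, which gives one inequality on all Borel sets; comparison of the
  total masses gives the other. On the bottom the measure has to be exactly Lebesgue measure, which
  rests on the isodiametric inequality.\<close>

lemmas borel_contI = borel_measurable_continuous_onI
lemmas sli_def = set_lebesgue_integral_def
lemmas int_bound = Bochner_Integration.integrable_bound
lemmas lint_cong = Bochner_Integration.integral_cong
lemmas lint_norm_le = Bochner_Integration.integral_norm_bound_integral
lemmas hk_combine = Henstock_Kurzweil_Integration.integral_combine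
lemmas int_ind = integrable_real_indicator
lemmas set_lint_eq = set_borel_integral_eq_integral
lemmas int_bdd_ind = integrableI_bounded_set_indicator
abbreviation "borel_fun \<equiv> borel_measurable borel"
abbreviation "C1c \<equiv> C1_compact_support"
lemmas C1c_def = C1_compact_support_def
abbreviation "dvg \<equiv> divergence"
notation scaleR (infixr "*." 75) and inner (infixl "@." 70)

section \<open>Hausdorff measure\<close>

text \<open>Caratheodory's criterion. Only closed sets \<open>C\<close> have to be split. The part
  of \<open>X\<close> at distance at least \<open>1 / (n + 1)\<close> from \<open>C\<close> is
  separated from \<open>C\<close>, so additivity holds for it; what remains off \<open>C\<close> is
  covered by the annuli \<open>R k\<close> with \<open>k \<ge> n\<close>. Their values form a
  convergent series, since annuli of the same parity are separated from each other and sum to at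
  most \<open>f X\<close>; hence the remainder is a tail that tends to 0.\<close>

lemma metric_outer_measure_imp_measure_space:
 fixes f :: "'a::metric_space set => ennreal"
 assumes f0: "f {} = 0" and mono: "!!A B. A \<subseteq> B ==> f A <= f B"
  and csub: "!!A::nat=>_. f (\<Union>i. A i) <= (\<Sum>i. f (A i))"
  and metric: "!!A B d. 0 < d ==> (!!x y. x : A ==> y : B ==> d <= dist x y) ==> f A + f B <= f (A Un B)"
 shows "measure_space UNIV (sets borel) f"
proof -
 interpret P: sigma_algebra "UNIV::'a set" "UNIV::'a set set"
  using sigma_algebra_Pow[of "UNIV::'a set"] by simp
 have sub2: "f (A Un B) <= f A + f B" for A B
 proof -
  have "A Un B = (\<Union>i. binaryset A B i)" by (simp add: UN_binaryset_eq)
  hence "f (A Un B) <= (\<Sum>i. f (binaryset A B i))" using csub[of "binaryset A B"] by simp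
  also have "... = f A + f B"
   using suminf_binaryset_eq[of f] f0 by simp
  finally show ?thesis .
 qed
 have oms: "outer_measure_space UNIV f"
  unfolding outer_measure_space_def positive_def increasing_def countably_subadditive_def
  using f0 mono csub by auto
 define L where "L = lambda_system UNIV UNIV f"
 have ms: "measure_space UNIV L f"
  unfolding L_def by (rule P.caratheodory_lemma[OF oms])
 have closed_L: "C : L" if C: "closed C" for C
 proof -
  have "f (C Int X) + f ((UNIV - C) Int X) = f X" for X
  proof (cases "C = {}")
   case True thus ?thesis using f0 by simp
  next
   case False
   have le1: "f X <= f (C Int X) + f ((UNIV - C) Int X)"
    using sub2[of "C Int X" "(UNIV - C) Int X"] by (metis Compl_eq_Diff_UNIV Int_Un_distrib2 Int_UNIV_left Un_UNIV_right Un_commute Compl_partition)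
   have "f (C Int X) + f ((UNIV - C) Int X) <= f X"
   proof (cases "f X = \<infinity>")
    case fin: False
    define Xn where "Xn = (%n::nat. {x\<in>X. 1 / (real n + 1) <= infdist x C})"
    define R where "R = (%k::nat. {x\<in>X. 1 / (real k + 2) <= infdist x C & infdist x C < 1 / (real k + 1)})"
    have a: "f (C Int X) + f (Xn n) <= f X" for n
    proof -
     have "f (C Int X) + f (Xn n) <= f (C Int X Un Xn n)"
     proof (rule metric[of "1 / (real n + 1)"])
      fix x y assume "x : C Int X" "y : Xn n"
      hence "1 / (real n + 1) <= infdist y C" "infdist y C <= dist y x"
       by (auto simp: Xn_def intro: infdist_le)
      thus "1 / (real n + 1) <= dist x y" by (simp add: dist_commute)
     qed simp
     also have "... <= f X" by (rule mono) (auto simp: Xn_def)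
     finally show ?thesis .
    qed
    have sep: "(\<Sum>i<m. f (R (2*i + p))) <= f (\<Union>i<m. R (2*i + p))" for m p :: nat
    proof (induction m)
     case (Suc m)
     define K where "K = 2 * real m + real p"
     have "f (\<Union>i<m. R (2*i + p)) + f (R (2*m+p)) <= f ((\<Union>i<m. R (2*i + p)) Un R (2*m+p))"
     proof (cases "m = 0")
      case False
      hence K: "0 < K" by (simp add: K_def)
      \<comment> \<open>The earlier annuli have index at most \<open>K - 2\<close>, hence distance
        at least \<open>1 / K\<close> from \<open>C\<close>; the new one, of index \<open>K\<close>,
        stays below \<open>1 / (K + 1)\<close>.\<close>
      show ?thesis
      proof (rule metric[of "1 / K - 1 / (K + 1)"])
       show "0 < 1 / K - 1 / (K + 1)" proof -
        have "1 / (K + 1) < 1 / K" by (rule divide_strict_left_mono) (use K in auto)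
        thus ?thesis by linarith
       qed
      next
       fix x y assume "x : (\<Union>i<m. R (2*i + p))" and y: "y : R (2*m+p)"
       then obtain i where i: "i < m" "x : R (2*i+p)" by auto
       have "1 / (2 * real i + p + 2) <= infdist x C" using i by (auto simp: R_def)
       moreover have "infdist y C < 1 / (K + 1)" using y by (auto simp: R_def K_def)
       moreover have "1 / K <= 1 / (2 * real i + p + 2)"
        using i K by (intro divide_left_mono) (auto simp: K_def)
       moreover have "infdist x C <= infdist y C + dist x y" by (rule infdist_triangle)
       ultimately show "1 / K - 1 / (K + 1) <= dist x y" by linarith
      qed
     qed (simp add: f0)
     hence "(\<Sum>i<Suc m. f (R (2*i + p))) <= f (\<Union>i<Suc m. R (2*i + p))"
     proof -
      assume a: "f (\<Union>i<m. R (2*i + p)) + f (R (2*m+p)) <= f ((\<Union>i<m. R (2*i + p)) Un R (2*m+p))"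
      have "(\<Sum>i<Suc m. f (R (2*i + p))) = (\<Sum>i<m. f (R (2*i + p))) + f (R (2*m+p))" by simp
      also have "... <= f (\<Union>i<m. R (2*i + p)) + f (R (2*m+p))" using Suc by (rule add_right_mono)
      also note a
      also have "(\<Union>i<m. R (2*i + p)) Un R (2*m+p) = (\<Union>i<Suc m. R (2*i + p))" by (auto simp: less_Suc_eq)
      finally show ?thesis .
     qed
     thus ?case .
    qed (simp add: f0)
    have sepX: "(\<Sum>i<m. f (R (2*i + p))) <= f X" for m p :: nat
     by (rule order_trans[OF sep mono]) (auto simp: R_def)
    have "(\<Sum>k<m. f (R k)) <= f X + f X" for m
    proof -
     have "(\<Sum>k<m. f (R k)) <= (\<Sum>k<2*m. f (R k))" by (rule sum_mono2) auto
     also have "... = (\<Sum>i<m. f (R (2*i+0))) + (\<Sum>i<m. f (R (2*i+1)))"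
      by (induction m) (simp_all add: ac_simps)
     also have "... <= f X + f X" by (intro add_mono sepX)
     finally show ?thesis .
    qed
    hence "(\<Sum>k. f (R k)) <= f X + f X" by (simp add: suminf_eq_SUP SUP_least)
    hence fin2: "(\<Sum>k. f (R k)) ~= \<infinity>"
     using fin by (auto simp: top_unique)
    define r where "r = (%k. enn2real (f (R k)))"
    have finR: "f (R k) ~= \<infinity>" for k
    proof -
     have "f (R k) <= f X" by (rule mono) (auto simp: R_def)
     thus ?thesis using fin by (auto simp: top_unique)
    qed
    have fr: "f (R k) = ennreal (r k)" and r0: "0 <= r k" for k
     using finR[of k] by (auto simp: r_def less_top)
    have sr: "summable r"
     by (rule summable_suminf_not_top) (use r0 fin2 fr in auto)
    show ?thesis
    proof (rule ennreal_le_epsilon)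
     fix e :: real assume e: "0 < e"
     obtain n where n: "norm (\<Sum>i. r (i + n)) < e"
      using suminf_exist_split[OF e sr] by auto
     have "(UNIV - C) Int X \<subseteq> Xn n Un (\<Union>k. R (k + n))"
     proof
      fix x assume x: "x : (UNIV - C) Int X"
      hence pos: "0 < infdist x C"
       using in_closed_iff_infdist_zero[OF C False] infdist_nonneg[of x C] by (auto simp: less_le)
      show "x : Xn n Un (\<Union>k. R (k + n))"
      proof (cases "x : Xn n")
       case notin: False
       hence lt: "infdist x C < 1 / (real n + 1)" using x by (auto simp: Xn_def)
       define k where "k = (LEAST k. 1 / (real k + 2) <= infdist x C)"
       have ex: "EX k. 1 / (real k + 2) <= infdist x C"
       proof -
        obtain k where "1 / real (Suc k) < infdist x C" using nat_approx_posE[OF pos] by blast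
        moreover have "1 / (real k + 2) <= 1 / real (Suc k)" by (intro divide_left_mono) auto
        ultimately show ?thesis by (intro exI[of _ k]) linarith
       qed
       have k1: "1 / (real k + 2) <= infdist x C" unfolding k_def by (rule LeastI_ex[OF ex])
       have "1 / (real k + 2) < 1 / (real n + 1)" using k1 lt by linarith
       hence kn: "n <= k" by (simp add: field_simps)
       have k2: "infdist x C < 1 / (real k + 1)"
       proof (cases k)
        case 0 thus ?thesis using lt kn by auto
       next
        case (Suc j)
        hence "\<not> 1 / (real j + 2) <= infdist x C"
         using not_less_Least[of j "%k. 1 / (real k + 2) <= infdist x C"] k_def by auto
        thus ?thesis using Suc by (simp add: add.commute)
       qed
       have "x : R ((k - n) + n)" using k1 k2 kn x by (simp add: R_def)
       thus ?thesis by blast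
      qed simp
     qed
     hence "f ((UNIV - C) Int X) <= f (Xn n) + f (\<Union>k. R (k + n))"
      by (rule order_trans[OF mono sub2])
     also have "f (\<Union>k. R (k + n)) <= (\<Sum>k. f (R (k + n)))" by (rule csub)
     also have "(\<Sum>k. f (R (k + n))) = ennreal (\<Sum>k. r (k + n))"
      using r0 sr by (simp add: fr suminf_ennreal2)
     also have "... <= ennreal e" using n by (intro ennreal_leI) auto
     finally have "f (C Int X) + f ((UNIV - C) Int X) <= f (C Int X) + (f (Xn n) + ennreal e)"
      by (simp add: add_left_mono)
     also have "... <= f X + ennreal e" unfolding add.assoc[symmetric] by (rule add_right_mono[OF a])
     finally show "f (C Int X) + f ((UNIV - C) Int X) <= f X + ennreal e" .
    qed
   qed simp
   thus ?thesis using le1 by (rule antisym)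
  qed
  thus ?thesis by (auto simp: L_def lambda_system_def)
 qed
 have sL: "sigma_algebra UNIV L" using ms by (simp add: measure_space_def)
 have sub: "sets borel \<subseteq> L"
 proof -
  have "sets (borel::'a measure) = sigma_sets UNIV {S. closed S}"
   by (simp add: borel_eq_closed)
  also have "... \<subseteq> L" by (rule sigma_algebra.sigma_sets_subset[OF sL]) (use closed_L in auto)
  finally show ?thesis .
 qed
 show ?thesis
  using ms sub sets.sigma_algebra_axioms[of "borel::'a measure"]
  by (auto simp: measure_space_def positive_def countably_additive_def)
qed

text \<open>The empty set has its own case because the general formula would charge 1 for it when
  \<open>k = 0\<close>.\<close>

definition hausdorff_gauge :: "nat => 'a::euclidean_space set => ennreal" where
 "hausdorff_gauge k S = (if S = {} then 0 else ennreal (unit_ball_vol (real k) * (diameter S / 2) ^ k))"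

lemma hausdorff_gauge_empty [simp]: "hausdorff_gauge k {} = 0"
 by (simp add: hausdorff_gauge_def)

lemma hausdorff_gauge_mono: "bounded T ==> (S ~= {} ==> T ~= {}) ==> diameter S <= diameter T ==> bounded S
  ==> hausdorff_gauge k S <= hausdorff_gauge k T"
 by (auto simp: hausdorff_gauge_def intro!: ennreal_leI mult_left_mono power_mono diameter_ge_0)

lemma hausdorff_pre_alt:
 "hausdorff_pre k \<delta> A = Inf {\<Sum>i. hausdorff_gauge k (C i) | C :: nat => 'a::euclidean_space set.
     A \<subseteq> (\<Union>i. C i) & (ALL i. bounded (C i) & diameter (C i) <= \<delta>)}"
 by (simp add: hausdorff_pre_def hausdorff_gauge_def)

lemma hausdorff_pre_le:
 assumes "A \<subseteq> (\<Union>i. C i)" "!!i. bounded (C i)" "!!i. diameter (C i) <= \<delta>"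
 shows "hausdorff_pre k \<delta> A <= (\<Sum>i. hausdorff_gauge k (C i))"
 unfolding hausdorff_pre_alt by (rule Inf_lower) (use assms in auto)

lemma hausdorff_pre_coverE:
 assumes "hausdorff_pre k \<delta> A < x"
 obtains C :: "nat => 'a::euclidean_space set" where "A \<subseteq> (\<Union>i. C i)" "!!i. bounded (C i)" "!!i. diameter (C i) <= \<delta>"
  "(\<Sum>i. hausdorff_gauge k (C i)) < x"
 using assms unfolding hausdorff_pre_alt Inf_less_iff by auto

lemma hausdorff_pre_greatest:
 assumes "!!C :: nat => 'a::euclidean_space set. A \<subseteq> (\<Union>i. C i) ==> (!!i. bounded (C i)) ==> (!!i. diameter (C i) <= \<delta>)
  ==> x <= (\<Sum>i. hausdorff_gauge k (C i))"
 shows "x <= hausdorff_pre k \<delta> A"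
 unfolding hausdorff_pre_alt by (rule Inf_greatest) (use assms in auto)

lemma hausdorff_pre_mono: "A \<subseteq> B ==> hausdorff_pre k \<delta> A <= hausdorff_pre k \<delta> B"
 by (rule hausdorff_pre_greatest) (auto intro!: hausdorff_pre_le)

lemma hausdorff_pre_antimono: "\<delta> <= \<delta>' ==> hausdorff_pre k \<delta>' A <= hausdorff_pre k \<delta> A"
 by (rule hausdorff_pre_greatest) (auto intro!: hausdorff_pre_le intro: order_trans)

lemma hausdorff_pre_empty: "0 < \<delta> ==> hausdorff_pre k \<delta> {} = 0"
 using hausdorff_pre_le[of "{}" "%_. {}" \<delta> k] by simp

lemma hausdorff_pre_countably_subadditive:
 assumes "0 < \<delta>"
 shows "hausdorff_pre k \<delta> (\<Union>n::nat. A n) <= (\<Sum>n. hausdorff_pre k \<delta> (A n))"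
proof (rule ennreal_le_epsilon)
 fix e :: real assume fin: "(\<Sum>n. hausdorff_pre k \<delta> (A n)) < top" and e: "0 < e"
 have "EX C. A n \<subseteq> (\<Union>i. C i) & (ALL i. bounded (C i)) & (ALL i. diameter (C i) <= \<delta>) &
   (\<Sum>i. hausdorff_gauge k (C i)) < hausdorff_pre k \<delta> (A n) + ennreal (e * (1/2)^Suc n)" for n
 proof -
  have "hausdorff_pre k \<delta> (A n) ~= top"
   using ennreal_suminf_lessD[OF fin] by (simp add: less_top)
  moreover have "0 < ennreal (e * (1/2)^Suc n)"
   using e by simp
  ultimately have "hausdorff_pre k \<delta> (A n) < hausdorff_pre k \<delta> (A n) + ennreal (e * (1/2)^Suc n)"
   by (cases "hausdorff_pre k \<delta> (A n)") (auto simp: ennreal_add_left_cancel_less less_top)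
  from hausdorff_pre_coverE[OF this] show ?thesis by metis
 qed
 then obtain C where C: "!!n. A n \<subseteq> (\<Union>i. C n i)" "!!n i. bounded (C n i)" "!!n i. diameter (C n i) <= \<delta>"
   and Cs: "!!n. (\<Sum>i. hausdorff_gauge k (C n i)) < hausdorff_pre k \<delta> (A n) + ennreal (e * (1/2)^Suc n)"
  by metis
 define D where "D = (%p. C (fst (prod_decode p)) (snd (prod_decode p)))"
 have "hausdorff_pre k \<delta> (\<Union>n. A n) <= (\<Sum>p. hausdorff_gauge k (D p))"
 proof (rule hausdorff_pre_le)
  show "(\<Union>n. A n) \<subseteq> (\<Union>p. D p)"
  proof safe
   fix n x assume "x : A n"
   then obtain i where "x : C n i" using C(1) by blast
   hence "x : D (prod_encode (n, i))" by (simp add: D_def)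
   thus "x : (\<Union>p. D p)" by blast
  qed
 qed (auto simp: D_def C)
 also have "... = (\<Sum>n. \<Sum>i. hausdorff_gauge k (C n i))"
  using suminf_ennreal_2dimen[of "%n. \<Sum>i. hausdorff_gauge k (C n i)" "%p. hausdorff_gauge k (C (fst p) (snd p))"]
  by (simp add: D_def)
 also have "... <= (\<Sum>n. hausdorff_pre k \<delta> (A n) + ennreal (e * (1/2)^Suc n))"
  by (intro suminf_le less_imp_le Cs) auto
 also have "... = (\<Sum>n. hausdorff_pre k \<delta> (A n)) + (\<Sum>n. ennreal (e * (1/2)^Suc n))"
  by (rule suminf_add[symmetric]) auto
 also have "(\<Sum>n. ennreal (e * (1/2)^Suc n)) = ennreal e"
  using e sums_mult[OF power_half_series, of e] by (intro suminf_ennreal_eq) auto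
 finally show "hausdorff_pre k \<delta> (\<Union>n. A n) <= (\<Sum>n. hausdorff_pre k \<delta> (A n)) + ennreal e" .
qed

text \<open>A set of diameter at most \<open>\<delta> < d\<close> cannot meet both sets, so a cover
  of the union splits into one subfamily covering \<open>A\<close> and another covering
  \<open>B\<close>.\<close>

lemma hausdorff_pre_separated:
 assumes "!!x y. x : A ==> y : B ==> d <= dist x y" "\<delta> < d"
 shows "hausdorff_pre k \<delta> A + hausdorff_pre k \<delta> B <= hausdorff_pre k \<delta> (A Un B)"
proof (rule hausdorff_pre_greatest)
 fix C :: "nat => 'a set"
 assume C: "A Un B \<subseteq> (\<Union>i. C i)" "!!i. bounded (C i)" "!!i. diameter (C i) <= \<delta>"
 have d0: "0 <= \<delta>" using C(2,3)[of 0] diameter_ge_0 order_trans by blast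
 define R where "R = (%S i. if C i Int S = {} then {} else C i)"
 have R: "hausdorff_pre k \<delta> S <= (\<Sum>i. hausdorff_gauge k (R S i))" if "S \<subseteq> A Un B" for S
  using that C d0 by (intro hausdorff_pre_le) (fastforce simp: R_def)+
 have one: "hausdorff_gauge k (R A i) + hausdorff_gauge k (R B i) <= hausdorff_gauge k (C i)" for i
 proof -
  have "C i Int A = {} \<or> C i Int B = {}"
  proof (rule ccontr)
   assume "\<not> ?thesis"
   then obtain x y where xy: "x : C i" "x : A" "y : C i" "y : B" by auto
   hence "dist x y <= diameter (C i)" using C(2) diameter_bounded_bound by blast
   thus False using assms(1)[OF xy(2,4)] assms(2) C(3)[of i] by linarith
  qed
  thus ?thesis by (auto simp: R_def)
 qed
 have "hausdorff_pre k \<delta> A + hausdorff_pre k \<delta> B <= (\<Sum>i. hausdorff_gauge k (R A i)) + (\<Sum>i. hausdorff_gauge k (R B i))"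
  by (intro add_mono R) auto
 also have "... = (\<Sum>i. hausdorff_gauge k (R A i) + hausdorff_gauge k (R B i))"
  by (rule suminf_add) auto
 also have "... <= (\<Sum>i. hausdorff_gauge k (C i))" by (intro suminf_le one) auto
 finally show "hausdorff_pre k \<delta> A + hausdorff_pre k \<delta> B <= (\<Sum>i. hausdorff_gauge k (C i))" .
qed

lemma hausdorff_pre_le_outer: "0 < \<delta> ==> hausdorff_pre k \<delta> A <= hausdorff_outer k A"
 unfolding hausdorff_outer_def by (rule SUP_upper) auto

lemma hausdorff_outer_mono: "A \<subseteq> B ==> hausdorff_outer k A <= hausdorff_outer k B"
 unfolding hausdorff_outer_def by (intro SUP_mono' hausdorff_pre_mono)

lemma hausdorff_outer_empty [simp]: "hausdorff_outer k {} = 0"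
 unfolding hausdorff_outer_def by (simp add: hausdorff_pre_empty)

lemma hausdorff_outer_countably_subadditive:
 "hausdorff_outer k (\<Union>n::nat. A n) <= (\<Sum>n. hausdorff_outer k (A n))"
 unfolding hausdorff_outer_def[of k "\<Union>n. A n"]
 by (intro SUP_least order_trans[OF hausdorff_pre_countably_subadditive] suminf_le hausdorff_pre_le_outer) auto

lemma hausdorff_outer_separated:
 assumes "0 < d" "!!x y. x : A ==> y : B ==> d <= dist x y"
 shows "hausdorff_outer k A + hausdorff_outer k B <= hausdorff_outer k (A Un B)"
proof -
 have "hausdorff_outer k A + hausdorff_outer k B = (SUP \<delta>\<in>{0<..}. hausdorff_pre k \<delta> A + hausdorff_pre k \<delta> B)"
  unfolding hausdorff_outer_def
 proof (rule SUP_add_directed_ennreal[symmetric])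
  fix i j :: real assume "i : {0<..}" "j : {0<..}"
  thus "EX k':{0<..}. hausdorff_pre k i A + hausdorff_pre k j B <= hausdorff_pre k k' A + hausdorff_pre k k' B"
   by (intro bexI[of _ "min i j"] add_mono hausdorff_pre_antimono) auto
 qed
 also have "... <= hausdorff_outer k (A Un B)"
 proof (rule SUP_least)
  fix \<delta> :: real assume "\<delta> : {0<..}"
  \<comment> \<open>Only scales below \<open>d\<close> matter for the supremum, and at these scales
    covers separate.\<close>
  define \<delta>' where "\<delta>' = min \<delta> (d/2)"
  have "hausdorff_pre k \<delta> A + hausdorff_pre k \<delta> B <= hausdorff_pre k \<delta>' A + hausdorff_pre k \<delta>' B"
   by (intro add_mono hausdorff_pre_antimono) (auto simp: \<delta>'_def)
  also have "... <= hausdorff_pre k \<delta>' (A Un B)"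
   by (rule hausdorff_pre_separated) (use assms in \<open>auto simp: \<delta>'_def\<close>)
  also have "... <= hausdorff_outer k (A Un B)"
   using \<open>\<delta> : _\<close> assms by (intro hausdorff_pre_le_outer) (auto simp: \<delta>'_def)
  finally show "hausdorff_pre k \<delta> A + hausdorff_pre k \<delta> B <= hausdorff_outer k (A Un B)" .
 qed
 finally show ?thesis .
qed

lemma space_hausdorff [simp]: "space (hausdorff_measure k) = UNIV"
 and sets_hausdorff [simp, measurable_cong]: "sets (hausdorff_measure k) = sets borel"
 using sets.sigma_sets_eq[of borel] by (simp_all add: hausdorff_measure_def)

lemma emeasure_hausdorff:
 assumes "A : sets borel"
 shows "emeasure (hausdorff_measure k) A = hausdorff_outer k A"
proof -
 have "measure_space UNIV (sets borel) (hausdorff_outer k :: 'a set => ennreal)"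
  by (rule metric_outer_measure_imp_measure_space)
   (auto intro: hausdorff_outer_mono hausdorff_outer_countably_subadditive hausdorff_outer_separated)
 thus ?thesis
  using assms unfolding hausdorff_measure_def
  by (intro emeasure_measure_of_sigma) (auto simp: measure_space_def)
qed

lemma hausdorff_outer_image_le:
 fixes f :: "'a::euclidean_space => 'b::euclidean_space"
 assumes "!!x y. x : S ==> y : S ==> dist (f x) (f y) <= dist x y"
 shows "hausdorff_outer k (f ` S) <= hausdorff_outer k S"
 unfolding hausdorff_outer_def
proof (rule SUP_mono')
 fix \<delta> :: real
 show "hausdorff_pre k \<delta> (f ` S) <= hausdorff_pre k \<delta> S"
 proof (rule hausdorff_pre_greatest)
  fix C :: "nat => 'a set"
  assume C: "S \<subseteq> (\<Union>i. C i)" "!!i. bounded (C i)" "!!i. diameter (C i) <= \<delta>"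
  have dist: "dist (f x) (f y) <= diameter (C i)" if "x : C i Int S" "y : C i Int S" for x y i
   using assms[of x y] that diameter_bounded_bound[OF C(2)[of i], of x y] by auto
  have bd: "bounded (f ` (C i Int S))" for i
  proof (cases "C i Int S = {}")
   case False
   then obtain x where "x : C i Int S" by blast
   hence "f ` (C i Int S) \<subseteq> cball (f x) (diameter (C i))" using dist by auto
   thus ?thesis using bounded_subset bounded_cball by blast
  qed simp
  have dm: "diameter (f ` (C i Int S)) <= diameter (C i)" for i
   by (rule diameter_le) (use dist diameter_ge_0[OF C(2)] in \<open>auto simp: dist_norm\<close>)
  have "hausdorff_pre k \<delta> (f ` S) <= (\<Sum>i. hausdorff_gauge k (f ` (C i Int S)))"
  proof (rule hausdorff_pre_le)
   show "f ` S \<subseteq> (\<Union>i. f ` (C i Int S))" using C(1) by blast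
  qed (use bd order_trans[OF dm C(3)] in auto)
  also have "... <= (\<Sum>i. hausdorff_gauge k (C i))"
   by (intro suminf_le hausdorff_gauge_mono bd dm C) auto
  finally show "hausdorff_pre k \<delta> (f ` S) <= (\<Sum>i. hausdorff_gauge k (C i))" .
 qed
qed

section \<open>Steiner symmetrization, the isodiametric inequality and the Hausdorff measure of
  planar sets\<close>

definition steiner :: "(real \<times> real) set => (real \<times> real) set" where
 "steiner S = {(x, y). 0 < measure lborel (Pair x -` S) & 2 * \<bar>y\<bar> <= measure lborel (Pair x -` S)}"

lemma section_borel: "S : sets (borel :: (real \<times> real) measure) ==> Pair x -` S : sets borel"
 by (rule sets_Pair1[of S borel borel]) (simp only: borel_prod)

lemma measurable_measure_section:
 assumes "S : sets (borel :: (real \<times> real) measure)"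
 shows "(%x. measure lborel (Pair x -` S)) : borel_fun"
proof -
 have "S : sets (lborel \<Otimes>\<^sub>M lborel)" using assms by (simp only: lborel_prod sets_lborel)
 from lborel.measurable_emeasure_Pair[OF this] show ?thesis
  unfolding measure_def by measurable
qed

lemma steiner_borel:
 assumes "S : sets borel"
 shows "steiner S : sets borel"
proof -
 have [measurable]: "(%x. measure lborel (Pair x -` S)) : borel_fun"
  by (rule measurable_measure_section[OF assms])
 have "{z \<in> space (borel \<Otimes>\<^sub>M borel). 0 < measure lborel (Pair (fst z) -` S) & 2 * \<bar>snd z\<bar> <= measure lborel (Pair (fst z) -` S)}
   : sets (borel \<Otimes>\<^sub>M borel)" by measurable
 also have "{z \<in> space (borel \<Otimes>\<^sub>M borel). 0 < measure lborel (Pair (fst z) -` S) & 2 * \<bar>snd z\<bar> <= measure lborel (Pair (fst z) -` S)} = steiner S"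
  by (auto simp: steiner_def space_pair_measure)
 finally show ?thesis by (simp only: borel_prod)
qed

lemma emeasure_lborel_pair_alt:
 assumes "S : sets (borel :: (real \<times> real) measure)"
 shows "emeasure lborel S = (\<integral>\<^sup>+x. emeasure lborel (Pair x -` S) \<partial>lborel)"
  and "emeasure lborel S = (\<integral>\<^sup>+y. emeasure lborel ((%x. (x, y)) -` S) \<partial>lborel)"
proof -
 have S: "S : sets (lborel \<Otimes>\<^sub>M lborel)" using assms by (simp only: lborel_prod sets_lborel)
 show "emeasure lborel S = (\<integral>\<^sup>+x. emeasure lborel (Pair x -` S) \<partial>lborel)"
  using lborel.emeasure_pair_measure_alt[OF S] by (simp only: lborel_prod)
 show "emeasure lborel S = (\<integral>\<^sup>+y. emeasure lborel ((%x. (x, y)) -` S) \<partial>lborel)"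
  using lborel_pair.emeasure_pair_measure_alt2[OF S] by (simp only: lborel_prod)
qed

lemma bounded_section:
 fixes S :: "(real \<times> real) set"
 assumes "bounded S" shows "bounded (Pair x -` S)"
proof -
 obtain B where "!!z. z : S ==> norm z <= B" using assms by (auto simp: bounded_iff)
 hence "norm y <= B" if "y : Pair x -` S" for y
  using that norm_snd_le[of "(x,y)" ] by (metis norm_snd_le order_trans snd_conv vimage_eq)
 thus ?thesis by (auto simp: bounded_iff)
qed

lemma emeasure_steiner:
 assumes S: "S : sets borel" and bd: "bounded S"
 shows "emeasure lborel (steiner S) = emeasure lborel S"
proof -
 have "emeasure lborel (Pair x -` steiner S) = emeasure lborel (Pair x -` S)" for x
 proof -
  define l where "l = measure lborel (Pair x -` S)"
  have "emeasure lborel (Pair x -` S) < \<infinity>"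
   by (rule emeasure_bounded_finite[OF bounded_section[OF bd]])
  hence l: "emeasure lborel (Pair x -` S) = ennreal l"
   unfolding l_def by (intro emeasure_eq_ennreal_measure) auto
  have "l \<ge> 0" by (simp add: l_def)
  moreover have "Pair x -` steiner S = (if 0 < l then {- (l/2)..l/2} else {})"
   by (auto simp: steiner_def l_def abs_if split: if_splits)
  ultimately show ?thesis by (auto simp: l)
 qed
 thus ?thesis using S steiner_borel[OF S] by (simp add: emeasure_lborel_pair_alt(1))
qed

text \<open>The one-dimensional core of the diameter estimate: \<open>Sup A - Inf B\<close> and
  \<open>Sup B - Inf A\<close> are both at most \<open>w\<close>, and their sum bounds the lengths
  of the two convex hulls.\<close>

lemma measure_add_le_of_dist:
 fixes A B :: "real set"
 assumes "A : sets borel" "B : sets borel" "A ~= {}" "B ~= {}"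
  and d: "!!a b. a : A ==> b : B ==> \<bar>a - b\<bar> <= w"
 shows "measure lborel A + measure lborel B <= 2 * w"
proof -
 obtain a0 b0 where ab: "a0 : A" "b0 : B" using assms by blast
 have bdA: "bdd_above A" "bdd_below A"
  using d[OF _ ab(2)] by (auto intro!: bdd_aboveI[of _ "b0 + w"] bdd_belowI[of _ "b0 - w"] simp: abs_le_iff) (smt (verit))+
 have bdB: "bdd_above B" "bdd_below B"
  using d[OF ab(1)] by (auto intro!: bdd_aboveI[of _ "a0 + w"] bdd_belowI[of _ "a0 - w"] simp: abs_le_iff) (smt (verit))+
 have le: "measure lborel X <= Sup X - Inf X" if "X : sets borel" "X ~= {}" "bdd_above X" "bdd_below X" for X :: "real set"
 proof -
  have "measure lborel X <= measure lborel {Inf X..Sup X}"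
  proof (rule measure_mono_fmeasurable)
   show "{Inf X..Sup X} : fmeasurable lborel" by (rule fmeasurableI) (auto simp: emeasure_lborel_Icc_eq)
  qed (use that in \<open>auto intro: cInf_lower cSup_upper\<close>)
  also have "... = Sup X - Inf X" using that by (simp add: cInf_le_cSup)
  finally show ?thesis .
 qed
 have 1: "Sup A <= w + Inf B"
 proof (rule cSup_least[OF assms(3)])
  fix a assume "a : A"
  hence "a - w <= Inf B" using d by (intro cInf_greatest[OF assms(4)]) (smt (verit))
  thus "a <= w + Inf B" by simp
 qed
 have 2: "Sup B <= w + Inf A"
 proof (rule cSup_least[OF assms(4)])
  fix b assume "b : B"
  hence "b - w <= Inf A" using d by (intro cInf_greatest[OF assms(3)]) (smt (verit))
  thus "b <= w + Inf A" by simp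
 qed
 show ?thesis using 1 2 le[OF assms(1,3) bdA] le[OF assms(2,4) bdB] by linarith
qed

text \<open>Over the abscissas \<open>x\<close> and \<open>x'\<close> all pairs of points of the two
  sections differ vertically by at most \<open>w\<close>. Hence the lengths of the sections sum to
  at most \<open>2 * w\<close>, and points within half of these lengths from the axis again differ
  by at most \<open>w\<close>.\<close>

lemma dist_steiner_le:
 assumes S: "S : sets borel" and d: "!!p q. p : S ==> q : S ==> dist p q <= D"
  and p: "p : steiner S" and q: "q : steiner S"
 shows "dist p q <= D"
proof -
 obtain x y x' y' where pq: "p = (x, y)" "q = (x', y')" by fastforce
 define A B where "A = Pair x -` S" and "B = Pair x' -` S"
 have A: "0 < measure lborel A" "2 * \<bar>y\<bar> <= measure lborel A"
  and B: "0 < measure lborel B" "2 * \<bar>y'\<bar> <= measure lborel B"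
  using p q by (auto simp: pq steiner_def A_def B_def)
 \<comment> \<open>\<open>steiner\<close> drops sections of measure zero, so both sections contain
   points of \<open>S\<close>.\<close>
 have ne: "A ~= {}" "B ~= {}" using A B by auto
 define w where "w = sqrt (D\<^sup>2 - (x - x')\<^sup>2)"
 have ab: "(a - b)\<^sup>2 <= D\<^sup>2 - (x - x')\<^sup>2 & 0 <= D" if "a : A" "b : B" for a b
 proof -
  have le: "dist (x, a) (x', b) <= D" using that by (intro d) (auto simp: A_def B_def)
  hence "0 <= D" using zero_le_dist order_trans by blast
  moreover have "(dist (x, a) (x', b))\<^sup>2 <= D\<^sup>2" using le by (intro power_mono) auto
  hence "(x - x')\<^sup>2 + (a - b)\<^sup>2 <= D\<^sup>2" by (simp add: dist_prod_def dist_real_def)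
  ultimately show ?thesis by auto
 qed
 obtain a b where "a : A" "b : B" using ne by blast
 from ab[OF this] have D: "0 <= D" "0 <= D\<^sup>2 - (x - x')\<^sup>2"
  using order_trans[OF zero_le_power2] by blast+
 have "measure lborel A + measure lborel B <= 2 * w"
 proof (rule measure_add_le_of_dist)
  show "\<bar>a - b\<bar> <= w" if "a : A" "b : B" for a b
   using ab[OF that] unfolding w_def by (intro real_le_rsqrt) auto
 qed (use ne section_borel[OF S] in \<open>auto simp: A_def B_def\<close>)
 hence "\<bar>y - y'\<bar> <= w" using A B by linarith
 hence "(y - y')\<^sup>2 <= w\<^sup>2" by (rule abs_le_square_iff[THEN iffD1, OF order_trans[OF _ abs_ge_self]])
 hence "(x - x')\<^sup>2 + (y - y')\<^sup>2 <= D\<^sup>2" using D by (simp add: w_def)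
 thus ?thesis using D by (simp add: pq dist_prod_def dist_real_def real_sqrt_le_iff sqrt_le_D real_le_lsqrt)
qed

text \<open>Symmetrization in one axis and then in the other preserves the area, does not increase
  the diameter and makes the set symmetric under \<open>z \<mapsto> - z\<close>. Then
  \<open>2 * norm z = dist z (- z) \<le> D\<close>, so the set lies in a disc of radius
  \<open>D / 2\<close>.\<close>

lemma isodiametric_inequality:
 fixes S :: "(real \<times> real) set"
 assumes S: "S : sets borel" and d: "!!p q. p : S ==> q : S ==> dist p q <= D" and D: "0 <= D"
 shows "emeasure lborel S <= ennreal (pi * (D / 2)\<^sup>2)"
proof -
 define S1 where "S1 = steiner S"
 define S1' where "S1' = prod.swap -` S1"
 define S2 where "S2 = steiner S1'"
 have bdd: "bounded X" if "!!p q. p : X ==> q : X ==> dist p q <= D" for X :: "(real \<times> real) set"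
  using that unfolding bounded_def by blast
 have d1: "dist p q <= D" if "p : S1" "q : S1" for p q
  using dist_steiner_le[OF S d] that by (auto simp: S1_def)
 have d1': "dist p q <= D" if "p : S1'" "q : S1'" for p q
  using d1[of "prod.swap p" "prod.swap q"] that by (cases p; cases q) (auto simp: S1'_def dist_prod_def add.commute)
 have S1: "S1 : sets borel" unfolding S1_def by (rule steiner_borel[OF S])
 have "prod.swap -` S1 Int space borel : sets borel"
 proof (rule measurable_sets[OF _ S1])
  show "prod.swap : borel_measurable (borel :: (real \<times> real) measure)"
   unfolding prod.swap_def[abs_def] by (intro borel_contI continuous_intros)
 qed
 hence S1': "S1' : sets borel" by (simp add: S1'_def)
 have d2: "dist p q <= D" if "p : S2" "q : S2" for p q
  using dist_steiner_le[OF S1' d1'] that by (auto simp: S2_def)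
 have "emeasure lborel S = emeasure lborel S1"
  unfolding S1_def using emeasure_steiner[OF S bdd[OF d]] by simp
 also have "... = emeasure lborel S1'"
  unfolding emeasure_lborel_pair_alt(2)[OF S1] emeasure_lborel_pair_alt(1)[OF S1']
  by (simp add: S1'_def vimage_def)
 also have "... = emeasure lborel S2"
  unfolding S2_def using emeasure_steiner[OF S1' bdd[OF d1']] by simp
 also have "S2 \<subseteq> cball 0 (D / 2)"
 proof
  fix z assume z: "z : S2"
  obtain x y where xy: "z = (x, y)" by fastforce
  \<comment> \<open>The symmetry gained in the first step survives the second: opposite sections
    agree, hence so do their symmetrizations.\<close>
  have "Pair (- x) -` S1' = Pair x -` S1'" by (auto simp: S1'_def S1_def steiner_def)
  hence "(- x, - y) : S2" using z by (simp add: S2_def steiner_def xy)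
  from d2[OF z this] have "dist z (- z) <= D" by (simp add: xy)
  moreover have "dist z (- z) = 2 * norm z"
   unfolding dist_norm by (simp flip: scaleR_2)
  ultimately show "z : cball 0 (D / 2)" by simp
 qed
 hence "emeasure lborel S2 <= emeasure lborel (cball (0::real\<times>real) (D/2))"
  by (intro emeasure_mono) auto
 also have "... = ennreal (pi * (D / 2)\<^sup>2)" using D by (simp add: emeasure_cball unit_ball_vol_2 power_divide power2_eq_square)
 finally show ?thesis .
qed

text \<open>Passing to closures makes the covering sets Borel without changing their diameters; by
  the isodiametric inequality the gauge of each of them is at least its area.\<close>

lemma emeasure_lborel_le_hausdorff_outer:
 fixes S :: "(real \<times> real) set"
 assumes "S : sets borel"
 shows "emeasure lborel S <= hausdorff_outer 2 S"
proof -
 have "emeasure lborel S <= hausdorff_pre 2 1 S"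
 proof (rule hausdorff_pre_greatest)
  fix C :: "nat => (real \<times> real) set"
  assume C: "S \<subseteq> (\<Union>i. C i)" "!!i. bounded (C i)"
  have "emeasure lborel S <= emeasure lborel (\<Union>i. closure (C i))"
   using C(1) closure_subset by (intro emeasure_mono) (auto, blast)
  also have "... <= (\<Sum>i. emeasure lborel (closure (C i)))"
   by (rule emeasure_subadditive_countably) auto
  also have "... <= (\<Sum>i. hausdorff_gauge 2 (C i))"
  proof (intro suminf_le)
   fix i
   show "emeasure lborel (closure (C i)) <= hausdorff_gauge 2 (C i)"
   proof (cases "C i = {}")
    case False
    have "emeasure lborel (closure (C i)) <= ennreal (pi * (diameter (C i) / 2)\<^sup>2)"
    proof (rule isodiametric_inequality)
     fix p q assume "p : closure (C i)" "q : closure (C i)"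
     thus "dist p q <= diameter (C i)"
      using diameter_bounded_bound[of "closure (C i)" p q] C(2)[of i]
      by (simp add: diameter_closure bounded_closure)
    qed (auto simp: diameter_ge_0 C(2))
    thus ?thesis using False by (simp add: hausdorff_gauge_def unit_ball_vol_2)
   qed simp
  qed auto
  finally show "emeasure lborel S <= (\<Sum>i. hausdorff_gauge 2 (C i))" .
 qed
 also have "... <= hausdorff_outer 2 S" by (rule hausdorff_pre_le_outer) simp
 finally show ?thesis .
qed

text \<open>Covers in \<open>hausdorff_pre\<close> are sequences. A countable family is reindexed
  along \<open>to_nat_on\<close> and padded with empty sets, which have gauge 0.\<close>

lemma hausdorff_pre_le_count_space:
 assumes I: "countable I" and A: "A \<subseteq> (\<Union>i\<in>I. X i)" and \<delta>: "0 < \<delta>"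
  and X: "!!i. i : I ==> bounded (X i)" "!!i. i : I ==> diameter (X i) <= \<delta>"
 shows "hausdorff_pre k \<delta> A <= (\<integral>\<^sup>+i. hausdorff_gauge k (X i) \<partial>count_space I)"
proof -
 define J where "J = to_nat_on I ` I"
 define C where "C = (%n. if n : J then X (from_nat_into I n) else {})"
 have inj: "inj_on (to_nat_on I) I" using I by (rule inj_on_to_nat_on)
 have "hausdorff_pre k \<delta> A <= (\<Sum>n. hausdorff_gauge k (C n))"
 proof (rule hausdorff_pre_le)
  show "A \<subseteq> (\<Union>n. C n)"
  proof
   fix x assume "x : A"
   then obtain i where i: "i : I" "x : X i" using A by blast
   hence "x : C (to_nat_on I i)" using I by (simp add: C_def J_def)
   thus "x : (\<Union>n. C n)" by blast
  qed
 qed (use X I \<delta> in \<open>auto simp: C_def J_def\<close>)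
 also have "... = (\<integral>\<^sup>+n. hausdorff_gauge k (C n) \<partial>count_space UNIV)"
  by (simp add: nn_integral_count_space_nat)
 also have "... = (\<integral>\<^sup>+n. hausdorff_gauge k (X (from_nat_into I n)) * indicator J n \<partial>count_space UNIV)"
  by (intro nn_integral_cong) (auto simp: C_def)
 also have "... = (\<integral>\<^sup>+n. hausdorff_gauge k (X (from_nat_into I n)) \<partial>count_space J)"
  by (simp add: nn_integral_count_space_indicator)
 also have "... = (\<integral>\<^sup>+i. hausdorff_gauge k (X (from_nat_into I (to_nat_on I i))) \<partial>count_space I)"
  by (rule nn_integral_bij_count_space[symmetric]) (auto simp: J_def inj bij_betw_def)
 also have "... = (\<integral>\<^sup>+i. hausdorff_gauge k (X i) \<partial>count_space I)"
  using I by (intro nn_integral_cong) simp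
 finally show ?thesis .
qed

lemma open_outer_lborel:
 fixes S :: "'a::euclidean_space set"
 assumes S: "S : sets borel" and e: "0 < (e::real)"
 obtains T where "open T" "S \<subseteq> T" "emeasure lborel T <= emeasure lborel S + ennreal e"
proof -
 obtain T where T: "open T" "S \<subseteq> T" "emeasure lborel (T - S) < e"
  using outer_regular_lborel[OF S e] by blast
 have "emeasure lborel T = emeasure lborel (S Un (T - S))" using T by (simp add: Un_absorb1 Un_Diff_cancel)
 also have "... <= emeasure lborel S + emeasure lborel (T - S)"
  using S T by (intro emeasure_subadditive) auto
 also have "... <= emeasure lborel S + ennreal e" using T by (intro add_left_mono) auto
 finally show ?thesis using T that by blast
qed

text \<open>The gauge of a disc is its area, so disjoint discs inside \<open>T\<close> cost at most
  the area of \<open>T\<close>. The dilation factor \<open>q\<close> will be 5 for the Vitali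
  covering lemma and 1 for the covering theorem.\<close>

lemma hausdorff_pre_disjoint_balls:
 fixes C :: "((real \<times> real) \<times> real) set"
 assumes C: "countable C" "pairwise (%i j. disjnt (cball (fst i) (snd i)) (cball (fst j) (snd j))) C"
  and r: "!!i. i : C ==> 0 < snd i & q * snd i <= \<delta> / 2 & cball (fst i) (snd i) \<subseteq> T" and T: "open T" and q: "1 <= q" and \<delta>: "0 < \<delta>"
 shows "hausdorff_pre 2 \<delta> (\<Union>i\<in>C. cball (fst i) (q * snd i)) <= ennreal (q\<^sup>2) * emeasure lborel T"
proof -
 have "hausdorff_pre 2 \<delta> (\<Union>i\<in>C. cball (fst i) (q * snd i)) <= (\<integral>\<^sup>+i. hausdorff_gauge 2 (cball (fst i) (q * snd i)) \<partial>count_space C)"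
 proof (intro hausdorff_pre_le_count_space C(1) \<delta>)
  show "diameter (cball (fst i) (q * snd i)) <= \<delta>" if "i : C" for i using r[OF that] \<delta> by (simp add: diameter_cball algebra_simps)
 qed auto
 also have "... = (\<integral>\<^sup>+i. ennreal (q\<^sup>2) * emeasure lborel (cball (fst i) (snd i)) \<partial>count_space C)"
 proof (rule nn_integral_cong)
  fix i assume "i : space (count_space C)"
  hence i: "0 < snd i" using r by simp
  have "hausdorff_gauge 2 (cball (fst i) (q * snd i)) = ennreal (pi * (q * snd i)\<^sup>2)"
   using i q by (simp add: hausdorff_gauge_def diameter_cball unit_ball_vol_2 not_less)
  also have "... = ennreal (q\<^sup>2) * ennreal (pi * (snd i)\<^sup>2)" by (simp add: ennreal_mult[symmetric] power_mult_distrib mult_ac)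
  finally show "hausdorff_gauge 2 (cball (fst i) (q * snd i)) = ennreal (q\<^sup>2) * emeasure lborel (cball (fst i) (snd i))"
   using i by (simp add: emeasure_cball unit_ball_vol_2 power2_eq_square)
 qed
 also have "... = ennreal (q\<^sup>2) * (\<integral>\<^sup>+i. emeasure lborel (cball (fst i) (snd i)) \<partial>count_space C)" by (rule nn_integral_cmult) auto
 also have "(\<integral>\<^sup>+i. emeasure lborel (cball (fst i) (snd i)) \<partial>count_space C) = emeasure lborel (\<Union>i\<in>C. cball (fst i) (snd i))"
  using C by (intro emeasure_UN_countable[symmetric]) (auto simp: disjoint_family_on_def pairwise_def disjnt_def)
 also have "... <= emeasure lborel T" using r T by (intro emeasure_mono) auto
 finally show ?thesis by (simp add: mult_left_mono)
qed

text \<open>Takes care of the null set that a Vitali cover leaves over. The covering lemma enlarges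
  disjoint discs by the factor 5, hence the tolerance \<open>e / 25\<close> for the open
  set.\<close>

lemma hausdorff_outer_null:
 fixes N :: "(real \<times> real) set"
 assumes N: "N : sets borel" "emeasure lborel N = 0"
 shows "hausdorff_outer 2 N = 0"
proof -
 have small: "hausdorff_pre 2 \<delta> N <= 0 + ennreal e" if \<delta>: "0 < \<delta>" and e: "0 < e" for \<delta> e :: real
 proof -
  obtain T where T: "open T" "N \<subseteq> T" "emeasure lborel T <= ennreal (e / 25)"
   using open_outer_lborel[OF N(1), of "e / 25"] N(2) e by auto
  define K where "K = {i :: (real \<times> real) \<times> real. 0 < snd i & 5 * snd i <= \<delta> / 2 & cball (fst i) (snd i) \<subseteq> T}"
  have "N \<subseteq> (\<Union>i\<in>K. cball (fst i) (snd i))"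
  proof
   fix x assume "x : N"
   then obtain r where r: "0 < r" "cball x r \<subseteq> T" using T open_contains_cball by blast
   have "cball x (min r (\<delta> / 10)) \<subseteq> cball x r" by (rule subset_cball) simp
   thus "x : (\<Union>i\<in>K. cball (fst i) (snd i))" using r \<delta> by (intro UN_I[of "(x, min r (\<delta> / 10))"]) (auto simp: K_def)
  qed
  moreover have "0 < snd i & snd i <= \<delta>" if "i : K" for i using that by (auto simp: K_def)
  ultimately obtain C where C: "countable C" "C \<subseteq> K" "pairwise (%i j. disjnt (cball (fst i) (snd i)) (cball (fst j) (snd j))) C"
   "N \<subseteq> (\<Union>i\<in>C. cball (fst i) (5 * snd i))" by (rule Vitali_covering_lemma_cballs)
  have "hausdorff_pre 2 \<delta> N <= hausdorff_pre 2 \<delta> (\<Union>i\<in>C. cball (fst i) (5 * snd i))" by (rule hausdorff_pre_mono[OF C(4)])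
  also have "... <= ennreal (5\<^sup>2) * emeasure lborel T"
   by (rule hausdorff_pre_disjoint_balls[OF C(1,3) _ T(1) _ \<delta>]) (use C(2) in \<open>auto simp: K_def\<close>)
  also have "... <= ennreal (5\<^sup>2) * ennreal (e / 25)" by (intro mult_left_mono T) simp
  also have "... = ennreal e" using e by (subst ennreal_mult[symmetric]) auto
  finally show ?thesis by simp
 qed
 have "hausdorff_outer 2 N <= 0" unfolding hausdorff_outer_def by (intro SUP_least ennreal_le_epsilon[OF small]) auto
 thus ?thesis by (simp only: le_zero_eq)
qed

text \<open>The lower bound is the isodiametric inequality. For the upper bound, disjoint discs of
  small radius inside an open set of slightly larger area exhaust \<open>S\<close> up to a null set,
  and for discs gauge and area agree.\<close>

lemma hausdorff_outer_2_eq_lborel: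
 fixes S :: "(real \<times> real) set"
 assumes S: "S : sets borel"
 shows "hausdorff_outer 2 S = emeasure lborel S"
proof (rule antisym)
 show "hausdorff_outer 2 S <= emeasure lborel S"
 proof (rule ennreal_le_epsilon)
  fix e :: real assume e: "0 < e"
  obtain T where T: "open T" "S \<subseteq> T" "emeasure lborel T <= emeasure lborel S + ennreal e"
   using open_outer_lborel[OF S e] by blast
  have "hausdorff_pre 2 \<delta> S <= emeasure lborel T" if \<delta>: "0 < \<delta>" for \<delta>
  proof -
   define K where "K = {i :: (real \<times> real) \<times> real. 0 < snd i & snd i <= \<delta> / 2 & cball (fst i) (snd i) \<subseteq> T}"
   obtain C where C: "countable C" "C \<subseteq> K" "pairwise (%i j. disjnt (cball (fst i) (snd i)) (cball (fst j) (snd j))) C"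
     "negligible (S - (\<Union>i\<in>C. cball (fst i) (snd i)))"
   proof (rule Vitali_covering_theorem_cballs[of K snd S fst])
    show "EX i. i : K & x : cball (fst i) (snd i) & snd i < d" if x: "x : S" and d: "0 < d" for x d
    proof -
     obtain r where r: "0 < r" "cball x r \<subseteq> T" using T x open_contains_cball by blast
     define s where "s = min (min r (\<delta>/2)) (d/2)"
     have "cball x s \<subseteq> cball x r" by (rule subset_cball) (simp add: s_def)
     thus ?thesis using r \<delta> d by (intro exI[of _ "(x, s)"]) (auto simp: K_def s_def)
    qed
   qed (auto simp: K_def)
   define B where "B = (\<Union>i\<in>C. cball (fst i) (snd i))"
   have Bm: "B : sets borel" unfolding B_def using C(1) by (intro sets.countable_UN') auto
   have "negligible (S - B)" using C(4) by (simp add: B_def)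
   hence 0: "emeasure lborel (S - B) = 0"
    using S Bm by (simp add: negligible_iff_emeasure0 emeasure_completion)
   have "S \<subseteq> (\<Union>i. binaryset B (S - B) i)" by (auto simp: UN_binaryset_eq)
   hence "hausdorff_pre 2 \<delta> S <= (\<Sum>i. hausdorff_pre 2 \<delta> (binaryset B (S - B) i))"
    by (rule order_trans[OF hausdorff_pre_mono hausdorff_pre_countably_subadditive[OF \<delta>]])
   also have "... = hausdorff_pre 2 \<delta> B + hausdorff_pre 2 \<delta> (S - B)"
    by (rule suminf_binaryset_eq) (simp add: hausdorff_pre_empty \<delta>)
   also have "hausdorff_pre 2 \<delta> (S - B) <= hausdorff_outer 2 (S - B)" by (rule hausdorff_pre_le_outer[OF \<delta>])
   also have "... = 0" using S Bm 0 by (intro hausdorff_outer_null) auto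
   also have "hausdorff_pre 2 \<delta> B <= ennreal (1\<^sup>2) * emeasure lborel T"
    using hausdorff_pre_disjoint_balls[OF C(1,3) _ T(1) _ \<delta>, of 1] C(2) by (auto simp: B_def K_def)
   finally show ?thesis by (simp add: add_right_mono)
  qed
  thus "hausdorff_outer 2 S <= emeasure lborel S + ennreal e"
   unfolding hausdorff_outer_def using T(3) by (intro SUP_least) (auto intro: order_trans)
 qed
qed (rule emeasure_lborel_le_hausdorff_outer[OF S])

section \<open>Minimax and strong limits\<close>

text \<open>The image of \<open>X\<close> under \<open>(f, g)\<close> is a convex subset of the
  plane that misses the quadrant \<open>Q\<close>. A separating functional has nonnegative
  coefficients, because \<open>Q\<close> is unbounded downwards in both coordinates; normalising
  them gives \<open>t\<close>. The operation \<open>mix\<close> stands for convex combination, so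
  that no vector space structure on the elements of \<open>X\<close> enters.\<close>

lemma two_function_minimax:
 fixes f g :: "'a => real" and mix :: "real => 'a => 'a => 'a"
 assumes X: "!!x y t. x : X ==> y : X ==> 0 <= t ==> t <= 1 ==> mix t x y : X"
  and f: "!!x y t. x : X ==> y : X ==> 0 <= t ==> t <= 1 ==> f (mix t x y) = (1 - t) * f x + t * f y"
  and g: "!!x y t. x : X ==> y : X ==> 0 <= t ==> t <= 1 ==> g (mix t x y) = (1 - t) * g x + t * g y"
  and c: "!!x. x : X ==> c < f x \<or> c < g x"
 shows "EX t:{0..1}. ALL x:X. c <= (1 - t) * f x + t * g x"
proof (cases "X = {}")
 case False
 define S where "S = (%x. (f x, g x)) ` X"
 define Q where "Q = {..c} \<times> {..c}"
 have cS: "convex S"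
 proof (rule convexI)
  fix p q :: "real \<times> real" and u v :: real
  assume "p : S" "q : S" and uv: "0 <= u" "0 <= v" "u + v = 1"
  then obtain x y where xy: "x : X" "y : X" "p = (f x, g x)" "q = (f y, g y)" by (auto simp: S_def)
  have u: "u = 1 - v" "v <= 1" using uv by auto
  have "u *. p + v *. q = (f (mix v x y), g (mix v x y))"
   using f[OF xy(1,2) uv(2) u(2)] g[OF xy(1,2) uv(2) u(2)] by (simp add: xy u)
  thus "u *. p + v *. q : S" using X[OF xy(1,2) uv(2) u(2)] by (simp add: S_def)
 qed
 have "convex Q" unfolding Q_def by (intro convex_Times) auto
 moreover have "S Int Q = {}" using c by (force simp: S_def Q_def)
 moreover have "S ~= {}" "Q ~= {}" using False by (auto simp: S_def Q_def)
 ultimately obtain a b where ab: "a ~= 0" "ALL z:Q. a @. z <= b" "ALL z:S. b <= a @. z"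
  using separating_hyperplane_sets[of Q S] cS by blast
 obtain a1 a2 where a: "a = (a1, a2)" by fastforce
 have Q: "a1 * x + a2 * y <= b" if "x <= c" "y <= c" for x y
  using ab(2) that by (auto simp: Q_def a inner_prod_def)
 \<comment> \<open>With a negative coefficient, the point \<open>c + m / a'\<close> of the half line
   would push the functional above \<open>b\<close>.\<close>
 have nonneg: "0 <= a'" if Q': "!!x. x <= c ==> a' * x + k <= b" for a' k
 proof (rule ccontr)
  assume neg: "\<not> 0 <= a'"
  define m where "m = \<bar>b - a' * c - k\<bar> + 1"
  have "a' * (c + m / a') + k <= b" by (rule Q') (use neg in \<open>auto simp: m_def divide_le_0_iff\<close>)
  moreover have "a' * (c + m / a') = a' * c + m" using neg by (simp add: distrib_left)
  ultimately show False by (simp add: m_def)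
 qed
 have a1: "0 <= a1" using Q[of _ c] by (intro nonneg[of a1 "a2 * c"]) auto
 have a2: "0 <= a2" using Q[of c] by (intro nonneg[of a2 "a1 * c"]) (auto simp: add.commute)
 have s: "0 < a1 + a2" using a1 a2 ab(1) by (auto simp: a zero_prod_def)
 define t where "t = a2 / (a1 + a2)"
 have t: "1 - t = a1 / (a1 + a2)" using s by (simp add: t_def field_simps)
 have "c <= (1 - t) * f x + t * g x" if x: "x : X" for x
 proof -
  have "a1 * c + a2 * c <= b" by (rule Q) auto
  also have "b <= a1 * f x + a2 * g x" using ab(3) x by (auto simp: S_def a inner_prod_def)
  finally have "c * (a1 + a2) <= a1 * f x + a2 * g x" by (simp add: algebra_simps)
  hence "c <= (a1 * f x + a2 * g x) / (a1 + a2)" using s by (simp add: pos_le_divide_eq)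
  also have "... = (1 - t) * f x + t * g x" by (simp only: t) (simp add: t_def add_divide_distrib)
  finally show ?thesis .
 qed
 thus ?thesis using a1 a2 s by (intro bexI[of _ t]) (auto simp: t_def divide_le_eq)
qed auto

text \<open>Argued by contradiction, with an induction: if at every point of \<open>Z\<close> some
  constraint of \<open>F\<close> exceeds \<open>c\<close>, a single element of \<open>Y\<close>
  stays above any smaller level on all of \<open>Z\<close>. For a new constraint \<open>p\<close>,
  the induction hypothesis is applied on the part of \<open>Z\<close> where \<open>p\<close> is at
  most \<open>c\<close>, and the resulting \<open>q\<close> is mixed with \<open>p\<close>. The
  levels \<open>c' < c2 < c1 < c\<close> pay for the strictness that each stage loses.\<close>

lemma finite_minimax:
 fixes \<Phi> :: "'a => 'b => real"
 assumes F: "finite F" "F \<subseteq> Y" and X0: "X ~= {}"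
  and mixX: "!!x y t. x : X ==> y : X ==> 0 <= t ==> t <= 1 ==> mixX t x y : X"
  and mixY: "!!p q t. p : Y ==> q : Y ==> 0 <= t ==> t <= 1 ==> mixY t p q : Y"
  and affX: "!!x y t p. x : X ==> y : X ==> p : Y ==> 0 <= t ==> t <= 1 ==> \<Phi> (mixX t x y) p = (1 - t) * \<Phi> x p + t * \<Phi> y p"
  and affY: "!!x p q t. x : X ==> p : Y ==> q : Y ==> 0 <= t ==> t <= 1 ==> \<Phi> x (mixY t p q) = (1 - t) * \<Phi> x p + t * \<Phi> x q"
  and le: "!!p. p : Y ==> EX x:X. \<Phi> x p <= d" and c: "d < c"
 shows "EX x:X. ALL p:F. \<Phi> x p <= c"
proof -
 have *: "EX q:Y. ALL x:Z. c' <= \<Phi> x q"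
  if "finite F" "F ~= {}" "F \<subseteq> Y" "Z \<subseteq> X" "!!x. x : Z ==> EX p:F. c < \<Phi> x p" "c' < c"
   "!!x y t. x : Z ==> y : Z ==> 0 <= t ==> t <= 1 ==> mixX t x y : Z" for F Z c c'
  using that
 proof (induction F arbitrary: Z c c' rule: finite_ne_induct)
  case (singleton p)
  show ?case
  proof (intro bexI ballI)
   fix x assume "x : Z"
   from singleton.prems(3)[OF this] have "c < \<Phi> x p" by simp
   thus "c' <= \<Phi> x p" using singleton.prems(4) by linarith
  next
   show "p : Y" using singleton.prems(1) by simp
  qed
 next
  case (insert p F)
  note prems = insert.prems
  have p: "p : Y" "F \<subseteq> Y" using prems(1) by auto
  define Z' where "Z' = {x\<in>Z. \<Phi> x p <= c}"
  obtain c1 where c1: "c' < c1" "c1 < c" using dense[OF prems(4)] by blast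
  have "EX q:Y. ALL x:Z'. c1 <= \<Phi> x q"
  proof (rule insert.IH)
   fix x y and t :: real assume xy: "x : Z'" "y : Z'" and t: "0 <= t" "t <= 1"
   have "\<Phi> (mixX t x y) p = (1 - t) * \<Phi> x p + t * \<Phi> y p"
    by (rule affX) (use xy t prems in \<open>auto simp: Z'_def\<close>)
   also have "... <= c" using xy t by (intro convex_bound_le) (auto simp: Z'_def)
   finally show "mixX t x y : Z'" using prems(5) xy t by (auto simp: Z'_def)
  next
   show "EX p:F. c < \<Phi> x p" if "x : Z'" for x
    using prems(3)[of x] that by (auto simp: Z'_def)
  qed (use prems c1 in \<open>auto simp: Z'_def\<close>)
  then obtain q where q: "q : Y" "!!x. x : Z' ==> c1 <= \<Phi> x q" by blast
  obtain c2 where c2: "c' < c2" "c2 < c1" using c1 dense by blast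
  have "EX t:{0..1}. ALL x:Z. c2 <= (1 - t) * \<Phi> x p + t * \<Phi> x q"
  proof (rule two_function_minimax[where mix=mixX])
   show "c2 < \<Phi> x p \<or> c2 < \<Phi> x q" if "x : Z" for x
    using that q(2)[of x] c1 c2 by (cases "\<Phi> x p <= c") (auto simp: Z'_def)
   show "\<Phi> (mixX t x y) p = (1 - t) * \<Phi> x p + t * \<Phi> y p" "\<Phi> (mixX t x y) q = (1 - t) * \<Phi> x q + t * \<Phi> y q"
    if "x : Z" "y : Z" "0 <= t" "t <= 1" for x y t
    using that prems(2) p q(1) by (auto intro!: affX)
  qed (rule prems(5))
  then obtain t where t: "t : {0..1}" "!!x. x : Z ==> c2 <= (1 - t) * \<Phi> x p + t * \<Phi> x q" by blast
  show ?case
  proof (intro bexI ballI)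
   show "mixY t p q : Y" using mixY[OF p(1) q(1)] t(1) by auto
   fix x assume x: "x : Z"
   have "\<Phi> x (mixY t p q) = (1 - t) * \<Phi> x p + t * \<Phi> x q"
    by (rule affY) (use x prems(2) p q t in auto)
   thus "c' <= \<Phi> x (mixY t p q)" using t(2)[OF x] c2 by linarith
  qed
 qed
 show ?thesis
 proof (rule ccontr)
  assume "\<not> ?thesis"
  hence no: "EX p:F. c < \<Phi> x p" if "x : X" for x using that by force
  hence "F ~= {}" using X0 by blast
  obtain c' where c': "d < c'" "c' < c" using c dense by blast
  obtain q where q: "q : Y" "ALL x:X. c' <= \<Phi> x q"
   using *[OF F(1) \<open>F ~= {}\<close> F(2) subset_refl no c'(2) mixX] by auto
  obtain x where "x : X" "\<Phi> x q <= d" using le[OF q(1)] by blast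
  thus False using q(2) c' by force
 qed
qed

text \<open>The minimisers of the \<open>L\<^sup>2\<close> norm over the constraint sets of a growing sequence of finite
 families form a Cauchy sequence by the parallelogram law; its limit satisfies all constraints.
 This replaces weak-* compactness of the unit ball of \<open>L\<^sup>\<infinity>\<close>.\<close>

lemma directed_L2_limit:
 fixes M :: "'a measure" and T :: "'i set => ('a => real) set"
 assumes fin: "finite_measure M"
  and meas: "!!F v. v : T F ==> v : borel_measurable M"
  and bnd: "!!F v x. v : T F ==> 0 <= v x & v x <= 1"
  and conv: "!!F v w. v : T F ==> w : T F ==> (%x. (v x + w x) / 2) : T F"
  and ne: "!!F. finite F ==> T F ~= {}"
  and anti: "!!F G. F \<subseteq> G ==> T G \<subseteq> T F"
 obtains v where "v : borel_measurable M" "!!x. 0 <= v x & v x <= 1"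
  "!!i. EX w. (ALL n. w n : T {i}) & (%n. \<integral>x. \<bar>w n x - v x\<bar> \<partial>M) \<longlonglongrightarrow> 0"
proof -
 interpret finite_measure M by fact
 define N where "N = (%v::'a=>real. \<integral>x. (v x)\<^sup>2 \<partial>M)"
 define r where "r = (%F. Inf (N ` T F))"
 have int: "integrable M (%x. (v x)\<^sup>2)" if "v : borel_measurable M" "!!x. \<bar>v x\<bar> <= 1" for v :: "'a => real"
  using that by (intro integrable_const_bound[of _ 1]) (auto simp: abs_square_le_1)
 have intp: "integrable M (%x. v x * w x)" if "v : borel_measurable M" "!!x. \<bar>v x\<bar> <= 1" "w : borel_measurable M" "!!x. \<bar>w x\<bar> <= 1" for v w :: "'a => real"
  using that by (intro integrable_const_bound[of _ 1]) (auto simp: abs_mult intro!: mult_le_one)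
 have bnd': "\<bar>v x\<bar> <= 1" if "v : T F" for v F x using bnd[OF that, of x] by auto
 have d01: "\<bar>p - q\<bar> <= 1" if "0 <= p & p <= 1" "0 <= q & q <= 1" for p q :: real
  using that by linarith
 have N0: "0 <= N v" for v by (simp add: N_def)
 have N1: "N v <= measure M (space M)" if "v : T F" for v F
 proof -
  have "N v <= (LINT x|M. 1)" unfolding N_def
   using meas[OF that] bnd'[OF that] by (intro integral_mono int) (auto simp: abs_square_le_1)
  thus ?thesis by simp
 qed
 have bb: "bdd_below (N ` T F)" for F using N0 by (intro bdd_belowI[of _ 0]) auto
 have r_le: "r F <= N v" if "v : T F" for v F
  unfolding r_def by (rule cInf_lower[OF _ bb]) (use that in auto)
 have r_bd: "r F <= measure M (space M)" if "finite F" for F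
  using ne[OF that] r_le N1 order_trans by (metis ex_in_conv)
 have r_mono: "r F <= r G" if "F \<subseteq> G" "finite G" for F G
  unfolding r_def using ne[OF that(2)] anti[OF that(1)] bb by (intro cInf_superset_mono image_mono) auto
 have par: "(LINT x|M. (v x - w x)\<^sup>2) <= 2 * N v + 2 * N w - 4 * r F" if vw: "v : T F" "w : T F" for v w F
 proof -
  have "(LINT x|M. (v x - w x)\<^sup>2) = (LINT x|M. 2 * (v x)\<^sup>2 + 2 * (w x)\<^sup>2 - 4 * ((v x + w x) / 2)\<^sup>2)"
   by (intro lint_cong) (auto simp: power2_eq_square field_simps)
  also have "... = 2 * N v + 2 * N w - 4 * N (%x. (v x + w x) / 2)"
   using int[OF meas[OF vw(1)] bnd'[OF vw(1)]] int[OF meas[OF vw(2)] bnd'[OF vw(2)]]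
    int[OF meas[OF conv[OF vw]] bnd'[OF conv[OF vw]]]
   by (simp add: N_def)
  also have "... <= 2 * N v + 2 * N w - 4 * r F" using r_le[OF conv[OF vw]] by simp
  finally show ?thesis .
 qed
 define R where "R = Sup (r ` {F. finite F})"
 have ba: "bdd_above (r ` {F. finite F})" using r_bd by (intro bdd_aboveI[of _ "measure M (space M)"]) auto
 have r_R: "r F <= R" if "finite F" for F unfolding R_def by (rule cSup_upper[OF _ ba]) (use that in auto)
 \<comment> \<open>The rate 16 makes squared distances of order \<open>1 / 16 ^ n\<close>; these
   become first-power distances of order \<open>1 / 4 ^ n\<close>, which are summable.\<close>
 have "EX F. finite F & R - 1 / 16 ^ n < r F" for n :: nat
  using less_cSup_iff[OF _ ba, of "R - 1 / 16 ^ n"] unfolding R_def[symmetric] by (auto simp: image_iff)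
 then obtain F0 where F0: "!!n. finite (F0 n)" "!!n. R - 1 / 16 ^ n < r (F0 n)" by metis
 define Fs where "Fs = (%n. \<Union>k\<le>n. F0 k)"
 have Fs: "finite (Fs n)" "R - 1 / 16 ^ n < r (Fs n)" for n
  using F0 r_mono[of "F0 n" "Fs n"] by (auto simp: Fs_def) (smt (verit) F0(2) UN_upper atMost_iff order_refl)
 have Fs_mono: "Fs m \<subseteq> Fs n" if "m <= n" for m n using that unfolding Fs_def by (intro UN_mono) auto
 have appr: "EX v:T G. N v < R + 1 / 16 ^ n" if "finite G" for G and n :: nat
 proof -
  have "Inf (N ` T G) < R + 1 / 16 ^ n" using r_R[OF that] unfolding r_def by (smt (verit) zero_less_divide_1_iff zero_less_power)
  thus ?thesis using cInf_less_iff[OF _ bb] ne[OF that] by auto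
 qed
 hence "EX v. ALL n. v n : T (Fs n) & N (v n) < R + 1 / 16 ^ n" using Fs(1) by (intro choice) blast
 then obtain v where v: "!!n. v n : T (Fs n)" "!!n. N (v n) < R + 1 / 16 ^ n" by blast
 have close: "(LINT x|M. \<bar>a x - b x\<bar>) <= K / 4 ^ n"
  if ab: "a : T (Fs n)" "b : T (Fs n)" "N a < R + 1 / 16 ^ n" "N b < R + 1 / 16 ^ n"
   and K: "K = (8 + measure M (space M)) / 2" for a b n K
 proof -
  have "(LINT x|M. (a x - b x)\<^sup>2) <= 8 / 16 ^ n"
   using par[OF ab(1,2)] Fs(2)[of n] ab(3,4) by simp
  \<comment> \<open>A weighted Young inequality, which takes the place of Cauchy-Schwarz on a finite
    measure space.\<close>
  have sq: "\<bar>a x - b x\<bar> <= (4 ^ n * (a x - b x)\<^sup>2 + 1 / 4 ^ n) / 2" for x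
  proof -
   have "0 <= (2 ^ n * \<bar>a x - b x\<bar> - 1 / 2 ^ n)\<^sup>2" by simp
   also have "... = (2 ^ n)\<^sup>2 * (a x - b x)\<^sup>2 - 2 * \<bar>a x - b x\<bar> + 1 / (2 ^ n)\<^sup>2"
    by (simp add: power2_diff[of "2 ^ n * \<bar>a x - b x\<bar>"] power_mult_distrib power_divide)
   also have "(2 ^ n)\<^sup>2 = (4::real) ^ n" by (simp add: power2_eq_square flip: power_mult_distrib)
   finally show ?thesis by simp
  qed
  have ib: "integrable M (%x. (a x - b x)\<^sup>2)"
   using meas[OF ab(1)] meas[OF ab(2)] d01[OF bnd[OF ab(1)] bnd[OF ab(2)]] by (intro int) auto
  have "(LINT x|M. \<bar>a x - b x\<bar>) <= (LINT x|M. (4 ^ n * (a x - b x)\<^sup>2 + 1 / 4 ^ n) / 2)"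
   using ib by (intro integral_mono' sq) auto
  also have "... = (4 ^ n * (LINT x|M. (a x - b x)\<^sup>2) + measure M (space M) / 4 ^ n) / 2"
   using ib by simp
  also have "... <= (4 ^ n * (8 / 16 ^ n) + measure M (space M) / 4 ^ n) / 2"
   using \<open>_ <= 8 / 16 ^ n\<close> by (intro divide_right_mono add_right_mono mult_left_mono) auto
  also have "(4::real) ^ n * (8 / 16 ^ n) = 8 / 4 ^ n"
  proof -
   have "(16::real) ^ n = 4 ^ n * 4 ^ n" by (simp flip: power_mult_distrib)
   thus ?thesis by simp
  qed
  finally show ?thesis by (simp add: K add_divide_distrib)
 qed
 define K where "K = (8 + measure M (space M)) / 2"
 have vm[measurable]: "v n : borel_measurable M" for n using meas[OF v(1)] .
 have vb: "0 <= v n x" "v n x <= 1" for n x using bnd[OF v(1)] by auto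
 have vR: "N (v n) < R + 1 / 16 ^ m" if "m <= n" for m n
 proof -
  have "(1::real) / 16 ^ n <= 1 / 16 ^ m" using that by (intro divide_left_mono power_increasing) auto
  thus ?thesis using v(2)[of n] by linarith
 qed
 have vT: "v n : T (Fs m)" if "m <= n" for m n using v(1) anti[OF Fs_mono[OF that]] by blast
 have step: "(LINT x|M. \<bar>v m x - v n x\<bar>) <= K / 4 ^ m" if "m <= n" for m n
  by (rule close[OF vT vT vR vR K_def]) (use that in auto)
 have i1: "integrable M (%x. \<bar>f x - g x\<bar>)" if "f : borel_measurable M" "g : borel_measurable M" "!!x. 0 <= f x & f x <= 1" "!!x. 0 <= g x & g x <= 1" for f g :: "'a => real"
  using that(1,2) d01[OF that(3,4)] by (intro integrable_const_bound[of _ 1]) auto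
 have "AE x in M. summable (%n. \<bar>v n x - v (Suc n) x\<bar>)"
 proof -
  have "(\<integral>\<^sup>+x. (\<Sum>n. ennreal \<bar>v n x - v (Suc n) x\<bar>) \<partial>M) = (\<Sum>n. \<integral>\<^sup>+x. ennreal \<bar>v n x - v (Suc n) x\<bar> \<partial>M)"
   by (rule nn_integral_suminf) measurable
  also have "... <= (\<Sum>n. ennreal (K / 4 ^ n))"
  proof (intro suminf_le)
   fix n
   have "(\<integral>\<^sup>+x. ennreal \<bar>v n x - v (Suc n) x\<bar> \<partial>M) = ennreal (LINT x|M. \<bar>v n x - v (Suc n) x\<bar>)"
    using vb by (intro nn_integral_eq_integral i1) auto
   also have "... <= ennreal (K / 4 ^ n)" by (intro ennreal_leI step) auto
   finally show "(\<integral>\<^sup>+x. ennreal \<bar>v n x - v (Suc n) x\<bar> \<partial>M) <= ennreal (K / 4 ^ n)" .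
  qed auto
  also have "... = ennreal (\<Sum>n. K / 4 ^ n)"
  proof (rule suminf_ennreal2)
   show "summable (%n. K / 4 ^ n)" using summable_mult[OF summable_geometric[of "1/4::real"], of K] by (simp add: power_divide)
  qed (simp add: K_def)
  finally have "(\<integral>\<^sup>+x. (\<Sum>n. ennreal \<bar>v n x - v (Suc n) x\<bar>) \<partial>M) ~= \<infinity>" by (auto simp: top_unique)
  hence "AE x in M. (\<Sum>n. ennreal \<bar>v n x - v (Suc n) x\<bar>) ~= \<infinity>"
   by (intro nn_integral_PInf_AE) measurable
  thus ?thesis by eventually_elim (auto intro!: summable_suminf_not_top)
 qed
 hence conv_ae: "AE x in M. convergent (%n. v n x)"
 proof eventually_elim
  case (elim x)
  hence "summable (%n. v n x - v (Suc n) x)" by (rule summable_rabs_cancel)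
  hence "summable (%n. v (Suc n) x - v n x)" using summable_minus by fastforce
  hence "convergent (%n. \<Sum>k<n. v (Suc k) x - v k x)" by (simp add: summable_iff_convergent)
  hence "convergent (%n. (\<Sum>k<n. v (Suc k) x - v k x) + v 0 x)"
   by (intro convergent_add convergent_const)
  thus ?case by (simp only: sum_lessThan_telescope[of "%n. v n x"]) simp
 qed
 \<comment> \<open>\<open>lim\<close> is arbitrary where the sequence diverges; clipping keeps
   \<open>u\<close> in the unit interval everywhere.\<close>
 define u where "u = (%x. min 1 (max 0 (lim (%n. v n x))))"
 have um[measurable]: "u : borel_measurable M" unfolding u_def by measurable
 have ub: "0 <= u x & u x <= 1" for x by (auto simp: u_def)
 have lim: "AE x in M. (%n. v n x) \<longlonglongrightarrow> u x"
  using conv_ae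
 proof eventually_elim
  case (elim x)
  hence L: "(%n. v n x) \<longlonglongrightarrow> lim (%n. v n x)" by (simp add: convergent_LIMSEQ_iff)
  have "0 <= lim (%n. v n x)" by (rule LIMSEQ_le_const[OF L]) (use vb in auto)
  moreover have "lim (%n. v n x) <= 1" by (rule LIMSEQ_le_const2[OF L]) (use vb in auto)
  ultimately show ?case using L by (simp add: u_def)
 qed
 have vu: "(%n. \<integral>x. \<bar>v n x - u x\<bar> \<partial>M) \<longlonglongrightarrow> (LINT x|M. 0)"
 proof (rule integral_dominated_convergence[where w="%_. 1"])
  show "AE x in M. (%n. \<bar>v n x - u x\<bar>) \<longlonglongrightarrow> 0"
   using lim by eventually_elim (auto intro!: tendsto_rabs_zero simp: LIM_zero)
  show "AE x in M. norm \<bar>v n x - u x\<bar> <= 1" for n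
   using d01[OF _ ub] vb by auto
 qed auto
 have "EX w. (ALL n. w n : T {i}) & (%n. \<integral>x. \<bar>w n x - u x\<bar> \<partial>M) \<longlonglongrightarrow> 0" for i
 proof -
  \<comment> \<open>The index \<open>i\<close> need not belong to any \<open>Fs n\<close>, so
    \<open>v n\<close> may violate its constraint. Near-minimisers that respect \<open>i\<close> as
    well still lie in \<open>T (Fs n)\<close> and are therefore close to \<open>v n\<close>.\<close>
  have "EX w. ALL n. w n : T (insert i (Fs n)) & N (w n) < R + 1 / 16 ^ n"
   using appr Fs(1) by (intro choice) blast
  then obtain w where w: "!!n. w n : T (insert i (Fs n))" "!!n. N (w n) < R + 1 / 16 ^ n" by blast
  have wF: "w n : T (Fs n)" for n using w(1) anti[of "Fs n" "insert i (Fs n)"] by blast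
  have wi: "w n : T {i}" for n using w(1) anti[of "{i}" "insert i (Fs n)"] by blast
  have wv: "(LINT x|M. \<bar>w n x - v n x\<bar>) <= K / 4 ^ n" for n
   by (rule close[OF wF v(1) w(2) v(2) K_def])
  have "(LINT x|M. \<bar>w n x - u x\<bar>) <= K / 4 ^ n + (LINT x|M. \<bar>v n x - u x\<bar>)" for n
  proof -
   have vn: "0 <= v n x & v n x <= 1" for x using vb by simp
   have a: "integrable M (%x. \<bar>w n x - v n x\<bar>)" "integrable M (%x. \<bar>v n x - u x\<bar>)" "integrable M (%x. \<bar>w n x - u x\<bar>)"
    by (rule i1[OF meas[OF wF] vm bnd[OF wF] vn] i1[OF vm um vn ub] i1[OF meas[OF wF] um bnd[OF wF] ub])+
   have "(LINT x|M. \<bar>w n x - u x\<bar>) <= (LINT x|M. \<bar>w n x - v n x\<bar> + \<bar>v n x - u x\<bar>)"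
    using a by (intro integral_mono) auto
   also have "... = (LINT x|M. \<bar>w n x - v n x\<bar>) + (LINT x|M. \<bar>v n x - u x\<bar>)" using a by simp
   finally show ?thesis using wv[of n] by linarith
  qed
  moreover have "(%n. K / 4 ^ n + (LINT x|M. \<bar>v n x - u x\<bar>)) \<longlonglongrightarrow> 0"
  proof -
   have "(%n. K * (1/4) ^ n) \<longlonglongrightarrow> K * 0" by (intro tendsto_mult LIMSEQ_realpow_zero tendsto_const) auto
   hence "(%n. K / 4 ^ n) \<longlonglongrightarrow> 0" by (simp add: power_divide)
   thus ?thesis using tendsto_add[OF _ vu] by force
  qed
  ultimately have "(%n. \<integral>x. \<bar>w n x - u x\<bar> \<partial>M) \<longlonglongrightarrow> 0"
   using tendsto_sandwich[OF _ _ tendsto_const, of 0 "%n. \<integral>x. \<bar>w n x - u x\<bar> \<partial>M" sequentially "%n. K / 4 ^ n + (LINT x|M. \<bar>v n x - u x\<bar>)"]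
   by simp
  thus ?thesis using wi by (intro exI[of _ w] conjI allI)
 qed
 thus thesis by (intro that[OF um ub])
qed

section \<open>Representation of bounded functionals on test fields\<close>

lemma C1_UNIV_I:
 fixes f' :: "'a::euclidean_space => 'a \<Rightarrow>\<^sub>L 'b::euclidean_space"
 assumes "continuous_on UNIV f'" "!!z. (f has_derivative blinfun_apply (f' z)) (at z)"
 shows "f : C1_upto UNIV"
proof -
 have "continuous_on UNIV f"
  by (meson assms(2) continuous_at_imp_continuous_on has_derivative_continuous)
 thus ?thesis using assms by (auto simp: C1_upto_def)
qed

lemma C1_UNIV_E:
 assumes "f : C1_upto UNIV"
 obtains f' :: "'a::euclidean_space => 'a \<Rightarrow>\<^sub>L 'b::euclidean_space"
 where "continuous_on UNIV f'" "!!z. (f has_derivative blinfun_apply (f' z)) (at z)" "continuous_on UNIV f"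
 using assms that by (auto simp: C1_upto_def)

lemma C1_const [intro]: "(%z. c) : C1_upto UNIV"
 by (rule C1_UNIV_I[of "%z. 0"]) (auto simp: zero_blinfun.rep_eq)

lemma C1_bounded_linear:
 assumes T: "bounded_linear T" and f: "f : C1_upto UNIV"
 shows "(%z. T (f z)) : C1_upto UNIV"
proof -
 obtain f' where f': "continuous_on UNIV f'" "!!z. (f has_derivative blinfun_apply (f' z)) (at z)"
  using f by (rule C1_UNIV_E) blast
 show ?thesis
 proof (rule C1_UNIV_I)
  show "continuous_on UNIV (%z. Blinfun T o\<^sub>L f' z)" by (intro continuous_intros f')
  show "((%z. T (f z)) has_derivative blinfun_apply (Blinfun T o\<^sub>L f' z)) (at z)" for z
   by (rule has_derivative_eq_rhs[OF bounded_linear.has_derivative[OF T f'(2)]])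
    (simp add: bounded_linear_Blinfun_apply[OF T] fun_eq_iff)
 qed
qed

lemma C1_ident: "(%z. z) : C1_upto UNIV"
 by (rule C1_UNIV_I[of "%z. id_blinfun"]) auto

lemma C1_add:
 assumes "f : C1_upto UNIV" "g : C1_upto UNIV"
 shows "(%z. f z + g z) : C1_upto UNIV"
proof -
 obtain f' where f': "continuous_on UNIV f'" "!!z. (f has_derivative blinfun_apply (f' z)) (at z)"
  using assms(1) by (rule C1_UNIV_E) blast
 obtain g' where g': "continuous_on UNIV g'" "!!z. (g has_derivative blinfun_apply (g' z)) (at z)"
  using assms(2) by (rule C1_UNIV_E) blast
 show ?thesis
 proof (rule C1_UNIV_I)
  show "continuous_on UNIV (%z. f' z + g' z)" by (intro continuous_intros f' g')
  show "((%z. f z + g z) has_derivative blinfun_apply (f' z + g' z)) (at z)" for z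
   by (rule has_derivative_eq_rhs[OF has_derivative_add[OF f'(2) g'(2)]]) (simp add: blinfun.add_left fun_eq_iff)
 qed
qed

lemma C1_scaleR:
 fixes g :: "'a::euclidean_space => real" and f :: "'a => 'b::euclidean_space"
 assumes "g : C1_upto UNIV" "f : C1_upto UNIV"
 shows "(%z. g z *. f z) : C1_upto UNIV"
proof -
 obtain f' where f': "continuous_on UNIV f'" "!!z. (f has_derivative blinfun_apply (f' z)) (at z)" "continuous_on UNIV f"
  using assms(2) by (rule C1_UNIV_E) blast
 obtain g' where g': "continuous_on UNIV g'" "!!z. (g has_derivative blinfun_apply (g' z)) (at z)" "continuous_on UNIV g"
  using assms(1) by (rule C1_UNIV_E) blast
 show ?thesis
 proof (rule C1_UNIV_I)
  show "continuous_on UNIV (%z. g z *. f' z + (blinfun_scaleR_left (f z) o\<^sub>L g' z))"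
   by (intro continuous_intros f' g' bounded_linear.continuous_on[OF bounded_linear_blinfun_scaleR_left])
  show "((%z. g z *. f z) has_derivative blinfun_apply (g z *. f' z + (blinfun_scaleR_left (f z) o\<^sub>L g' z))) (at z)" for z
   by (rule has_derivative_eq_rhs[OF has_derivative_scaleR[OF g'(2) f'(2)]])
    (simp add: blinfun.add_left blinfun.scaleR_left fun_eq_iff)
 qed
qed

lemma C1_mult:
 fixes g f :: "'a::euclidean_space => real"
 assumes "g : C1_upto UNIV" "f : C1_upto UNIV"
 shows "(%z. g z * f z) : C1_upto UNIV"
 using C1_scaleR[OF assms] by simp

lemma C1_cmult: "f : C1_upto UNIV ==> (%z. (c::real) * f z) : C1_upto UNIV"
 by (intro C1_mult C1_const)

lemma C1_diff:
 fixes f g :: "'a::euclidean_space => 'b::euclidean_space"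
 assumes "f : C1_upto UNIV" "g : C1_upto UNIV" shows "(%z. f z - g z) : C1_upto UNIV"
 using C1_add[OF assms(1) C1_scaleR[OF C1_const[of "-1"] assms(2)]] by simp

lemma C1_sum: "(!!i. i : I ==> f i : C1_upto UNIV) ==> (%z. SUM i:I. f i z) : C1_upto UNIV"
proof (induction I rule: infinite_finite_induct)
 case (insert i I)
 have "(%z. f i z + (SUM i:I. f i z)) : C1_upto UNIV" by (rule C1_add) (use insert in auto)
 thus ?case using insert by simp
qed auto

lemma C1_prod:
 fixes f :: "'i => 'a::euclidean_space => real"
 shows "(!!i. i : I ==> f i : C1_upto UNIV) ==> (%z. \<Prod>i\<in>I. f i z) : C1_upto UNIV"
proof (induction I rule: infinite_finite_induct)
 case (insert i I)
 have "(%z. f i z * (\<Prod>i\<in>I. f i z)) : C1_upto UNIV" by (rule C1_mult) (use insert in auto)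
 thus ?case using insert by simp
qed auto

lemma C1_compose_real:
 fixes g :: "'a::euclidean_space => real" and h :: "real => real"
 assumes g: "g : C1_upto UNIV" and h: "!!t. (h has_real_derivative h' t) (at t)" "continuous_on UNIV h'"
 shows "(%z. h (g z)) : C1_upto UNIV"
proof -
 obtain g' where g': "continuous_on UNIV g'" "!!z. (g has_derivative blinfun_apply (g' z)) (at z)" "continuous_on UNIV g"
  using g by (rule C1_UNIV_E) blast
 show ?thesis
 proof (rule C1_UNIV_I)
  show "continuous_on UNIV (%z. h' (g z) *. g' z)"
   by (intro continuous_intros g' continuous_on_compose2[OF h(2) g'(3)]) auto
  show "((%z. h (g z)) has_derivative blinfun_apply (h' (g z) *. g' z)) (at z)" for z
  proof -
   have "(h has_derivative (%x. x * h' (g z))) (at (g z))"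
    using h(1)[of "g z"] by (simp add: has_field_derivative_def mult.commute[of "h' (g z)"] mult_commute_abs)
   from has_derivative_compose[OF g'(2) this]
   show ?thesis by (rule has_derivative_eq_rhs) (simp add: blinfun.scaleR_left fun_eq_iff mult.commute)
  qed
 qed
qed

lemma C1_dist_square: "(%z::'a::euclidean_space. (dist z a)\<^sup>2) : C1_upto UNIV"
proof (rule C1_UNIV_I)
 show "continuous_on UNIV (%z::'a. 2 *. blinfun_inner_right (z - a))"
  by (intro continuous_intros bounded_linear.continuous_on[OF bounded_linear_blinfun_inner_right])
 show "((%z. (dist z a)\<^sup>2) has_derivative blinfun_apply (2 *. blinfun_inner_right (z - a))) (at z)" for z
  unfolding dist_norm power2_norm_eq_inner
  by (auto intro!: derivative_eq_intros simp: blinfun.scaleR_left inner_commute)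
qed

lemma sqr_pos_part_deriv: "((%t::real. (max 0 t)\<^sup>2) has_real_derivative 2 * max 0 t) (at t)"
proof -
 consider "t < 0" | "t = 0" | "0 < t" by linarith
 thus ?thesis
 proof cases
  case 1
  have "((%t::real. 0) has_real_derivative 2 * max 0 t) (at t)" using 1 by (auto intro!: derivative_eq_intros)
  thus ?thesis
   by (rule has_field_derivative_transform_within_open[of _ _ _ "{..<0}"]) (use 1 in auto)
 next
  case 3
  have "((%t::real. t\<^sup>2) has_real_derivative 2 * max 0 t) (at t)" using 3 by (auto intro!: derivative_eq_intros)
  thus ?thesis
   by (rule has_field_derivative_transform_within_open[of _ _ _ "{0<..}"]) (use 3 in auto)
 next
  case 2
  have "((%h::real. ((max 0 (0 + h))\<^sup>2 - (max 0 0)\<^sup>2) / h) \<longlongrightarrow> 0) (at 0)"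
  proof (rule Lim_null_comparison)
   show "\<forall>\<^sub>F h in at 0. norm (((max 0 (0 + h))\<^sup>2 - (max 0 0)\<^sup>2) / h) <= \<bar>h::real\<bar>"
    by (intro always_eventually allI) (auto simp: max_def power2_eq_square)
   show "((%h::real. \<bar>h\<bar>) \<longlongrightarrow> 0) (at 0)" by (intro tendsto_eq_intros) auto
  qed
  thus ?thesis using 2 by (simp add: DERIV_def)
 qed
qed

text \<open>A C1 transition from 0 for \<open>t \<le> 0\<close> to 1 for \<open>t \<ge> 1\<close>.
  Squares of positive parts are C1, and the denominator is positive because \<open>t\<close> and
  \<open>1 - t\<close> are never both nonpositive.\<close>

definition smooth_step :: "real => real" where
 "smooth_step t = (max 0 t)\<^sup>2 / ((max 0 t)\<^sup>2 + (max 0 (1 - t))\<^sup>2)"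

lemma smooth_step_denominator: "0 < (max 0 t)\<^sup>2 + (max 0 (1 - t))\<^sup>2" for t :: real
 by (cases "t <= 0") (auto simp: max_def add_nonneg_pos add_pos_nonneg)

lemma smooth_step_bounds: "0 <= smooth_step t" "smooth_step t <= 1"
 using smooth_step_denominator[of t] by (auto simp: smooth_step_def divide_le_eq_1)

lemma smooth_step_0: "t <= 0 ==> smooth_step t = 0"
 by (simp add: smooth_step_def)

lemma smooth_step_1:
 assumes "1 <= t" shows "smooth_step t = 1"
proof -
 have "max 0 (1 - t) = 0" "max 0 t = t" "t ~= 0" using assms by auto
 thus ?thesis by (simp add: smooth_step_def)
qed

lemma C1_smooth_step:
 assumes "g : C1_upto UNIV" shows "(%z. smooth_step (g z)) : C1_upto UNIV"
proof -
 define D where "D = (%t::real. (max 0 t)\<^sup>2 + (max 0 (1 - t))\<^sup>2)"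
 have D0: "D t ~= 0" for t using smooth_step_denominator[of t] unfolding D_def by linarith
 define S' where "S' = (%t. (2 * max 0 t * D t - (max 0 t)\<^sup>2 * (2 * max 0 t - 2 * max 0 (1 - t))) / (D t * D t))"
 have dp: "((%t. (max 0 (1 - t))\<^sup>2) has_real_derivative (- (2 * max 0 (1 - t)))) (at t)" for t :: real
 proof -
  have "((%t::real. 1 - t) has_real_derivative -1) (at t)" by (auto intro!: derivative_eq_intros)
  from DERIV_chain2[where f="%t. (max 0 t)\<^sup>2", OF sqr_pos_part_deriv this] show ?thesis by simp
 qed
 have "(D has_real_derivative (2 * max 0 t - 2 * max 0 (1 - t))) (at t)" for t
  unfolding D_def using DERIV_add[OF sqr_pos_part_deriv dp] by simp
 hence "((%t. (max 0 t)\<^sup>2 / D t) has_real_derivative S' t) (at t)" for t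
  unfolding S'_def by (intro DERIV_divide sqr_pos_part_deriv D0)
 hence S': "(smooth_step has_real_derivative S' t) (at t)" for t
  by (simp add: smooth_step_def[abs_def] D_def)
 have "continuous_on UNIV S'"
  unfolding S'_def using D0 unfolding D_def by (intro continuous_intros) auto
 thus ?thesis by (rule C1_compose_real[OF assms S'])
qed

lemma C1c_I:
 "f : C1_upto UNIV ==> compact K ==> K \<subseteq> U ==> (!!z. z ~: K ==> f z = 0) ==> f : C1c U"
 by (auto simp: C1c_def)

lemma C1c_E:
 assumes "f : C1c U"
 obtains K where "f : C1_upto UNIV" "compact K" "K \<subseteq> U" "!!z. z ~: K ==> f z = 0"
 using assms that by (auto simp: C1c_def)

text \<open>Finitely many balls, whose doubles lie in \<open>A\<close>, cover \<open>K\<close>; the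
  product of the functions \<open>1 - b x\<close> vanishes where one bump is 1 and equals 1 where
  all bumps vanish. The open set \<open>W\<close> is recorded because derivatives of products with
  \<open>\<eta>\<close> have to be computed at the points of \<open>K\<close>, for which values on
  \<open>K\<close> alone do not suffice.\<close>

lemma C1_cutoff:
 fixes K :: "'a::euclidean_space set"
 assumes K: "compact K" and A: "open A" "K \<subseteq> A"
 obtains \<eta> W K' where "\<eta> : C1_upto UNIV" "!!z. 0 <= \<eta> z & \<eta> z <= (1::real)" "open W" "K \<subseteq> W" "!!z. z : W ==> \<eta> z = 1"
  "compact K'" "K' \<subseteq> A" "!!z. z ~: K' ==> \<eta> z = 0"
proof -
 have ex: "EX r. 0 < r & cball x (2 * r) \<subseteq> A" if xK: "x : K" for x
 proof -
  obtain e where "e > 0" "cball x e \<subseteq> A"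
   using open_contains_cball[THEN iffD1, OF A(1), rule_format, OF subsetD[OF A(2) xK]] by (elim exE conjE)
  thus ?thesis by (intro exI[of _ "e/2"]) auto
 qed
 from bchoice[OF ballI[OF ex]] obtain r where r': "ALL x:K. 0 < r x & cball x (2 * r x) \<subseteq> A" by (rule exE)
 have r: "0 < r x" "cball x (2 * r x) \<subseteq> A" if "x : K" for x using r' that by auto
 have "K \<subseteq> (\<Union>x\<in>K. ball x (r x))" using r by auto
 then obtain X where X: "X \<subseteq> K" "finite X" "K \<subseteq> (\<Union>x\<in>X. ball x (r x))"
  by (rule compactE_image[OF K, of K "%x. ball x (r x)", rotated]) auto
 \<comment> \<open>The argument of the step is at least 1 within distance \<open>r x\<close> and at
   most -2 beyond distance \<open>2 * r x\<close>.\<close>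
 define b where "b = (%x z. smooth_step (2 - 1 / (r x)\<^sup>2 * (dist z x)\<^sup>2))"
 have bC: "b x : C1_upto UNIV" for x
  unfolding b_def by (intro C1_smooth_step C1_diff C1_const C1_cmult C1_dist_square)
 have b01: "0 <= b x z & b x z <= 1" for x z by (simp add: b_def smooth_step_bounds)
 have b1: "b x z = 1" if "x : X" "z : ball x (r x)" for x z
 proof -
  have "0 < r x" "dist z x <= r x" using that r X by (auto simp: dist_commute)
  hence "(dist z x)\<^sup>2 <= (r x)\<^sup>2" by (intro power_mono) auto
  hence "1 / (r x)\<^sup>2 * (dist z x)\<^sup>2 <= 1" using \<open>0 < r x\<close> by (simp add: divide_le_eq_1)
  thus ?thesis unfolding b_def by (intro smooth_step_1) linarith
 qed
 have b0: "b x z = 0" if "x : X" "z ~: cball x (2 * r x)" for x z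
 proof -
  have "0 < r x" "2 * r x <= dist z x" using that r X by (auto simp: dist_commute)
  hence "(2 * r x)\<^sup>2 <= (dist z x)\<^sup>2" by (intro power_mono) auto
  hence "4 <= 1 / (r x)\<^sup>2 * (dist z x)\<^sup>2" using \<open>0 < r x\<close> by (simp add: pos_le_divide_eq power_mult_distrib)
  thus ?thesis unfolding b_def by (intro smooth_step_0) linarith
 qed
 define \<eta> where "\<eta> = (%z. 1 - (\<Prod>x\<in>X. 1 - b x z))"
 show thesis
 proof (rule that[of \<eta> "\<Union>x\<in>X. ball x (r x)" "\<Union>x\<in>X. cball x (2 * r x)"])
  show "\<eta> : C1_upto UNIV" unfolding \<eta>_def by (intro C1_diff C1_const C1_prod bC)
  show "0 <= \<eta> z & \<eta> z <= 1" for z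
   unfolding \<eta>_def using b01 by (auto intro!: prod_le_1 prod_nonneg)
  show "\<eta> z = 1" if "z : (\<Union>x\<in>X. ball x (r x))" for z
   using that b1 X(2) by (auto simp: \<eta>_def prod_zero_iff)
  show "\<eta> z = 0" if "z ~: (\<Union>x\<in>X. cball x (2 * r x))" for z
   using that b0 by (auto simp: \<eta>_def)
  show "(\<Union>x\<in>X. cball x (2 * r x)) \<subseteq> A" using r(2) X(1) by blast
 qed (use X in auto)
qed

text \<open>A discrete layer-cake formula: up to an error 1, \<open>x\<close> is the number of
  naturals \<open>k\<close> below it. The \<open>k\<close>-th smooth step lies between the
  indicators of \<open>k + 1 \<le> x\<close> and of \<open>k < x\<close>.\<close>

lemma smooth_step_sum:
 fixes x :: real
 assumes "0 <= x" "x <= real n"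
 shows "(\<Sum>k<n. of_bool (real k < x)) <= x + 1" "\<bar>(\<Sum>k<n. smooth_step (2 * (x - real k))) - x\<bar> <= 1"
proof -
 have "(\<Sum>k<m. of_bool (real k < x)) <= min (real m) (x + 1)" for m
  using assms(1) by (induction m) (auto simp: of_bool_def)
 from this[of n] show 1: "(\<Sum>k<n. of_bool (real k < x)) <= x + 1" by simp
 have "min (real m) (x - 1) <= (\<Sum>k<m. of_bool (real k + 1 <= x))" for m
  by (induction m) (auto simp: of_bool_def)
 from this[of n] have 2: "x - 1 <= (\<Sum>k<n. of_bool (real k + 1 <= x) :: real)" using assms(2) by simp
 have "smooth_step (2 * (x - real k)) <= of_bool (real k < x)" for k
  using smooth_step_bounds smooth_step_0[of "2 * (x - real k)"] by (auto simp: of_bool_def)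
 hence "(\<Sum>k<n. smooth_step (2 * (x - real k))) <= (\<Sum>k<n. of_bool (real k < x))" by (rule sum_mono)
 moreover have "of_bool (real k + 1 <= x) <= smooth_step (2 * (x - real k))" for k
  using smooth_step_bounds smooth_step_1[of "2 * (x - real k)"] by (auto simp: of_bool_def)
 hence "(\<Sum>k<n. of_bool (real k + 1 <= x)) <= (\<Sum>k<n. smooth_step (2 * (x - real k)))" by (rule sum_mono)
 ultimately show "\<bar>(\<Sum>k<n. smooth_step (2 * (x - real k))) - x\<bar> <= 1" using 1 2 by linarith
qed

lemma C1c_bounded:
 fixes f :: "'a::euclidean_space => 'b::euclidean_space"
 assumes "f : C1c U"
 obtains B where "0 < B" "!!z. norm (f z) <= B"
proof -
 obtain K where K: "f : C1_upto UNIV" "compact K" "!!z. z ~: K ==> f z = 0" using assms by (rule C1c_E) blast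
 have "continuous_on K f" using K(1) by (auto simp: C1_upto_def intro: continuous_on_subset)
 hence "bounded (f ` K)" using K(2) compact_continuous_image compact_imp_bounded by blast
 then obtain B where B: "!!z. z : K ==> norm (f z) <= B" by (auto simp: bounded_iff)
 show thesis
 proof (rule that[of "max B 1"])
  show "norm (f z) <= max B 1" for z using B[of z] K(3)[of z] by (cases "z : K") auto
 qed simp
qed

lemma C1c_integrable:
 fixes f :: "'a::euclidean_space => 'b::euclidean_space"
 assumes f: "f : C1c U" and M: "finite_measure M" "sets M = sets borel"
 shows "integrable M f" "f : borel_fun"
proof -
 interpret finite_measure M by fact
 obtain B where B: "0 < B" "!!z. norm (f z) <= B" by (rule C1c_bounded[OF f]) blast
 show m: "f : borel_fun"
  using f by (intro borel_contI) (auto simp: C1c_def C1_upto_def)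
 show "integrable M f"
  by (rule integrable_const_bound[of _ B]) (use B m M in \<open>auto cong: measurable_cong_sets\<close>)
qed

section \<open>Riesz representation of a bounded functional on C1 test functions\<close>

locale C1_functional =
 fixes U :: "'a::euclidean_space set" and T :: "('a => real) => real" and C :: real
 assumes U: "open U"
  and add: "!!f g. f : C1c U ==> g : C1c U ==> T (%z. f z + g z) = T f + T g"
  and scale: "!!f c. f : C1c U ==> T (%z. c * f z) = c * T f"
  and bound: "!!f. f : C1c U ==> (!!z. \<bar>f z\<bar> <= 1) ==> \<bar>T f\<bar> <= C"
begin

definition test :: "'a set => ('a => real) set" where
 "test G = {g \<in> C1c U. (ALL z. 0 <= g z & g z <= 1) & (EX K. compact K & K \<subseteq> G & (ALL z. z ~: K --> g z = 0))}"

text \<open>For a functional without sign this is the mass of its positive part on open sets;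
  \<open>ennreal\<close> truncates negative values.\<close>

definition variation :: "'a set => ennreal" where
 "variation G = (SUP g\<in>test G. ennreal (T g))"

definition outer :: "'a set => ennreal" where
 "outer S = (INF G\<in>{G. open G & S \<subseteq> G}. variation G)"

lemma zero_mem: "(%z. 0) : C1c V"
 by (rule C1c_I[of _ "{}"]) auto

lemma zero: "T (%z. 0) = 0"
 using scale[OF zero_mem, of 0] by simp

lemma zero_test: "(%z. 0) : test G"
 by (auto simp: test_def zero_mem)

lemma C_nonneg: "0 <= C"
 using bound[OF zero_mem] by (auto simp: zero)

lemma variation_upper: "g : test G ==> ennreal (T g) <= variation G"
 unfolding variation_def by (rule SUP_upper)

lemma variation_le_C: "variation G <= ennreal C"
 unfolding variation_def
proof (rule SUP_least)
 fix g assume "g : test G"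
 hence "\<bar>T g\<bar> <= C" by (intro bound) (auto simp: test_def)
 thus "ennreal (T g) <= ennreal C" by (intro ennreal_leI) auto
qed

lemma variation_mono: "G \<subseteq> H ==> variation G <= variation H"
 unfolding variation_def by (rule SUP_subset_mono) (auto simp: test_def)

lemma variation_empty: "variation {} = 0"
proof -
 have "ennreal (T g) = 0" if "g : test {}" for g
 proof -
  have "g = (%z. 0)" using that by (auto simp: test_def)
  thus ?thesis by (simp add: zero)
 qed
 thus ?thesis unfolding variation_def using zero_test by (intro SUP_eq_const) auto
qed

lemma support_mult:
 fixes g f :: "'a => real"
 assumes "g : C1c U" "f : C1_upto UNIV"
 shows "(%z. g z * f z) : C1c U"
proof -
 obtain K where "g : C1_upto UNIV" "compact K" "K \<subseteq> U" "!!z. z ~: K ==> g z = 0" using assms(1) by (rule C1c_E) auto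
 thus ?thesis using assms(2) by (intro C1c_I[of _ K] C1_mult) auto
qed

lemma support_add:
 assumes "g : C1c U" "f : C1c U"
 shows "(%z. g z + f z) : C1c U"
proof -
 obtain K where K: "g : C1_upto UNIV" "compact K" "K \<subseteq> U" "!!z. z ~: K ==> g z = 0" using assms(1) by (rule C1c_E) auto
 obtain L where L: "f : C1_upto UNIV" "compact L" "L \<subseteq> U" "!!z. z ~: L ==> f z = 0" using assms(2) by (rule C1c_E) auto
 show ?thesis using K L by (intro C1c_I[of _ "K Un L"] C1_add) auto
qed

text \<open>A partition of unity for two sets, iterated. A cutoff \<open>\<eta>\<close> that is 1
  near the compact set \<open>K - G N\<close> and supported in the union \<open>A\<close> of the
  other sets splits \<open>g\<close> into \<open>g * \<eta>\<close>, supported in \<open>A\<close>,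
  and \<open>g * (1 - \<eta>)\<close>, supported in \<open>K - W \<subseteq> G N\<close>.\<close>

lemma variation_finite_union:
 fixes N :: nat
 assumes "!!n. open (G n)" "g : test (\<Union>n<N. G n)"
 shows "ennreal (T g) <= (\<Sum>n<N. variation (G n))"
 using assms(2)
proof (induction N arbitrary: g)
 case 0
 hence "g = (%z. 0)" by (auto simp: test_def)
 thus ?case by (simp add: zero)
next
 case (Suc N)
 define A where "A = (\<Union>n<N. G n)"
 obtain K where K: "compact K" "K \<subseteq> A Un G N" "!!z. z ~: K ==> g z = 0"
  using Suc.prems by (auto simp: test_def lessThan_Suc A_def Un_commute)
 have g: "g : C1c U" "!!z. 0 <= g z & g z <= 1" using Suc.prems by (auto simp: test_def)
 have "compact (K - G N)" using K(1) assms(1) by (intro compact_diff) auto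
 moreover have "open A" "K - G N \<subseteq> A" using assms(1) K(2) by (auto simp: A_def)
 ultimately obtain \<eta> W K' where c: "\<eta> : C1_upto UNIV" "!!z. 0 <= \<eta> z & \<eta> z <= (1::real)" "open W" "K - G N \<subseteq> W"
  "!!z. z : W ==> \<eta> z = 1" "compact K'" "K' \<subseteq> A" "!!z. z ~: K' ==> \<eta> z = 0"
  by (rule C1_cutoff) blast
 have c1: "(%z. 1 - \<eta> z) : C1_upto UNIV" using c(1) by (intro C1_diff C1_const)
 have g1: "(%z. g z * \<eta> z) : test A"
  using g c support_mult[OF g(1) c(1)] by (auto simp: test_def intro!: mult_le_one exI[of _ K'])
 have g2: "(%z. g z * (1 - \<eta> z)) : test (G N)"
 proof -
  have "compact (K - W)" using K(1) c(3) by (intro compact_diff)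
  moreover have "K - W \<subseteq> G N" using c(4) by auto
  moreover have "g z * (1 - \<eta> z) = 0" if "z ~: K - W" for z using that K(3) c(5) by auto
  ultimately show ?thesis
   using g c support_mult[OF g(1) c1] by (auto simp: test_def intro!: mult_le_one exI[of _ "K - W"])
 qed
 have "T g = T (%z. g z * \<eta> z + g z * (1 - \<eta> z))" by (simp add: algebra_simps)
 also have "... = T (%z. g z * \<eta> z) + T (%z. g z * (1 - \<eta> z))"
  by (rule add[OF support_mult[OF g(1) c(1)] support_mult[OF g(1) c1]])
 finally have "ennreal (T g) <= ennreal (T (%z. g z * \<eta> z)) + ennreal (T (%z. g z * (1 - \<eta> z)))"
  by (simp add: ennreal_plus_if ennreal_leI)
 also have "... <= (\<Sum>n<N. variation (G n)) + variation (G N)"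
  using Suc.IH[OF g1[unfolded A_def]] variation_upper[OF g2] by (intro add_mono)
 finally show ?case by simp
qed

lemma variation_countable_union:
 assumes "!!n::nat. open (G n)"
 shows "variation (\<Union>n. G n) <= (\<Sum>n. variation (G n))"
 unfolding variation_def[of "\<Union>n. G n"]
proof (rule SUP_least)
 fix g assume g: "g : test (\<Union>n. G n)"
 then obtain K where K: "compact K" "K \<subseteq> (\<Union>n. G n)" "!!z. z ~: K ==> g z = 0" by (auto simp: test_def)
 obtain D where D: "finite D" "K \<subseteq> (\<Union>n\<in>D. G n)"
  using compactE_image[OF K(1), of UNIV G] assms K(2) by auto
 obtain N where "D \<subseteq> {..<N}" using D(1) finite_nat_iff_bounded by blast
 hence "K \<subseteq> (\<Union>n<N. G n)" using D(2) by blast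
 hence "g : test (\<Union>n<N. G n)" using g K by (auto simp: test_def)
 from variation_finite_union[OF assms this]
 show "ennreal (T g) <= (\<Sum>n. variation (G n))"
  by (rule order_trans[OF _ sum_le_suminf]) auto
qed

lemma outer_open: "open G ==> outer G = variation G"
 unfolding outer_def by (rule antisym) (auto intro!: INF_lower INF_greatest variation_mono)

lemma outer_mono: "A \<subseteq> B ==> outer A <= outer B"
 unfolding outer_def by (rule INF_superset_mono) auto

lemma outer_countably_subadditive: "outer (\<Union>n::nat. A n) <= (\<Sum>n. outer (A n))"
proof (rule ennreal_le_epsilon)
 fix e :: real assume fin: "(\<Sum>n. outer (A n)) < top" and e: "0 < e"
 have "EX G. open G & A n \<subseteq> G & variation G < outer (A n) + ennreal (e * (1/2)^Suc n)" for n
 proof -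
  have "outer (A n) ~= top" using ennreal_suminf_lessD[OF fin] by (simp add: less_top)
  moreover have "0 < ennreal (e * (1/2)^Suc n)" using e by simp
  ultimately have "outer (A n) < outer (A n) + ennreal (e * (1/2)^Suc n)"
   by (cases "outer (A n)") (auto simp: ennreal_add_left_cancel_less less_top)
  thus ?thesis unfolding outer_def[of "A n"] INF_less_iff by auto
 qed
 then obtain G where G: "!!n. open (G n)" "!!n. A n \<subseteq> G n" "!!n. variation (G n) < outer (A n) + ennreal (e * (1/2)^Suc n)"
  by metis
 have "outer (\<Union>n. A n) <= variation (\<Union>n. G n)"
  unfolding outer_def using G by (intro INF_lower) blast
 also have "... <= (\<Sum>n. variation (G n))" by (rule variation_countable_union[OF G(1)])
 also have "... <= (\<Sum>n. outer (A n) + ennreal (e * (1/2)^Suc n))"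
  by (intro suminf_le less_imp_le G(3)) auto
 also have "... = (\<Sum>n. outer (A n)) + (\<Sum>n. ennreal (e * (1/2)^Suc n))"
  by (rule suminf_add[symmetric]) auto
 also have "(\<Sum>n. ennreal (e * (1/2)^Suc n)) = ennreal e"
  using e sums_mult[OF power_half_series, of e] by (intro suminf_ennreal_eq) auto
 finally show "outer (\<Union>n. A n) <= (\<Sum>n. outer (A n)) + ennreal e" .
qed

lemma variation_disjoint:
 assumes "G Int H = {}"
 shows "variation G + variation H <= variation (G Un H)"
proof -
 have "ennreal (T f) + ennreal (T g) <= variation (G Un H)" if f: "f : test G" and g: "g : test H" for f g
 proof -
  have sub: "f : test (G Un H)" "g : test (G Un H)" using f g by (auto simp: test_def)
  obtain K L where K: "compact K" "K \<subseteq> G" "!!z. z ~: K ==> f z = 0" and L: "compact L" "L \<subseteq> H" "!!z. z ~: L ==> g z = 0"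
   using f g by (auto simp: test_def)
  have fg: "f : C1c U" "g : C1c U" using f g by (auto simp: test_def)
  have 0: "f z = 0 \<or> g z = 0" for z using K L assms by blast
  have "0 <= f z + g z & f z + g z <= 1" for z using 0[of z] f g by (auto simp: test_def)
  moreover have "EX K. compact K & K \<subseteq> G Un H & (ALL z. z ~: K --> f z + g z = 0)"
   by (rule exI[of _ "K Un L"]) (use K L in auto)
  ultimately have "(%z. f z + g z) : test (G Un H)"
   using support_add[OF fg] by (simp add: test_def)
  hence "ennreal (T f + T g) <= variation (G Un H)" using variation_upper add[OF fg] by fastforce
  hence s: "ennreal (T f + T g) <= variation (G Un H)" .
  \<comment> \<open>\<open>ennreal\<close> turns a negative value into 0, in which case the other
    function alone is a competitor for the union.\<close>
  consider "T f < 0" | "T g < 0" | "0 <= T f" "0 <= T g" by linarith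
  thus ?thesis
  proof cases
   case 1 thus ?thesis using variation_upper[OF sub(2)] by (simp add: ennreal_neg)
  next
   case 2 thus ?thesis using variation_upper[OF sub(1)] by (simp add: ennreal_neg)
  next
   case 3 thus ?thesis using s by (simp add: ennreal_plus)
  qed
 qed
 hence 1: "(SUP f\<in>test G. ennreal (T f) + ennreal (T g)) <= variation (G Un H)" if "g : test H" for g
  using that by (intro SUP_least) auto
 have ne: "test X ~= {}" for X using zero_test by blast
 have 2: "variation G + ennreal (T g) <= variation (G Un H)" if "g : test H" for g
  using 1[OF that] unfolding variation_def[of G] ennreal_SUP_add_left[OF ne] .
 have "(SUP g\<in>test H. variation G + ennreal (T g)) <= variation (G Un H)"
  using 2 by (rule SUP_least)
 thus ?thesis unfolding variation_def[of H] ennreal_SUP_add_right[OF ne] .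
qed

lemma outer_separated:
 assumes d: "0 < d" "!!x y. x : A ==> y : B ==> d <= dist x y"
 shows "outer A + outer B <= outer (A Un B)"
 unfolding outer_def[of "A Un B"]
proof (rule INF_greatest)
 fix G assume "G : {G. open G & A Un B \<subseteq> G}"
 hence G: "open G" "A Un B \<subseteq> G" by auto
 define G1 G2 where "G1 = G Int (\<Union>x\<in>A. ball x (d/2))" and "G2 = G Int (\<Union>x\<in>B. ball x (d/2))"
 have disj: "G1 Int G2 = {}"
 proof (rule ccontr)
  assume "G1 Int G2 ~= {}"
  then obtain z x y where "x : A" "y : B" "dist x z < d/2" "dist y z < d/2" by (auto simp: G1_def G2_def)
  thus False using d(2)[of x y] dist_triangle[of x y z] by (simp add: dist_commute)
 qed
 have "outer A <= variation G1" "outer B <= variation G2"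
  unfolding outer_def using G d(1) by (auto intro!: INF_lower simp: G1_def G2_def)
 hence "outer A + outer B <= variation G1 + variation G2" by (rule add_mono)
 also have "... <= variation (G1 Un G2)" by (rule variation_disjoint[OF disj])
 also have "... <= variation G" by (rule variation_mono) (auto simp: G1_def G2_def)
 finally show "outer A + outer B <= variation G" .
qed

definition upper_measure :: "'a measure" where
 "upper_measure = measure_of UNIV (sets borel) outer"

lemma space_upper [simp]: "space upper_measure = UNIV"
 and sets_upper [simp, measurable_cong]: "sets upper_measure = sets borel"
 using sets.sigma_sets_eq[of borel] by (simp_all add: upper_measure_def)

lemma emeasure_upper: "A : sets borel ==> emeasure upper_measure A = outer A"
proof -
 assume A: "A : sets borel"
 have "outer {} = 0" by (simp add: outer_open variation_empty)
 hence "measure_space UNIV (sets borel) outer"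
  using outer_mono outer_countably_subadditive outer_separated
  by (intro metric_outer_measure_imp_measure_space) auto
 thus ?thesis
  using A unfolding upper_measure_def
  by (intro emeasure_measure_of_sigma) (auto simp: measure_space_def)
qed

lemma finite_upper: "finite_measure upper_measure"
proof
 have "emeasure upper_measure UNIV <= ennreal C" by (simp add: emeasure_upper outer_open variation_le_C)
 thus "emeasure upper_measure (space upper_measure) ~= \<infinity>" by (auto simp: top_unique)
qed

lemma measure_upper_le_C: "measure upper_measure A <= C"
proof -
 interpret finite_measure upper_measure by (rule finite_upper)
 have "emeasure upper_measure UNIV <= ennreal C" by (simp add: emeasure_upper outer_open variation_le_C)
 hence "measure upper_measure UNIV <= C" by (simp add: emeasure_eq_measure C_nonneg)
 moreover have "measure upper_measure A <= measure upper_measure UNIV"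
  by (metis bounded_measure space_upper)
 ultimately show ?thesis by simp
qed

lemma measure_upper_open: "open G ==> variation G = ennreal (measure upper_measure G)"
 using finite_measure.emeasure_eq_measure[OF finite_upper, of G] emeasure_upper[of G] outer_open[of G] by simp

lemma upper_compl: "emeasure upper_measure (- U) = 0"
proof -
 interpret finite_measure upper_measure by (rule finite_upper)
 have "variation UNIV <= variation U"
  unfolding variation_def by (rule SUP_subset_mono) (auto simp: test_def C1c_def)
 hence "emeasure upper_measure UNIV <= emeasure upper_measure U" using U by (simp add: emeasure_upper outer_open)
 hence "measure upper_measure UNIV <= measure upper_measure U" by (simp add: emeasure_eq_measure)
 moreover have "measure upper_measure (space upper_measure - U) = measure upper_measure (space upper_measure) - measure upper_measure U"
  using U by (intro finite_measure_compl) simp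
 ultimately have "measure upper_measure (- U) <= 0" by (simp add: Compl_eq_Diff_UNIV)
 thus ?thesis by (simp add: emeasure_eq_measure measure_le_0_iff)
qed

lemma sum_mem: "(!!i. i : I ==> f i : C1c U) ==>
  (%z. SUM i:I. f i z) : C1c U & T (%z. SUM i:I. f i z) = (SUM i:I. T (f i))"
proof (induction I rule: infinite_finite_induct)
 case (insert i I)
 thus ?case using support_add[of "f i" "%z. SUM i:I. f i z"] add[of "f i" "%z. SUM i:I. f i z"] by simp
qed (auto simp: zero_mem zero)

text \<open>The sum of the layers differs from \<open>n * g\<close> by at most 1 pointwise, so the
  bound on \<open>T\<close> controls the difference by \<open>C\<close>, uniformly in
  \<open>n\<close>. After division by \<open>n\<close> it disappears.\<close>

lemma layer:
 assumes g: "g : C1c U" "!!z. 0 <= g z & g z <= 1" and n: "0 < (n::nat)"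
 defines "\<theta> \<equiv> %k z. smooth_step (2 * (real n * g z - real k))"
 shows "\<theta> k : C1c U" and "\<bar>(\<Sum>k<n. T (\<theta> k)) - real n * T g\<bar> <= C"
proof -
 obtain K where K: "g : C1_upto UNIV" "compact K" "K \<subseteq> U" "!!z. z ~: K ==> g z = 0" using g(1) by (rule C1c_E) auto
 have mem: "\<theta> k : C1c U" for k
 proof (rule C1c_I[OF _ K(2,3)])
  show "\<theta> k : C1_upto UNIV" unfolding \<theta>_def by (intro C1_smooth_step C1_cmult C1_diff C1_const K(1))
  show "\<theta> k z = 0" if "z ~: K" for z using K(4)[OF that] by (simp add: \<theta>_def smooth_step_0)
 qed
 thus "\<theta> k : C1c U" .
 have ng: "(%z. (- real n) * g z) : C1c U" using support_mult[OF g(1) C1_const[of "- real n"]] by (simp add: mult.commute)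
 have s: "(%z. \<Sum>k<n. \<theta> k z) : C1c U" "T (%z. \<Sum>k<n. \<theta> k z) = (\<Sum>k<n. T (\<theta> k))"
  using sum_mem[of "{..<n}" \<theta>] mem by auto
 have "\<bar>T (%z. (\<Sum>k<n. \<theta> k z) + (- real n) * g z)\<bar> <= C"
 proof (rule bound)
  show "(%z. (\<Sum>k<n. \<theta> k z) + (- real n) * g z) : C1c U" by (rule support_add[OF s(1) ng])
  show "\<bar>(\<Sum>k<n. \<theta> k z) + (- real n) * g z\<bar> <= 1" for z
   using smooth_step_sum(2)[of "real n * g z" n] g(2)[of z] by (simp add: \<theta>_def mult_left_le)
 qed
 thus "\<bar>(\<Sum>k<n. T (\<theta> k)) - real n * T g\<bar> <= C"
  unfolding add[OF s(1) ng] scale[OF g(1)] s(2) by simp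
qed

lemma integrable_test:
 fixes g :: "'a => real"
 assumes "g : C1c U" "!!z. 0 <= g z & g z <= 1"
 shows "integrable upper_measure g" "g : borel_fun" "continuous_on UNIV g"
proof -
 interpret finite_measure upper_measure by (rule finite_upper)
 show c: "continuous_on UNIV g" using assms(1) by (auto simp: C1c_def C1_upto_def)
 show m: "g : borel_fun" by (rule borel_contI[OF c])
 show "integrable upper_measure g"
 proof (rule integrable_const_bound[of _ 1])
  show "AE x in upper_measure. norm (g x) <= 1" using assms(2) by (intro AE_I2) (simp add: abs_of_nonneg)
 qed (use m in simp)
qed

lemma le_of_forall_nat:
 assumes "!!n::nat. 0 < n ==> a <= b + c / real n"
 shows "a <= (b::real)"
proof (rule LIMSEQ_le_const[of "%n. b + c / real n"])
 have "(%n. b + c / real n) \<longlonglongrightarrow> b + 0" by (intro tendsto_intros lim_const_over_n)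
 thus "(%n. b + c / real n) \<longlonglongrightarrow> b" by simp
 show "EX N. ALL n>=N. a <= b + c / real n" using assms by (intro exI[of _ 1]) auto
qed

text \<open>The layer \<open>k \<ge> 1\<close> is a test function for the superlevel set
  \<open>E (k - 1)\<close>, so \<open>T\<close> of it is at most the measure of that set; these
  measures add up to the integral of \<open>n * g\<close>, up to the total mass. The error
  \<open>3 * C\<close> collects the layer-cake error, the layer \<open>k = 0\<close> and the total
  mass.\<close>

lemma le_integral_upper01:
 assumes g: "g : C1c U" "!!z. 0 <= g z & g z <= 1"
 shows "T g <= (LINT z|upper_measure. g z)"
proof (rule le_of_forall_nat[where c="3 * C"])
 fix n :: nat assume n: "0 < n"
 interpret finite_measure upper_measure by (rule finite_upper)
 note [measurable] = integrable_test(2)[OF g]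
 define \<theta> where "\<theta> = (%k z. smooth_step (2 * (real n * g z - real k)))"
 define E where "E = (%k::nat. {z. real k < real n * g z})"
 have E: "open (E k)" for k
  unfolding E_def by (intro open_Collect_less continuous_intros integrable_test(3)[OF g])
 have Em: "E k : sets upper_measure" for k using E[of k] by simp
 have ind: "integrable upper_measure (indicat_real (E k))" for k
  by (rule int_ind[OF Em]) (simp add: less_top[symmetric])
 have t0: "T (\<theta> k) <= (if k = 0 then C else measure upper_measure (E (k - 1)))" for k
 proof (cases "k = 0")
  case True
  have "\<bar>T (\<theta> k)\<bar> <= C" using layer(1)[OF g n, of k] by (intro bound) (auto simp: \<theta>_def abs_le_iff smooth_step_bounds intro: order_trans[OF _ smooth_step_bounds(1)])
  thus ?thesis using True by simp
 next
  case False
  obtain K where K: "compact K" "!!z. z ~: K ==> g z = 0" using g(1) by (rule C1c_E) auto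
  have "closed {z. real k <= real n * g z}"
   by (intro closed_Collect_le continuous_intros integrable_test(3)[OF g])
  hence "compact (K Int {z. real k <= real n * g z})" by (intro compact_Int_closed K)
  moreover have "K Int {z. real k <= real n * g z} \<subseteq> E (k - 1)" using False by (auto simp: E_def of_nat_diff)
  moreover have "\<theta> k z = 0" if "z ~: K Int {z. real k <= real n * g z}" for z
   using that K(2)[of z] by (auto simp: \<theta>_def intro!: smooth_step_0)
  ultimately have "\<theta> k : test (E (k - 1))"
   using layer(1)[OF g n, of k] smooth_step_bounds unfolding test_def \<theta>_def by blast
  from variation_upper[OF this] have "ennreal (T (\<theta> k)) <= ennreal (measure upper_measure (E (k - 1)))"
   by (simp add: measure_upper_open[OF E])
  thus ?thesis using False by (simp add: ennreal_le_iff)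
 qed
 have "real n * T g <= (\<Sum>k<n. T (\<theta> k)) + C" using layer(2)[OF g n] unfolding \<theta>_def by linarith
 also have "(\<Sum>k<n. T (\<theta> k)) <= C + (\<Sum>k<n. measure upper_measure (E k))"
 proof -
  obtain m where m: "n = Suc m" using n by (cases n) auto
  have "(\<Sum>k<n. T (\<theta> k)) = T (\<theta> 0) + (\<Sum>k<m. T (\<theta> (Suc k)))" unfolding m by (rule sum.lessThan_Suc_shift)
  also have "... <= C + (\<Sum>k<m. measure upper_measure (E k))"
   using t0[of 0] t0[of "Suc _"] by (intro add_mono sum_mono) auto
  also have "... <= C + (\<Sum>k<n. measure upper_measure (E k))" unfolding m by simp
  finally show ?thesis .
 qed
 also have "(\<Sum>k<n. measure upper_measure (E k)) = (LINT z|upper_measure. (\<Sum>k<n. indicator (E k) z))"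
  using ind by (simp add: Bochner_Integration.integral_sum)
 also have "... <= (LINT z|upper_measure. real n * g z + 1)"
 proof (rule integral_mono)
  show "(\<Sum>k<n. indicator (E k) z) <= real n * g z + 1" for z
   using smooth_step_sum(1)[of "real n * g z" n] g(2)[of z]
   by (simp add: indicator_def E_def mult_left_le of_bool_def)
 qed (use ind integrable_test(1)[OF g] in \<open>auto intro!: Bochner_Integration.integrable_sum Bochner_Integration.integrable_add\<close>)
 also have "... = real n * (LINT z|upper_measure. g z) + measure upper_measure UNIV"
  using integrable_test(1)[OF g] by simp
 finally have "real n * T g <= real n * (LINT z|upper_measure. g z) + 3 * C"
  using measure_upper_le_C[of UNIV] by linarith
 hence "real n * T g / real n <= (real n * (LINT z|upper_measure. g z) + 3 * C) / real n"
  by (rule divide_right_mono) simp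
 thus "T g <= (LINT z|upper_measure. g z) + 3 * C / real n" using n by (simp add: add_divide_distrib)
qed

lemma le_integral_upper:
 assumes g: "g : C1c U" "!!z. 0 <= g z"
 shows "T g <= (LINT z|upper_measure. g z)"
proof -
 obtain B where B: "0 < B" "!!z. norm (g z) <= B" using C1c_bounded[OF g(1)] by blast
 have "(%z. (1/B) * g z) : C1c U" using support_mult[OF g(1) C1_const[of "1/B"]] by (simp add: mult.commute)
 moreover have "0 <= (1/B) * g z & (1/B) * g z <= 1" for z using B g(2)[of z] by (simp add: divide_le_eq_1 abs_le_iff)
 ultimately have "T (%z. (1/B) * g z) <= (LINT z|upper_measure. (1/B) * g z)" by (rule le_integral_upper01)
 thus ?thesis unfolding scale[OF g(1)] using B(1) by (simp add: divide_le_cancel)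
qed

text \<open>For a positive functional let \<open>\<eta>\<close> be a cutoff with \<open>T \<eta>\<close> close to the total mass. Applying
 \<open>le_integral_upper\<close> to \<open>B \<eta> + g\<close> and \<open>B \<eta> - g\<close> squeezes \<open>T g\<close>.\<close>

lemma integral_upper_eq:
 assumes pos: "!!f. f : C1c U ==> (!!z. 0 <= f z) ==> 0 <= T f" and g: "g : C1c U"
 shows "(LINT z|upper_measure. g z) = T g"
proof -
 interpret finite_measure upper_measure by (rule finite_upper)
 note int = C1c_integrable(1)[OF _ finite_upper sets_upper]
 define m where "m = measure upper_measure UNIV"
 obtain K where K: "compact K" "K \<subseteq> U" "!!z. z ~: K ==> g z = 0" using g by (rule C1c_E) blast
 obtain B where B: "0 < B" "!!z. norm (g z) <= B" using C1c_bounded[OF g] by blast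
 have "\<bar>T g - (LINT z|upper_measure. g z)\<bar> <= 0 + B / real n" if n: "0 < n" for n :: nat
 proof -
  define e where "e = 1 / real n"
  have "EX t:test UNIV. m - e < T t"
  proof (rule ccontr)
   assume "\<not> ?thesis"
   hence c: "T t <= m - e" if "t : test UNIV" for t using that by (auto simp: not_less)
   hence "variation UNIV <= ennreal (m - e)" unfolding variation_def by (intro SUP_least ennreal_leI)
   moreover have "0 <= m - e" using c[OF zero_test] by (simp add: zero)
   ultimately show False using n by (simp add: measure_upper_open m_def e_def)
  qed
  then obtain t where t: "t : C1c U" "!!z. 0 <= t z & t z <= 1" "m - e < T t" by (auto simp: test_def)
  obtain L where L: "compact L" "L \<subseteq> U" "!!z. z ~: L ==> t z = 0" using t(1) by (rule C1c_E) blast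
  obtain \<eta> W K' where c: "\<eta> : C1_upto UNIV" "!!z. 0 <= \<eta> z & \<eta> z <= (1::real)" "open W" "K Un L \<subseteq> W"
   "!!z. z : W ==> \<eta> z = 1" "compact K'" "K' \<subseteq> U" "!!z. z ~: K' ==> \<eta> z = 0"
   using C1_cutoff[OF compact_Un[OF K(1) L(1)] U] K(2) L(2) by blast
  have \<eta>: "\<eta> : C1c U" by (rule C1c_I[OF c(1,6,7,8)])
  have lin: "(%z. a * f z) : C1c U" if "f : C1c U" for a and f :: "'a => real"
   using support_mult[OF that C1_const[of a]] by (simp add: mult.commute)
  have one: "\<eta> z = 1" if "z : K Un L" for z using c(4,5) that by blast
  have "0 <= \<eta> z + (-1) * t z" for z using c(2)[of z] one[of z] t(2)[of z] L(3)[of z] by (cases "z : L") auto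
  hence "0 <= T (%z. \<eta> z + (-1) * t z)" by (intro pos support_add lin \<eta> t)
  hence 1: "T t <= T \<eta>" unfolding add[OF \<eta> lin[OF t(1)]] scale[OF t(1)] by simp
  have "(LINT z|upper_measure. \<eta> z) <= (LINT z|upper_measure. 1)" using int[OF \<eta>] c(2) by (intro integral_mono) auto
  hence 2: "(LINT z|upper_measure. \<eta> z) <= m" by (simp add: m_def)
  have 3: "s * T g + B * T \<eta> <= s * (LINT z|upper_measure. g z) + B * (LINT z|upper_measure. \<eta> z)" if s: "s = 1 \<or> s = -1" for s
  proof -
   have "0 <= s * g z + B * \<eta> z" for z using B(1) K(3)[of z] c(2)[of z] one[of z] B(2)[of z] s by (cases "z : K") (auto simp: abs_le_iff)
   hence "T (%z. s * g z + B * \<eta> z) <= (LINT z|upper_measure. s * g z + B * \<eta> z)"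
    by (intro le_integral_upper support_add lin g \<eta>)
   thus ?thesis unfolding add[OF lin[OF g] lin[OF \<eta>]] scale[OF g] scale[OF \<eta>] using int[OF g] int[OF \<eta>] by simp
  qed
  have "B * ((LINT z|upper_measure. \<eta> z) - T \<eta>) <= B * e" using 1 2 t(3) B(1) by (intro mult_left_mono) auto
  thus ?thesis using 3[of 1] 3[of "-1"] by (simp add: e_def abs_le_iff right_diff_distrib)
 qed
 hence "\<bar>T g - (LINT z|upper_measure. g z)\<bar> <= 0" by (rule le_of_forall_nat)
 thus ?thesis by simp
qed

end

lemma sum_of_measures:
 fixes \<nu> :: "'i => 'a measure"
 assumes I: "finite I" and s: "!!i. i : I ==> sets (\<nu> i) = sets M"
 obtains N where "sets N = sets M" "!!A. A : sets M ==> emeasure N A = (SUM i:I. emeasure (\<nu> i) A)"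
proof -
 define N where "N = measure_of (space M) (sets M) (%A. SUM i:I. emeasure (\<nu> i) A)"
 have N: "sets N = sets M" unfolding N_def by (simp add: sets.space_closed)
 have "emeasure N A = (SUM i:I. emeasure (\<nu> i) A)" if "A : sets M" for A
  unfolding N_def
 proof (rule emeasure_measure_of_sigma[OF sets.sigma_algebra_axioms])
  show "positive (sets M) (%A. SUM i:I. emeasure (\<nu> i) A)" by (simp add: positive_def)
  show "countably_additive (sets M) (%A. SUM i:I. emeasure (\<nu> i) A)"
  proof (rule countably_additiveI)
   fix A :: "nat => 'a set" assume A: "range A \<subseteq> sets M" "disjoint_family A"
   have "(\<Sum>n. SUM i:I. emeasure (\<nu> i) (A n)) = (SUM i:I. \<Sum>n. emeasure (\<nu> i) (A n))"
    by (rule suminf_sum) auto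
   also have "... = (SUM i:I. emeasure (\<nu> i) (\<Union>n. A n))"
    using A s by (intro sum.cong refl suminf_emeasure) auto
   finally show "(\<Sum>n. SUM i:I. emeasure (\<nu> i) (A n)) = (SUM i:I. emeasure (\<nu> i) (\<Union>n. A n))" .
  qed
 qed fact
 thus thesis using N that by blast
qed

context C1_functional begin

text \<open>Since \<open>upper_measure\<close> dominates \<open>T\<close> on nonnegative functions,
  the difference \<open>P\<close> is a positive functional; it is again bounded, by
  \<open>2 * C\<close>, and hence represented exactly by its own upper measure. \<open>T\<close> is
  then a difference of two finite measures.\<close>

lemma signed_representation:
 obtains \<nu>1 \<nu>2 where "finite_measure \<nu>1" "finite_measure \<nu>2" "sets \<nu>1 = sets borel" "sets \<nu>2 = sets borel"
  "emeasure \<nu>1 (- U) = 0" "emeasure \<nu>2 (- U) = 0"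
  "!!g. g : C1c U ==> T g = (LINT z|\<nu>1. g z) - (LINT z|\<nu>2. g z)"
proof -
 define P where "P = (%g. (LINT z|upper_measure. g z) - T g)"
 note int = C1c_integrable(1)[OF _ finite_upper sets_upper]
 interpret P: C1_functional U P "2 * C"
 proof
  show "open U" by (rule U)
  show "P (%z. f z + g z) = P f + P g" if "f : C1c U" "g : C1c U" for f g
   using that int[OF that(1)] int[OF that(2)] by (simp add: P_def add)
  show "P (%z. c * f z) = c * P f" if "f : C1c U" for f c
   using that by (simp add: P_def scale right_diff_distrib)
  show "\<bar>P f\<bar> <= 2 * C" if f: "f : C1c U" "!!z. \<bar>f z\<bar> <= 1" for f
  proof -
   interpret finite_measure upper_measure by (rule finite_upper)
   have "\<bar>\<integral>z. f z \<partial>upper_measure\<bar> <= (LINT z|upper_measure. \<bar>f z\<bar>)" by (rule integral_abs_bound)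
   also have "... <= (LINT z|upper_measure. 1)"
    using int[OF f(1)] f(2) by (intro integral_mono) auto
   also have "... <= C" using measure_upper_le_C[of UNIV] by simp
   finally show ?thesis using bound[OF f] by (simp add: P_def)
  qed
 qed
 have "(\<integral>z. g z \<partial>P.upper_measure) = P g" if "g : C1c U" for g
  by (rule P.integral_upper_eq[OF _ that]) (simp add: P_def le_integral_upper)
 hence "T g = (LINT z|upper_measure. g z) - (\<integral>z. g z \<partial>P.upper_measure)" if "g : C1c U" for g
  using that by (simp add: P_def)
 thus thesis
  by (intro that[of upper_measure P.upper_measure] finite_upper P.finite_upper sets_upper P.sets_upper upper_compl P.upper_compl)
qed

end

text \<open>All components have densities with respect to the sum \<open>N\<close> of the given
  measures. With \<open>G\<close> the resulting vector density, \<open>m\<close> is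
  \<open>norm G\<close> times \<open>N\<close> and \<open>\<sigma>\<close> is the direction of
  \<open>G\<close>; where \<open>G\<close> vanishes there is no \<open>m\<close>-mass, so
  \<open>\<sigma>\<close> has unit length almost everywhere.\<close>

lemma vector_measure_polar:
 fixes \<nu> :: "'a::euclidean_space \<times> bool => 'a measure"
 assumes fin: "!!i. finite_measure (\<nu> i)" and s: "!!i. sets (\<nu> i) = sets borel" and null: "!!i. emeasure (\<nu> i) (- U) = 0"
  and U: "open U"
 obtains m \<sigma> where "sets m = sets borel" "finite_measure m" "emeasure m (- U) = 0" "\<sigma> : borel_fun"
  "AE z in m. norm (\<sigma> z) = 1"
  "!!\<psi> :: 'a => 'a. \<psi> : C1c U ==>
    (LINT z|m. \<psi> z @. \<sigma> z) = (SUM b:Basis. (\<integral>z. \<psi> z @. b \<partial>\<nu> (b, True)) - (\<integral>z. \<psi> z @. b \<partial>\<nu> (b, False)))"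
proof -
 define I where "I = (Basis :: 'a set) \<times> (UNIV :: bool set)"
 have I: "finite I" by (simp add: I_def)
 obtain N where N: "sets N = sets (borel :: 'a measure)" "!!A. A : sets borel ==> emeasure N A = (SUM i:I. emeasure (\<nu> i) A)"
  using sum_of_measures[OF I, of \<nu> borel] s by blast
 have spN: "space N = UNIV" using sets_eq_imp_space_eq[OF N(1)] by simp
 have sp: "space (\<nu> i) = UNIV" for i using sets_eq_imp_space_eq[OF s] by simp
 have UN: "UNIV : sets N" by (simp add: N(1))
 interpret N: finite_measure N
 proof
  have "emeasure (\<nu> i) UNIV ~= \<infinity>" for i using finite_measure.finite_emeasure_space[OF fin, of i] by (simp add: sp)
  thus "emeasure N (space N) ~= \<infinity>" using I by (simp add: spN N(2))
 qed
 have "EX D. D : borel_measurable N & (ALL z. 0 <= D z) & density N (%z. ennreal (D z)) = \<nu> i" if i: "i : I" for i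
 proof -
  have ac: "absolutely_continuous N (\<nu> i)"
   unfolding absolutely_continuous_def
  proof
   fix A assume A: "A : null_sets N"
   hence "(SUM i:I. emeasure (\<nu> i) A) = 0" using N by (auto simp: null_sets_def)
   hence "emeasure (\<nu> i) A = 0" using i I by simp
   thus "A : null_sets (\<nu> i)" using A N s by (auto simp: null_sets_def)
  qed
  have se: "sets (\<nu> i) = sets N" using N s by simp
  obtain D where D: "D : borel_measurable N" "AE x in N. RN_deriv N (\<nu> i) x = ennreal (D x)" "!!x. 0 <= D x"
   using N.real_RN_deriv[OF fin ac se] by blast
  have "density N (%z. ennreal (D z)) = density N (RN_deriv N (\<nu> i))"
   using D by (intro density_cong) auto
  thus ?thesis using N.density_RN_deriv[OF ac se] D by auto
 qed
 then obtain D where D: "!!i. i : I ==> D i : borel_measurable N" "!!i z. i : I ==> 0 <= D i z"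
  "!!i. i : I ==> density N (%z. ennreal (D i z)) = \<nu> i" by metis
 have Dint: "integrable N (D i)" if i: "i : I" for i
 proof -
  have "(\<integral>\<^sup>+z. ennreal (D i z) \<partial>N) = emeasure (density N (%z. ennreal (D i z))) (space N)"
   using D(1)[OF i] by (subst emeasure_density) (auto simp: spN UN cong: nn_integral_cong)
  also have "... = emeasure (\<nu> i) UNIV" by (simp add: D(3)[OF i] spN)
  also have "... < \<infinity>" using finite_measure.finite_emeasure_space[OF fin, of i] sp by (simp add: less_top)
  finally show ?thesis using D(1,2)[OF i] by (intro integrableI_nonneg) auto
 qed
 define G where "G = (%z. SUM b:Basis. (D (b, True) z - D (b, False) z) *. b)"
 have mem: "(b, t) : I" if "b : Basis" for b t using that by (simp add: I_def)
 have Gm: "G : borel_measurable N" unfolding G_def using D(1) mem by measurable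
 have GmB: "G : borel_fun" using Gm measurable_cong_sets[OF N(1) refl] by blast
 have Gint: "integrable N G" unfolding G_def using Dint mem by (intro Bochner_Integration.integrable_sum integrable_scaleR_left Bochner_Integration.integrable_diff) auto
 define m where "m = density N (%z. ennreal (norm (G z)))"
 define \<sigma> where "\<sigma> = (%z. sgn (G z))"
 have ms: "sets m = sets borel" by (simp add: m_def N)
 have sm: "\<sigma> : borel_fun" unfolding \<sigma>_def sgn_div_norm using GmB by measurable
 have mU: "emeasure m (- U) = 0"
 proof -
  have "emeasure N (- U) = 0" using U by (simp add: N null)
  hence "- U : null_sets N" using U N by (auto simp: null_sets_def)
  moreover have "absolutely_continuous N m" unfolding m_def by (rule absolutely_continuousI_density) (use Gm in measurable)
  ultimately show ?thesis by (auto simp: absolutely_continuous_def)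
 qed
 have fm: "finite_measure m"
 proof
  have "emeasure m (space m) = (\<integral>\<^sup>+z. ennreal (norm (G z)) \<partial>N)"
   unfolding m_def using Gm by (subst emeasure_density) (auto simp: spN UN cong: nn_integral_cong)
  also have "... < \<infinity>" using Gint by (simp add: integrable_iff_bounded)
  finally show "emeasure m (space m) ~= \<infinity>" by simp
 qed
 have ae: "AE z in m. norm (\<sigma> z) = 1"
  unfolding m_def using Gm by (subst AE_density) (auto simp: \<sigma>_def norm_sgn)
 have eq: "(LINT z|m. \<psi> z @. \<sigma> z) = (SUM b:Basis. (\<integral>z. \<psi> z @. b \<partial>\<nu> (b, True)) - (\<integral>z. \<psi> z @. b \<partial>\<nu> (b, False)))"
  if psi: "\<psi> : C1c U" for \<psi> :: "'a => 'a"
 proof -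
  have pm: "\<psi> : borel_fun" by (rule C1c_integrable(2)[OF psi N.finite_measure_axioms N(1)])
  have pmN: "\<psi> : borel_measurable N" using pm measurable_cong_sets[OF N(1) refl] by blast
  have smN: "\<sigma> : borel_measurable N" using sm measurable_cong_sets[OF N(1) refl] by blast
  obtain B where B: "0 < B" "!!z. norm (\<psi> z) <= B" by (rule C1c_bounded[OF psi]) blast
  have int: "integrable N (%z. D i z * (\<psi> z @. b))" if "i : I" "b : Basis" for i b
  proof (rule int_bound[of N "%z. B * D i z"])
   show "AE z in N. norm (D i z * (\<psi> z @. b)) <= norm (B * D i z)"
   proof (rule AE_I2)
    fix z
    have "\<bar>\<psi> z @. b\<bar> <= B" using B(2)[of z] Basis_le_norm[OF that(2), of "\<psi> z"] by linarith
    hence "D i z * \<bar>\<psi> z @. b\<bar> <= D i z * B" using D(2)[OF that(1), of z] by (rule mult_left_mono)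
    thus "norm (D i z * (\<psi> z @. b)) <= norm (B * D i z)"
     using D(2)[OF that(1), of z] B(1) by (simp add: abs_mult mult.commute)
   qed
  qed (use Dint[OF that(1)] D(1)[OF that(1)] pmN in auto)
  have comp: "(LINT z|\<nu> i. \<psi> z @. b) = (LINT z|N. D i z * (\<psi> z @. b))" if "i : I" for i b
   using D[OF that] pmN by (subst D(3)[OF that, symmetric], subst integral_real_density) auto
  have "(LINT z|m. \<psi> z @. \<sigma> z) = (LINT z|N. norm (G z) * (\<psi> z @. \<sigma> z))"
   unfolding m_def using Gm pmN smN by (subst integral_real_density) auto
  also have "... = (LINT z|N. (SUM b:Basis. D (b, True) z * (\<psi> z @. b) - D (b, False) z * (\<psi> z @. b)))"
  proof (intro lint_cong refl)
   fix z
   have "norm (G z) * (\<psi> z @. \<sigma> z) = \<psi> z @. G z" by (cases "G z = 0") (simp_all add: \<sigma>_def sgn_div_norm)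
   also have "... = (SUM b:Basis. D (b, True) z * (\<psi> z @. b) - D (b, False) z * (\<psi> z @. b))"
    by (simp add: G_def inner_sum_right left_diff_distrib)
   finally show "norm (G z) * (\<psi> z @. \<sigma> z) = ..." .
  qed
  also have "... = (SUM b:Basis. (LINT z|N. D (b, True) z * (\<psi> z @. b)) - (LINT z|N. D (b, False) z * (\<psi> z @. b)))"
   using int mem by (subst Bochner_Integration.integral_sum) auto
  also have "... = (SUM b:Basis. (\<integral>z. \<psi> z @. b \<partial>\<nu> (b, True)) - (\<integral>z. \<psi> z @. b \<partial>\<nu> (b, False)))"
   using comp mem by (intro sum.cong) auto
  finally show ?thesis .
 qed
 show thesis by (rule that[OF ms fm mU sm ae eq])
qed

theorem riesz_vector_measure:
 fixes L :: "('a::euclidean_space => 'a) => real"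
 assumes U: "open U"
  and add: "!!f g. f : C1c U ==> g : C1c U ==> L (%z. f z + g z) = L f + L g"
  and scale: "!!f c. f : C1c U ==> L (%z. c *. f z) = c * L f"
  and bound: "!!f. f : C1c U ==> (!!z. norm (f z) <= 1) ==> \<bar>L f\<bar> <= C"
 obtains m \<sigma> where "sets m = sets borel" "finite_measure m" "emeasure m (- U) = 0" "\<sigma> : borel_fun"
  "AE z in m. norm (\<sigma> z) = 1"
  "!!\<psi>. \<psi> : C1c U ==> L \<psi> = (LINT z|m. \<psi> z @. \<sigma> z)"
proof -
 \<comment> \<open>Set to zero off \<open>Basis\<close>, so that the locale assumptions hold for
   every \<open>b\<close> and the measures can be chosen for all \<open>b\<close> at once.\<close>
 define T where "T = (%b g. if b : Basis then L (%z. g z *. (b::'a)) else 0)"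
 have mem: "(%z. g z *. b) : C1c U" if g: "g : C1c U" for g :: "'a => real" and b :: 'a
 proof -
  obtain K where K: "g : C1_upto UNIV" "compact K" "K \<subseteq> U" "!!z. z ~: K ==> g z = 0" using g by (rule C1c_E) blast
  show ?thesis using K by (intro C1c_I[of _ K] C1_scaleR C1_const) auto
 qed
 have "(%z. 0::'a) : C1c U" by (rule C1c_I[of _ "{}"]) auto
 from order_trans[OF abs_ge_zero bound[OF this]] have C0: "0 <= C" by simp
 have fn: "C1_functional U (T b) C" for b
 proof
  show "T b (%z. f z + g z) = T b f + T b g" if "f : C1c U" "g : C1c U" for f g
   using add[OF mem[OF that(1)] mem[OF that(2)]] by (simp add: T_def scaleR_add_left)
  show "T b (%z. c * f z) = c * T b f" if "f : C1c U" for f c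
   using scale[OF mem[OF that]] by (simp add: T_def)
  show "\<bar>T b f\<bar> <= C" if "f : C1c U" "!!z. \<bar>f z\<bar> <= 1" for f
   unfolding T_def using bound[OF mem[OF that(1)], of b] C0 that(2) by simp
 qed (rule U)
 define good where "good = (%b \<nu>1 \<nu>2. finite_measure \<nu>1 & finite_measure \<nu>2 & sets \<nu>1 = sets borel & sets \<nu>2 = sets borel &
  emeasure \<nu>1 (- U) = 0 & emeasure \<nu>2 (- U) = 0 & (ALL g:C1c U. T b g = (LINT z|\<nu>1. g z) - (LINT z|\<nu>2. g z)))"
 have "EX \<nu>1 \<nu>2. good b \<nu>1 \<nu>2" for b
  by (rule C1_functional.signed_representation[OF fn, of b]) (auto simp: good_def)
 then obtain \<nu>1 \<nu>2 where nu: "!!b. good b (\<nu>1 b) (\<nu>2 b)" by metis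
 define \<nu> where "\<nu> = (%(b, t). if t then \<nu>1 b else \<nu>2 b)"
 have n: "finite_measure (\<nu> i)" "sets (\<nu> i) = sets borel" "emeasure (\<nu> i) (- U) = 0" for i
  using nu unfolding \<nu>_def good_def by (auto split: prod.split)
 obtain m \<sigma> where ms: "sets m = sets borel" "finite_measure m" "emeasure m (- U) = 0" "\<sigma> : borel_fun"
  "AE z in m. norm (\<sigma> z) = 1"
  "!!\<psi> :: 'a => 'a. \<psi> : C1c U ==>
    (LINT z|m. \<psi> z @. \<sigma> z) = (SUM b:Basis. (\<integral>z. \<psi> z @. b \<partial>\<nu> (b, True)) - (\<integral>z. \<psi> z @. b \<partial>\<nu> (b, False)))"
  by (rule vector_measure_polar[of \<nu> U]) (use n U in auto)
 have "L \<psi> = (LINT z|m. \<psi> z @. \<sigma> z)" if psi: "\<psi> : C1c U" for \<psi>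
 proof -
  obtain K where K: "\<psi> : C1_upto UNIV" "compact K" "K \<subseteq> U" "!!z. z ~: K ==> \<psi> z = 0" using psi by (rule C1c_E) blast
  have c: "(%z. \<psi> z @. b) : C1c U" for b
   using K by (intro C1c_I[of _ K] C1_bounded_linear[OF bounded_linear_inner_left]) auto
  have s: "finite J ==> (%z. SUM b:J. (\<psi> z @. b) *. b) : C1c U &
    L (%z. SUM b:J. (\<psi> z @. b) *. b) = (SUM b:J. L (%z. (\<psi> z @. b) *. b))" for J
  proof (induction J rule: finite_induct)
   case empty
   have z: "(%z::'a. 0::'a) : C1c U" by (rule C1c_I[of _ "{}"]) auto
   thus ?case using scale[OF z, of 0] by simp
  next
   case (insert b J)
   have "(%z. (\<psi> z @. b) *. b + (SUM b:J. (\<psi> z @. b) *. b)) : C1c U"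
    using K by (intro C1c_I[of _ K] C1_add C1_sum C1_scaleR C1_const C1_bounded_linear[OF bounded_linear_inner_left]) auto
   thus ?case using insert add[OF mem[OF c[of b]], of "%z. SUM b:J. (\<psi> z @. b) *. b" b] by simp
  qed
  have "L \<psi> = L (%z. SUM b:Basis. (\<psi> z @. b) *. b)" by (simp add: euclidean_representation)
  also have "... = (SUM b:Basis. T b (%z. \<psi> z @. b))" using s[of Basis] by (simp add: T_def)
  also have "... = (SUM b:Basis. (\<integral>z. \<psi> z @. b \<partial>\<nu> (b, True)) - (\<integral>z. \<psi> z @. b \<partial>\<nu> (b, False)))"
   using nu c by (intro sum.cong refl) (simp add: \<nu>_def good_def)
  finally show ?thesis using ms(6)[OF psi] by simp
 qed
 thus thesis using that[OF ms(1-5)] by blast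
qed

section \<open>Almost everywhere differentiability of Lipschitz functions on the line\<close>

lemma lipschitz_density:
 fixes g :: "real => real"
 assumes lip: "!!s t. \<bar>g s - g t\<bar> <= \<bar>s - t\<bar>"
 obtains \<rho> where "\<rho> : borel_fun" "!!a b. a <= b ==> (\<rho> has_integral (g b - g a)) {a..b}"
proof -
 \<comment> \<open>\<open>h\<close> and \<open>k\<close> are nondecreasing and add up to
   \<open>2 * t\<close>. Their Stieltjes measures therefore sum to twice Lebesgue measure, which
   makes the one of \<open>h\<close> absolutely continuous; its density minus 1 is the density of
   \<open>g\<close>.\<close>
 define h k where "h = (%t. g t + t)" and "k = (%t. t - g t)"
 have cont: "continuous_on UNIV g"
  unfolding continuous_on_iff dist_real_def using lip by (metis le_less_trans)
 have mono: "h x <= h y" "k x <= k y" if "x <= y" for x y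
  using lip[of x y] that by (auto simp: h_def k_def)
 have rc: "continuous (at_right a) h" "continuous (at_right a) k" for a
  using cont unfolding h_def k_def
  by (auto intro!: continuous_intros simp: continuous_on_eq_continuous_at[OF open_UNIV] continuous_at_imp_continuous_at_within)
 define \<nu> where "\<nu> = (%t::bool. interval_measure (if t then h else k))"
 obtain N where N: "sets N = sets (borel :: real measure)" "!!A. A : sets borel ==> emeasure N A = (SUM t:UNIV. emeasure (\<nu> t) A)"
  using sum_of_measures[of UNIV \<nu> borel] by (auto simp: \<nu>_def)
 have N2: "emeasure N A = emeasure (interval_measure h) A + emeasure (interval_measure k) A" if "A : sets borel" for A
  using N(2)[OF that] by (simp add: UNIV_bool \<nu>_def add.commute)
 have Ioc: "emeasure N {a<..b} = ennreal (2 * (b - a))" if "a <= b" for a b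
  using that mono rc by (simp add: N2 emeasure_interval_measure_Ioc ennreal_plus[symmetric] del: ennreal_plus) (simp add: h_def k_def)
 have "N = density lborel (%_. 2)"
 proof (rule measure_eqI_generator_eq[where E="range (%(a, b). {a<..b::real})" and A="%n::nat. {- real n<..real n}" and \<Omega>=UNIV])
  show "Int_stable (range (%(a, b). {a<..b::real}))"
   by (auto simp: Int_stable_def)
  show "sets N = sigma_sets UNIV (range (%(a, b). {a<..b::real}))" "sets (density lborel (%_. 2)) = sigma_sets UNIV (range (%(a, b). {a<..b::real}))"
   by (simp_all add: N(1) borel_sigma_sets_Ioc)
  show "emeasure N X = emeasure (density lborel (%_. 2)) X" if X: "X : range (%(a, b). {a<..b::real})" for X
  proof -
   obtain a b where X: "X = {a<..b}" using X by auto
   show ?thesis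
   proof (cases "a <= b")
    case True
    hence "emeasure (density lborel (%_. 2)) X = ennreal 2 * ennreal (b - a)"
     by (simp add: X emeasure_density nn_integral_cmult_indicator)
    also have "... = ennreal (2 * (b - a))" using True by (intro ennreal_mult[symmetric]) auto
    finally show ?thesis using Ioc[OF True] X by simp
   qed (simp add: X)
  qed
  show "(\<Union>n::nat. {- real n<..real n}) = UNIV"
  proof -
   have "EX n::nat. - real n < x & x <= real n" for x :: real
    using reals_Archimedean2[of "\<bar>x\<bar>"] by (auto intro: exI simp: abs_less_iff) (smt (verit))
   thus ?thesis by auto
  qed
  show "emeasure N {- real n<..real n} ~= \<infinity>" for n using Ioc[of "- real n" "real n"] by simp
 qed auto
 hence le: "emeasure (interval_measure h) A <= 2 * emeasure lborel A" if "A : sets borel" for A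
  using N2[OF that] that by (simp add: emeasure_density nn_integral_cmult_indicator)
 have ac: "absolutely_continuous lborel (interval_measure h)"
  unfolding absolutely_continuous_def
 proof
  fix A assume "A : null_sets (lborel :: real measure)"
  hence A: "A : sets borel" "emeasure lborel A = 0" by auto
  have "emeasure (interval_measure h) A = 0" using le[OF A(1)] A(2) by simp
  thus "A : null_sets (interval_measure h)" using A by auto
 qed
 define F where "F = RN_deriv lborel (interval_measure h)"
 have Fm[measurable]: "F : borel_fun" unfolding F_def using borel_measurable_RN_deriv[of lborel] by simp
 have FD: "density lborel F = interval_measure h"
  unfolding F_def by (rule sigma_finite_measure.density_RN_deriv[OF lborel.sigma_finite_measure_axioms ac]) simp
 have Fint: "(\<integral>\<^sup>+t. F t * indicator {a<..b} t \<partial>lborel) = ennreal (h b - h a)" if "a <= b" for a b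
 proof -
  have "ennreal (h b - h a) = emeasure (density lborel F) {a<..b}"
   unfolding FD using that mono rc by (simp add: emeasure_interval_measure_Ioc)
  thus ?thesis by (simp add: emeasure_density)
 qed
 have fin: "AE t in lborel. F t ~= \<infinity>"
 proof -
  have "AE t in lborel. F t * indicator {- real n<..real n} t ~= \<infinity>" for n
   by (rule nn_integral_PInf_AE) (use Fint[of "- real n" "real n"] in auto)
  hence "AE t in lborel. ALL n. F t * indicator {- real n<..real n} t ~= \<infinity>" by (simp add: AE_all_countable)
  thus ?thesis
  proof eventually_elim
   case (elim t)
   obtain n :: nat where "\<bar>t\<bar> < real n" using reals_Archimedean2 by blast
   thus ?case using elim[rule_format, of n] by (auto simp: indicator_def abs_less_iff split: if_splits)
  qed
 qed
 define r where "r = (%t. enn2real (F t))"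
 have rm[measurable]: "r : borel_fun" unfolding r_def by measurable
 have hi: "(r has_integral (h b - h a)) {a..b}" if ab: "a <= b" for a b
 proof -
  have "(\<integral>\<^sup>+t. ennreal (r t * indicator {a..b} t) \<partial>lborel) = (\<integral>\<^sup>+t. F t * indicator {a<..b} t \<partial>lborel)"
  proof (rule nn_integral_cong_AE)
   show "AE t in lborel. ennreal (r t * indicator {a..b} t) = F t * indicator {a<..b} t"
    using fin AE_lborel_singleton[of a]
    by eventually_elim (auto simp: r_def indicator_def less_top)
  qed
  hence "(\<integral>\<^sup>+t. ennreal (r t * indicator {a..b} t) \<partial>lborel) = ennreal (h b - h a)" using Fint[OF ab] by simp
  hence "((%t. r t * indicator {a..b} t) has_integral (h b - h a)) UNIV"
   using mono(1)[OF ab] by (intro nn_integral_has_integral) (auto simp: r_def)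
  moreover have "(%t. r t * indicator {a..b} t) = (%t. if t : {a..b} then r t else 0)"
   by (auto simp: indicator_def fun_eq_iff)
  ultimately show ?thesis by (simp only: has_integral_restrict_UNIV)
 qed
 show thesis
 proof (rule that[of "%t. r t - 1"])
  show "((%t. r t - 1) has_integral (g b - g a)) {a..b}" if "a <= b" for a b
   using has_integral_diff[OF hi[OF that] has_integral_const_real[of 1 a b]] that by (simp add: h_def algebra_simps)
 qed measurable
qed

text \<open>Lebesgue differentiation yields the limit of difference quotients from the right only;
  the left ones come from the reflected function \<open>g (- x)\<close>, whose exceptional set is
  reflected back.\<close>

lemma lipschitz_ae_derivative:
 fixes g :: "real => real"
 assumes lip: "!!s t. \<bar>g s - g t\<bar> <= \<bar>s - t\<bar>"
 obtains \<rho> N where "\<rho> : borel_fun" "!!t. \<bar>\<rho> t\<bar> <= 1" "!!a b. a <= b ==> (\<rho> has_integral (g b - g a)) {a..b}"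
  "negligible N" "!!t. t ~: N ==> (g has_real_derivative \<rho> t) (at t)"
proof -
 obtain r where r: "r : borel_fun" "!!a b. a <= b ==> (r has_integral (g b - g a)) {a..b}"
  by (rule lipschitz_density[OF lip]) blast
 have right: "EX N. negligible N & (ALL x e. x ~: N --> 0 < e --> (EX d>0. ALL h. 0 < h & h < d --> \<bar>(G (x + h) - G x) / h - R x\<bar> < e))"
  if R: "!!a b. a <= b ==> (R has_integral (G b - G a)) {a..b}" for R G :: "real => real"
 proof -
  have "R integrable_on cbox a b" for a b
   by (cases "a <= b") (auto intro: has_integral_integrable[OF R])
  from integrable_ccontinuous_explicit[OF this] obtain N where N: "negligible N"
    "!!x e. [|x ~: N; 0 < e|] ==> EX d>0. ALL h. 0 < h & h < d -->
             norm (integral (cbox x (x + h *. One)) R /\<^sub>R h ^ DIM(real) - R x) < e" by blast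
  have "EX d>0. ALL h. 0 < h & h < d --> \<bar>(G (x + h) - G x) / h - R x\<bar> < e" if x: "x ~: N" and e: "0 < e" for x e
  proof -
   obtain d where d: "d > 0" "!!h. 0 < h ==> h < d ==> norm (integral (cbox x (x + h *. One)) R /\<^sub>R h ^ DIM(real) - R x) < e"
    using N(2)[OF x e] by blast
   have "\<bar>(G (x + h) - G x) / h - R x\<bar> < e" if h: "0 < h" "h < d" for h
   proof -
    have "integral {x..x + h} R = G (x + h) - G x" using h by (intro integral_unique R) auto
    thus ?thesis using d(2)[OF h] by (simp add: divide_inverse mult.commute)
   qed
   thus ?thesis using d(1) by blast
  qed
  thus ?thesis using N(1) by blast
 qed
 obtain N1 where N1: "negligible N1" "!!x e. x ~: N1 ==> 0 < e ==> (EX d>0. ALL h. 0 < h & h < d --> \<bar>(g (x + h) - g x) / h - r x\<bar> < e)"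
  using right[OF r(2)] by blast
 have r': "((%x. - r (- x)) has_integral (g (- b) - g (- a))) {a..b}" if "a <= b" for a b
 proof -
  have "(r has_integral (g (- a) - g (- b))) (cbox (- b) (- a))" using r(2)[of "- b" "- a"] that by simp
  from has_integral_neg[OF has_integral_reflect_lemma[OF this]] show ?thesis by simp
 qed
 obtain N2 where N2: "negligible N2" "!!x e. x ~: N2 ==> 0 < e ==> (EX d>0. ALL h. 0 < h & h < d --> \<bar>(g (- (x + h)) - g (- x)) / h - (- r (- x))\<bar> < e)"
  using right[of "%x. - r (- x)" "%x. g (- x)"] r' by blast
 define N where "N = N1 Un uminus ` N2"
 have N: "negligible N" unfolding N_def
  using N1(1) negligible_differentiable_image_negligible[OF _ N2(1), of uminus]
  by (auto intro!: negligible_Un derivative_intros simp: differentiable_on_def)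
 have der: "(g has_real_derivative r t) (at t)" if t: "t ~: N" for t
 proof -
  have t1: "t ~: N1" and t2: "- t ~: N2" using t by (auto simp: N_def image_iff)
  show ?thesis unfolding DERIV_def LIM_eq
  proof (intro allI impI)
   fix e :: real assume e: "0 < e"
   obtain d1 where d1: "d1 > 0" "!!h. 0 < h ==> h < d1 ==> \<bar>(g (t + h) - g t) / h - r t\<bar> < e" using N1(2)[OF t1 e] by blast
   obtain d2 where d2: "d2 > 0" "!!h. 0 < h ==> h < d2 ==> \<bar>(g (- (- t + h)) - g (- (- t))) / h - (- r (- (- t)))\<bar> < e" using N2(2)[OF t2 e] by blast
   show "EX s>0. ALL x. x ~= 0 & norm (x - 0) < s --> norm ((g (t + x) - g t) / x - r t) < e"
   proof (intro exI[of _ "min d1 d2"] conjI allI impI)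
    fix x :: real assume x: "x ~= 0 & norm (x - 0) < min d1 d2"
    show "norm ((g (t + x) - g t) / x - r t) < e"
    proof (cases "0 < x")
     case True thus ?thesis using d1(2)[of x] x by simp
    next
     case False
     hence "\<bar>(g (t + x) - g t) / (- x) + r t\<bar> < e" using d2(2)[of "- x"] x by (simp add: add.commute)
     moreover have "\<bar>(g (t + x) - g t) / (- x) + r t\<bar> = \<bar>(g (t + x) - g t) / x - r t\<bar>" by (simp add: abs_if)
     ultimately show ?thesis by (simp add: add.commute)
    qed
   qed (use d1 d2 in auto)
  qed
 qed
 have rb: "\<bar>r t\<bar> <= 1" if t: "t ~: N" for t
 proof (rule tendsto_upperbound)
  show "((%h. \<bar>(g (t + h) - g t) / h\<bar>) \<longlongrightarrow> \<bar>r t\<bar>) (at 0)"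
   using der[OF t] unfolding DERIV_def by (rule tendsto_rabs)
  show "\<forall>\<^sub>F h in at 0. \<bar>(g (t + h) - g t) / h\<bar> <= 1"
   using lip[of "t + _" t] by (intro always_eventually allI) (simp add: divide_le_eq_1)
 qed simp
 \<comment> \<open>Clipping gives the bound for every \<open>t\<close>; the values change only on
   the null set \<open>N\<close>.\<close>
 define \<rho> where "\<rho> = (%t. max (- 1) (min 1 (r t)))"
 have eq: "\<rho> t = r t" if "t ~: N" for t using rb[OF that] by (auto simp: \<rho>_def)
 show thesis
 proof (rule that[of \<rho> N])
  show "\<rho> : borel_fun" unfolding \<rho>_def using r(1) by measurable
  show "\<bar>\<rho> t\<bar> <= 1" for t by (auto simp: \<rho>_def)
  show "(\<rho> has_integral (g b - g a)) {a..b}" if "a <= b" for a b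
   by (rule has_integral_spike[OF N _ r(2)[OF that]]) (simp add: eq)
  show "(g has_real_derivative \<rho> t) (at t)" if "t ~: N" for t using der[OF that] eq[OF that] by simp
 qed (rule N)
qed

section \<open>The boundary curve\<close>

locale convex_curve =
 fixes Om :: "plane set" and \<gamma> :: "real => plane"
 assumes open_Om: "open Om" and bounded_Om: "bounded Om" and convex_Om: "convex Om" and ne_Om: "Om ~= {}"
  and ccw: "ccw_arclength_param Om \<gamma>"
begin

definition len :: real where "len = perimeter Om"

lemma bij_\<gamma>: "bij_betw \<gamma> {0..<len} (frontier Om)"
 using ccw by (simp add: ccw_arclength_param_def len_def)

lemma length_\<gamma>: "0 <= s ==> s <= t ==> t < len ==> curve_length \<gamma> s t = ennreal (t - s)"
 using ccw by (simp add: ccw_arclength_param_def len_def)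

lemma frontier_ne: "frontier Om ~= {}"
 using frontier_eq_empty[of Om] ne_Om bounded_Om not_bounded_UNIV by auto

lemma len_pos: "0 < len"
 using bij_\<gamma> frontier_ne by (auto simp: bij_betw_def)

lemma \<gamma>_mem: "0 <= t ==> t < len ==> \<gamma> t : frontier Om"
 using bij_\<gamma> by (auto simp: bij_betw_def)

lemma \<gamma>_inj: "0 <= s ==> s < len ==> 0 <= t ==> t < len ==> \<gamma> s = \<gamma> t ==> s = t"
 using bij_\<gamma> by (auto simp: bij_betw_def inj_on_def)

lemma \<gamma>_surj: "p : frontier Om ==> EX t. 0 <= t & t < len & p = \<gamma> t"
proof -
 assume "p : frontier Om"
 hence "p : \<gamma> ` {0..<len}" using bij_\<gamma> by (simp add: bij_betw_def)
 thus ?thesis by auto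
qed

lemma compact_frontier: "compact (frontier Om)"
 by (rule compact_frontier_bounded[OF bounded_Om])

lemma \<gamma>_lip:
 assumes "0 <= s" "s <= t" "t < len"
 shows "dist (\<gamma> s) (\<gamma> t) <= t - s"
proof -
 have "ennreal (\<Sum>i<length [s, t] - 1. dist (\<gamma> ([s, t] ! i)) (\<gamma> ([s, t] ! Suc i))) <= curve_length \<gamma> s t"
  unfolding curve_length_def by (rule SUP_upper) (use assms in auto)
 thus ?thesis using assms by (simp add: length_\<gamma> ennreal_le_iff)
qed

lemma \<gamma>_lip': "0 <= s ==> s < len ==> 0 <= t ==> t < len ==> dist (\<gamma> s) (\<gamma> t) <= \<bar>s - t\<bar>"
 using \<gamma>_lip[of s t] \<gamma>_lip[of t s] by (cases "s <= t") (auto simp: dist_commute)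

lemma \<gamma>_cont: "continuous_on {0..<len} \<gamma>"
 unfolding continuous_on_iff
proof (intro ballI allI impI)
 fix x e assume "x : {0..<len}" "(0::real) < e"
 thus "EX d>0. ALL x':{0..<len}. dist x' x < d --> dist (\<gamma> x') (\<gamma> x) < e"
  by (intro exI[of _ e] conjI ballI impI le_less_trans[OF \<gamma>_lip']) (auto simp: dist_real_def)
qed

text \<open>The frontier is a topological circle, and a punctured circle is homeomorphic to a
  line.\<close>

lemma connected_frontier_minus:
 assumes "a : frontier Om" shows "connected (frontier Om - {a})"
proof -
 have "interior Om ~= {}" using open_Om ne_Om by (simp add: interior_open)
 hence rf: "rel_frontier Om = frontier Om" by (rule rel_frontier_nonempty_interior)
 have dim: "aff_dim Om = 2" using aff_dim_open[OF open_Om ne_Om] by simp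
 obtain H :: "plane set" where H: "affine H" "aff_dim H = 1"
  using choose_affine_subset[of "UNIV :: plane set" 1] by (auto simp: affine_UNIV)
 have "frontier Om - {a} homeomorphic H"
  using homeomorphic_punctured_sphere_affine_gen[OF convex_Om bounded_Om, of a H] assms H dim rf by simp
 thus ?thesis using homeomorphic_connectedness affine_imp_convex[OF H(1)] convex_connected by blast
qed

text \<open>A limit point \<open>\<gamma> c\<close> with \<open>0 < c\<close> would split \<open>frontier \<Omega> - {\<gamma> c}\<close>, a punctured circle, into the
 two arcs before and after \<open>c\<close>.\<close>

lemma \<gamma>_closes_up: "0 <= t ==> t < len ==> dist (\<gamma> t) (\<gamma> 0) <= len - t"
proof -
 define s where "s = (%n. len - len / real (n + 2))"
 have s: "0 <= s n" "s n < len" for n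
  using len_pos by (auto simp: s_def divide_le_eq)
 have sl: "s \<longlonglongrightarrow> len"
 proof -
  have "(%n. len - len / real (n + 2)) \<longlonglongrightarrow> len - 0"
   by (intro tendsto_intros LIMSEQ_ignore_initial_segment[OF lim_const_over_n])
  thus ?thesis by (simp add: s_def)
 qed
 have "ALL n. \<gamma> (s n) : frontier Om" using \<gamma>_mem s by blast
 from seq_compactE[OF compact_imp_seq_compact[OF compact_frontier] this]
 obtain p r where p: "p : frontier Om" "strict_mono r" "((%n. \<gamma> (s n)) \<circ> r) \<longlonglongrightarrow> p" .
 have srl: "(%n. s (r n)) \<longlonglongrightarrow> len" using LIMSEQ_subseq_LIMSEQ[OF sl p(2)] by (simp add: o_def)
 have lim: "dist (\<gamma> t) p <= len - t" if t: "0 <= t" "t < len" for t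
 proof (rule tendsto_le[of sequentially])
  show "(%n. \<bar>t - s (r n)\<bar>) \<longlonglongrightarrow> len - t"
  proof -
   have "(%n. \<bar>t - s (r n)\<bar>) \<longlonglongrightarrow> \<bar>t - len\<bar>" by (intro tendsto_intros srl)
   thus ?thesis using t by simp
  qed
  show "(%n. dist (\<gamma> t) (\<gamma> (s (r n)))) \<longlonglongrightarrow> dist (\<gamma> t) p"
   using p(3) by (intro tendsto_intros) (simp add: o_def)
  show "\<forall>\<^sub>F n in sequentially. dist (\<gamma> t) (\<gamma> (s (r n))) <= \<bar>t - s (r n)\<bar>"
   using \<gamma>_lip' t s by (intro always_eventually) auto
 qed simp
 obtain c where c: "0 <= c" "c < len" "p = \<gamma> c" using \<gamma>_surj[OF p(1)] by blast
 have "c = 0"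
 proof (rule ccontr)
  assume "c ~= 0"
  hence c0: "0 < c" using c by simp
  define A where "A = \<gamma> ` {0..c}"
  define B where "B = \<gamma> ` {c..<len}"
  have "closed A" unfolding A_def
   using c by (intro compact_imp_closed compact_continuous_image continuous_on_subset[OF \<gamma>_cont]) auto
  moreover have "closed B"
  proof -
   define g where "g = (%t. if t < len then \<gamma> t else p)"
   have "continuous_on {c..len} g"
    unfolding continuous_on_iff
   proof (intro ballI allI impI)
    fix x e assume x: "x : {c..len}" and e: "(0::real) < e"
    have "dist (g x') (g x) <= dist x' x" if "x' : {c..len}" for x'
     using x that c lim[of x] lim[of x'] \<gamma>_lip'[of x' x] by (auto simp: g_def dist_real_def dist_commute)
    thus "EX d>0. ALL x':{c..len}. dist x' x < d --> dist (g x') (g x) < e"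
     using e by (intro exI[of _ e] conjI ballI impI) (auto intro: order.strict_trans1)
   qed
   hence "compact (g ` {c..len})" by (intro compact_continuous_image) auto
   moreover have "g ` {c..len} = B"
   proof
    show "g ` {c..len} \<subseteq> B" using c by (auto simp: g_def B_def)
    show "B \<subseteq> g ` {c..len}" unfolding B_def g_def using c by (auto intro!: image_eqI)
   qed
   ultimately show ?thesis using compact_imp_closed by simp
  qed
  moreover have "frontier Om - {p} \<subseteq> A Un B"
   using \<gamma>_surj by (force simp: A_def B_def)
  moreover have "A Int B Int (frontier Om - {p}) = {}"
  proof (rule ccontr)
   assume "A Int B Int (frontier Om - {p}) ~= {}"
   then obtain z where z: "z : A" "z : B" "z ~= p" by blast
   obtain a where a: "0 <= a" "a <= c" "z = \<gamma> a" using z(1) by (auto simp: A_def)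
   obtain b where b: "c <= b" "b < len" "z = \<gamma> b" using z(2) by (auto simp: B_def)
   have ab: "0 <= a" "a <= c" "c <= b" "b < len" "\<gamma> a = \<gamma> b" "\<gamma> a ~= p" using a b z by auto
   hence "a = b" using \<gamma>_inj[of a b] c by auto
   thus False using ab c by auto
  qed
  moreover have "A Int (frontier Om - {p}) ~= {}"
  proof -
   have "\<gamma> 0 ~= p" using \<gamma>_inj[of 0 c] c c0 by auto
   hence "\<gamma> 0 : A Int (frontier Om - {p})" using \<gamma>_mem[of 0] len_pos c by (auto simp: A_def)
   thus ?thesis by blast
  qed
  moreover have "B Int (frontier Om - {p}) ~= {}"
  proof -
   define b where "b = (c + len) / 2"
   have b: "c < b" "b < len" using c by (auto simp: b_def)
   have "\<gamma> b ~= p" using \<gamma>_inj[of b c] c b by auto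
   hence "\<gamma> b : B Int (frontier Om - {p})" using \<gamma>_mem[of b] b c by (auto simp: B_def)
   thus ?thesis by blast
  qed
  ultimately show False using connected_frontier_minus[OF p(1)] unfolding connected_closed by blast
 qed
 thus "0 <= t ==> t < len ==> dist (\<gamma> t) (\<gamma> 0) <= len - t" using lim c by simp
qed

text \<open>The curve, continued by the constant \<open>\<gamma> 0\<close> to the whole line.
  Because the curve closes up, the continuation is still 1-Lipschitz, so differentiation theory on
  the line applies without boundary cases; in particular
  \<open>gam len = \<gamma> 0\<close>.\<close>

definition gam :: "real => plane" where
 "gam t = (if 0 <= t & t < len then \<gamma> t else \<gamma> 0)"

lemma gam_eq: "0 <= t ==> t < len ==> gam t = \<gamma> t" by (simp add: gam_def)

lemma gam_lip: "dist (gam s) (gam t) <= \<bar>s - t\<bar>"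
proof -
 have *: "dist (gam s) (gam t) <= t - s" if "s <= t" for s t
  using that \<gamma>_lip[of s t] \<gamma>_lip[of 0 t] \<gamma>_closes_up[of s] \<gamma>_closes_up[of t] len_pos
  by (auto simp: gam_def dist_commute)
 show ?thesis using *[of s t] *[of t s] by (cases "s <= t") (auto simp: dist_commute)
qed

lemma gam_cont: "continuous_on UNIV gam"
 unfolding continuous_on_iff
proof (intro ballI allI impI)
 fix x e :: real assume "0 < e"
 thus "EX d>0. ALL x':UNIV. dist x' x < d --> dist (gam x') (gam x) < e"
  using gam_lip[of _ x] by (intro exI[of _ e]) (auto simp: dist_real_def intro: le_less_trans)
qed

lemma gam_borel [measurable]: "gam : borel_fun"
 by (rule borel_contI[OF gam_cont])

lemma gam_mem: "gam t : frontier Om"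
 using \<gamma>_mem len_pos by (auto simp: gam_def)

lemma ex_tangent: "EX v::real=>plane. v : borel_fun & (ALL t i. \<bar>v t $ i\<bar> <= 1) &
  (ALL i a b. a <= b --> ((%t. v t $ i) has_integral (gam b $ i - gam a $ i)) {a..b}) &
  (EX N. negligible N & (ALL t. t ~: N --> (gam has_vector_derivative v t) (at t)))"
proof -
 have lip: "\<bar>gam s $ i - gam t $ i\<bar> <= \<bar>s - t\<bar>" for s t i
  using component_le_norm_cart[of "gam s - gam t" i] gam_lip[of s t] by (simp add: dist_norm)
 have "EX \<rho> N. \<rho> : borel_fun & (ALL t. \<bar>\<rho> t\<bar> <= 1) & (ALL a b. a <= b --> (\<rho> has_integral (gam b $ i - gam a $ i)) {a..b})
  & negligible N & (ALL t. t ~: N --> ((%t. gam t $ i) has_real_derivative \<rho> t) (at t))" for i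
  by (rule lipschitz_ae_derivative[of "%t. gam t $ i", OF lip]) blast
 then obtain \<rho> N where r: "!!i. \<rho> i : borel_fun" "!!i t. \<bar>\<rho> i t\<bar> <= 1"
   "!!i a b. a <= b ==> (\<rho> i has_integral (gam b $ i - gam a $ i)) {a..b}"
   "!!i. negligible (N i)" "!!i t. t ~: N i ==> ((%t. gam t $ i) has_real_derivative \<rho> i t) (at t)"
  by metis
 define v where "v = (%t. vec_lambda (%i. \<rho> i t) :: plane)"
 have v: "v t $ i = \<rho> i t" for t i by (simp add: v_def)
 have "v : borel_fun"
  by (subst borel_measurable_euclidean_space) (auto simp: Basis_vec_def inner_axis v r(1))
 moreover have "(gam has_vector_derivative v t) (at t)" if t: "t ~: (\<Union>i. N i)" for t
 proof -
  have "((%t. gam t $ i) has_vector_derivative v t $ i) (at t)" for i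
   using r(5)[of t i] t by (simp add: v has_real_derivative_iff_has_vector_derivative)
  thus ?thesis
   unfolding has_vector_derivative_def
   by (subst has_derivative_componentwise_within) (auto simp: Basis_vec_def inner_axis)
 qed
 moreover have "negligible (\<Union>i. N i)" using r(4) by (intro negligible_Union) auto
 ultimately show ?thesis
  using r(2,3) by (intro exI[of _ v]) (auto simp: v)
qed

text \<open>A Borel version of the almost everywhere derivative. The bound on the components holds
  at every parameter, which makes integrability immediate; unit length is available only almost
  everywhere.\<close>

definition tangent :: "real => plane" where
 "tangent = (SOME v. v : borel_fun & (ALL t i. \<bar>v t $ i\<bar> <= 1) &
  (ALL i a b. a <= b --> ((%t. v t $ i) has_integral (gam b $ i - gam a $ i)) {a..b}) &
  (EX N. negligible N & (ALL t. t ~: N --> (gam has_vector_derivative v t) (at t))))"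

lemma tangent_borel [measurable]: "tangent : borel_fun"
 and tangent_le_1: "\<bar>tangent t $ i\<bar> <= 1"
 and tangent_integral: "a <= b ==> ((%t. tangent t $ i) has_integral (gam b $ i - gam a $ i)) {a..b}"
 and tangent_derivative: "EX N. negligible N & (ALL t. t ~: N --> (gam has_vector_derivative tangent t) (at t))"
 using someI_ex[OF ex_tangent] unfolding tangent_def[symmetric] by blast+

lemma tangent_component_borel [measurable]: "(%t. tangent t $ i) : borel_fun"
proof -
 have "(%t. tangent t @. axis i 1) : borel_fun" by measurable
 thus ?thesis by (simp add: inner_axis)
qed

lemma AE_tangent: "AE t in lborel. (gam has_vector_derivative tangent t) (at t)"
proof -
 obtain N where N: "negligible N" "!!t. t ~: N ==> (gam has_vector_derivative tangent t) (at t)"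
  using tangent_derivative by blast
 have "N : null_sets lebesgue" using N(1) negligible_iff_null_sets by blast
 hence "AE t in lebesgue. t ~: N" by (rule AE_not_in)
 hence "AE t in lborel. t ~: N" by (simp add: AE_completion_iff)
 thus ?thesis by eventually_elim (rule N(2))
qed

lemma tangent_ccw:
 assumes t: "0 < t" "t < len" and d: "(gam has_vector_derivative d) (at t)" and y: "y : Om"
 shows "0 < d $ 1 * (y - gam t) $ 2 - d $ 2 * (y - gam t) $ 1"
proof -
 have "(\<gamma> has_vector_derivative d) (at t)"
  by (rule has_vector_derivative_transform_within_open[OF d, of "{0<..<len}"]) (use t in \<open>auto simp: gam_eq\<close>)
 hence "0 < d $ 1 * (y - \<gamma> t) $ 2 - d $ 2 * (y - \<gamma> t) $ 1"
  using ccw t y unfolding ccw_arclength_param_def len_def by blast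
 thus ?thesis using t by (simp add: gam_eq)
qed

lemma tangent_norm_le:
 assumes "(gam has_vector_derivative d) (at t)" shows "norm d <= 1"
proof (rule tendsto_lowerbound)
 have "((%y. norm (gam y - gam t - (y - t) *. d) / norm (y - t)) \<longlongrightarrow> 0) (at t)"
  using assms unfolding has_vector_derivative_def has_derivative_iff_norm by simp
 from tendsto_add[OF tendsto_const[of 1] this]
 show "((%y. 1 + norm (gam y - gam t - (y - t) *. d) / norm (y - t)) \<longlongrightarrow> 1) (at t)" by simp
 have "norm d <= 1 + norm (gam y - gam t - (y - t) *. d) / norm (y - t)" if y: "y ~= t" for y
 proof -
  have "norm ((y - t) *. d) <= norm (gam y - gam t) + norm (gam y - gam t - (y - t) *. d)"
   using norm_triangle_ineq4[of "gam y - gam t" "gam y - gam t - (y - t) *. d"] by simp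
  also have "... <= \<bar>y - t\<bar> + norm (gam y - gam t - (y - t) *. d)" using gam_lip[of y t] by (simp add: dist_norm)
  finally have "\<bar>y - t\<bar> * norm d <= \<bar>y - t\<bar> + norm (gam y - gam t - (y - t) *. d)" by simp
  thus ?thesis using y by (simp add: field_simps)
 qed
 thus "\<forall>\<^sub>F y in at t. norm d <= 1 + norm (gam y - gam t - (y - t) *. d) / norm (y - t)"
  by (auto simp: eventually_at_filter)
qed simp

lemma integrable_on_bounded:
 fixes f :: "real => real"
 assumes "f : borel_fun" "!!t. \<bar>f t\<bar> <= B"
 shows "set_integrable lborel {a..b} f"
 unfolding set_integrable_def
proof (rule int_bdd_ind[of _ _ _ B])
 show "emeasure lborel {a..b} < \<infinity>" by (simp add: emeasure_lborel_Icc_eq)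
qed (use assms in auto)

lemma dist_gam_le_integral:
 assumes "a <= b"
 shows "dist (gam a) (gam b) <= (LINT t:{a..b}|lborel. norm (tangent t))"
proof -
 have nm: "norm (tangent t) <= 2" for t
 proof -
  have "norm (tangent t) <= (SUM i:UNIV. \<bar>tangent t $ i\<bar>)" by (rule norm_le_l1_cart)
  also have "... <= (SUM i:(UNIV::2 set). 1)" by (intro sum_mono tangent_le_1)
  finally show ?thesis by simp
 qed
 have vi: "set_integrable lborel {a..b} tangent"
  unfolding set_integrable_def
  by (rule int_bdd_ind[of _ _ _ 2]) (use nm in \<open>auto simp: emeasure_lborel_Icc_eq\<close>)
 have "(LINT t:{a..b}|lborel. tangent t) $ i = gam b $ i - gam a $ i" for i
 proof -
  have "(LINT t:{a..b}|lborel. tangent t) @. axis i 1 = (LINT t:{a..b}|lborel. tangent t $ i)"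
   using vi unfolding sli_def set_integrable_def
   by (subst integral_inner_left[symmetric]) (auto simp: inner_axis cong: lint_cong)
  also have "... = integral {a..b} (%t. tangent t $ i)"
   by (rule set_lint_eq(2)[OF integrable_on_bounded[of _ 1]]) (auto simp: tangent_le_1)
  also have "... = gam b $ i - gam a $ i" by (rule integral_unique[OF tangent_integral[OF assms]])
  finally show ?thesis by (simp add: inner_axis)
 qed
 hence "gam b - gam a = (LINT t:{a..b}|lborel. tangent t)" by (simp add: vec_eq_iff)
 moreover have "dist (gam a) (gam b) = norm (gam b - gam a)" by (metis dist_commute dist_norm)
 ultimately have "dist (gam a) (gam b) = norm (LINT t:{a..b}|lborel. tangent t)" by simp
 also have "... <= (LINT t:{a..b}|lborel. norm (tangent t))"
  unfolding sli_def
  by (rule order_trans[OF integral_norm_bound]) (auto intro!: Bochner_Integration.integral_mono_AE' simp: indicator_def set_integrable_def[symmetric] vi set_integrable_norm)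
 finally show ?thesis .
qed

lemma norm_tangent_le_2: "norm (tangent t) <= 2"
proof -
 have "norm (tangent t) <= (SUM i:UNIV. \<bar>tangent t $ i\<bar>)" by (rule norm_le_l1_cart)
 also have "... <= (SUM i:(UNIV::2 set). 1)" by (intro sum_mono tangent_le_1)
 finally show ?thesis by simp
qed

text \<open>The curve has length \<open>T\<close> on \<open>[0, T]\<close>, while every inscribed
  polygon is at most as long as the integral of \<open>norm (tangent t)\<close>, an integrand that
  is at most 1 almost everywhere. So the deficit \<open>1 - norm (tangent t)\<close> integrates to
  0. The length is given only for \<open>T < len\<close>, hence the exhaustion by
  \<open>s n\<close>.\<close>

lemma AE_norm_tangent: "AE t in lborel. 0 < t & t < len --> norm (tangent t) = 1"
proof -
 define f where "f = (%t. norm (tangent t))"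
 have fi: "set_integrable lborel {a..b} f" for a b
  unfolding f_def using norm_tangent_le_2 by (intro integrable_on_bounded[of _ 2]) auto
 have fHK: "f integrable_on {a..b}" for a b by (rule set_lint_eq(1)[OF fi])
 have dle: "dist (gam a) (gam b) <= integral {a..b} f" if "a <= b" for a b
  using dist_gam_le_integral[OF that] set_lint_eq(2)[OF fi, of a b] by (simp add: f_def)
 have full: "AE t in lborel. t : {0..T} --> f t = 1" if T: "0 < T" "T < len" for T
 proof -
  have "(\<Sum>i<length ts - 1. dist (\<gamma> (ts ! i)) (\<gamma> (ts ! Suc i))) <= integral {0..T} f" if ts: "sorted ts" "set ts \<subseteq> {0..T}" for ts
  proof (cases "ts = []")
   case True
   thus ?thesis by (auto simp: f_def intro!: integral_nonneg fHK[unfolded f_def])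
  next
   case False
   have el: "0 <= ts ! i" "ts ! i <= T" if "i < length ts" for i
    using subsetD[OF ts(2) nth_mem[OF that]] by auto
   have g: "gam (ts ! i) = \<gamma> (ts ! i)" if "i < length ts" for i using el[OF that] T by (simp add: gam_eq)
   have "k < length ts ==> (\<Sum>i<k. dist (\<gamma> (ts ! i)) (\<gamma> (ts ! Suc i))) <= integral {ts ! 0..ts ! k} f" for k
   proof (induction k)
    case (Suc k)
    have s: "ts ! 0 <= ts ! k" "ts ! k <= ts ! Suc k" using ts(1) Suc.prems by (auto simp: sorted_iff_nth_mono)
    have "dist (\<gamma> (ts ! k)) (\<gamma> (ts ! Suc k)) <= integral {ts ! k..ts ! Suc k} f"
     using dle[OF s(2)] g Suc.prems by simp
    moreover have "integral {ts ! 0..ts ! k} f + integral {ts ! k..ts ! Suc k} f = integral {ts ! 0..ts ! Suc k} f"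
     by (rule hk_combine[OF s fHK])
    ultimately show ?case using Suc by simp
   qed simp
   from this[of "length ts - 1"] False
   have "(\<Sum>i<length ts - 1. dist (\<gamma> (ts ! i)) (\<gamma> (ts ! Suc i))) <= integral {ts ! 0..ts ! (length ts - 1)} f" by simp
   also have "... <= integral {0..T} f"
    using el[of 0] el[of "length ts - 1"] False by (intro integral_subset_le fHK) (auto simp: f_def)
   finally show ?thesis .
  qed
  hence "curve_length \<gamma> 0 T <= ennreal (integral {0..T} f)"
   unfolding curve_length_def by (intro SUP_least ennreal_leI) auto
  hence "T <= integral {0..T} f"
   using T length_\<gamma>[of 0 T] by (simp add: ennreal_le_iff2)
  hence le: "T <= (LINT t:{0..T}|lborel. f t)" using set_lint_eq(2)[OF fi, of 0 T] by simp
  have i1: "set_integrable lborel {0..T} (%t. 1 - f t)"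
   by (intro set_integral_diff fi integrable_on_bounded[of _ 1]) auto
  have "(LINT t:{0..T}|lborel. 1 - f t) = (LINT t:{0..T}|lborel. 1) - (LINT t:{0..T}|lborel. f t)"
   by (intro set_integral_diff fi integrable_on_bounded[of _ 1]) auto
  also have "(LINT t:{0..T}|lborel. (1::real)) = T" using T by (simp add: sli_def)
  finally have le0: "(LINT t|lborel. indicator {0..T} t * (1 - f t)) <= 0" using le by (simp add: sli_def)
  have nn: "AE t in lborel. 0 <= indicator {0..T} t * (1 - f t)"
   using AE_tangent by eventually_elim (auto simp: f_def indicator_def dest: tangent_norm_le)
  hence "(LINT t|lborel. indicator {0..T} t * (1 - f t)) = 0" using le0 integral_nonneg_AE[OF nn] by linarith
  hence "AE t in lborel. indicator {0..T} t * (1 - f t) = 0"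
   using i1 nn by (subst (asm) integral_nonneg_eq_0_iff_AE) (auto simp: set_integrable_def)
  thus ?thesis by eventually_elim (auto simp: indicator_def)
 qed
 define s where "s = (%n. len - len / real (n + 2))"
 have s: "0 < s n" "s n < len" for n using len_pos by (auto simp: s_def divide_less_eq)
 have "AE t in lborel. ALL n. t : {0..s n} --> f t = 1" unfolding AE_all_countable using full[OF s] by blast
 thus ?thesis
 proof eventually_elim
  case (elim t)
  show ?case
  proof
   assume t: "0 < t & t < len"
   obtain n :: nat where n: "len / (len - t) < real n" using reals_Archimedean2 by blast
   have "len < real n * (len - t)" using n t by (simp add: pos_divide_less_eq)
   also have "... <= real (n + 2) * (len - t)" using t by (intro mult_right_mono) auto
   finally have "len / real (n + 2) < len - t" by (simp add: pos_divide_less_eq mult.commute)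
   hence "t : {0..s n}" using t by (simp add: s_def)
   thus "norm (tangent t) = 1" using elim unfolding f_def by blast
  qed
 qed
qed

end

section \<open>Hausdorff measure on the side of the cylinder\<close>

lemma set_integral_pushforward:
 fixes g :: "'b => real"
 assumes f: "f : measurable M N" and A: "A : sets M" and B: "B : sets N" and g: "g : borel_measurable N"
  and eq: "!!E. E : sets N ==> emeasure M (A Int f -` E) = emeasure N (E Int B)"
 shows "(LINT z:B|N. g z) = (LINT p:A|M. g (f p))"
proof -
 have "density N (indicator B) = distr (density M (indicator A)) N f"
 proof (rule measure_eqI)
  fix E assume "E : sets (density N (indicator B))"
  hence E: "E : sets N" by simp
  have fE: "f -` E Int space M : sets M" using f E by (rule measurable_sets)
  have "A Int (f -` E Int space M) = A Int f -` E" using sets.sets_into_space[OF A] by auto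
  hence "emeasure (distr (density M (indicator A)) N f) E = emeasure M (A Int f -` E)"
   using f A E fE by (simp add: emeasure_distr emeasure_restricted)
  moreover have "emeasure (density N (indicator B)) E = emeasure N (E Int B)"
   using B E by (simp add: emeasure_restricted Int_commute)
  ultimately show "emeasure (density N (indicator B)) E = emeasure (distr (density M (indicator A)) N f) E"
   using eq[OF E] by simp
 qed simp
 hence "(LINT z|density N (%z. ennreal (indicator B z)). g z) = (LINT z|distr (density M (%z. ennreal (indicator A z))) N f. g z)"
  by (simp add: ennreal_indicator)
 thus ?thesis
  using f g A B by (simp add: integral_distr integral_real_density sli_def)
qed

lemma hausdorff_lipschitz_image_le:
 fixes f :: "real \<times> real => 'b::euclidean_space"
 assumes "S : sets borel" "!!x y. x : S ==> y : S ==> dist (f x) (f y) <= dist x y"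
 shows "hausdorff_outer 2 (f ` S) <= emeasure lborel S"
 using hausdorff_outer_image_le[of S f 2] assms by (simp add: hausdorff_outer_2_eq_lborel)

context convex_curve begin

definition side_map :: "real \<times> real => plane \<times> real" where "side_map p = (gam (fst p), snd p)"

lemma side_map_dist: "dist (side_map p) (side_map q) <= dist p q"
 unfolding side_map_def dist_prod_def fst_conv snd_conv
 using gam_lip[of "fst p" "fst q"] by (intro real_sqrt_le_mono add_mono power_mono) (auto simp: dist_real_def)

lemma side_map_cont: "continuous_on UNIV side_map"
 unfolding side_map_def by (intro continuous_intros continuous_on_compose2[OF gam_cont]) auto

lemma side_map_borel [measurable]: "side_map : borel_fun"
 by (rule borel_contI[OF side_map_cont])

lemma side_eq_image: "frontier Om \<times> {0..M} = side_map ` ({0..<len} \<times> {0..M})"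
proof
 show "frontier Om \<times> {0..M} \<subseteq> side_map ` ({0..<len} \<times> {0..M})"
 proof clarify
  fix p and s :: real assume p: "p : frontier Om" "s : {0..M}"
  obtain t where "0 <= t" "t < len" "p = \<gamma> t" using \<gamma>_surj[OF p(1)] by blast
  thus "(p, s) : side_map ` ({0..<len} \<times> {0..M})"
   using p by (intro image_eqI[of _ _ "(t, s)"]) (auto simp: side_map_def gam_eq)
 qed
qed (auto simp: side_map_def gam_mem)

lemma rect_borel: "{0..<len} \<times> {0..M} \<in> sets (borel :: (real \<times> real) measure)"
 by (rule borel_Times) auto

lemma emeasure_rect: "0 <= a ==> 0 <= M ==> emeasure lborel ({0..<a} \<times> {0..M}) = ennreal (a * M)"
proof -
 assume "0 <= a" "0 <= M"
 have "emeasure (lborel \<Otimes>\<^sub>M lborel) ({0..<a} \<times> {0..M}) = emeasure lborel {0..<a} * emeasure lborel {0..M}"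
  by (rule lborel.emeasure_pair_measure_Times) auto
 thus ?thesis using \<open>0 <= a\<close> \<open>0 <= M\<close> by (simp add: lborel_prod ennreal_mult)
qed

lemma arc_borel:
 assumes "0 <= a" "a <= b" "b < len"
 shows "\<gamma> ` {a..<b} \<times> {0..M} \<in> sets (borel :: (plane \<times> real) measure)"
proof -
 have "\<gamma> ` {a..<b} = \<gamma> ` {a..b} - {\<gamma> b}"
  using \<gamma>_inj[of _ b] assms by (auto simp: less_le)
 moreover have "compact (\<gamma> ` {a..b})"
  using assms by (intro compact_continuous_image continuous_on_subset[OF \<gamma>_cont]) auto
 ultimately have "\<gamma> ` {a..<b} \<in> sets borel"
  using sets.Diff[OF borel_compact[of "\<gamma> ` {a..b}"] borel_singleton[of "{}" "\<gamma> b"]] by simp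
 thus ?thesis by (intro borel_Times) auto
qed

text \<open>Projection to the line through the end points is 1-Lipschitz and, by the intermediate
  value theorem, covers the chord; so this piece of the side has at least the measure of a flat
  rectangle.\<close>

lemma hausdorff_arc_ge:
 assumes ab: "0 <= a" "a <= b" "b < len" and M: "0 <= M"
 shows "ennreal (M * dist (\<gamma> a) (\<gamma> b)) <= hausdorff_outer 2 (\<gamma> ` {a..<b} \<times> {0..M})"
proof (cases "\<gamma> a = \<gamma> b")
 case False
 define D where "D = norm (\<gamma> b - \<gamma> a)"
 have D: "0 < D" using False by (simp add: D_def)
 define e where "e = (\<gamma> b - \<gamma> a) /\<^sub>R D"
 have e1: "norm e = 1" using D by (simp add: e_def D_def)
 define P where "P = (%z::plane \<times> real. ((fst z - \<gamma> a) @. e, snd z))"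
 have Pl: "dist (P z) (P w) <= dist z w" for z w
 proof -
  have "\<bar>(fst z - \<gamma> a) @. e - (fst w - \<gamma> a) @. e\<bar> <= dist (fst z) (fst w)"
   using Cauchy_Schwarz_ineq2[of "fst z - fst w" e] e1 by (simp add: dist_norm inner_diff_left)
  thus ?thesis unfolding P_def dist_prod_def fst_conv snd_conv dist_real_def[of "_ @. _"]
   by (intro real_sqrt_le_mono add_mono power_mono) auto
 qed
 have "{0..<D} \<times> {0..M} \<subseteq> P ` (\<gamma> ` {a..<b} \<times> {0..M})"
 proof clarify
  fix y s :: real assume y: "y : {0..<D}" and s: "s : {0..M}"
  have fb: "(\<gamma> b - \<gamma> a) @. e = D" using D by (simp add: e_def D_def power2_norm_eq_inner[symmetric] power2_eq_square)
  have "continuous_on {a..b} (%t. (\<gamma> t - \<gamma> a) @. e)"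
   using ab by (intro continuous_intros continuous_on_subset[OF \<gamma>_cont]) auto
  hence "EX t>=a. t <= b & (\<gamma> t - \<gamma> a) @. e = y"
   using y fb ab by (intro IVT') auto
  then obtain t where t: "a <= t" "t <= b" "(\<gamma> t - \<gamma> a) @. e = y" by blast
  hence "t ~= b" using fb y by auto
  thus "(y, s) : P ` (\<gamma> ` {a..<b} \<times> {0..M})"
   using t s by (intro image_eqI[of _ _ "(\<gamma> t, s)"]) (auto simp: P_def)
 qed
 hence "hausdorff_outer 2 ({0..<D} \<times> {0..M}) \<le> hausdorff_outer 2 (P ` (\<gamma> ` {a..<b} \<times> {0..M}))"
  by (rule hausdorff_outer_mono)
 also have "... <= hausdorff_outer 2 (\<gamma> ` {a..<b} \<times> {0..M})" by (rule hausdorff_outer_image_le[OF Pl])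
 also have "hausdorff_outer 2 ({0..<D} \<times> {0..M}) = ennreal (D * M)"
  using D M by (subst hausdorff_outer_2_eq_lborel) (auto simp: emeasure_rect borel_Times)
 finally show ?thesis by (simp add: D_def dist_norm norm_minus_commute mult.commute)
qed simp

lemma hausdorff_side_le:
 assumes E: "E : sets borel"
 shows "hausdorff_outer 2 (E Int frontier Om \<times> {0..M}) \<le> emeasure lborel (({0..<len} \<times> {0..M}) Int side_map -` E)"
proof -
 have "E Int frontier Om \<times> {0..M} = side_map ` (({0..<len} \<times> {0..M}) Int side_map -` E)"
  unfolding side_eq_image by auto
 moreover have "({0..<len} \<times> {0..M}) Int side_map -` E : sets borel"
  using measurable_sets_borel[OF side_map_borel E] rect_borel by simp
 ultimately show ?thesis using hausdorff_lipschitz_image_le side_map_dist by metis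
qed

text \<open>Summing the chord bound over a partition gives \<open>M\<close> times the length of an
  inscribed polygon. The supremum over polygons on \<open>[0, T]\<close> is \<open>T\<close>, and
  \<open>T\<close> tends to \<open>len\<close>.\<close>

lemma hausdorff_side_ge:
 assumes M: "0 < M"
 shows "ennreal (len * M) <= hausdorff_outer 2 (frontier Om \<times> {0..M})"
proof -
 define h where "h = hausdorff_outer 2 (frontier Om \<times> {0..M})"
 have "h <= emeasure lborel ({0..<len} \<times> {0..M})"
  using hausdorff_side_le[of UNIV M] by (simp add: h_def)
 hence "h <= ennreal (len * M)" using len_pos M by (simp add: emeasure_rect)
 hence hr: "h = ennreal (enn2real h)" by (metis ennreal_enn2real_if ennreal_less_top infinity_ennreal_def leD)
 define H where "H = (hausdorff_measure 2 :: (plane \<times> real) measure)"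
 have T: "M * T <= enn2real h" if T: "0 < T" "T < len" for T
 proof -
  have "(\<Sum>i<length ts - 1. dist (\<gamma> (ts ! i)) (\<gamma> (ts ! Suc i))) <= enn2real h / M"
   if ts: "sorted ts" "set ts \<subseteq> {0..T}" for ts
  proof (cases "ts = []")
   case False
   have el: "0 <= ts ! i" "ts ! i <= T" if "i < length ts" for i
    using subsetD[OF ts(2) nth_mem[OF that]] by auto
   have step: "k < length ts ==> ennreal (M * (\<Sum>i<k. dist (\<gamma> (ts ! i)) (\<gamma> (ts ! Suc i)))) <= emeasure H (\<gamma> ` {ts ! 0..<ts ! k} \<times> {0..M})" for k
   proof (induction k)
    case (Suc k)
    have s: "ts ! 0 <= ts ! k" "ts ! k <= ts ! Suc k" using ts(1) Suc.prems by (auto simp: sorted_iff_nth_mono)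
    have b: "0 <= ts ! 0" "0 <= ts ! k" "ts ! k < len" "ts ! Suc k < len"
     using el[of 0] el[of k] el[of "Suc k"] Suc.prems T False by auto
    have "\<gamma> ` {ts ! 0..<ts ! k} Int \<gamma> ` {ts ! k..<ts ! Suc k} = {}"
     using inj_on_image_Int[of \<gamma> "{0..<len}" "{ts ! 0..<ts ! k}" "{ts ! k..<ts ! Suc k}"] bij_\<gamma> b
     by (auto simp: bij_betw_def)
    hence disj: "(\<gamma> ` {ts ! 0..<ts ! k} \<times> {0..M}) Int (\<gamma> ` {ts ! k..<ts ! Suc k} \<times> {0..M}) = {}" by auto
    have un: "\<gamma> ` {ts ! 0..<ts ! Suc k} \<times> {0..M} = (\<gamma> ` {ts ! 0..<ts ! k} \<times> {0..M}) Un (\<gamma> ` {ts ! k..<ts ! Suc k} \<times> {0..M})"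
    proof -
     have "{ts ! 0..<ts ! Suc k} = {ts ! 0..<ts ! k} Un {ts ! k..<ts ! Suc k}" using s by auto
     thus ?thesis by (simp only: image_Un Sigma_Un_distrib1)
    qed
    have "emeasure H (\<gamma> ` {ts ! 0..<ts ! Suc k} \<times> {0..M}) =
      emeasure H (\<gamma> ` {ts ! 0..<ts ! k} \<times> {0..M}) + emeasure H (\<gamma> ` {ts ! k..<ts ! Suc k} \<times> {0..M})"
     unfolding un using b s disj arc_borel by (intro plus_emeasure[symmetric]) (auto simp: H_def)
    moreover have "ennreal (M * dist (\<gamma> (ts ! k)) (\<gamma> (ts ! Suc k))) <= emeasure H (\<gamma> ` {ts ! k..<ts ! Suc k} \<times> {0..M})"
     using hausdorff_arc_ge[OF b(2) s(2) b(4), of M] arc_borel[OF b(2) s(2) b(4)] M by (simp add: H_def emeasure_hausdorff)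
    moreover have "ennreal (M * (\<Sum>i<Suc k. dist (\<gamma> (ts ! i)) (\<gamma> (ts ! Suc i)))) =
      ennreal (M * (\<Sum>i<k. dist (\<gamma> (ts ! i)) (\<gamma> (ts ! Suc i)))) + ennreal (M * dist (\<gamma> (ts ! k)) (\<gamma> (ts ! Suc k)))"
     using M by (simp add: distrib_left ennreal_plus sum_nonneg)
    ultimately show ?case using Suc by (simp add: add_mono)
   qed simp
   have k: "length ts - 1 < length ts" using False by simp
   have b: "0 <= ts ! 0" "ts ! 0 <= ts ! (length ts - 1)" "ts ! (length ts - 1) < len"
    using el[of 0] el[OF k] ts(1) False T by (auto simp: sorted_iff_nth_mono)
   note step[OF k]
   also have "emeasure H (\<gamma> ` {ts ! 0..<ts ! (length ts - 1)} \<times> {0..M}) \<le> h"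
    unfolding h_def H_def emeasure_hausdorff[OF arc_borel[OF b]]
    using \<gamma>_mem b by (intro hausdorff_outer_mono) auto
   finally have "M * (\<Sum>i<length ts - 1. dist (\<gamma> (ts ! i)) (\<gamma> (ts ! Suc i))) <= enn2real h"
    by (subst (asm) hr) (simp add: ennreal_le_iff)
   thus ?thesis using M by (simp add: pos_le_divide_eq mult.commute)
  qed (use M in simp)
  hence "curve_length \<gamma> 0 T <= ennreal (enn2real h / M)"
   unfolding curve_length_def by (intro SUP_least ennreal_leI) auto
  hence "T <= enn2real h / M" using T length_\<gamma>[of 0 T] M by (simp add: ennreal_le_iff)
  thus ?thesis using M by (simp add: pos_le_divide_eq mult.commute)
 qed
 have "len * M <= enn2real h"
 proof (rule ccontr)
  assume "\<not> len * M <= enn2real h"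
  hence lt: "enn2real h / M < len" using M by (simp add: pos_divide_less_eq)
  define q where "q = enn2real h / M"
  define T where "T = (q + len) / 2"
  have "0 <= q" using M by (simp add: q_def)
  hence "0 < T" "T < len" "enn2real h / M < T" using lt len_pos unfolding q_def[symmetric] by (auto simp: T_def)
  thus False using T[of T] M by (simp add: pos_divide_less_eq mult.commute)
 qed
 hence "ennreal (len * M) <= ennreal (enn2real h)" by (rule ennreal_leI)
 also have "... = h" by (rule hr[symmetric])
 finally show ?thesis by (simp add: h_def)
qed

text \<open>\<open>side_map\<close> is 1-Lipschitz, so the surface measure is at most the parameter
  measure, for \<open>E\<close> and for its complement alike. The total parameter measure is finite
  and not larger than the total surface measure, so neither inequality can be strict.\<close>

lemma hausdorff_side_eq:
 assumes M: "0 < M" and E: "E : sets borel"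
 shows "emeasure lborel (({0..<len} \<times> {0..M}) Int side_map -` E) = emeasure (hausdorff_measure 2) (E Int frontier Om \<times> {0..M})"
proof -
 define R where "R = {0..<len} \<times> {0..M}"
 define S where "S = frontier Om \<times> {0..M}"
 have Sb: "S : sets borel" unfolding S_def by (intro borel_Times borel_closed) (auto simp: frontier_closed)
 have Rb: "R : sets borel" unfolding R_def by (rule rect_borel)
 have pb: "side_map -` X : sets borel" if "X : sets borel" for X using measurable_sets_borel[OF side_map_borel that] by simp
 let ?H = "hausdorff_measure 2 :: (plane \<times> real) measure"
 have le: "emeasure ?H (X Int S) <= emeasure lborel (R Int side_map -` X)" if "X : sets borel" for X
  using hausdorff_side_le[OF that, of M] that Sb by (simp add: emeasure_hausdorff R_def S_def)
 define x y a b where "x = emeasure ?H (E Int S)" and "y = emeasure ?H (- E Int S)"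
  and "a = emeasure lborel (R Int side_map -` E)" and "b = emeasure lborel (R Int side_map -` (- E))"
 have "a + b = emeasure lborel ((R Int side_map -` E) Un (R Int side_map -` (- E)))"
  unfolding a_def b_def using Rb E pb by (intro plus_emeasure) auto
 also have "(R Int side_map -` E) Un (R Int side_map -` (- E)) = R" by auto
 also have "emeasure lborel R = ennreal (len * M)" unfolding R_def using len_pos M by (simp add: emeasure_rect)
 finally have ab: "a + b = ennreal (len * M)" .
 have "ennreal (len * M) <= emeasure ?H S" using hausdorff_side_ge[OF M] Sb by (simp add: emeasure_hausdorff S_def)
 also have "S = (E Int S) Un (- E Int S)" by auto
 also have "emeasure ?H ... = x + y" unfolding x_def y_def using E Sb by (intro plus_emeasure[symmetric]) auto
 finally have xy: "a + b <= x + y" using ab by simp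
 have "x <= a" "y <= b" using le E by (auto simp: x_def y_def a_def b_def)
 moreover have "b ~= top"
 proof
  assume "b = top" with ab show False by simp
 qed
 ultimately have "a <= x"
  using xy by (metis add_left_mono add.commute ennreal_add_left_cancel_le infinity_ennreal_def order_trans)
 thus ?thesis using \<open>x <= a\<close> by (simp add: x_def a_def R_def S_def)
qed

lemma side_integral:
 assumes "0 < M" "g : borel_fun"
 shows "(LINT z:frontier Om \<times> {0..M}|hausdorff_measure 2. g z) = (LINT p:{0..<len} \<times> {0..M}|lborel. (g (side_map p) :: real))"
proof (rule set_integral_pushforward)
 show "frontier Om \<times> {0..M} \<in> sets (hausdorff_measure 2)"
  by (simp, intro borel_Times borel_closed) (auto simp: frontier_closed)
 show "g : borel_measurable (hausdorff_measure 2)" using assms(2) by simp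
 show "side_map : lborel \<rightarrow>\<^sub>M hausdorff_measure 2" by simp
 show "{0..<len} \<times> {0..M} \<in> sets lborel" using rect_borel by simp
 show "emeasure lborel (({0..<len} \<times> {0..M}) Int side_map -` E) = emeasure (hausdorff_measure 2) (E Int frontier Om \<times> {0..M})"
  if "E : sets (hausdorff_measure 2)" for E using hausdorff_side_eq[OF assms(1)] that by simp
qed

end

section \<open>Horizontal slices, outward normals and the boundary integral\<close>

definition plane_of :: "real \<times> real => plane" where "plane_of p = vector [fst p, snd p]"

lemma plane_of_nth [simp]: "plane_of p $ 1 = fst p" "plane_of p $ 2 = snd p"
 by (simp_all add: plane_of_def)

lemma plane_of_dist: "dist (plane_of p) (plane_of q) = dist p q"
 by (simp add: dist_vec_def L2_set_def sum_2 dist_prod_def)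

lemma plane_of_surj: "plane_of (x $ 1, x $ 2) = x"
 by (simp add: vec_eq_iff forall_2)

lemma plane_of_borel [measurable]: "plane_of : borel_fun"
proof (rule borel_contI)
 show "continuous_on UNIV plane_of" unfolding continuous_on_iff by (auto simp: plane_of_dist)
qed

lemma plane_cases_Basis: "(Basis :: plane set) = {axis 1 1, axis 2 1}"
 by (auto simp: Basis_vec_def UNIV_2)

lemma axis_1_ne_2: "(axis 1 1 :: plane) ~= axis 2 1"
 by (simp add: axis_eq_axis)

lemma distr_plane_of: "distr lborel borel plane_of = lborel"
proof (rule lborel_eqI[symmetric])
 fix l u :: plane assume lu: "!!b. b : Basis ==> l @. b <= u @. b"
 have "plane_of -` box l u = box (l $ 1, l $ 2) (u $ 1, u $ 2)"
  by (auto simp: box_def plane_cases_Basis Basis_prod_def inner_axis)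
 hence "emeasure (distr lborel borel plane_of) (box l u) = emeasure lborel (box (l $ 1, l $ 2) (u $ 1, u $ 2))"
  by (simp add: emeasure_distr)
 also have "... = (\<Prod>b\<in>Basis. (u - l) @. b)"
  using lu[of "axis 1 1"] lu[of "axis 2 1"] axis_1_ne_2
  by (subst emeasure_lborel_box) (auto simp: plane_cases_Basis Basis_prod_def inner_axis)
 finally show "emeasure (distr lborel borel plane_of) (box l u) = (\<Prod>b\<in>Basis. (u - l) @. b)" .
qed simp

text \<open>\<open>plane_of\<close> is an isometry from \<open>real \<times> real\<close>, where
  \<open>hausdorff_outer 2\<close> is known to be Lebesgue measure; composed with the embedding at
  height \<open>c\<close> it transports that result to horizontal slices.\<close>

lemma slice_integral:
 fixes g :: "plane \<times> real => real" and A :: "plane set"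
 assumes A: "A : sets borel" and g: "g : borel_fun"
 shows "(LINT z:A \<times> {c}|hausdorff_measure 2. g z) = (LINT x:A|lborel. g (x, c))"
proof (rule set_integral_pushforward)
 show "A \<times> {c} \<in> sets (hausdorff_measure 2)" using A by (simp add: borel_Times)
 show "g : borel_measurable (hausdorff_measure 2)" using g by simp
 show m: "(%x. (x, c)) : lborel \<rightarrow>\<^sub>M (hausdorff_measure 2 :: (plane \<times> real) measure)"
  by (subst measurable_cong_sets[OF sets_lborel sets_hausdorff]) (intro borel_contI continuous_intros)
 show "A : sets lborel" using A by simp
 show "emeasure lborel (A Int (%x. (x, c)) -` E) = emeasure (hausdorff_measure 2) (E Int A \<times> {c})"
  if E: "E : sets (hausdorff_measure 2)" for E
 proof -
  define X where "X = A Int (%x. (x, c)) -` E"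
  have X: "X : sets borel" using measurable_sets[OF m E] A by (simp add: X_def)
  define Y where "Y = plane_of -` X"
  have Y: "Y : sets borel" unfolding Y_def using measurable_sets_borel[OF plane_of_borel X] by simp
  have "emeasure lborel X = emeasure lborel Y"
   unfolding Y_def using X by (subst distr_plane_of[symmetric]) (simp add: emeasure_distr)
  also have "... = hausdorff_outer 2 Y" using Y by (simp add: hausdorff_outer_2_eq_lborel)
  also have "... = hausdorff_outer 2 (E Int A \<times> {c})"
  proof (rule antisym)
   have 1: "E Int A \<times> {c} = (%p. (plane_of p, c)) ` Y"
   proof
    show "E Int A \<times> {c} \<subseteq> (%p. (plane_of p, c)) ` Y"
    proof clarify
     fix x assume "(x, c) : E" "x : A"
     thus "(x, c) : (%p. (plane_of p, c)) ` Y"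
      by (intro image_eqI[of _ _ "(x $ 1, x $ 2)"]) (auto simp: plane_of_surj Y_def X_def)
    qed
   qed (auto simp: Y_def X_def)
   have 2: "Y = (%z. (fst z $ 1, fst z $ 2)) ` (E Int A \<times> {c})"
    unfolding 1 image_image by simp
   show "hausdorff_outer 2 (E Int A \<times> {c}) \<le> hausdorff_outer 2 Y"
    unfolding 1 by (rule hausdorff_outer_image_le) (simp add: dist_prod_def[of "(plane_of _, _)"] plane_of_dist)
   have "dist (fst z $ 1, fst z $ 2) (fst w $ 1, fst w $ 2) <= dist z w" for z w :: "plane \<times> real"
   proof -
    have "dist (fst z $ 1, fst z $ 2) (fst w $ 1, fst w $ 2) = dist (fst z) (fst w)"
     using plane_of_dist[of "(fst z $ 1, fst z $ 2)" "(fst w $ 1, fst w $ 2)"] by (simp add: plane_of_surj)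
    thus ?thesis by (simp add: dist_fst_le)
   qed
   thus "hausdorff_outer 2 Y <= hausdorff_outer 2 (E Int A \<times> {c})"
    by (subst 2) (rule hausdorff_outer_image_le)
  qed
  also have "... = emeasure (hausdorff_measure 2) (E Int A \<times> {c})"
   using E A by (intro emeasure_hausdorff[symmetric] sets.Int borel_Times) auto
  finally show ?thesis by (simp add: X_def)
 qed
qed

lemma outward_normal_eqI:
 assumes "norm \<nu> = 1" "!!y. y : S ==> (y - p) @. \<nu> <= 0"
  and "!!\<nu>'. norm \<nu>' = 1 ==> (!!y. y : S ==> (y - p) @. \<nu>' <= 0) ==> \<nu>' = \<nu>"
 shows "outward_normal S p = \<nu>"
proof -
 have ex1: "EX! \<nu>. norm \<nu> = 1 & (ALL y:S. (y - p) @. \<nu> <= 0)"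
  by (rule ex1I[of _ \<nu>]) (use assms in blast)+
 hence "(THE \<nu>. norm \<nu> = 1 & (ALL y:S. (y - p) @. \<nu> <= 0)) = \<nu>"
  by (rule the1_equality) (use assms in blast)
 thus ?thesis using ex1 by (simp add: outward_normal_def)
qed

lemma null_sets_lborel_Times:
 assumes "N : null_sets (lborel :: 'a::euclidean_space measure)"
 shows "N \<times> UNIV : null_sets (lborel :: ('a \<times> 'b::euclidean_space) measure)" "UNIV \<times> N : null_sets (lborel :: ('b \<times> 'a) measure)"
 using assms lborel.emeasure_pair_measure_Times[of N lborel "UNIV :: 'b set"] lborel.emeasure_pair_measure_Times[of "UNIV :: 'b set" lborel N]
  borel_Times[of N "UNIV :: 'b set"] borel_Times[of "UNIV :: 'b set" N] by (auto simp: lborel_prod null_sets_def)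

lemma AE_lborel_fst:
 assumes "AE x in (lborel :: 'a::euclidean_space measure). P x"
 shows "AE p in (lborel :: ('a \<times> 'b::euclidean_space) measure). P (fst p)"
proof -
 obtain N where "{x. \<not> P x} \<subseteq> N" "N : null_sets lborel" using assms by (auto simp: eventually_ae_filter)
 thus ?thesis by (intro AE_I'[OF null_sets_lborel_Times(1)]) auto
qed

lemma AE_lborel_snd:
 assumes "AE x in (lborel :: 'b::euclidean_space measure). P x"
 shows "AE p in (lborel :: ('a::euclidean_space \<times> 'b) measure). P (snd p)"
proof -
 obtain N where "{x. \<not> P x} \<subseteq> N" "N : null_sets lborel" using assms by (auto simp: eventually_ae_filter)
 thus ?thesis by (intro AE_I'[OF null_sets_lborel_Times(2)]) auto
qed

lemma norm_outward_normal_le: "norm (outward_normal S p) <= 1"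
proof (cases "EX! \<nu>. norm \<nu> = 1 & (ALL y:S. (y - p) @. \<nu> <= 0)")
 case True
 from theI'[OF this] show ?thesis using True by (simp add: outward_normal_def)
qed (simp add: outward_normal_def)

text \<open>The relation "\<open>\<nu>\<close> is a unit normal at \<open>p\<close>" is closed and
  the sphere is compact, so the points with a normal in a given closed set form a closed set. The
  points with a unique normal are those with some normal, minus the countable union of the closed
  sets on which two normals are at least \<open>1 / (k + 1)\<close> apart.\<close>

lemma borel_measurable_outward_normal:
 fixes S :: "'a::euclidean_space set"
 shows "outward_normal S : borel_fun"
proof -
 define N where "N = (%p. {\<nu>. norm \<nu> = 1 & (ALL y:S. (y - p) @. \<nu> <= 0)})"
 have clN: "closed {(\<nu>, p). \<nu> : N p}"
 proof -
  have "{(\<nu>, p). \<nu> : N p} = {z. norm (fst z) = 1} Int (\<Inter>y\<in>S. {z. (y - snd z) @. fst z <= 0})"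
   by (auto simp: N_def)
  also have "closed ..."
   by (intro closed_Int closed_INT ballI closed_Collect_eq closed_Collect_le continuous_intros)
  finally show ?thesis .
 qed
 have hit: "closed {p. EX \<nu>:N p. \<nu> : C}" if C: "closed C" for C
 proof -
  have "closed {p. EX \<nu>. \<nu> : sphere 0 1 Int C & (\<nu>, p) : {(\<nu>, p). \<nu> : N p}}"
   by (rule closed_compact_projection) (use C clN in \<open>auto intro: compact_Int_closed\<close>)
  moreover have "{p. EX \<nu>. \<nu> : sphere 0 1 Int C & (\<nu>, p) : {(\<nu>, p). \<nu> : N p}} = {p. EX \<nu>:N p. \<nu> : C}"
   by (auto simp: N_def)
  ultimately show ?thesis by simp
 qed
 have two: "closed {p. EX \<nu>1:N p. EX \<nu>2:N p. 1 / real (Suc k) <= dist \<nu>1 \<nu>2}" for k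
 proof -
  let ?P = "(sphere 0 1 \<times> sphere 0 1) Int {z. 1 / real (Suc k) <= dist (fst z) (snd z)}"
  let ?T = "{w::('a \<times> 'a) \<times> 'a. (fst (fst w), snd w) : {(\<nu>, p). \<nu> : N p} & (snd (fst w), snd w) : {(\<nu>, p). \<nu> : N p}}"
  have "closed ((%w::('a \<times> 'a) \<times> 'a. (fst (fst w), snd w)) -` {(\<nu>, p). \<nu> : N p} Int (%w. (snd (fst w), snd w)) -` {(\<nu>, p). \<nu> : N p})"
   by (intro closed_Int closed_vimage clN continuous_intros)
  hence T: "closed ?T" by (simp add: vimage_def Collect_conj_eq)
  have "closed {p. EX z. z : ?P & (z, p) : ?T}"
   by (rule closed_compact_projection[OF _ T])
    (intro compact_Int_closed compact_Times compact_sphere closed_Collect_le continuous_intros)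
  moreover have "{p. EX z. z : ?P & (z, p) : ?T} = {p. EX \<nu>1:N p. EX \<nu>2:N p. 1 / real (Suc k) <= dist \<nu>1 \<nu>2}"
   by (auto simp: N_def)
  ultimately show ?thesis by simp
 qed
 define Z where "Z = {p. EX! \<nu>. \<nu> : N p}"
 have Zeq: "Z = {p. EX \<nu>:N p. \<nu> : UNIV} - (\<Union>k. {p. EX \<nu>1:N p. EX \<nu>2:N p. 1 / real (Suc k) <= dist \<nu>1 \<nu>2})"
 proof -
  have "(EX k. EX \<nu>1:N p. EX \<nu>2:N p. 1 / real (Suc k) <= dist \<nu>1 \<nu>2) \<longleftrightarrow> (EX \<nu>1:N p. EX \<nu>2:N p. \<nu>1 ~= \<nu>2)" for p
  proof
   assume "EX \<nu>1:N p. EX \<nu>2:N p. \<nu>1 ~= \<nu>2"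
   then obtain \<nu>1 \<nu>2 where n: "\<nu>1 : N p" "\<nu>2 : N p" "0 < dist \<nu>1 \<nu>2" by auto
   obtain k where "1 / real (Suc k) < dist \<nu>1 \<nu>2" using nat_approx_posE[OF n(3)] by blast
   thus "EX k. EX \<nu>1:N p. EX \<nu>2:N p. 1 / real (Suc k) <= dist \<nu>1 \<nu>2" using n by (meson less_imp_le)
  next
   assume "EX k. EX \<nu>1:N p. EX \<nu>2:N p. 1 / real (Suc k) <= dist \<nu>1 \<nu>2"
   then obtain k \<nu>1 \<nu>2 where n: "\<nu>1 : N p" "\<nu>2 : N p" "1 / real (Suc k) <= dist \<nu>1 \<nu>2" by blast
   have "0 < 1 / real (Suc k)" by simp
   hence "\<nu>1 ~= \<nu>2" using n(3) by auto
   thus "EX \<nu>1:N p. EX \<nu>2:N p. \<nu>1 ~= \<nu>2" using n by blast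
  qed
  thus ?thesis by (auto simp: Z_def)
 qed
 have Z1: "{p. EX \<nu>:N p. \<nu> : UNIV} : sets borel" by (rule borel_closed[OF hit]) simp
 have Z2: "(\<Union>k. {p. EX \<nu>1:N p. EX \<nu>2:N p. 1 / real (Suc k) <= dist \<nu>1 \<nu>2}) : sets borel"
  by (rule sets.countable_UN, rule image_subsetI, rule borel_closed, rule two)
 have Z: "Z : sets borel" unfolding Zeq by (rule sets.Diff[OF Z1 Z2])
 have on: "outward_normal S p = (if p : Z then THE \<nu>. \<nu> : N p else 0)" for p
  by (simp add: outward_normal_def Z_def N_def)
 have pre: "outward_normal S -` C : sets borel" if C: "closed C" for C
 proof -
  have the: "(THE \<nu>. \<nu> : N p) : C \<longleftrightarrow> (EX \<nu>:N p. \<nu> : C)" if pZ: "p : Z" for p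
  proof -
   obtain \<nu> where n: "\<nu> : N p" "!!\<nu>'. \<nu>' : N p ==> \<nu>' = \<nu>" using pZ unfolding Z_def by blast
   have "(THE \<nu>. \<nu> : N p) = \<nu>" using n by (rule the_equality)
   thus ?thesis using n(1) by (metis n(2))
  qed
  have "outward_normal S -` C = (Z Int {p. EX \<nu>:N p. \<nu> : C}) Un (if 0 : C then - Z else {})"
   using the by (auto simp: on split: if_splits)
  also have "... : sets borel" using Z hit[OF C] by (auto intro!: sets.Un sets.Int borel_closed)
  finally show ?thesis .
 qed
 have "outward_normal S : measurable borel (sigma UNIV {S :: 'a set. closed S})"
  by (rule measurable_measure_of) (use pre in auto)
 thus ?thesis by (simp add: borel_eq_closed)
qed

lemma inner_plane: "(x::plane) @. y = x $ 1 * y $ 1 + x $ 2 * y $ 2"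
 by (simp add: inner_vec_def sum_2)

context convex_curve begin

text \<open>The tangent turned clockwise by a right angle, which points outward along a
  counterclockwise curve.\<close>

definition nrm :: "real => plane" where "nrm t = plane_of (tangent t $ 2, - tangent t $ 1)"

lemma nrm_borel [measurable]: "nrm : borel_fun"
 unfolding nrm_def by measurable

lemma outward_normal_bottom:
 fixes M :: real
 assumes x: "x : Om" and M: "0 < M"
 shows "outward_normal (Om \<times> {0<..<M}) (x, 0) = (0, - 1)"
proof (rule outward_normal_eqI)
 fix \<nu> :: "plane \<times> real" assume n: "norm \<nu> = 1" and le: "!!y. y : Om \<times> {0<..<M} ==> (y - (x, 0)) @. \<nu> <= 0"
 obtain a b where ab: "\<nu> = (a, b)" by fastforce
 have le': "(y - x) @. a + s * b <= 0" if "y : Om" "0 < s" "s < M" for y s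
  using le[of "(y, s)"] that by (simp add: ab inner_prod_def)
 have b: "b <= 0" using le'[OF x, of "M/2"] M by (simp add: mult_le_0_iff)
 have le0: "(y - x) @. a <= 0" if y: "y : Om" for y
 proof (rule tendsto_upperbound[of "%s. (y - x) @. a + s * b" _ "at_right 0"])
  have "((%s. (y - x) @. a + s * b) \<longlongrightarrow> (y - x) @. a + 0 * b) (at_right 0)" by (intro tendsto_intros)
  thus "((%s. (y - x) @. a + s * b) \<longlongrightarrow> (y - x) @. a) (at_right 0)" by simp
  show "\<forall>\<^sub>F s in at_right 0. (y - x) @. a + s * b <= 0"
   using eventually_at_right_real[OF M] by eventually_elim (use le' y in auto)
 qed simp
 have "a = 0"
 proof (rule ccontr)
  assume a: "a ~= 0"
  obtain e where e: "0 < e" "ball x e \<subseteq> Om" using open_Om x open_contains_ball by blast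
  define y where "y = x + (e / 2 / norm a) *. a"
  have "y : Om" using e a by (intro subsetD[OF e(2)]) (simp add: y_def dist_norm)
  from le0[OF this] have "e / 2 / norm a * (a @. a) <= 0" by (simp add: y_def)
  moreover have "0 < e / 2 / norm a * (a @. a)" using e a by (intro mult_pos_pos divide_pos_pos) auto
  ultimately show False by linarith
 qed
 thus "\<nu> = (0, - 1)" using n b by (auto simp: ab norm_prod_def)
qed (auto simp: inner_prod_def norm_prod_def)

text \<open>A unit normal is horizontal because \<open>s\<close> can move both ways, and orthogonal
  to \<open>d\<close> because its horizontal part is maximised along the curve at \<open>t\<close>.
  The remaining sign is decided by a point of the domain, which lies to the left of the
  tangent.\<close>

lemma outward_normal_side:
 fixes s M :: real
 assumes t: "0 < t" "t < len" and s: "0 < s" "s < M" and d: "(gam has_vector_derivative d) (at t)" "norm d = 1"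
 shows "outward_normal (Om \<times> {0<..<M}) (gam t, s) = (plane_of (d $ 2, - d $ 1), 0)"
proof (rule outward_normal_eqI)
 define r where "r = plane_of (d $ 2, - d $ 1)"
 have d2: "(d $ 1)\<^sup>2 + (d $ 2)\<^sup>2 = 1" using d(2) by (simp add: norm_eq_1 inner_plane power2_eq_square)
 have neg: "(y - gam t) @. r < 0" if "y : Om" for y
  using tangent_ccw[OF t d(1) that] by (simp add: r_def inner_plane algebra_simps)
 have nr: "norm r = 1" using d2 by (simp add: r_def norm_eq_1 inner_plane power2_eq_square)
 thus "norm (plane_of (d $ 2, - d $ 1), 0::real) = 1" by (simp add: r_def norm_prod_def)
 show "(y - (gam t, s)) @. (plane_of (d $ 2, - d $ 1), 0) <= 0" if "y : Om \<times> {0<..<M}" for y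
  using neg[of "fst y"] that by (auto simp: inner_prod_def r_def less_imp_le)
 fix \<nu> :: "plane \<times> real" assume n: "norm \<nu> = 1" and le: "!!y. y : Om \<times> {0<..<M} ==> (y - (gam t, s)) @. \<nu> <= 0"
 obtain a b where ab: "\<nu> = (a, b)" by fastforce
 have le': "(y - gam t) @. a + (s' - s) * b <= 0" if y: "y : closure Om" and s': "0 < s'" "s' < M" for y s'
 proof (rule continuous_le_on_closure[OF _ y])
  show "continuous_on (closure Om) (%y. (y - gam t) @. a + (s' - s) * b)" by (intro continuous_intros)
  show "(y - gam t) @. a + (s' - s) * b <= 0" if "y : Om" for y
   using le[of "(y, s')"] that s' by (simp add: ab inner_prod_def)
 qed
 have gc: "gam t' : closure Om" for t' using gam_mem[of t'] by (simp add: frontier_def)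
 have b0: "b = 0"
 proof -
  have "(M - s) / 2 * b <= 0" using le'[OF gc[of t], of "(s + M) / 2"] s by (simp add: diff_divide_distrib add_divide_distrib)
  moreover have "- (s / 2) * b <= 0" using le'[OF gc[of t], of "s / 2"] s by simp
  ultimately show ?thesis using s by (auto simp: mult_le_0_iff zero_le_mult_iff)
 qed
 have le0: "(y - gam t) @. a <= 0" if "y : closure Om" for y using le'[OF that s] by simp
 have "((%t'. gam t' @. a) has_real_derivative d @. a) (at t)"
  using d(1) unfolding has_vector_derivative_def has_field_derivative_def
  by (auto intro!: derivative_eq_intros simp: fun_eq_iff mult.commute)
 hence da: "d @. a = 0"
  by (rule DERIV_local_max[of _ _ _ 1]) (use le0[OF gc] in \<open>auto simp: inner_diff_left\<close>)
 define c where "c = a @. r"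
 have ac: "a = c *. r"
 proof -
  have "a $ 1 = (a $ 1) * ((d $ 1)\<^sup>2 + (d $ 2)\<^sup>2)" "a $ 2 = (a $ 2) * ((d $ 1)\<^sup>2 + (d $ 2)\<^sup>2)" using d2 by auto
  moreover have "d $ 1 * a $ 1 + d $ 2 * a $ 2 = 0" using da by (simp add: inner_plane)
  ultimately have "a $ 1 = c * d $ 2" "a $ 2 = c * (- d $ 1)"
   by (auto simp: c_def r_def inner_plane power2_eq_square) algebra+
  thus ?thesis by (simp add: vec_eq_iff forall_2 r_def)
 qed
 have "norm a = 1" using n b0 by (simp add: ab norm_prod_def)
 hence c1: "\<bar>c\<bar> = 1" using nr by (simp add: ac)
 obtain y where y: "y : Om" using ne_Om by blast
 have "c * ((y - gam t) @. r) <= 0" using le0[of y] y closure_subset by (auto simp: ac)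
 hence "c = 1" using neg[OF y] c1 by (auto simp: mult_le_0_iff abs_if split: if_splits)
 thus "\<nu> = (plane_of (d $ 2, - d $ 1), 0)" using ac b0 by (simp add: ab r_def)
qed

text \<open>The inverse of the parameterization made total; the value 0 off the frontier keeps the
  range inside \<open>[0, len)\<close>.\<close>

definition par :: "plane => real" where
 "par x = (if x : frontier Om then the_inv_into {0..<len} \<gamma> x else 0)"

lemma par_gam: "0 <= t ==> t < len ==> par (gam t) = t"
 using the_inv_into_f_f[of \<gamma> "{0..<len}" t] bij_\<gamma> gam_mem[of t]
 by (auto simp: par_def gam_eq bij_betw_def)

lemma par_range: "0 <= par x & par x < len"
 using the_inv_into_into[of \<gamma> "{0..<len}" x "{0..<len}"] bij_\<gamma> len_pos
 by (auto simp: par_def bij_betw_def)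

lemma gam_par: "x : frontier Om ==> gam (par x) = x"
 using \<gamma>_surj[of x] par_gam by (metis gam_eq)

lemma arc_borel': "{x \<in> frontier Om. par x < c} : sets borel"
proof -
 consider "c <= 0" | "0 < c" "c < len" | "len <= c" by linarith
 thus ?thesis
 proof cases
  case 1
  hence "\<not> par x < c" for x using par_range[of x] by linarith
  hence "{x \<in> frontier Om. par x < c} = {}" by blast
  thus ?thesis by (simp only: sets.empty_sets)
 next
  case 2
  have "{x \<in> frontier Om. par x < c} = \<gamma> ` {0..c} - {\<gamma> c}"
  proof
   show "{x \<in> frontier Om. par x < c} \<subseteq> \<gamma> ` {0..c} - {\<gamma> c}"
   proof clarify
    fix x assume x: "x : frontier Om" "par x < c"
    hence "x = \<gamma> (par x)" using gam_par[OF x(1)] par_range[of x] by (simp add: gam_eq)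
    moreover have "x ~= \<gamma> c" using x par_gam[of c] 2 by (auto simp: gam_eq)
    ultimately show "x : \<gamma> ` {0..c} - {\<gamma> c}" using x par_range[of x] by auto
   qed
   show "\<gamma> ` {0..c} - {\<gamma> c} \<subseteq> {x \<in> frontier Om. par x < c}"
   proof clarify
    fix t assume t: "t : {0..c}" "\<gamma> t ~= \<gamma> c"
    hence "t < c" by (auto simp: less_le)
    thus "\<gamma> t : frontier Om & par (\<gamma> t) < c" using t 2 par_gam[of t] \<gamma>_mem[of t] by (simp add: gam_eq)
   qed
  qed
  moreover have "compact (\<gamma> ` {0..c})"
   using 2 by (intro compact_continuous_image continuous_on_subset[OF \<gamma>_cont]) auto
  ultimately show ?thesis
   using sets.Diff[OF borel_compact[of "\<gamma> ` {0..c}"] borel_singleton[of "{}" "\<gamma> c"]] by simp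
 next
  case 3
  hence "{x \<in> frontier Om. par x < c} = frontier Om" using par_range by (auto intro: less_le_trans)
  thus ?thesis by (simp add: borel_closed)
 qed
qed

lemma par_borel [measurable]: "par : borel_fun"
proof (rule borel_measurableI_less)
 fix c
 have "{x. par x < c} = {x \<in> frontier Om. par x < c} Un (if 0 < c then - frontier Om else {})"
  by (auto simp: par_def)
 also have "... : sets borel" using arc_borel' by (auto intro!: sets.Un borel_open)
 finally show "{x \<in> space borel. par x < c} : sets borel" by simp
qed

lemma frontier_cylinder:
 fixes M :: real
 assumes M: "0 < M"
 shows "frontier (Om \<times> {0<..<M}) = frontier Om \<times> {0..M} Un Om \<times> {0} Un Om \<times> {M}"
proof -
 have "frontier (Om \<times> {0<..<M}) = closure Om \<times> {0..M} - Om \<times> {0<..<M}"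
  using M interior_open[OF open_Times[OF open_Om open_greaterThanLessThan[of 0 M]]]
  by (simp add: frontier_def closure_Times)
 also have "closure Om = frontier Om Un Om"
  using closure_subset[of Om] open_Om by (auto simp: frontier_def interior_open)
 moreover have "frontier Om Int Om = {}" using open_Om by (auto simp: frontier_def interior_open)
 ultimately show ?thesis using M by (auto simp: less_le)
qed

text \<open>The boundary integral of the theorem, written with the arclength parameter.\<close>

definition flux :: "real => (plane => real) => (plane \<times> real => plane \<times> real) => real" where
 "flux M u \<phi> = (LINT p:{0..<len} \<times> {0..M}|lborel. of_bool (snd p < u (gam (fst p))) * (fst (\<phi> (side_map p)) @. nrm (fst p)))
   - (LINT x:Om|lborel. snd (\<phi> (x, 0)))"

text \<open>The hypothesis on \<open>u\<close> concerns its values off the domain, the ones that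
  \<open>ind_u\<close> reads. On the side the normal is known for almost every parameter, and the
  heights 0 and \<open>M\<close> form null sets, so after the change of variables the integrand
  agrees with the one in \<open>flux\<close> almost everywhere.\<close>

lemma boundary_integral_eq_flux:
 assumes M: "0 < M" and \<phi>: "continuous_on (closure Om \<times> {0..M}) \<phi>"
  and u: "(%x. if x : Om then 0 else u x) : borel_fun"
 shows "(LINT z:frontier (Om \<times> {0<..<M})|hausdorff_measure 2.
    ind_u Om M u z * (\<phi> z @. outward_normal (Om \<times> {0<..<M}) z)) = flux M u \<phi>"
proof -
 define A where "A = closure Om \<times> {0..M}"
 define H where "H = (hausdorff_measure 2 :: (plane \<times> real) measure)"
 have sH: "sets H = sets borel" by (simp add: H_def)
 have mH: "f : borel_measurable H" if "f : borel_fun" for f :: "plane \<times> real => real"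
  using that measurable_cong_sets[OF sH refl] by blast
 have cA: "compact A" unfolding A_def using bounded_Om by (intro compact_Times) auto
 have Ab: "A : sets borel" using cA by (rule borel_compact)
 define \<phi>' where "\<phi>' = (%z. indicator A z *. \<phi> z)"
 have \<phi>m[measurable]: "\<phi>' : borel_fun"
  unfolding \<phi>'_def using borel_measurable_continuous_on_indicator[OF Ab] \<phi> by (simp add: A_def)
 obtain B where B: "!!z. norm (\<phi>' z) <= B"
 proof -
  have "bounded (\<phi> ` A)" using \<phi> cA by (intro compact_imp_bounded compact_continuous_image) (auto simp: A_def)
  then obtain B where "!!z. z : A ==> norm (\<phi> z) <= B" by (auto simp: bounded_iff)
  hence "norm (\<phi>' z) <= max B 0" for z by (auto simp: \<phi>'_def indicator_def le_max_iff_disj)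
  thus thesis using that by blast
 qed
 define n where "n = outward_normal (Om \<times> {0<..<M})"
 have nm[measurable]: "n : borel_fun" unfolding n_def by (rule borel_measurable_outward_normal)
 have n1: "norm (n z) <= 1" for z by (simp add: n_def norm_outward_normal_le)
 have Omb[measurable]: "Om : sets borel" using open_Om by simp
 define u' where "u' = (%x. if x : Om then 0 else u x)"
 have u'm[measurable]: "u' : borel_fun" using u by (simp add: u'_def)
 have "(%z. if snd z < 0 then 1 else if snd z > M then 0
   else if fst z ~: Om then (if u' (fst z) > snd z then 1 else 0)
   else (if snd z = 0 then 1 else (0::real))) : borel_fun"
  unfolding borel_prod[symmetric] by measurable
 moreover have "ind_u Om M u = (%z. if snd z < 0 then 1 else if snd z > M then 0
   else if fst z ~: Om then (if u' (fst z) > snd z then 1 else 0)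
   else (if snd z = 0 then 1 else (0::real)))"
  by (auto simp: ind_u_def u'_def fun_eq_iff)
 ultimately have im[measurable]: "ind_u Om M u : borel_fun" by simp
 have i01: "\<bar>ind_u Om M u z\<bar> <= 1" for z by (simp add: ind_u_def split: prod.split)
 define F where "F = (%z. ind_u Om M u z * (\<phi>' z @. n z))"
 have Fm[measurable]: "F : borel_fun" unfolding F_def by measurable
 have FB: "\<bar>F z\<bar> <= B" for z
 proof -
  have "\<bar>\<phi>' z @. n z\<bar> <= norm (\<phi>' z) * norm (n z)" by (rule Cauchy_Schwarz_ineq2)
  also have "... <= B * 1" using B n1 order_trans[OF norm_ge_zero B] by (intro mult_mono) auto
  finally have "\<bar>ind_u Om M u z\<bar> * \<bar>\<phi>' z @. n z\<bar> <= 1 * B" using i01 by (intro mult_mono) auto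
  thus ?thesis by (simp add: F_def abs_mult)
 qed
 have parts: "frontier Om \<times> {0..M} \<in> sets borel" "Om \<times> {0::real} \<in> sets borel" "Om \<times> {M} \<in> sets borel"
  by (rule borel_Times; simp add: borel_closed frontier_closed)+
 have fin: "emeasure H X < \<infinity>" if "X : {frontier Om \<times> {0..M}, Om \<times> {0}, Om \<times> {M}}" for X
 proof -
  have 1: "emeasure H (frontier Om \<times> {0..M}) < \<infinity>"
  proof -
   have "emeasure H (frontier Om \<times> {0..M}) = ennreal (len * M)"
    using hausdorff_side_eq[OF M, of UNIV] emeasure_rect[of len M] len_pos M by (simp add: H_def)
   thus ?thesis by simp
  qed
  have 2: "emeasure H (Om \<times> {c}) < \<infinity>" for c
  proof -
   have "Om \<times> {c} = (%p. (plane_of p, c)) ` (plane_of -` Om)"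
    by (force simp: image_iff plane_of_surj intro: plane_of_surj[symmetric])
   moreover have "hausdorff_outer 2 ((%p. (plane_of p, c)) ` (plane_of -` Om)) <= emeasure lborel (plane_of -` Om)"
    using measurable_sets_borel[OF plane_of_borel Omb]
    by (intro hausdorff_lipschitz_image_le) (simp_all add: dist_prod_def[of "(plane_of _, _)"] plane_of_dist)
   moreover have "emeasure H (Om \<times> {c}) = hausdorff_outer 2 (Om \<times> {c})"
    unfolding H_def by (intro emeasure_hausdorff borel_Times) auto
   ultimately have "emeasure H (Om \<times> {c}) \<le> emeasure lborel (plane_of -` Om)" by simp
   also have "... = emeasure lborel Om" by (subst distr_plane_of[symmetric]) (simp add: emeasure_distr)
   also have "... < \<infinity>" by (rule emeasure_bounded_finite[OF bounded_Om])
   finally show ?thesis .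
  qed
  show ?thesis using that 1 2 by auto
 qed
 have Fi: "set_integrable H X F" if "X : {frontier Om \<times> {0..M}, Om \<times> {0}, Om \<times> {M}}" for X
  unfolding set_integrable_def
  by (rule int_bdd_ind[of _ _ _ B]) (use that parts fin FB mH[OF Fm] sH in auto)
 have fr: "frontier (Om \<times> {0<..<M}) = frontier Om \<times> {0..M} Un (Om \<times> {0} Un Om \<times> {M})"
  using frontier_cylinder[OF M] by auto
 have dj: "frontier Om Int Om = {}" using open_Om by (auto simp: frontier_def interior_open)
 have "frontier (Om \<times> {0<..<M}) \<subseteq> A"
  unfolding fr A_def using M closure_subset by (auto simp: frontier_def)
 hence "(LINT z:frontier (Om \<times> {0<..<M})|H. ind_u Om M u z * (\<phi> z @. n z)) = (LINT z:frontier (Om \<times> {0<..<M})|H. F z)"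
  unfolding sli_def
  by (intro lint_cong refl) (auto simp: F_def \<phi>'_def indicator_def)
 also have "... = (LINT z:frontier Om \<times> {0..M}|H. F z) + (LINT z:Om \<times> {0} Un Om \<times> {M}|H. F z)"
  unfolding fr using dj Fi by (intro set_integral_Un set_integrable_Un) (auto simp: sH parts)
 also have "(LINT z:Om \<times> {0} Un Om \<times> {M}|H. F z) = (LINT z:Om \<times> {0}|H. F z) + (LINT z:Om \<times> {M}|H. F z)"
  using M Fi by (intro set_integral_Un) auto
 \<comment> \<open>On the top face the indicator is 0; this uses that \<open>M\<close> is not
   0.\<close>
 also have "(LINT z:Om \<times> {M}|H. F z) = 0"
  using M unfolding sli_def by (intro integral_eq_zero_AE AE_I2) (auto simp: F_def ind_u_def indicator_def)
 also have "(LINT z:Om \<times> {0}|H. F z) = (LINT x:Om|lborel. F (x, 0))"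
  unfolding H_def by (rule slice_integral) measurable
 also have "... = (LINT x:Om|lborel. - snd (\<phi> (x, 0)))"
  unfolding sli_def
 proof (intro lint_cong refl)
  fix x
  have "F (x, 0) = - snd (\<phi> (x, 0))" if "x : Om"
   using that M closure_subset[of Om] outward_normal_bottom[OF that M]
   by (auto simp: F_def n_def ind_u_def \<phi>'_def A_def inner_prod_def indicator_def)
  thus "indicat_real Om x *. F (x, 0) = indicat_real Om x *. - snd (\<phi> (x, 0))" by (simp add: indicator_def)
 qed
 also have "... = - (LINT x:Om|lborel. snd (\<phi> (x, 0)))" by (simp add: sli_def)
 also have "(LINT z:frontier Om \<times> {0..M}|H. F z) = (LINT p:{0..<len} \<times> {0..M}|lborel. F (side_map p))"
  unfolding H_def by (rule side_integral[OF M Fm])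
 also have "... = (LINT p:{0..<len} \<times> {0..M}|lborel. of_bool (snd p < u (gam (fst p))) * (fst (\<phi>' (side_map p)) @. nrm (fst p)))"
  unfolding sli_def
 proof (rule integral_cong_AE)
  have ugm: "(%t. u (gam t)) : borel_fun"
  proof -
   have "(%t. u' (gam t)) : borel_fun" by measurable
   moreover have "u' (gam t) = u (gam t)" for t using gam_mem[of t] dj by (auto simp: u'_def)
   ultimately show ?thesis by simp
  qed
  have "(%p. of_bool (snd p < u (gam (fst p))) * (fst (\<phi>' (side_map p)) @. nrm (fst p))) : borel_fun"
  proof -
   have [measurable]: "(%p. fst (\<phi>' (side_map p))) : borel_measurable (borel :: (real \<times> real) measure)"
    by (intro measurable_compose[OF _ borel_contI[of fst]] measurable_compose[OF side_map_borel \<phi>m] continuous_intros)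
   have [measurable]: "(%p. of_bool (snd p < u (gam (fst p))) :: real) : borel_measurable (borel :: (real \<times> real) measure)"
    unfolding borel_prod[symmetric] using ugm by measurable
   have [measurable]: "(%p. nrm (fst p)) : borel_measurable (borel :: (real \<times> real) measure)"
    unfolding borel_prod[symmetric] by measurable
   show ?thesis by measurable
  qed
  thus "(%p. indicat_real ({0..<len} \<times> {0..M}) p *. (of_bool (snd p < u (gam (fst p))) * (fst (\<phi>' (side_map p)) @. nrm (fst p)))) : borel_measurable lborel"
   using rect_borel by simp
  show "(%p. indicat_real ({0..<len} \<times> {0..M}) p *. F (side_map p)) : borel_measurable lborel"
   using rect_borel by simp
  have "AE t in lborel. t ~= 0 --> t : {0..<len} --> (gam has_vector_derivative tangent t) (at t) & norm (tangent t) = 1"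
   using AE_tangent AE_norm_tangent by eventually_elim auto
  hence a1: "AE t in lborel. t : {0..<len} --> 0 < t & (gam has_vector_derivative tangent t) (at t) & norm (tangent t) = 1"
   using AE_lborel_singleton[of 0] by eventually_elim auto
  have a2: "AE s in lborel. s ~= 0 & s ~= M" using AE_lborel_singleton[of 0] AE_lborel_singleton[of M] by eventually_elim auto
  have a3: "AE p in lborel. fst p : {0..<len} --> 0 < fst p & (gam has_vector_derivative tangent (fst p)) (at (fst p)) & norm (tangent (fst p)) = 1"
   by (rule AE_lborel_fst[OF a1])
  have a4: "AE p in lborel. snd p ~= 0 & snd p ~= M" by (rule AE_lborel_snd[OF a2])
  show "AE p in lborel. indicat_real ({0..<len} \<times> {0..M}) p *. F (side_map p) =
    indicat_real ({0..<len} \<times> {0..M}) p *. (of_bool (snd p < u (gam (fst p))) * (fst (\<phi>' (side_map p)) @. nrm (fst p)))"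
   using a3 a4
  proof eventually_elim
   case (elim p)
   show ?case
   proof (cases "p : {0..<len} \<times> {0..M}")
    case True
    obtain t s where p: "p = (t, s)" by fastforce
    have ts: "0 < t" "t < len" "0 < s" "s < M" using True elim by (auto simp: p less_le)
    have "n (gam t, s) = (plane_of (tangent t $ 2, - tangent t $ 1), 0)"
     unfolding n_def by (rule outward_normal_side) (use ts elim in \<open>auto simp: p\<close>)
    moreover have "gam t ~: Om" using gam_mem[of t] dj by blast
    ultimately show ?thesis using ts by (simp add: F_def p side_map_def ind_u_def inner_prod_def nrm_def)
   qed simp
  qed
 qed
 also have "... = (LINT p:{0..<len} \<times> {0..M}|lborel. of_bool (snd p < u (gam (fst p))) * (fst (\<phi> (side_map p)) @. nrm (fst p)))"
  unfolding sli_def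
  by (intro lint_cong refl)
   (use gam_mem in \<open>auto simp: \<phi>'_def A_def side_map_def indicator_def frontier_def\<close>)
 finally show ?thesis by (simp add: flux_def H_def n_def)
qed

end

section \<open>Sections of the domain by parallel lines\<close>

definition rot :: "plane => plane" where "rot e = plane_of (- (e $ 2), e $ 1)"

text \<open>Coordinates adapted to a direction: \<open>y\<close> selects a line parallel to
  \<open>e\<close>, and \<open>a\<close> runs along it.\<close>

definition pt :: "plane => real => real => plane" where "pt e a y = a *. e + y *. rot e"

lemma rot_uminus: "rot (- e) = - rot e"
 by (simp add: rot_def vec_eq_iff forall_2)

lemma pt_uminus: "pt (- e) a y = pt e (- a) (- y)"
 by (simp add: pt_def rot_uminus)

lemma rot_inner: "rot e @. e = 0" "e @. rot e = 0" "rot e @. rot e = e @. e"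
 by (simp_all add: rot_def inner_plane)

lemma pt_coords:
 assumes "norm e = 1"
 shows "pt e a y @. e = a" "pt e a y @. rot e = y" "pt e (x @. e) (x @. rot e) = x"
proof -
 have ee: "e @. e = 1" using assms by (simp add: norm_eq_1)
 show "pt e a y @. e = a" "pt e a y @. rot e = y"
  using ee rot_inner[of e] by (simp_all add: pt_def inner_add_left)
 have e2: "e $ 1 * e $ 1 + e $ 2 * e $ 2 = 1" using ee by (simp add: inner_plane)
 have "(x $ 1 * e $ 1 + x $ 2 * e $ 2) * e $ 1 + (x $ 1 * (- e $ 2) + x $ 2 * e $ 1) * (- e $ 2) = x $ 1"
  "(x $ 1 * e $ 1 + x $ 2 * e $ 2) * e $ 2 + (x $ 1 * (- e $ 2) + x $ 2 * e $ 1) * e $ 1 = x $ 2"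
  using e2 by algebra+
 thus "pt e (x @. e) (x @. rot e) = x"
  by (simp add: vec_eq_iff forall_2 pt_def rot_def inner_plane)
qed

lemma pt_diff: "pt e a y - pt e b y = (a - b) *. e"
 by (simp add: pt_def scaleR_diff_left)

lemma pt_comb:
 assumes "u + v = 1"
 shows "u *. pt e a y + v *. pt e b y = pt e (u * a + v * b) y"
proof -
 have "u *. pt e a y + v *. pt e b y = (u * a + v * b) *. e + ((u + v) * y) *. rot e"
  by (simp add: pt_def algebra_simps)
 thus ?thesis by (simp add: assms pt_def)
qed

lemma pt_cont: "continuous_on UNIV (%p. pt e (fst p) (snd p))"
 unfolding pt_def by (intro continuous_intros)

context convex_curve begin

definition proj :: "plane => real set" where "proj e = {y. EX a. pt e a y : Om}"
definition hi :: "plane => real => real" where "hi e y = Sup {a. pt e a y : Om}"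
text \<open>Replacing \<open>e\<close> by \<open>- e\<close> changes the sign of both coordinates,
  so in this form each statement on left endpoints is one on right endpoints.\<close>

definition lo :: "plane => real => real" where "lo e y = - hi (- e) (- y)"

lemma proj_uminus: "y : proj (- e) \<longleftrightarrow> - y : proj e"
 by (auto simp: proj_def pt_uminus) (metis minus_minus)

lemma proj_eq: "norm e = 1 ==> proj e = (%x. x @. rot e) ` Om"
 unfolding proj_def using pt_coords[of e] by (auto simp: image_iff) (metis)+

lemma section_bdd:
 assumes "norm e = 1"
 shows "bdd_above {a. pt e a y : Om}" "bdd_below {a. pt e a y : Om}"
proof -
 obtain B where B: "!!x. x : Om ==> norm x <= B" using bounded_Om by (auto simp: bounded_iff)
 have "\<bar>a\<bar> <= B" if "pt e a y : Om" for a
  using Cauchy_Schwarz_ineq2[of "pt e a y" e] B[OF that] assms pt_coords(1)[OF assms, of a y] by simp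
 thus "bdd_above {a. pt e a y : Om}" "bdd_below {a. pt e a y : Om}"
  by (auto intro!: bdd_aboveI[of _ B] bdd_belowI[of _ "- B"] simp: abs_le_iff) (smt (verit))
qed

lemma open_section: "open {a. pt e a y : Om}"
proof -
 have "open ((%a. pt e a y) -` Om)"
  by (intro open_vimage open_Om) (auto simp: pt_def intro!: continuous_intros)
 thus ?thesis by (simp add: vimage_def)
qed

lemma convex_section: "convex {a. pt e a y : Om}"
proof (rule convexI)
 fix a b u v :: real assume ab: "a : {a. pt e a y : Om}" "b : {a. pt e a y : Om}" and uv: "0 <= u" "0 <= v" "u + v = 1"
 have "u *. pt e a y + v *. pt e b y = pt e (u *. a + v *. b) y"
  using pt_comb[OF uv(3)] by simp
 moreover have "u *. pt e a y + v *. pt e b y : Om" using convex_Om ab uv by (auto simp: convex_def)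
 ultimately show "u *. a + v *. b : {a. pt e a y : Om}" by simp
qed

lemma section_lt_hi:
 assumes e: "norm e = 1" and a: "pt e a y : Om"
 shows "a < hi e y"
proof -
 obtain d where d: "0 < d" "ball a d \<subseteq> {a. pt e a y : Om}" using open_section a open_contains_ball by blast
 have "a + d / 2 : {a. pt e a y : Om}" using d by (intro subsetD[OF d(2)]) (auto simp: dist_real_def)
 hence "a + d / 2 <= hi e y" unfolding hi_def by (rule cSup_upper[OF _ section_bdd(1)[OF e]])
 thus ?thesis using d by simp
qed

lemma section_gt_lo:
 assumes e: "norm e = 1" and a: "pt e a y : Om"
 shows "lo e y < a"
 using section_lt_hi[of "- e" "- a" "- y"] a e by (simp add: pt_uminus lo_def)

lemma section_between:
 assumes e: "norm e = 1" and y: "y : proj e" and a: "lo e y < a" "a < hi e y"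
 shows "pt e a y : Om"
proof -
 have ne: "{a. pt e a y : Om} ~= {}" using y by (auto simp: proj_def)
 obtain b where b: "pt e b y : Om" "a < b" using less_cSup_iff[OF ne section_bdd(1)[OF e], of a] a(2) by (auto simp: hi_def)
 have ne': "{a. pt (- e) a (- y) : Om} ~= {}" using y by (auto simp: proj_def pt_uminus) (metis minus_minus)
 have "- a < hi (- e) (- y)" using a(1) by (simp add: lo_def)
 then obtain c where c: "pt (- e) c (- y) : Om" "- a < c"
  using less_cSup_iff[OF ne' section_bdd(1)[of "- e"], of "- a"] e by (auto simp: hi_def)
 hence "pt e (- c) y : Om" "- c < a" by (auto simp: pt_uminus)
 thus ?thesis
  using b convex_section[of e y] mem_is_interval_1_I[of "{a. pt e a y : Om}" "- c" b a] by (auto simp: is_interval_convex_1)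
qed

lemma lo_less_hi: "norm e = 1 ==> y : proj e ==> lo e y < hi e y"
 using section_lt_hi section_gt_lo by (force simp: proj_def)

lemma hi_closure:
 assumes e: "norm e = 1" and y: "y : proj e"
 shows "pt e (hi e y) y : closure Om"
proof -
 have "hi e y : closure {lo e y<..<hi e y}" using lo_less_hi[OF e y] by simp
 moreover have "(%a. pt e a y) ` closure {lo e y<..<hi e y} \<subseteq> closure Om"
 proof (rule image_closure_subset)
  show "continuous_on (closure {lo e y<..<hi e y}) (%a. pt e a y)" unfolding pt_def by (intro continuous_intros)
  show "(%a. pt e a y) ` {lo e y<..<hi e y} \<subseteq> closure Om"
   using section_between[OF e y] by (auto intro!: subsetD[OF closure_subset])
 qed simp
 ultimately show ?thesis by blast
qed

lemma hi_frontier: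
 assumes e: "norm e = 1" and y: "y : proj e"
 shows "pt e (hi e y) y : frontier Om"
 using hi_closure[OF e y] section_lt_hi[OF e, of "hi e y" y] open_Om by (auto simp: frontier_def interior_open)

lemma lo_frontier:
 assumes e: "norm e = 1" and y: "y : proj e"
 shows "pt e (lo e y) y : frontier Om"
 using hi_frontier[of "- e" "- y"] e y proj_uminus[of "- y" e] by (simp add: pt_uminus lo_def)

text \<open>Otherwise the right endpoint would lie strictly between a point of the open domain and a
  point of its closure, hence in the interior.\<close>

lemma closure_section_le:
 assumes e: "norm e = 1" and y: "y : proj e" and a: "pt e a y : closure Om"
 shows "a <= hi e y"
proof (rule ccontr)
 assume "\<not> a <= hi e y"
 hence lt: "hi e y < a" by simp
 obtain b where b: "pt e b y : Om" using y by (auto simp: proj_def)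
 have bh: "b < hi e y" by (rule section_lt_hi[OF e b])
 define s where "s = (hi e y - b) / (a - b)"
 have s: "0 < s" "s < 1" using lt bh by (auto simp: s_def)
 have "pt e b y : interior Om" using b open_Om by (simp add: interior_open)
 moreover have "pt e (hi e y) y : open_segment (pt e a y) (pt e b y)"
  unfolding in_segment
 proof (intro conjI exI[of _ "1 - s"])
  show "pt e a y ~= pt e b y" using pt_coords(1)[OF e, of a y] pt_coords(1)[OF e, of b y] lt bh by auto
  have "s * (a - b) = hi e y - b" using lt bh by (simp add: s_def)
  hence "(1 - (1 - s)) * a + (1 - s) * b = hi e y" by (simp add: algebra_simps)
  thus "pt e (hi e y) y = (1 - (1 - s)) *. pt e a y + (1 - s) *. pt e b y"
   by (subst pt_comb) auto
 qed (use s in auto)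
 ultimately have "pt e (hi e y) y : interior Om"
  using in_interior_closure_convex_segment[OF convex_Om _ a] by (simp add: open_segment_commute subset_iff)
 thus False using hi_frontier[OF e y] by (simp add: frontier_def)
qed

lemma closure_section_ge:
 assumes e: "norm e = 1" and y: "y : proj e" and a: "pt e a y : closure Om"
 shows "lo e y <= a"
 using closure_section_le[of "- e" "- y" "- a"] assms proj_uminus[of "- y" e] by (simp add: pt_uminus lo_def)

lemma open_proj: "open (proj e)"
proof -
 have "proj e = (\<Union>a. {y. pt e a y : Om})" by (auto simp: proj_def)
 moreover have "open {y. pt e a y : Om}" for a
 proof -
  have "open ((%y. pt e a y) -` Om)" by (intro open_vimage open_Om) (auto simp: pt_def intro!: continuous_intros)
  thus ?thesis by (simp add: vimage_def)
 qed
 ultimately show ?thesis by auto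
qed

lemma bounded_proj: "norm e = 1 ==> bounded (proj e)"
proof -
 assume e: "norm e = 1"
 hence "proj e = (%x. x @. rot e) ` Om" by (rule proj_eq)
 thus ?thesis using bounded_linear_image[OF bounded_Om bounded_linear_inner_left] by simp
qed

lemma convex_proj: "norm e = 1 ==> convex (proj e)"
 using convex_linear_image[of "%x. x @. rot e" Om] convex_Om by (simp add: proj_eq bounded_linear_inner_left bounded_linear.linear)

text \<open>\<open>hi\<close> exceeds \<open>c\<close> on exactly those lines that meet the domain
  beyond \<open>c\<close>, and these form an open set.\<close>

lemma hi_borel:
 assumes e: "norm e = 1"
 shows "(%y. if y : proj e then hi e y else 0) : borel_fun"
proof (rule borel_measurableI_greater)
 fix c
 have "{y. (if y : proj e then hi e y else 0) > c} = (\<Union>a\<in>{c<..}. {y. pt e a y : Om}) Un (if c < 0 then - proj e else {})"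
 proof -
  have "y : proj e & c < hi e y \<longleftrightarrow> (EX a>c. pt e a y : Om)" for y
  proof
   assume y: "y : proj e & c < hi e y"
   hence ne: "{a. pt e a y : Om} ~= {}" by (auto simp: proj_def)
   thus "EX a>c. pt e a y : Om" using less_cSup_iff[OF ne section_bdd(1)[OF e], of c] y by (auto simp: hi_def)
  next
   assume "EX a>c. pt e a y : Om"
   thus "y : proj e & c < hi e y" using section_lt_hi[OF e] by (force simp: proj_def)
  qed
  thus ?thesis by auto
 qed
 moreover have "open (\<Union>a\<in>{c<..}. {y. pt e a y : Om})"
 proof (intro open_UN ballI)
  fix a show "open {y. pt e a y : Om}"
   using open_vimage[OF open_Om, of "%y. pt e a y"] by (simp add: vimage_def pt_def continuous_intros)
 qed
 ultimately show "{y \<in> space borel. c < (if y : proj e then hi e y else 0)} : sets borel"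
  using open_proj[of e] by (auto intro!: sets.Un)
qed

lemma height_derivative:
 assumes "(gam has_vector_derivative d) (at t)"
 shows "((%t. gam t @. rot e) has_real_derivative d @. rot e) (at t)"
 using assms unfolding has_vector_derivative_def has_field_derivative_def
 by (auto intro!: derivative_eq_intros simp: fun_eq_iff mult.commute)

text \<open>If the line in direction \<open>e\<close> through \<open>gam t\<close> missed the domain, \<open>t\<close> would be an extremum of the height.\<close>

lemma right_endpoint:
 assumes e: "norm e = 1" and t: "0 < t" "t < len" and d: "(gam has_vector_derivative d) (at t)" and pos: "0 < d @. rot e"
 shows "gam t @. rot e : proj e" "gam t = pt e (hi e (gam t @. rot e)) (gam t @. rot e)"
proof -
 define y where "y = gam t @. rot e"
 have gc: "gam t' : closure Om" for t' using gam_mem[of t'] by (simp add: frontier_def)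
 show yp: "gam t @. rot e : proj e"
 proof (rule ccontr)
  assume ny: "gam t @. rot e ~: proj e"
  have "(ALL y':proj e. y' < y) \<or> (ALL y':proj e. y < y')"
  proof (rule ccontr)
   assume "\<not> ?thesis"
   then obtain y1 y2 where "y1 : proj e" "y <= y1" "y2 : proj e" "y2 <= y" by (auto simp: not_less)
   hence "y : proj e" using mem_is_interval_1_I[of "proj e" y2 y1 y] convex_proj[OF e] by (auto simp: is_interval_convex_1)
   thus False using ny by (simp add: y_def)
  qed
  thus False
  proof
   assume a: "ALL y':proj e. y' < y"
   have le: "x @. rot e <= y" if "x : closure Om" for x
    by (rule continuous_le_on_closure[OF _ that]) (use a in \<open>auto intro!: continuous_intros less_imp_le simp: proj_eq[OF e]\<close>)
   have "d @. rot e = 0"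
    by (rule DERIV_local_max[OF height_derivative[OF d], of 1]) (use le[OF gc] in \<open>auto simp: y_def\<close>)
   thus False using pos by simp
  next
   assume a: "ALL y':proj e. y < y'"
   have le: "y <= x @. rot e" if "x : closure Om" for x
    by (rule continuous_ge_on_closure[OF _ that]) (use a in \<open>auto intro!: continuous_intros less_imp_le simp: proj_eq[OF e]\<close>)
   have "d @. rot e = 0"
    by (rule DERIV_local_min[OF height_derivative[OF d], of 1]) (use le[OF gc] in \<open>auto simp: y_def\<close>)
   thus False using pos by simp
  qed
 qed
 define a where "a = gam t @. e"
 have ga: "gam t = pt e a y" by (simp add: a_def y_def pt_coords(3)[OF e])
 have yp': "y : proj e" using yp by (simp add: y_def)
 have ahi: "a <= hi e y" by (rule closure_section_le[OF e yp']) (simp add: gc flip: ga)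
 \<comment> \<open>If \<open>gam t\<close> were not the right endpoint, a point of the domain
   further along \<open>e\<close> on the same line would lie on the wrong side of the
   tangent.\<close>
 have "a = hi e y"
 proof (rule ccontr)
  assume "a ~= hi e y"
  hence lt: "a < hi e y" using ahi by simp
  have lt': "lo e y < hi e y" by (rule lo_less_hi[OF e yp'])
  have alo: "lo e y <= a" by (rule closure_section_ge[OF e yp']) (simp add: gc flip: ga)
  define b where "b = (a + hi e y) / 2"
  have b: "a < b" "b < hi e y" using lt by (auto simp: b_def)
  have x: "pt e b y : Om" by (rule section_between[OF e yp']) (use b alo in auto)
  have "0 < d $ 1 * (pt e b y - gam t) $ 2 - d $ 2 * (pt e b y - gam t) $ 1" by (rule tangent_ccw[OF t d x])
  also have "pt e b y - gam t = (b - a) *. e" by (simp add: ga pt_diff)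
  also have "d $ 1 * ((b - a) *. e) $ 2 - d $ 2 * ((b - a) *. e) $ 1 = - (b - a) * (d @. rot e)"
   by (simp add: inner_plane rot_def algebra_simps)
  finally show False using mult_neg_pos[of "a - b" "d @. rot e"] b pos by simp
 qed
 hence "gam t = pt e (hi e y) y" using ga by simp
 thus "gam t = pt e (hi e (gam t @. rot e)) (gam t @. rot e)" unfolding y_def .
qed

end

text \<open>Sard's theorem on the line, transferred from \<open>real^1\<close>, where the derivative
  0 is a matrix of rank less than 1.\<close>

lemma negligible_image_critical:
 fixes h :: "real => real"
 assumes "!!t. t : Z ==> (h has_real_derivative 0) (at t)"
 shows "negligible (h ` Z)"
proof -
 define f where "f = (%x::real^1. vec (h (x $ 1)) :: real^1)"
 have "negligible (f ` (vec ` Z))"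
 proof (rule baby_Sard)
  fix x :: "real^1" assume "x : vec ` Z"
  then obtain t where t: "t : Z" "x = vec t" by blast
  have c: "((%x::real^1. x $ 1) has_derivative (%x. x $ 1)) (at x)"
   by (rule bounded_linear_imp_has_derivative) (rule bounded_linear_vec_nth)
  have "(h has_derivative (%s. 0)) (at (x $ 1))" using assms[OF t(1)] t(2) by (simp add: has_field_derivative_def lambda_zero)
  from has_derivative_compose[OF c this] have hx: "((%x. h (x $ 1)) has_derivative (%s. 0)) (at x)" .
  have "bounded_linear (vec :: real => real^1)" by (simp add: linear_conv_bounded_linear[symmetric] linear_vec)
  from bounded_linear.has_derivative[OF this hx]
  have "(f has_derivative (%s. 0)) (at x)" by (simp add: f_def vec_0)
  thus "(f has_derivative (%s. 0)) (at x within vec ` Z)" by (rule has_derivative_at_withinI)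
  have "matrix (%s::real^1. 0::real^1) = 0" by (simp add: matrix_def vec_eq_iff)
  thus "rank (matrix (%s::real^1. 0::real^1)) < CARD(1)" by (simp add: rank_0)
 qed simp
 hence "negligible ((%x. x $ 1) ` (f ` (vec ` Z)))"
 proof (rule negligible_locally_Lipschitz_image[rotated])
  show "EX T B. open T & x : T & (ALL y:f ` vec ` Z Int T. norm (y $ 1 - x $ 1) <= B * norm (y - x))" for x :: "real^1"
   by (intro exI[of _ UNIV] exI[of _ 1]) (use component_le_norm_cart[of "_ - x" 1] in auto)
 qed simp
 moreover have "(%x. x $ 1) ` (f ` (vec ` Z)) = h ` Z" by (simp add: f_def image_image)
 ultimately show ?thesis by simp
qed

context convex_curve begin

lemma height_borel [measurable]: "(%t. tangent t @. rot e) : borel_fun"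
 by measurable

lemma height_bound: "\<bar>tangent t @. rot e\<bar> <= 2 * norm e"
proof -
 have "\<bar>tangent t @. rot e\<bar> <= norm (tangent t) * norm (rot e)" by (rule Cauchy_Schwarz_ineq2)
 also have "norm (rot e) = norm e" by (simp add: norm_eq_sqrt_inner rot_inner)
 also have "norm (tangent t) * norm e <= 2 * norm e" by (intro mult_right_mono norm_tangent_le_2) simp
 finally show ?thesis .
qed

text \<open>Change of variables along the height function, on the set \<open>P\<close> of parameters
  where the height has positive derivative. There the curve runs through right endpoints, so the
  height is injective. Heights in \<open>proj e\<close> that are missed come from
  \<open>t = 0\<close>, from the null set without derivative or from critical points; the images of
  the last two are null by the Lipschitz bound and by Sard.\<close>

lemma line_integral_right:
 fixes g :: "plane => real"
 assumes e: "norm e = 1" and g[measurable]: "g : borel_fun" and B: "!!x. \<bar>g x\<bar> <= B"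
 shows "(LINT t:{0..<len}|lborel. max 0 (tangent t @. rot e) * g (gam t)) = (LINT y:proj e|lborel. g (pt e (hi e y) y))"
proof -
 obtain N where N: "negligible N" "!!t. t ~: N ==> (gam has_vector_derivative tangent t) (at t)"
  using tangent_derivative by blast
 define h where "h = (%t. gam t @. rot e)"
 define v where "v = (%t. tangent t @. rot e)"
 define G where "G = (%y. g (pt e (hi e y) y))"
 define P where "P = {t. 0 < t & t < len & 0 < v t} - N"
 have vm[measurable]: "v : borel_fun" unfolding v_def by measurable
 have Ns: "N : sets lebesgue" using N(1) negligible_imp_sets by blast
 have P0: "{t. 0 < t & t < len & 0 < v t} : sets borel" by measurable
 have Ps: "P : sets lebesgue" unfolding P_def using P0 Ns by (intro sets.Diff) auto
 have der: "(h has_real_derivative v t) (at t)" if "t ~: N" for t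
  unfolding h_def v_def by (rule height_derivative[OF N(2)[OF that]])
 have endp: "h t : proj e" "gam t = pt e (hi e (h t)) (h t)" if "t : P" for t
  using right_endpoint[OF e, of t "tangent t"] N(2)[of t] that by (auto simp: P_def h_def v_def)
 have inj: "inj_on h P"
 proof (rule inj_onI)
  fix s t assume st: "s : P" "t : P" "h s = h t"
  hence "gam s = gam t" using endp(2)[OF st(1)] endp(2)[OF st(2)] by simp
  thus "s = t" using \<gamma>_inj[of s t] st by (auto simp: P_def gam_eq)
 qed
 have miss: "negligible (proj e - h ` P)"
 proof (rule negligible_subset)
  define Z where "Z = {t. t ~: N & v t = 0}"
  have hl: "\<bar>h s - h t\<bar> <= 1 * \<bar>s - t\<bar>" for s t
  proof -
   have "\<bar>h s - h t\<bar> <= norm (gam s - gam t) * norm (rot e)"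
    using Cauchy_Schwarz_ineq2[of "gam s - gam t" "rot e"] by (simp add: h_def inner_diff_left)
   also have "norm (rot e) = 1" using e by (simp add: norm_eq_sqrt_inner rot_inner)
   finally show ?thesis using gam_lip[of s t] by (simp add: dist_norm)
  qed
  have "negligible (h ` N)"
  proof (rule negligible_locally_Lipschitz_image[OF _ N(1)])
   show "EX T B. open T & x : T & (ALL y:N Int T. norm (h y - h x) <= B * norm (y - x))" for x
    by (intro exI[of _ UNIV] exI[of _ 1]) (use hl in auto)
  qed simp
  moreover have "negligible (h ` Z)" proof (rule negligible_image_critical)
   show "(h has_real_derivative 0) (at t)" if "t : Z" for t using der[of t] that by (simp add: Z_def)
  qed
  ultimately show "negligible ({h 0} Un h ` N Un h ` Z)" by (intro negligible_Un) auto
  show "proj e - h ` P \<subseteq> {h 0} Un h ` N Un h ` Z"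
  proof
   fix y assume y: "y : proj e - h ` P"
   define q where "q = pt e (hi e y) y"
   have q: "q : frontier Om" unfolding q_def using hi_frontier[OF e] y by blast
   obtain t where t: "0 <= t" "t < len" "q = gam t" using \<gamma>_surj[OF q] gam_eq by metis
   have ht: "h t = y" using t(3) pt_coords(2)[OF e] by (simp add: h_def q_def flip: t(3))
   show "y : {h 0} Un h ` N Un h ` Z"
   proof (rule ccontr)
    assume "y ~: {h 0} Un h ` N Un h ` Z"
    hence nt: "t ~= 0" "t ~: N" "v t ~= 0" using ht by (auto simp: Z_def)
    hence t0: "0 < t" using t by simp
    show False
    proof (cases "0 < v t")
     case True
     hence "t : P" using t t0 nt by (simp add: P_def)
     thus False using y ht by blast
    next
     case False
     \<comment> \<open>A negative height derivative makes \<open>gam t\<close> a left endpoint, by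
       the same lemma for \<open>- e\<close>; it would then coincide with the right endpoint of a
       nonempty open section.\<close>
     hence neg: "0 < tangent t @. rot (- e)" using nt by (simp add: v_def rot_uminus)
     have "gam t = pt (- e) (hi (- e) (gam t @. rot (- e))) (gam t @. rot (- e))"
      by (rule right_endpoint(2)[OF _ t0 t(2) N(2)[OF nt(2)] neg]) (use e in simp)
     hence "gam t = pt e (lo e y) y" using ht by (simp add: rot_uminus pt_uminus lo_def h_def)
     hence "pt e (hi e y) y = pt e (lo e y) y" using t(3) unfolding q_def by (rule trans[rotated])
     from arg_cong[OF this, of "%z. z @. e"] have "hi e y = lo e y" by (simp only: pt_coords(1)[OF e])
     thus False using lo_less_hi[OF e, of y] y by simp
    qed
   qed
  qed
 qed
 have sub: "h ` P \<subseteq> proj e" using endp(1) by blast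
 have Pbd: "emeasure lebesgue P < \<infinity>"
 proof -
  have "emeasure lebesgue P <= emeasure lebesgue {0..len}"
  proof (rule emeasure_mono)
   show "P \<subseteq> {0..len}" unfolding P_def by (rule subsetI) simp
  qed simp
  thus ?thesis using len_pos by (simp add: le_less_trans)
 qed
 have B0: "0 <= B" using B[of 0] by linarith
 have GP: "G (h t) = g (gam t)" if "t : P" for t unfolding G_def using endp(2)[OF that] by simp
 have intP: "(%t. \<bar>v t\<bar> * G (h t)) absolutely_integrable_on P"
 proof -
  have "set_integrable lebesgue P (%t. \<bar>v t\<bar> * g (gam t))"
   unfolding set_integrable_def
  proof (rule int_bdd_ind[OF Ps _ Pbd, of _ "2 * B"])
   have "(%t. \<bar>v t\<bar> * g (gam t)) : borel_measurable lborel" by measurable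
   thus "(%t. \<bar>v t\<bar> * g (gam t)) : borel_measurable lebesgue" by (rule measurable_completion)
   show "AE x in lebesgue. x : P --> norm (\<bar>v x\<bar> * g (gam x)) <= 2 * B"
   proof (intro AE_I2 impI)
    fix x
    have "\<bar>v x\<bar> * \<bar>g (gam x)\<bar> <= 2 * B"
     using height_bound[of x e] B e by (intro mult_mono) (auto simp: v_def)
    thus "norm (\<bar>v x\<bar> * g (gam x)) <= 2 * B" by (simp add: abs_mult)
   qed
  qed
  moreover have "(%t. indicat_real P t *. (\<bar>v t\<bar> * g (gam t))) = (%t. indicat_real P t *. (\<bar>v t\<bar> * G (h t)))"
   using GP by (auto simp: fun_eq_iff indicator_def)
  ultimately show ?thesis unfolding set_integrable_def by simp
 qed
 have derP: "(h has_field_derivative v t) (at t within P)" if "t : P" for t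
  using der[of t] that by (auto simp: P_def intro: has_field_derivative_at_within)
 have cv: "integral (h ` P) G = integral P (%t. \<bar>v t\<bar> * G (h t))"
  using has_absolute_integral_change_of_variables_1'[OF Ps derP inj, of G] intP by blast
 have "(LINT t:{0..<len}|lborel. max 0 (v t) * g (gam t)) = (LINT t:{0..<len}|lebesgue. max 0 (v t) * g (gam t))"
  unfolding sli_def by (rule integral_completion[symmetric]) measurable
 also have "... = (LINT t:P|lebesgue. \<bar>v t\<bar> * G (h t))"
  unfolding sli_def
 proof (rule integral_cong_AE)
  have "(%t. indicator {0..<len} t *. (max 0 (v t) * g (gam t))) : borel_measurable lborel" by measurable
  thus "(%t. indicator {0..<len} t *. (max 0 (v t) * g (gam t))) : borel_measurable lebesgue" by (rule measurable_completion)
  show "(%t. indicat_real P t *. (\<bar>v t\<bar> * G (h t))) : borel_measurable lebesgue"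
   using intP unfolding set_integrable_def by (rule borel_measurable_integrable)
  have "N Un {0} \<in> null_sets lebesgue" using N(1) by (simp add: negligible_iff_null_sets[symmetric] negligible_Un)
  hence "AE t in lebesgue. t ~: N Un {0}" by (rule AE_not_in)
  thus "AE t in lebesgue. indicator {0..<len} t *. (max 0 (v t) * g (gam t)) = indicat_real P t *. (\<bar>v t\<bar> * G (h t))"
  proof eventually_elim
   case (elim t)
   show ?case
   proof (cases "t : P")
    case True
    thus ?thesis using GP[OF True] by (auto simp: P_def indicator_def)
   next
    case False
    hence "t ~: {0..<len} \<or> v t <= 0" using elim by (auto simp: P_def)
    thus ?thesis using False by (auto simp: indicator_def)
   qed
  qed
 qed
 also have "... = integral P (%t. \<bar>v t\<bar> * G (h t))" by (rule set_lebesgue_integral_eq_integral(2)[OF intP])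
 also have "... = integral (h ` P) G" by (rule cv[symmetric])
 also have "... = integral (proj e) G"
  by (rule integral_spike_set) (use sub miss in \<open>auto intro: negligible_subset simp: Diff_eq_empty_iff[THEN iffD2]\<close>)
 also have "... = (LINT y:proj e|lborel. G y)"
 proof (rule set_lint_eq(2)[symmetric])
  show "set_integrable lborel (proj e) G"
   unfolding set_integrable_def
  proof (rule int_bound[of lborel "%y. B * indicator (proj e) y"])
   show "integrable lborel (%y. B * indicator (proj e) y)"
    using emeasure_bounded_finite[OF bounded_proj[OF e]] open_proj[of e] by (intro integrable_mult_right int_ind) auto
   have [measurable]: "(%y. if y : proj e then hi e y else 0) : borel_fun" by (rule hi_borel[OF e])
   have [measurable]: "proj e : sets borel" using open_proj by simp
   have "(%y. indicator (proj e) y * g (pt e (if y : proj e then hi e y else 0) y)) : borel_fun"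
    unfolding pt_def by measurable
   also have "(%y. indicator (proj e) y * g (pt e (if y : proj e then hi e y else 0) y)) = (%y. indicat_real (proj e) y *. G y)"
    by (auto simp: G_def indicator_def)
   finally show "(%y. indicat_real (proj e) y *. G y) : borel_measurable lborel" by simp
   show "AE y in lborel. norm (indicat_real (proj e) y *. G y) <= norm (B * indicator (proj e) y)"
    using B B0 by (intro AE_I2) (auto simp: G_def indicator_def)
  qed
 qed
 finally show ?thesis by (simp add: v_def G_def)
qed

text \<open>The height derivative is the difference of its positive parts for \<open>e\<close> and
  for \<open>- e\<close>; the second one runs through left endpoints after the reflection
  \<open>y \<mapsto> - y\<close>.\<close>

lemma line_integral:
 fixes g :: "plane => real"
 assumes e: "norm e = 1" and g[measurable]: "g : borel_fun" and B: "!!x. \<bar>g x\<bar> <= B"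
 shows "(LINT t:{0..<len}|lborel. (tangent t @. rot e) * g (gam t)) =
  (LINT y:proj e|lborel. g (pt e (hi e y) y)) - (LINT y:proj e|lborel. g (pt e (lo e y) y))"
proof -
 have i: "set_integrable lborel {0..<len} (%t. max 0 (tangent t @. rot d) * g (gam t))" if d: "norm d = 1" for d
  unfolding set_integrable_def
 proof (rule int_bdd_ind[of _ _ _ "2 * B"])
  show "AE x in lborel. x : {0..<len} --> norm (max 0 (tangent x @. rot d) * g (gam x)) <= 2 * B"
  proof (intro AE_I2 impI)
   fix x
   have "\<bar>max 0 (tangent x @. rot d)\<bar> * \<bar>g (gam x)\<bar> <= 2 * B"
    using height_bound[of x d] B d by (intro mult_mono) auto
   thus "norm (max 0 (tangent x @. rot d) * g (gam x)) <= 2 * B" by (simp add: abs_mult)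
  qed
  show "(%x. max 0 (tangent x @. rot d) * g (gam x)) : borel_measurable lborel" by measurable
 qed (use len_pos in auto)
 have "(LINT t:{0..<len}|lborel. (tangent t @. rot e) * g (gam t)) =
   (LINT t:{0..<len}|lborel. max 0 (tangent t @. rot e) * g (gam t) - max 0 (tangent t @. rot (- e)) * g (gam t))"
  unfolding sli_def
  by (intro lint_cong refl) (simp add: rot_uminus max_def algebra_simps)
 also have "... = (LINT t:{0..<len}|lborel. max 0 (tangent t @. rot e) * g (gam t)) - (LINT t:{0..<len}|lborel. max 0 (tangent t @. rot (- e)) * g (gam t))"
  by (rule set_integral_diff(2)) (use i e in auto)
 also have "(LINT t:{0..<len}|lborel. max 0 (tangent t @. rot (- e)) * g (gam t)) = (LINT y:proj (- e)|lborel. g (pt (- e) (hi (- e) y) y))"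
  by (rule line_integral_right[OF _ g B]) (use e in simp)
 also have "... = (LINT y|lborel. indicator (proj (- e)) (0 + (-1) * y) *. g (pt (- e) (hi (- e) (0 + (-1) * y)) (0 + (-1) * y)))"
  unfolding sli_def by (subst lborel_integral_real_affine[where c="-1" and t=0]) simp_all
 also have "... = (LINT y:proj e|lborel. g (pt e (lo e y) y))"
  unfolding sli_def
  by (intro lint_cong refl) (auto simp: indicator_def proj_uminus pt_uminus lo_def)
 also have "(LINT t:{0..<len}|lborel. max 0 (tangent t @. rot e) * g (gam t)) = (LINT y:proj e|lborel. g (pt e (hi e y) y))"
  by (rule line_integral_right[OF e g B])
 finally show ?thesis .
qed

end

text \<open>In the application \<open>u\<close> has only bounded variation, so
  \<open>K x (u x)\<close> cannot be differentiated by the chain rule. On each of \<open>n\<close>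
  cells \<open>u\<close> is frozen at its left value \<open>r\<close>, and \<open>K x r\<close> is
  differentiated exactly. Unfreezing costs \<open>S * v i\<close> in the boundary term and
  \<open>S' * v i * h\<close> in the integral. The second kind sums to a multiple of
  \<open>1 / n\<close>, the first remains as \<open>S * W\<close>.\<close>

lemma variation_estimate:
 fixes u :: "real => real" and k K :: "real => real => real"
 assumes bc: "b <= c" and int: "(%x. k x (u x)) integrable_on {b..c}"
  and u: "!!x. u x : R"
  and der: "!!x r. r : R ==> ((%x. K x r) has_real_derivative k x r) (at x)"
  and K: "!!x r r'. r : R ==> r' : R ==> \<bar>K x r - K x r'\<bar> <= S * \<bar>r - r'\<bar>"
  and k: "!!x r r'. r : R ==> r' : R ==> \<bar>k x r - k x r'\<bar> <= S' * \<bar>r - r'\<bar>"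
  and S: "0 <= S" "0 <= S'"
  and osc: "!!n::nat. 0 < n ==> EX v. sum v {..<n} \<le> W &
   (ALL i<n. ALL x:{b + real i * ((c - b) / n)..b + real (Suc i) * ((c - b) / n)}.
    ALL x':{b + real i * ((c - b) / n)..b + real (Suc i) * ((c - b) / n)}. \<bar>u x - u x'\<bar> <= v i)"
 shows "\<bar>integral {b..c} (%x. k x (u x)) - (K c (u c) - K b (u b))\<bar> <= S * W"
proof (rule LIMSEQ_le_const[of "%n. S * W + S' * W * (c - b) / real n"])
 have "(%n. S * W + S' * W * (c - b) / real n) \<longlonglongrightarrow> S * W + 0" by (intro tendsto_intros lim_const_over_n)
 thus "(%n. S * W + S' * W * (c - b) / real n) \<longlonglongrightarrow> S * W" by simp
 have "\<bar>integral {b..c} (%x. k x (u x)) - (K c (u c) - K b (u b))\<bar> <= S * W + S' * W * (c - b) / real n" if n: "0 < n" for n :: nat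
 proof -
  define h where "h = (c - b) / real n"
  define x where "x = (%i. b + real i * h)"
  have h: "0 <= h" using bc by (simp add: h_def)
  have xS: "x (Suc i) = x i + h" for i by (simp add: x_def algebra_simps)
  have xm: "i <= j ==> x i <= x j" for i j using h by (simp add: x_def mult_right_mono)
  have x0: "x 0 = b" "x n = c" using n by (simp_all add: x_def h_def)
  obtain v where v: "sum v {..<n} \<le> W" "!!i y y'. i < n ==> y : {x i..x (Suc i)} ==> y' : {x i..x (Suc i)} ==> \<bar>u y - u y'\<bar> <= v i"
   using osc[OF n] unfolding x_def h_def by blast
  define f where "f = (%t. k t (u t))"
  have fi: "f integrable_on {x i..x j}" if "i <= j" "j <= n" for i j
   using int xm[of 0 i] xm[of j n] that unfolding f_def x0 by (auto intro: integrable_on_subinterval)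
  have sum: "integral {x 0..x m} f = (\<Sum>i<m. integral {x i..x (Suc i)} f)" if "m <= n" for m
   using that
  proof (induction m)
   case (Suc m)
   have "integral {x 0..x (Suc m)} f = integral {x 0..x m} f + integral {x m..x (Suc m)} f"
    using Suc.prems by (intro hk_combine[symmetric] xm fi) auto
   thus ?case using Suc by simp
  qed simp
  have piece: "\<bar>integral {x i..x (Suc i)} f - (K (x (Suc i)) (u (x (Suc i))) - K (x i) (u (x i)))\<bar> <= S * v i + S' * v i * h" if i: "i < n" for i
  proof -
   define r where "r = u (x i)"
   have xi: "x i <= x (Suc i)" by (rule xm) simp
   have "((%t. k t r) has_integral (K (x (Suc i)) r - K (x i) r)) {x i..x (Suc i)}"
    using der[OF u[of "x i"]] xi unfolding r_def
    by (intro fundamental_theorem_of_calculus) (auto simp: has_real_derivative_iff_has_vector_derivative intro: has_vector_derivative_at_within)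
   moreover have "(f has_integral integral {x i..x (Suc i)} f) {x i..x (Suc i)}"
    using fi[of i "Suc i"] i by (simp add: integrable_integral)
   ultimately have "((%t. f t - k t r) has_integral (integral {x i..x (Suc i)} f - (K (x (Suc i)) r - K (x i) r))) {x i..x (Suc i)}"
    by (rule has_integral_diff[rotated])
   moreover have "norm (f t - k t r) <= S' * v i" if t: "t : cbox (x i) (x (Suc i))" for t
   proof -
    have "norm (f t - k t r) <= S' * \<bar>u t - r\<bar>" using k[OF u u] by (simp add: f_def r_def)
    also have "\<bar>u t - r\<bar> <= v i" unfolding r_def using t xi i by (intro v(2)) (auto)
    finally show ?thesis using S(2) by (meson mult_left_mono order_trans t)
   qed
   moreover have "0 <= S' * v i" using v(2)[OF i, of "x i" "x i"] xi S(2) by simp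
   ultimately have "norm (integral {x i..x (Suc i)} f - (K (x (Suc i)) r - K (x i) r)) <= S' * v i * measure lborel (cbox (x i) (x (Suc i)))"
    by (intro has_integral_bound) auto
   hence 1: "\<bar>integral {x i..x (Suc i)} f - (K (x (Suc i)) r - K (x i) r)\<bar> <= S' * v i * h"
    using xi h by (simp add: xS)
   have "\<bar>K (x (Suc i)) r - K (x (Suc i)) (u (x (Suc i)))\<bar> <= S * \<bar>r - u (x (Suc i))\<bar>" unfolding r_def by (rule K[OF u u])
   also have "... <= S * v i" unfolding r_def using v(2)[OF i] xi S by (intro mult_left_mono) auto
   finally show ?thesis using 1 unfolding r_def by linarith
  qed
  have "integral {b..c} f - (K c (u c) - K b (u b)) = (\<Sum>i<n. integral {x i..x (Suc i)} f - (K (x (Suc i)) (u (x (Suc i))) - K (x i) (u (x i))))"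
   unfolding sum_subtractf[of "%i. integral {x i..x (Suc i)} f"] sum_lessThan_telescope[of "%i. K (x i) (u (x i))" n] using sum[of n] by (simp only: x0 order_refl)
  also have "\<bar>...\<bar> <= (\<Sum>i<n. S * v i + S' * v i * h)" using piece by (intro order_trans[OF sum_abs] sum_mono) auto
  also have "... = (S + S' * h) * sum v {..<n}" by (simp add: sum_distrib_left sum.distrib[symmetric] algebra_simps)
  also have "... <= (S + S' * h) * W" using v(1) S h by (intro mult_left_mono) auto
  also have "... = S * W + S' * W * (c - b) / real n" by (simp add: h_def algebra_simps)
  finally show ?thesis unfolding f_def .
 qed
 thus "EX N. ALL n>=N. \<bar>integral {b..c} (%x. k x (u x)) - (K c (u c) - K b (u b))\<bar> <= S * W + S' * W * (c - b) / real n"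
  by (intro exI[of _ 1]) auto
qed

context convex_curve begin

section \<open>The closest-point retraction onto the closed domain\<close>

definition ret :: "plane => plane" where "ret = closest_point (closure Om)"
definition gap :: "plane => real" where "gap x = dist x (ret x)"

lemma cl_ne: "closure Om ~= {}" using ne_Om by simp

lemma ret_mem: "ret x : closure Om"
 unfolding ret_def using cl_ne by (rule closest_point_in_set[OF closed_closure])

lemma ret_cont: "continuous_on S ret"
 unfolding ret_def by (rule continuous_on_closest_point) (auto simp: convex_closure convex_Om ne_Om)

lemma ret_borel [measurable]: "ret : borel_fun"
 by (rule borel_contI[OF ret_cont])

lemma gap_le: "y : closure Om ==> gap x <= dist x y"
 unfolding gap_def ret_def by (rule closest_point_le) auto

lemma gap_cont: "continuous_on S gap"
 unfolding gap_def by (intro continuous_intros ret_cont)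

lemma gap_borel [measurable]: "gap : borel_fun"
 by (rule borel_contI[OF gap_cont])

lemma gap_nonneg: "0 <= gap x" by (simp add: gap_def)

lemma ret_self: "x : closure Om ==> ret x = x" by (simp add: ret_def closest_point_self)

lemma gap_0_iff: "gap x = 0 \<longleftrightarrow> x : closure Om"
 using ret_mem[of x] ret_self[of x] by (auto simp: gap_def)

lemma closure_eq: "closure Om = Om Un frontier Om"
 using closure_subset[of Om] open_Om by (auto simp: frontier_def interior_open)

lemma frontier_disj: "x : frontier Om ==> x ~: Om"
 using open_Om by (auto simp: frontier_def interior_open)

lemma nbhd1_eq: "nbhd1 Om = {x. gap x < 1}"
proof
 show "nbhd1 Om \<subseteq> {x. gap x < 1}"
 proof
  fix x assume "x : nbhd1 Om"
  then obtain y where "y : Om" "dist y x < 1" by (auto simp: nbhd1_def)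
  thus "x : {x. gap x < 1}" using gap_le[of y x] closure_subset[of Om] by (auto simp: dist_commute)
 qed
 show "{x. gap x < 1} \<subseteq> nbhd1 Om"
 proof
  fix x assume "x : {x. gap x < 1}"
  hence "0 < 1 - gap x" by simp
  then obtain y where y: "y : Om" "dist y (ret x) < 1 - gap x" using ret_mem[of x] unfolding closure_approachable by blast
  have "dist y x <= dist y (ret x) + dist (ret x) x" by (rule dist_triangle)
  hence "dist y x < 1" using y(2) by (simp add: gap_def dist_commute)
  thus "x : nbhd1 Om" using y(1) by (auto simp: nbhd1_def)
 qed
qed

lemma ret_frontier:
 assumes "x ~: Om" shows "ret x : frontier Om"
proof (cases "x : closure Om")
 case True
 thus ?thesis using assms ret_self closure_eq by auto
next
 case False
 have "ret x ~: Om"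
 proof
  assume r: "ret x : Om"
  then obtain d where d: "0 < d" "ball (ret x) d \<subseteq> Om" using open_Om open_contains_ball by blast
  have ne: "x ~= ret x" using False ret_mem by metis
  define t where "t = min 1 (d / (2 * norm (x - ret x)))"
  have t: "0 < t" "t <= 1" "t * norm (x - ret x) < d"
   using ne d by (auto simp: t_def min_def field_simps)
  define z where "z = ret x + t *. (x - ret x)"
  have "z : Om" using d(2) t by (auto simp: z_def dist_norm)
  hence "gap x <= dist x z" using gap_le closure_subset by blast
  also have "x - z = (1 - t) *. (x - ret x)" by (simp add: z_def algebra_simps)
  hence "dist x z = (1 - t) * gap x" using t by (simp add: dist_norm gap_def)
  finally have "t * gap x <= 0" by (simp add: algebra_simps)
  thus False using t ne by (simp add: gap_def mult_le_0_iff)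
 qed
 thus ?thesis using ret_mem closure_eq by auto
qed

text \<open>Outside the domain the nearest point of the closure lies on the frontier, so both
  projections agree. \<open>bdry_u\<close> is defined with the projection to the frontier, while
  continuity and convexity of the fibres come from projecting to the convex closure.\<close>

lemma closest_frontier:
 assumes x: "x ~: Om" shows "closest_point (frontier Om) x = ret x"
proof -
 let ?q = "closest_point (frontier Om) x"
 have q: "?q : frontier Om" using frontier_ne by (intro closest_point_in_set) (auto simp: frontier_closed)
 have "dist x ?q <= dist x (ret x)" by (rule closest_point_le) (auto simp: frontier_closed ret_frontier x)
 hence "ALL z:closure Om. dist x ?q <= dist x z" using gap_le[of _ x] by (auto simp: gap_def intro: order_trans)
 hence "?q = closest_point (closure Om) x"
  using q by (intro closest_point_unique[OF convex_closure[OF convex_Om] closed_closure]) (auto simp: closure_eq)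
 thus ?thesis by (simp add: ret_def)
qed

text \<open>The nearest point is \<open>q\<close> exactly if \<open>x - q\<close> makes no acute
  angle with \<open>y - q\<close> for any \<open>y\<close> in the closure, a condition that is
  preserved under convex combinations of \<open>x\<close>. It limits how often the retraction of a
  line can return to the same boundary point.\<close>

lemma ret_fibre_convex:
 assumes "ret x = q" "ret x' = q" and uv: "0 <= s" "0 <= t" "s + t = 1"
 shows "ret (s *. x + t *. x') = q"
proof -
 define z where "z = s *. x + t *. x'"
 have q: "q : closure Om" using ret_mem assms(1) by blast
 have zq: "z - q = s *. (x - q) + t *. (x' - q)"
 proof -
  have "q = (s + t) *. q" using uv by simp
  hence "z - q = s *. x + t *. x' - (s + t) *. q" unfolding z_def by simp
  thus ?thesis by (simp add: algebra_simps)
 qed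
 have "dist z q <= dist z y" if y: "y : closure Om" for y
 proof -
  have "(x - q) @. (y - q) <= 0" "(x' - q) @. (y - q) <= 0"
   using closest_point_dot[OF convex_closure[OF convex_Om] closed_closure y, of x] closest_point_dot[OF convex_closure[OF convex_Om] closed_closure y, of x'] assms(1,2)
   unfolding ret_def by simp_all
  hence "(z - q) @. (y - q) <= 0" using uv unfolding zq inner_add_left inner_scaleR_left
   by (intro add_nonpos_nonpos mult_nonneg_nonpos)
  moreover have "(norm (z - y))\<^sup>2 = (norm (z - q))\<^sup>2 - 2 * ((z - q) @. (y - q)) + (norm (y - q))\<^sup>2"
  proof -
   have "z - y = (z - q) - (y - q)" by simp
   moreover have "(norm ((z - q) - (y - q)))\<^sup>2 = (norm (z - q))\<^sup>2 - 2 * ((z - q) @. (y - q)) + (norm (y - q))\<^sup>2"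
    using dot_norm_neg[of "z - q" "y - q"] by simp
   ultimately show ?thesis by simp
  qed
  ultimately have "(norm (z - q))\<^sup>2 <= (norm (z - y))\<^sup>2" using zero_le_power2[of "norm (y - q)"] by linarith
  thus ?thesis unfolding dist_norm by (rule power2_le_imp_le) simp
 qed
 hence "q = closest_point (closure Om) z"
  using q by (intro closest_point_unique) (auto simp: convex_closure convex_Om)
 thus ?thesis by (simp add: ret_def z_def)
qed

lemma gap_sublevel_convex: "convex {x. gap x <= d}"
proof (rule convexI)
 fix x y s t :: real and X Y :: plane
 assume X: "X : {x. gap x <= d}" "Y : {x. gap x <= d}" and st: "0 <= s" "0 <= t" "s + t = 1"
 have "s *. ret X + t *. ret Y : closure Om"
  using convex_closure[OF convex_Om] ret_mem st by (simp add: convexD)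
 hence "gap (s *. X + t *. Y) <= dist (s *. X + t *. Y) (s *. ret X + t *. ret Y)" by (rule gap_le)
 also have "... = norm (s *. (X - ret X) + t *. (Y - ret Y))" by (simp add: dist_norm algebra_simps)
 also have "... <= s * gap X + t * gap Y"
  using norm_triangle_ineq[of "s *. (X - ret X)" "t *. (Y - ret Y)"] st by (simp add: gap_def dist_norm)
 also have "... <= s * d + t * d" using X st by (intro add_mono mult_left_mono) auto
 also have "... = d" using st by (simp flip: distrib_right)
 finally show "s *. X + t *. Y : {x. gap x <= d}" by simp
qed

lemma gap_sublevel_compact: "compact {x. gap x <= d}"
proof -
 have "closed {x. gap x <= d}" by (intro closed_Collect_le gap_cont continuous_intros)
 moreover obtain B where B: "!!x. x : closure Om ==> norm x <= B" using bounded_closure[OF bounded_Om] by (auto simp: bounded_iff)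
 have "norm x <= B + d" if "gap x <= d" for x
  using norm_triangle_ineq[of "x - ret x" "ret x"] B[OF ret_mem[of x]] that by (simp add: gap_def dist_norm)
 hence "bounded {x. gap x <= d}" by (auto simp: bounded_iff)
 ultimately show ?thesis by (simp add: compact_eq_bounded_closed)
qed

text \<open>Deleting a point \<open>a\<close> of the arc and a point \<open>b\<close> off the arc
  leaves two pieces of the circle, with \<open>p\<close> and \<open>q\<close> in different pieces. A
  connected set that contains \<open>p\<close> and \<open>q\<close> therefore cannot miss both
  \<open>a\<close> and \<open>b\<close>.\<close>

lemma arc_in_connected:
 assumes S: "connected S" "S \<subseteq> frontier Om" and pq: "p : S" "q : S" "par p <= par q"
 defines "A \<equiv> {x \<in> frontier Om. par p <= par x & par x < par q}"
 shows "A \<subseteq> S \<or> frontier Om - A \<subseteq> S"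
proof (rule ccontr)
 assume "\<not> ?thesis"
 then obtain a b where a: "a : A" "a ~: S" and b: "b : frontier Om" "b ~: A" "b ~: S" by blast
 have fr: "p : frontier Om" "q : frontier Om" "a : frontier Om" using S pq a by (auto simp: A_def)
 have inj: "par x = par y ==> x : frontier Om ==> y : frontier Om ==> x = y" for x y using gam_par by metis
 have ab: "par p < par a" "par a < par q"
  using a inj[of p a] fr pq by (auto simp: A_def less_le)
 have bo: "par b < par p \<or> par q < par b"
 proof (rule ccontr)
  assume "\<not> ?thesis"
  hence "par b = par q" using b(1,2) by (auto simp: A_def)
  thus False using inj[of b q] fr b pq by auto
 qed
 define l r where "l = min (par a) (par b)" and "r = max (par a) (par b)"
 define E where "E = gam ` {l..r}"
 \<comment> \<open>Including the parameter \<open>len\<close> makes \<open>F\<close> compact; it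
   adds only \<open>gam len = \<gamma> 0\<close>, whose parameter is 0.\<close>
 define F where "F = gam ` ({0..l} Un {r..len})"
 have "compact E" "compact F"
  unfolding E_def F_def by (intro compact_continuous_image continuous_on_subset[OF gam_cont] compact_Un; simp)+
 hence cl: "closed E" "closed F" by (auto intro: compact_imp_closed)
 have in_E: "x : E" if "x : frontier Om" "l <= par x" "par x <= r" for x
  using gam_par[OF that(1)] that(2,3) unfolding E_def by (intro image_eqI[of _ _ "par x"]) auto
 have in_F: "x : F" if "x : frontier Om" "par x <= l \<or> r <= par x" for x
  using gam_par[OF that(1)] that(2) par_range[of x] unfolding F_def by (intro image_eqI[of _ _ "par x"]) auto
 have lr: "0 <= l" "r < len" using par_range by (auto simp: l_def r_def)
 have EF: "x = a \<or> x = b" if xE: "x : E" and xF: "x : F" for x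
 proof -
  obtain s where s: "x = gam s" "l <= s" "s <= r" using xE by (auto simp: E_def)
  have lr': "l <= r" by (simp add: l_def r_def)
  obtain t where "x = gam t" "t : {0..l} Un {r..len}" using xF by (auto simp: F_def)
  hence t: "x = gam t" "0 <= t" "t <= len" "t <= l \<or> r <= t" using lr lr' by auto
  have ps: "par x = s" using s lr par_gam by simp
  have "s = l \<or> s = r"
  proof (cases "t = len")
   case True
   hence "x = gam 0" using t(1) len_pos by (simp add: gam_def)
   hence "par x = 0" using par_gam len_pos by simp
   thus ?thesis using ps s lr by simp
  next
   case False
   hence "par x = t" using t par_gam by simp
   thus ?thesis using ps s t by linarith
  qed
  hence "par x = par a \<or> par x = par b" using ps unfolding l_def r_def by linarith
  moreover have "x : frontier Om" using s(1) gam_mem by simp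
  ultimately show ?thesis using inj fr b(1) by blast
 qed
 have "S \<subseteq> E Un F"
 proof
  fix x assume "x : S"
  thus "x : E Un F" using in_E[of x] in_F[of x] S(2) by (cases "l <= par x & par x <= r") auto
 qed
 moreover have "E Int F Int S = {}" using EF a b by blast
 moreover have "E Int S ~= {}" "F Int S ~= {}"
 proof -
  have "(p : F & q : E) \<or> (p : E & q : F)"
  proof (cases "par b < par p")
   case True
   hence "l = par b" "r = par a" using ab by (auto simp: l_def r_def)
   thus ?thesis using in_E[OF fr(1)] in_F[OF fr(2)] True ab by simp
  next
   case False
   hence "l = par a" "r = par b" using ab bo by (auto simp: l_def r_def)
   thus ?thesis using in_E[OF fr(2)] in_F[OF fr(1)] False bo ab by simp
  qed
  thus "E Int S ~= {}" "F Int S ~= {}" using pq by blast+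
 qed
 ultimately show False using S(1) cl unfolding connected_closed by blast
qed

end

section \<open>The boundary measures and the oscillation of the boundary data\<close>

locale boundary_data = convex_curve +
 fixes \<mu>p \<mu>m :: "plane measure" and M :: real
 assumes radon: "finite_radon_on (frontier Om) \<mu>p" "finite_radon_on (frontier Om) \<mu>m"
  and mass: "measure \<mu>p (frontier Om) = measure \<mu>m (frontier Om)"
  and range: "ALL x:nbhd1 Om - Om. 0 <= bdry_u Om \<gamma> \<mu>p \<mu>m x & bdry_u Om \<gamma> \<mu>p \<mu>m x <= M"
begin

abbreviation bu :: "plane => real" where "bu \<equiv> bdry_u Om \<gamma> \<mu>p \<mu>m"

definition trace :: "plane => real" where "trace q = (if q : frontier Om then bu q else 0)"

sublocale P: finite_measure \<mu>p using radon by (simp add: finite_radon_on_def)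
sublocale N: finite_measure \<mu>m using radon by (simp add: finite_radon_on_def)

lemma sets_mu: "A : sets borel ==> A Int frontier Om : sets \<mu>p" "A : sets borel ==> A Int frontier Om : sets \<mu>m"
 using radon by (auto simp: finite_radon_on_def sets_restrict_space)

lemma ex_total_variation: "EX N. sets N = sets (borel :: plane measure) &
  (ALL A:sets borel. emeasure N A = emeasure \<mu>p (A Int frontier Om) + emeasure \<mu>m (A Int frontier Om))"
proof -
 define D where "D = (%i. if i then distr \<mu>p borel (%x. x) else distr \<mu>m borel (%x. x))"
 obtain N where N: "sets N = sets (borel::plane measure)" "!!A. A : sets borel ==> emeasure N A = (SUM i:UNIV. emeasure (D i) A)"
  by (rule sum_of_measures[of UNIV D borel]) (auto simp: D_def)
 have sp: "space \<mu>p = frontier Om" "space \<mu>m = frontier Om"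
  using radon sets_eq_imp_space_eq[of _ "restrict_space borel (frontier Om)"] by (auto simp: finite_radon_on_def space_restrict_space)
 have meas: "(%x. x) : measurable \<mu>p borel" "(%x. x) : measurable \<mu>m borel"
  using sets_mu by (auto intro!: measurableI simp: sp Int_commute)
 have "emeasure N A = emeasure \<mu>p (A Int frontier Om) + emeasure \<mu>m (A Int frontier Om)" if "A : sets borel" for A
  using N(2)[OF that] meas that by (simp add: D_def UNIV_bool emeasure_distr sp add.commute)
 thus ?thesis using N(1) by blast
qed

text \<open>The sum of both measures, viewed as a Borel measure on the plane, rather than the total
  variation of their difference. It bounds the increments of \<open>trace\<close>.\<close>

definition tv :: "plane measure" where
 "tv = (SOME N. sets N = sets borel &
  (ALL A:sets borel. emeasure N A = emeasure \<mu>p (A Int frontier Om) + emeasure \<mu>m (A Int frontier Om)))"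

lemma sets_tv [simp, measurable_cong]: "sets tv = sets borel"
 and emeasure_tv: "A : sets borel ==> emeasure tv A = emeasure \<mu>p (A Int frontier Om) + emeasure \<mu>m (A Int frontier Om)"
 using someI_ex[OF ex_total_variation] unfolding tv_def by auto

lemma space_tv [simp]: "space tv = UNIV" using sets_eq_imp_space_eq[OF sets_tv] by simp

sublocale T: finite_measure tv
proof
 show "emeasure tv (space tv) ~= \<infinity>"
  by (simp add: emeasure_tv P.emeasure_eq_measure N.emeasure_eq_measure flip: ennreal_plus)
qed

lemma measure_tv: "A : sets borel ==> measure tv A = measure \<mu>p (A Int frontier Om) + measure \<mu>m (A Int frontier Om)"
 using emeasure_tv[of A] by (simp add: P.emeasure_eq_measure N.emeasure_eq_measure T.emeasure_eq_measure flip: ennreal_plus)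

definition arc :: "real => plane set" where "arc t = {x \<in> frontier Om. par x < t}"

lemma arc_sets: "arc t : sets borel" "arc t : sets \<mu>p" "arc t : sets \<mu>m"
 using arc_borel'[of t] sets_mu[of "arc t"] by (auto simp: arc_def Int_absorb2 Collect_restrict)

lemma bu_ret: "x ~: Om ==> bu x = trace (ret x)"
 using closest_frontier[of x] closest_frontier[OF frontier_disj[OF ret_frontier]] ret_frontier[of x] ret_self[of "ret x"] ret_mem[of x]
 by (simp add: bdry_u_def trace_def)

lemma trace_eq: "q : frontier Om ==> trace q = measure \<mu>p (arc (par q)) - measure \<mu>m (arc (par q))"
proof -
 assume q: "q : frontier Om"
 have "closest_point (frontier Om) q = q" using q by (rule closest_point_self)
 moreover have "\<gamma> ` {0..<par q} = arc (par q)"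
 proof
  show "\<gamma> ` {0..<par q} \<subseteq> arc (par q)"
   using \<gamma>_mem par_gam gam_eq par_range[of q] by (auto simp: arc_def)
  show "arc (par q) \<subseteq> \<gamma> ` {0..<par q}"
  proof
   fix x assume "x : arc (par q)"
   hence "x = \<gamma> (par x)" "par x : {0..<par q}" using gam_par[of x] gam_eq[of "par x"] par_range[of x] by (auto simp: arc_def)
   thus "x : \<gamma> ` {0..<par q}" by (rule image_eqI)
  qed
 qed
 ultimately show ?thesis using q by (simp add: trace_def bdry_u_def par_def[of q] len_def Let_def)
qed

lemma trace_bounds: "0 <= trace q" "trace q <= M"
proof -
 have fr: "p : nbhd1 Om - Om" if "p : frontier Om" for p
  using that frontier_disj[OF that] gap_0_iff[of p] closure_eq by (auto simp: nbhd1_eq)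
 thus "0 <= trace q" using range by (auto simp: trace_def)
 obtain p where "p : frontier Om" using frontier_ne by blast
 hence "0 <= M" using fr range by (meson order_trans)
 thus "trace q <= M" using fr range by (auto simp: trace_def)
qed

lemma M_nonneg: "0 <= M" using trace_bounds order_trans by blast

lemma trace_borel [measurable]: "trace : borel_fun"
proof -
 define F where "F = (%t. measure \<mu>p (arc t))"
 define G where "G = (%t. measure \<mu>m (arc t))"
 have "mono F" "mono G" unfolding F_def G_def
  by (auto intro!: monoI P.finite_measure_mono N.finite_measure_mono arc_sets) (auto simp: arc_def)
 hence [measurable]: "F : borel_fun" "G : borel_fun" by (auto intro: borel_measurable_mono)
 have "trace = (%q. if q : frontier Om then F (par q) - G (par q) else 0)"
  using trace_eq by (auto simp: F_def G_def trace_def fun_eq_iff)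
 also have "... : borel_fun" by (intro measurable_If_set) (auto simp: borel_closed)
 finally show ?thesis .
qed

text \<open>An increment of \<open>trace\<close> is the signed mass of the arc between the two
  parameters. By equality of the total masses it is also minus the signed mass of the complementary
  arc, and the connected set \<open>S\<close> contains one of the two arcs.\<close>

lemma trace_diff_le:
 assumes S: "connected S" "compact S" "S \<subseteq> frontier Om" and pq: "p : S" "q : S"
 shows "\<bar>trace p - trace q\<bar> <= measure tv S"
proof -
 have *: "\<bar>trace p - trace q\<bar> <= measure tv S" if pq: "p : S" "q : S" and le: "par p <= par q" for p q
 proof -
  define A where "A = arc (par q) - arc (par p)"
  have A: "A = {x \<in> frontier Om. par p <= par x & par x < par q}" by (auto simp: A_def arc_def)
  have fr: "p : frontier Om" "q : frontier Om" using pq S by auto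
  have sub: "arc (par p) \<subseteq> arc (par q)" using le by (auto simp: arc_def)
  have Ab: "A : sets borel" "A : sets \<mu>p" "A : sets \<mu>m" unfolding A_def by (intro sets.Diff arc_sets)+
  have fb: "frontier Om : sets borel" "frontier Om : sets \<mu>p" "frontier Om : sets \<mu>m"
   using sets_mu[of UNIV] by (auto simp: borel_closed)
  have "trace q - trace p = measure \<mu>p A - measure \<mu>m A"
   unfolding A_def using fr sub arc_sets by (simp add: trace_eq P.finite_measure_Diff N.finite_measure_Diff)
  moreover have "measure \<mu>p (frontier Om - A) - measure \<mu>m (frontier Om - A) = - (measure \<mu>p A - measure \<mu>m A)"
  proof -
   have "A \<subseteq> frontier Om" by (auto simp: A)
   thus ?thesis using P.finite_measure_Diff[OF fb(2) Ab(2)] N.finite_measure_Diff[OF fb(3) Ab(3)] mass by simp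
  qed
  moreover have *: "\<bar>measure \<mu>p B - measure \<mu>m B\<bar> <= measure tv S" if "B \<subseteq> S" "B : sets borel" for B
  proof -
   have "B Int frontier Om = B" using that S by auto
   hence "\<bar>measure \<mu>p B - measure \<mu>m B\<bar> <= measure tv B"
    using measure_tv[OF that(2)] measure_nonneg[of \<mu>p B] measure_nonneg[of \<mu>m B] by (simp del: measure_nonneg add: abs_le_iff)
   also have "... <= measure tv S" using that S(2) by (intro T.finite_measure_mono) (auto simp: borel_compact)
   finally show ?thesis .
  qed
  moreover have "A \<subseteq> S \<or> frontier Om - A \<subseteq> S" using arc_in_connected[OF S(1,3) pq le] unfolding A .
  ultimately show ?thesis using *[of A] *[of "frontier Om - A"] Ab(1) sets.Diff[OF fb(1) Ab(1)] by linarith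
 qed
 show ?thesis using *[OF pq] *[OF pq(2,1)] by (cases "par p <= par q") (auto simp: abs_minus_commute)
qed

text \<open>On a cell the oscillation of the data is at most the mass of the image of the cell under
  the retraction. These images overlap at most twice: fibres on a line are intervals, so if three
  cells hit the same point, the middle one is retracted to that point alone. Since the line stays
  within distance \<open>d\<close> of the closed domain, all images lie in the strip of width
  \<open>d\<close> on either side of it.\<close>

lemma oscillation:
 assumes e: "norm e = 1" and bc: "b <= c" and out: "!!a. a : {b..c} ==> pt e a y ~: Om" and d: "!!a. a : {b..c} ==> gap (pt e a y) <= d"
  and n: "0 < (n::nat)"
 shows "EX v. sum v {..<n} \<le> 2 * measure tv {q. \<bar>q @. rot e - y\<bar> <= d} &
   (ALL i<n. ALL x:{b + real i * ((c - b) / n)..b + real (Suc i) * ((c - b) / n)}.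
    ALL x':{b + real i * ((c - b) / n)..b + real (Suc i) * ((c - b) / n)}. \<bar>trace (ret (pt e x y)) - trace (ret (pt e x' y))\<bar> <= v i)"
proof -
 define h where "h = (c - b) / real n"
 define x where "x = (%i. b + real i * h)"
 define f where "f = (%a. ret (pt e a y))"
 define I where "I = (%i. {x i..x (Suc i)})"
 \<comment> \<open>A cell retracted to a single point has no oscillation and is given no mass;
   arbitrarily many cells may share such a point.\<close>
 define B where "B = (%i. if f constant_on I i then {} else f ` I i)"
 define T where "T = {q. \<bar>q @. rot e - y\<bar> <= d}"
 have h: "0 <= h" using bc by (simp add: h_def)
 have xm: "i <= j ==> x i <= x j" for i j using h by (simp add: x_def mult_right_mono)
 have x0: "x 0 = b" "x n = c" using n by (simp_all add: x_def h_def)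
 have I: "I i \<subseteq> {b..c}" if "i < n" for i using xm[of 0 i] xm[of "Suc i" n] that by (auto simp: I_def x0)
 have fc: "continuous_on A f" for A unfolding f_def
  by (intro continuous_on_compose2[OF ret_cont[of UNIV]] continuous_on_compose2[OF pt_cont, of _ "%a. (a, y)", simplified] continuous_intros) auto
 have ft: "f a : frontier Om Int T" if "a : {b..c}" for a
 proof -
  have "\<bar>(f a - pt e a y) @. rot e\<bar> <= norm (f a - pt e a y) * norm (rot e)" by (rule Cauchy_Schwarz_ineq2)
  also have "norm (rot e) = 1" using e by (simp add: norm_eq_sqrt_inner rot_inner)
  also have "norm (f a - pt e a y) = gap (pt e a y)" by (simp add: gap_def f_def dist_norm norm_minus_commute)
  finally show ?thesis using d[OF that] ret_frontier[OF out[OF that]] pt_coords(2)[OF e, of a y]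
   by (simp add: T_def f_def inner_diff_left)
 qed
 have Bc: "compact (B i)" "connected (B i)" for i
  by (auto simp: B_def I_def intro!: compact_continuous_image connected_continuous_image fc)
 have Bs: "B i \<subseteq> frontier Om Int T" if "i < n" for i using ft I[OF that] by (auto simp: B_def)
 have fib: "f a = q" if "f z = q" "f z' = q" "z <= a" "a <= z'" for z z' a q
 proof (cases "z = z'")
  case False
  define t where "t = (a - z) / (z' - z)"
  have t: "0 <= t" "t <= 1" "t * (z' - z) = a - z" using that(3,4) False by (auto simp: t_def divide_simps)
  have "(1 - t) * z + t * z' = a" using t(3) by (simp add: algebra_simps)
  hence "(1 - t) *. pt e z y + t *. pt e z' y = pt e a y" by (subst pt_comb) auto
  moreover have "ret ((1 - t) *. pt e z y + t *. pt e z' y) = q"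
   using that t by (intro ret_fibre_convex) (auto simp: f_def)
  ultimately show ?thesis by (simp add: f_def)
 qed (use that in auto)
 have card2: "card {i. i < n & q : B i} <= 2" for q
 proof -
  define J where "J = {i. i < n & q : B i}"
  have no3: False if "i : J" "j : J" "k : J" "i < j" "j < k" for i j k
  proof -
   have "q : f ` I i" "q : f ` I k" using that(1,3) by (auto simp: J_def B_def split: if_splits)
   then obtain z z' where z: "z : I i" "f z = q" and z': "z' : I k" "f z' = q" by fastforce
   have "f a = q" if a: "a : I j" for a
    using fib[OF z(2) z'(2), of a] a z(1) z'(1) xm[of "Suc i" j] xm[of "Suc j" k] \<open>i < j\<close> \<open>j < k\<close> by (auto simp: I_def)
   hence "f constant_on I j" by (auto simp: constant_on_def)
   thus False using that(2) by (simp add: J_def B_def)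
  qed
  have "J \<subseteq> {Min J, Max J}"
  proof
   fix j assume j: "j : J"
   have fJ: "finite J" by (simp add: J_def)
   have "Min J : J" "Max J : J" "Min J <= j" "j <= Max J" using fJ j by (auto intro: Min_in Max_in)
   thus "j : {Min J, Max J}" using no3[of "Min J" j "Max J"] j by (auto simp: less_le)
  qed
  hence "card J <= card {Min J, Max J}" by (intro card_mono) auto
  also have "... <= 2" by (simp add: card_insert_if)
  finally show ?thesis by (simp add: J_def)
 qed
 have Tb: "T : sets borel" unfolding T_def by measurable
 have Bb: "B i : sets borel" for i using Bc(1) by (rule borel_compact)
 have "(\<Sum>i<n. measure tv (B i)) = (\<Sum>i<n. \<integral>q. indicator (B i) q \<partial>tv)" using Bb by simp
 also have "... = (LINT q|tv. (\<Sum>i<n. indicator (B i) q))"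
  using Bb by (intro Bochner_Integration.integral_sum[symmetric] int_ind) (auto simp: T.emeasure_eq_measure)
 also have "... <= (LINT q|tv. 2 * indicator T q)"
 proof (rule integral_mono)
  show "integrable tv (%q. \<Sum>i<n. indicator (B i) q :: real)"
   using Bb by (intro Bochner_Integration.integrable_sum int_ind) (auto simp: T.emeasure_eq_measure)
  show "integrable tv (%q. 2 * indicator T q :: real)"
   using Tb by (intro integrable_mult_right int_ind) (auto simp: T.emeasure_eq_measure)
  fix q
  have "(\<Sum>i<n. indicator (B i) q :: real) = real (card {i. i < n & q : B i})"
   by (simp add: indicator_def sum.If_cases Int_def lessThan_def)
  also have "... <= 2 * indicator T q"
  proof (cases "q : T")
   case True
   thus ?thesis using card2[of q] by simp
  next
   case False
   hence "{i. i < n & q : B i} = {}" using Bs by blast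
   thus ?thesis by (simp only: card.empty) simp
  qed
  finally show "(\<Sum>i<n. indicator (B i) q :: real) <= 2 * indicator T q" .
 qed
 also have "... = 2 * measure tv T" using Tb by simp
 finally have 1: "(\<Sum>i<n. measure tv (B i)) <= 2 * measure tv T" .
 have 2: "\<bar>trace (f z) - trace (f z')\<bar> <= measure tv (B i)" if "i < n" "z : I i" "z' : I i" for i z z'
 proof (cases "f constant_on I i")
  case True
  hence "f z = f z'" using that by (auto simp: constant_on_def)
  thus ?thesis by simp
 next
  case False
  hence "f z : B i" "f z' : B i" using that by (auto simp: B_def)
  thus ?thesis using Bs[OF that(1)] by (intro trace_diff_le Bc) auto
 qed
 show ?thesis using 1 2 unfolding T_def f_def I_def x_def h_def by (intro exI[of _ "%i. measure tv (B i)"]) (auto simp: B_def f_def I_def x_def h_def)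
qed

end

section \<open>Integration by parts\<close>

lemma parametric_integral_derivative:
 fixes f f' :: "real \<times> real => real"
 assumes "continuous_on UNIV f" "continuous_on UNIV f'"
  and "!!a s. ((%a. f (a, s)) has_real_derivative f' (a, s)) (at a)"
 shows "((%a. integral {l..r} (%s. f (a, s))) has_real_derivative integral {l..r} (%s. f' (a, s))) (at a)"
proof -
 have "((%a. integral (cbox l r) (%s. f (a, s))) has_field_derivative integral (cbox l r) (%s. f' (a, s))) (at a within UNIV)"
 proof (rule leibniz_rule_field_derivative)
  show "(%s. f (x, s)) integrable_on cbox l r" for x
   by (intro integrable_continuous continuous_on_compose2[OF assms(1)] continuous_intros) auto
  show "continuous_on (UNIV \<times> cbox l r) (%(x, t). f' (x, t))"
   unfolding case_prod_unfold prod.collapse by (rule continuous_on_subset[OF assms(2)]) simp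
 qed (use assms(3) in auto)
 thus ?thesis by simp
qed

lemma integral_upper_limit_lipschitz:
 fixes g :: "real => real"
 assumes g: "continuous_on UNIV g" "!!s. \<bar>g s\<bar> <= S" and r: "l <= r" "l <= r'"
 shows "\<bar>integral {l..r} g - integral {l..r'} g\<bar> <= S * \<bar>r - r'\<bar>"
proof -
 have gi: "g integrable_on {a..b}" for a b by (rule integrable_continuous_real) (rule continuous_on_subset[OF g(1)], simp)
 have *: "\<bar>integral {l..r} g - integral {l..r'} g\<bar> <= S * \<bar>r - r'\<bar>" if "l <= r" "r <= r'" for r r'
 proof -
  have "integral {l..r'} g = integral {l..r} g + integral {r..r'} g"
   using that by (intro hk_combine[symmetric] gi)
  moreover have "norm (integral {r..r'} g) <= S * (r' - r)"
   using that g(2) by (intro integral_bound continuous_on_subset[OF g(1)]) auto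
  ultimately show ?thesis using that by simp
 qed
 show ?thesis using *[of r r'] *[of r' r] r by (cases "r <= r'") (auto simp: abs_minus_commute)
qed

lemma zero_on_closure:
 fixes g :: "real => real"
 assumes "continuous_on UNIV g" "!!a. a : A ==> g a = 0" "b : closure A"
 shows "g b = 0"
proof -
 have "closed {a. g a = 0}" using assms(1) by (intro closed_Collect_eq continuous_intros) auto
 hence "closure A \<subseteq> {a. g a = 0}" using assms(2) by (intro closure_minimal) auto
 thus ?thesis using assms(3) by auto
qed

lemma integral_below:
 fixes g :: "real => real"
 assumes g: "continuous_on UNIV g" "!!s. s <= l ==> g s = 0"
 shows "(LINT s|lborel. of_bool (s < r) * g s) = integral {l..r} g"
proof -
 have "(LINT s|lborel. of_bool (s < r) * g s) = (LINT s:{l..r}|lborel. g s)"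
  unfolding sli_def
 proof (rule integral_cong_AE)
  have [measurable]: "g : borel_fun" by (rule borel_contI[OF g(1)])
  show "(%s. of_bool (s < r) * g s) : borel_measurable lborel" by measurable
  show "(%s. indicat_real {l..r} s *. g s) : borel_measurable lborel" by measurable
  show "AE s in lborel. of_bool (s < r) * g s = indicat_real {l..r} s *. g s"
   by (rule AE_mp[OF AE_lborel_singleton[of r]], rule AE_I2) (auto simp: indicator_def not_le g(2))
 qed
 also have "... = integral {l..r} g"
  by (rule set_lint_eq(2)[OF borel_integrable_atLeastAtMost']) (rule continuous_on_subset[OF g(1)], simp)
 finally show ?thesis .
qed

context boundary_data begin

text \<open>The top of the prescribed subgraph: the boundary data outside the domain, continued by 0
  over the domain, where the prescribed region of value 1 is \<open>s < 0\<close>.\<close>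

definition height :: "plane => real" where "height x = (if x : Om then 0 else trace (ret x))"

lemma height_bounds: "0 <= height x" "height x <= M"
 using trace_bounds M_nonneg by (auto simp: height_def)

lemma height_borel [measurable]: "height : borel_fun"
 unfolding height_def by (intro measurable_If_set) (use open_Om in auto)

lemma height_eq: "height x = (if x : Om then 0 else bu x)"
 by (simp add: height_def bu_ret)

definition strip :: "plane => real => real => plane set" where
 "strip e d y = {q. \<bar>q @. rot e - y\<bar> <= d}"

definition side_fn :: "(plane \<times> real => real) => plane => real" where
 "side_fn f x = (LINT s|lborel. of_bool (0 < s & s < trace x) * f (x, s))"

lemma side_fn_integral:
 assumes f: "continuous_on UNIV f"
 shows "side_fn f x = integral {0..trace x} (%s. f (x, s))"
proof -
 have fs: "continuous_on A (%s. f (x, s))" for A by (intro continuous_on_compose2[OF f] continuous_intros) simp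
 have "side_fn f x = (LINT s:{0<..<trace x}|lborel. f (x, s))"
  unfolding side_fn_def sli_def
  by (intro lint_cong) (auto simp: indicator_def)
 also have "... = integral {0<..<trace x} (%s. f (x, s))"
  by (rule set_lint_eq(2), rule set_integrable_subset[OF borel_integrable_atLeastAtMost'[OF fs[of "{0..trace x}"]]]) auto
 finally show ?thesis using integral_open_interval_real[of 0 "trace x" "%s. f (x, s)"] by simp
qed

text \<open>By convexity the line meets \<open>gap x \<le> d\<close> in one segment
  \<open>{b..c}\<close>. If it crosses the domain between \<open>l\<close> and \<open>h\<close>, the
  integral over the inner part is exact, since the height is 0 there, and
  \<open>variation_estimate\<close> handles the two outer parts; each contributes two strip masses,
  hence the factor 4. The jumps of the height between the data and 0 at \<open>l\<close> and
  \<open>h\<close> leave the vertical integrals \<open>side_fn\<close>.\<close>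

lemma line_estimate:
 fixes f f' :: "plane \<times> real => real"
 assumes e: "norm e = 1" and T: "0 <= T"
  and cont: "continuous_on UNIV f" "continuous_on UNIV f'"
  and der: "!!a s. ((%a. f (pt e a y, s)) has_real_derivative f' (pt e a y, s)) (at a)"
  and low: "!!x s. s <= - T ==> f (x, s) = 0 & f' (x, s) = 0"
  and supp: "!!x s. d < gap x ==> f (x, s) = 0 & f' (x, s) = 0"
  and bd: "!!z. \<bar>f z\<bar> <= S" "!!z. \<bar>f' z\<bar> <= S'" and d: "0 <= d"
 shows "\<bar>(LINT a|lborel. LINT s|lborel. of_bool (s < height (pt e a y)) * f' (pt e a y, s))
   + (if y : proj e then side_fn f (pt e (hi e y) y) - side_fn f (pt e (lo e y) y) else 0)\<bar> <= S * (4 * measure tv (strip e d y))"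
proof -
 define F where "F = (%a. LINT s|lborel. of_bool (s < height (pt e a y)) * f' (pt e a y, s))"
 define K where "K = (%a r. integral {-T..r} (%s. f (pt e a y, s)))"
 define k where "k = (%a r. integral {-T..r} (%s. f' (pt e a y, s)))"
 define u where "u = (%a. trace (ret (pt e a y)))"
 have ptc: "continuous_on A (%p. (pt e (fst p) y, snd p))" for A :: "(real \<times> real) set"
  unfolding pt_def by (intro continuous_intros)
 have fc: "continuous_on UNIV (%p. f (pt e (fst p) y, snd p))" "continuous_on UNIV (%p. f' (pt e (fst p) y, snd p))"
  by (rule continuous_on_compose2[OF cont(1) ptc], simp, rule continuous_on_compose2[OF cont(2) ptc], simp)
 have fs: "continuous_on UNIV (%s. f (x, s))" "continuous_on UNIV (%s. f' (x, s))" for x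
  by (rule continuous_on_compose2[OF cont(1)], intro continuous_intros, simp, rule continuous_on_compose2[OF cont(2)], intro continuous_intros, simp)
 have fa: "continuous_on UNIV (%a. f (pt e a y, s))" for s
  using continuous_on_compose2[OF fc(1), of UNIV "%a. (a, s)"] by (simp add: continuous_intros)
 have ptc1: "continuous_on A (%a. pt e a y)" for A
  unfolding pt_def by (intro continuous_intros)
 have [measurable]: "(%a. pt e a y) : borel_fun" by (rule borel_contI[OF ptc1])
 have [measurable]: "f' : borel_fun" "f : borel_fun"
  using cont by (simp_all add: borel_contI)
 have f'm: "(%p. f' (pt e (fst p) y, snd p)) : borel_measurable (borel \<Otimes>\<^sub>M borel)"
  unfolding borel_prod by (rule borel_contI[OF fc(2)])
 have Fm [measurable]: "F : borel_fun"
 proof -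
  have "(%p. of_bool (snd p < height (pt e (fst p) y)) * f' (pt e (fst p) y, snd p)) : borel_measurable (borel \<Otimes>\<^sub>M lborel)"
   using f'm by measurable
  hence "(%a. LINT s|lborel. (%p. of_bool (snd p < height (pt e (fst p) y)) * f' (pt e (fst p) y, snd p)) (a, s)) : borel_fun"
   by measurable
  thus ?thesis by (simp add: F_def)
 qed
 have kder: "((%a. K a r) has_real_derivative k a r) (at a)" for a r
  unfolding K_def k_def using parametric_integral_derivative[OF fc] der by simp
 have Klip: "\<bar>K a r - K a r'\<bar> <= S * \<bar>r - r'\<bar>" "\<bar>k a r - k a r'\<bar> <= S' * \<bar>r - r'\<bar>" if "r : {0..M}" "r' : {0..M}" for a r r'
  unfolding K_def k_def using that T bd by (simp_all add: integral_upper_limit_lipschitz fs)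
 have S: "0 <= S" "0 <= S'" using bd(1)[of undefined] bd(2)[of undefined] by linarith+
 have Fk: "F a = k a (height (pt e a y))" for a
  unfolding F_def k_def by (rule integral_below[OF fs(2)]) (use low in simp)
 have k0: "k a r = 0" if "d < gap (pt e a y)" for a r unfolding k_def using supp[OF that] by simp
 have Fb: "\<bar>F a\<bar> <= S' * (M + T)" for a
 proof -
  have "norm (integral {-T..height (pt e a y)} (%s. f' (pt e a y, s))) <= S' * (height (pt e a y) - (-T))"
   using bd(2) order_trans[OF _ height_bounds(1)] T by (intro integral_bound continuous_on_subset[OF fs(2)]) auto
  also have "... <= S' * (M + T)" using S height_bounds(2) by (intro mult_left_mono) auto
  finally show ?thesis unfolding Fk k_def by simp
 qed
 have Fi: "set_integrable lborel {b..c} F" for b c by (rule integrable_on_bounded[OF Fm Fb])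
 have uR: "u a : {0..M}" for a using trace_bounds by (simp add: u_def)
 have piece: "\<bar>integral {b..c} F - (K c (u c) - K b (u b))\<bar> <= S * (2 * measure tv (strip e d y))"
  if "b <= c" and out: "!!a. a : {b..c} ==> pt e a y ~: Om" and dd: "!!a. a : {b..c} ==> gap (pt e a y) <= d" for b c
 proof -
  have Fu: "F a = k a (u a)" if "a : {b..c}" for a using out[OF that] by (simp add: Fk height_def u_def)
  have "F integrable_on {b..c}" using Fi by (rule set_lint_eq(1))
  hence ki: "(%a. k a (u a)) integrable_on {b..c}" using Fu by (rule integrable_eq)
  have "\<bar>integral {b..c} (%a. k a (u a)) - (K c (u c) - K b (u b))\<bar> <= S * (2 * measure tv (strip e d y))"
  proof (rule variation_estimate[OF that(1) ki uR kder Klip S])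
   show "EX v. sum v {..<n} \<le> 2 * measure tv (strip e d y) &
    (ALL i<n. ALL x:{b + real i * ((c - b) / real n)..b + real (Suc i) * ((c - b) / real n)}.
     ALL x':{b + real i * ((c - b) / real n)..b + real (Suc i) * ((c - b) / real n)}. \<bar>u x - u x'\<bar> <= v i)" if "0 < n" for n :: nat
    unfolding u_def strip_def by (rule oscillation[OF e \<open>b <= c\<close> out dd that])
  qed
  moreover have "integral {b..c} F = integral {b..c} (%a. k a (u a))" using Fu by (rule integral_cong)
  ultimately show ?thesis by simp
 qed
 define J where "J = {a. gap (pt e a y) <= d}"
 have "EX b c. J = {b..c}"
 proof (rule connected_compact_interval_1[THEN iffD1], rule conjI)
  have "convex J"
  proof (rule convexI)
   fix a b s t :: real assume ab: "a : J" "b : J" and st: "0 <= s" "0 <= t" "s + t = 1"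
   have "s *. pt e a y + t *. pt e b y : {x. gap x <= d}"
    using convexD[OF gap_sublevel_convex[of d] _ _ st, of "pt e a y" "pt e b y"] ab by (simp add: J_def)
   thus "s *. a + t *. b : J" using st by (simp add: J_def pt_comb)
  qed
  thus "connected J" by (rule convex_connected)
  have "closed J" unfolding J_def by (intro closed_Collect_le continuous_on_compose2[OF gap_cont ptc1] continuous_intros) auto
  moreover have "bounded J"
  proof -
   obtain B where B: "!!x. gap x <= d ==> norm x <= B"
    using compact_imp_bounded[OF gap_sublevel_compact[of d], unfolded bounded_iff] by auto
   have "\<bar>a\<bar> <= B" if "a : J" for a
   proof -
    have "\<bar>pt e a y @. e\<bar> <= norm (pt e a y) * norm e" by (rule Cauchy_Schwarz_ineq2)
    thus ?thesis using B[of "pt e a y"] that e pt_coords(1)[OF e, of a y] by (simp add: J_def)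
   qed
   thus ?thesis by (auto simp: bounded_iff)
  qed
  ultimately show "compact J" by (simp add: compact_eq_bounded_closed)
 qed
 then obtain b c where J: "J = {b..c}" by blast
 have Fsum: "(LINT a|lborel. F a) = integral {b..c} F"
 proof -
  have "F a = indicator {b..c} a *. F a" for a
  proof (cases "a : J")
   case False
   hence "F a = 0" using k0[of a] by (simp add: J_def Fk)
   thus ?thesis by simp
  qed (simp add: J)
  hence "(LINT a|lborel. F a) = (LINT a:{b..c}|lborel. F a)"
   unfolding sli_def by (rule lint_cong[OF refl])
  thus ?thesis using set_lint_eq(2)[OF Fi] by simp
 qed
 have Kend: "K b r = 0" "K c r = 0" for r
 proof -
  have out: "f (pt e a y, s) = 0" if "a < b \<or> c < a" for a s
   using supp[of "pt e a y" s] J that unfolding J_def set_eq_iff by (metis atLeastAtMost_iff mem_Collect_eq not_le)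
  have "f (pt e b y, s) = 0" for s by (rule zero_on_closure[OF fa, of "{..<b}"]) (use out in auto)
  thus "K b r = 0" by (simp add: K_def)
  have "f (pt e c y, s) = 0" for s by (rule zero_on_closure[OF fa, of "{c<..}"]) (use out in auto)
  thus "K c r = 0" by (simp add: K_def)
 qed
 have tvn: "0 <= measure tv (strip e d y)" by simp
 show ?thesis
 proof (cases "y : proj e")
  case False
  hence out: "pt e a y ~: Om" for a by (auto simp: proj_def)
  have "\<bar>integral {b..c} F\<bar> <= S * (2 * measure tv (strip e d y))"
  proof (cases "b <= c")
   case True
   thus ?thesis using piece[OF True out] J Kend by (simp add: J_def set_eq_iff)
  next
   case neg: False
   hence "integral {b..c} F = 0" by simp
   thus ?thesis using S tvn by simp
  qed
  also have "... <= S * (4 * measure tv (strip e d y))" using S tvn by (intro mult_left_mono) auto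
  finally show ?thesis using False Fsum by (simp add: F_def)
 next
  case True
  define l h where "l = lo e y" and "h = hi e y"
  have lh: "l < h" using lo_less_hi[OF e True] by (simp add: l_def h_def)
  have fr: "pt e l y : frontier Om" "pt e h y : frontier Om" using lo_frontier[OF e True] hi_frontier[OF e True] by (simp_all add: l_def h_def)
  hence "gap (pt e l y) = 0" "gap (pt e h y) = 0" unfolding gap_0_iff closure_eq by simp_all
  hence "l : J" "h : J" using d by (simp_all add: J_def)
  hence bl: "b <= l" and hc: "h <= c" by (auto simp: J)
  have dd: "gap (pt e a y) <= d" if "a : {b..c}" for a using that unfolding J[symmetric] J_def by simp
  have rfr: "ret (pt e l y) = pt e l y" "ret (pt e h y) = pt e h y" using fr closure_eq by (auto intro!: ret_self)
  have p1: "\<bar>integral {b..l} F - K l (u l)\<bar> <= S * (2 * measure tv (strip e d y))"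
  proof -
   have "\<bar>integral {b..l} F - (K l (u l) - K b (u b))\<bar> <= S * (2 * measure tv (strip e d y))"
   proof (rule piece[OF bl])
    fix a assume a: "a : {b..l}"
    show "pt e a y ~: Om" using section_gt_lo[OF e, of a y] a by (auto simp: l_def)
    show "gap (pt e a y) <= d" using a lh hc by (intro dd) auto
   qed
   thus ?thesis by (simp add: Kend)
  qed
  have p2: "\<bar>integral {h..c} F + K h (u h)\<bar> <= S * (2 * measure tv (strip e d y))"
  proof -
   have "\<bar>integral {h..c} F - (K c (u c) - K h (u h))\<bar> <= S * (2 * measure tv (strip e d y))"
   proof (rule piece[OF hc])
    fix a assume a: "a : {h..c}"
    show "pt e a y ~: Om" using section_lt_hi[OF e, of a y] a by (auto simp: h_def)
    show "gap (pt e a y) <= d" using a lh bl by (intro dd) auto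
   qed
   thus ?thesis by (simp add: Kend)
  qed
  have p3: "integral {l..h} F = K h 0 - K l 0"
  proof -
   have "((%a. k a 0) has_integral (K h 0 - K l 0)) {l..h}"
    using kder lh by (intro fundamental_theorem_of_calculus) (auto simp: has_real_derivative_iff_has_vector_derivative intro: has_vector_derivative_at_within)
   hence "(F has_integral (K h 0 - K l 0)) {l..h}"
   proof (rule has_integral_spike_finite[rotated 2])
    show "F a = k a 0" if "a : {l..h} - {l, h}" for a
     using section_between[OF e True, of a] that by (simp add: Fk height_def l_def h_def)
   qed simp
   thus ?thesis by (rule integral_unique)
  qed
  have cmb: "integral {b..c} F = integral {b..l} F + integral {l..h} F + integral {h..c} F"
   using hk_combine[OF bl, of c F] hk_combine[of l h c F]
    lh hc set_lint_eq(1)[OF Fi] by simp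
  have sf: "side_fn f (pt e a y) = K a (u a) - K a 0" if "a : {l, h}" for a
  proof -
   have "ret (pt e a y) = pt e a y" using that rfr by auto
   hence ua: "u a = trace (pt e a y)" by (simp add: u_def)
   have fsi: "(%s. f (pt e a y, s)) integrable_on {p..q}" for p q
    by (intro integrable_continuous_real continuous_on_subset[OF fs(1)]) simp
   have "side_fn f (pt e a y) = integral {0..u a} (%s. f (pt e a y, s))" by (simp add: side_fn_integral[OF cont(1)] ua)
   also have "... = K a (u a) - K a 0"
    unfolding K_def using hk_combine[OF _ _ fsi, of "-T" 0 "u a"] T uR[of a] by simp
   finally show ?thesis .
  qed
  have "\<bar>integral {b..c} F + (side_fn f (pt e h y) - side_fn f (pt e l y))\<bar> <= S * (4 * measure tv (strip e d y))"
   using p1 p2 unfolding cmb p3 by (simp add: sf)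
  thus ?thesis using True Fsum by (simp add: F_def l_def h_def)
 qed
qed

end

lemma C1c_derivative:
 fixes f :: "'a::euclidean_space => 'b::euclidean_space"
 assumes "f : C1c U"
 obtains D K where "continuous_on UNIV f" "continuous_on UNIV D" "!!z. (f has_derivative blinfun_apply (D z)) (at z)"
  "!!z. frechet_derivative f (at z) = blinfun_apply (D z)" "compact K" "K \<subseteq> U" "!!z. z ~: K ==> f z = 0"
  "!!z V. open V ==> z : V ==> (!!w. w : V ==> f w = 0) ==> D z = 0" "!!z. z ~: K ==> D z = 0"
proof -
 obtain K where K: "f : C1_upto UNIV" "compact K" "K \<subseteq> U" "!!z. z ~: K ==> f z = 0" using assms by (rule C1c_E) blast
 obtain D where D: "continuous_on UNIV D" "!!z. (f has_derivative blinfun_apply (D z)) (at z)" "continuous_on UNIV f"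
  using K(1) by (rule C1_UNIV_E) blast
 have fd: "frechet_derivative f (at z) = blinfun_apply (D z)" for z using frechet_derivative_at[OF D(2)] by simp
 have z: "D z = 0" if "open V" "z : V" "!!w. w : V ==> f w = 0" for z V
 proof -
  have "((%w. 0) has_derivative blinfun_apply (D z)) (at z)"
   by (rule has_derivative_transform_within_open[OF D(2) that(1,2)]) (use that(3) in simp)
  moreover have "((%w. 0) has_derivative (%h. 0)) (at z)" by simp
  ultimately have "blinfun_apply (D z) = (%h. 0)" by (rule has_derivative_unique)
  thus ?thesis by (intro blinfun_eqI) simp
 qed
 have z': "D z = 0" if "z ~: K" for z
  using z[of "- K" z] K that compact_imp_closed by auto
 show ?thesis by (rule that[OF D(3,1,2) fd K(2,3,4) z z'])
qed

lemma pt_axis: "pt (axis 1 1) a y = plane_of (a, y)" "pt (axis 2 1) a y = plane_of (- y, a)"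
 by (simp_all add: vec_eq_iff forall_2 pt_def rot_def axis_def)

text \<open>For the second axis the label of the line is \<open>y = - x $ 1\<close>, so the iterated
  integral has to be reflected.\<close>

lemma plane_fubini:
 fixes h :: "plane => real"
 assumes h: "integrable lborel h" and e: "e = axis 1 1 \<or> e = axis 2 1"
 shows "integrable lborel (%y. LINT a|lborel. h (pt e a y))"
  and "(LINT x|lborel. h x) = (LINT y|lborel. LINT a|lborel. h (pt e a y))"
proof -
 have hm [measurable]: "h : borel_fun" using h by auto
 have i: "integrable (lborel \<Otimes>\<^sub>M lborel) (%p. h (plane_of p))"
  using h unfolding lborel_prod by (subst (asm) distr_plane_of[symmetric], subst (asm) integrable_distr_eq) auto
 have eq: "(LINT x|lborel. h x) = (LINT p|(lborel \<Otimes>\<^sub>M lborel). h (plane_of p))"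
  unfolding lborel_prod by (subst distr_plane_of[symmetric], subst integral_distr) auto
 have i': "integrable (lborel \<Otimes>\<^sub>M lborel) (%(x, y). h (plane_of (x, y)))" using i by (simp add: case_prod_unfold)
 have "integrable lborel (%y. LINT a|lborel. h (pt e a y)) & (LINT x|lborel. h x) = (LINT y|lborel. LINT a|lborel. h (pt e a y))"
 proof (cases "e = axis 1 1")
  case True
  thus ?thesis unfolding eq True pt_axis
   using lborel_pair.integrable_snd[OF i'] lborel_pair.integral_snd[OF i'] by (simp add: case_prod_unfold)
 next
  case False
  hence e: "e = axis 2 1" using e by simp
  define G where "G = (%x. LINT a|lborel. h (plane_of (x, a)))"
  have G: "integrable lborel G" "(LINT x|lborel. h x) = (LINT x|lborel. G x)"
   unfolding eq G_def using lborel_pair.integrable_fst[OF i'] lborel_pair.integral_fst[OF i'] by (simp_all add: case_prod_unfold)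
  have "integrable lborel (%y. G (0 + (-1) * y))" using G(1) by (rule lborel_integrable_real_affine) simp
  moreover have "(LINT x|lborel. G x) = (LINT y|lborel. G (0 + (-1) * y))"
   using lborel_integral_real_affine[of "-1" G 0] by simp
  ultimately show ?thesis unfolding G(2) e pt_axis G_def by simp
 qed
 thus "integrable lborel (%y. LINT a|lborel. h (pt e a y))"
  and "(LINT x|lborel. h x) = (LINT y|lborel. LINT a|lborel. h (pt e a y))" by auto
qed

lemma continuous_compact_support_integrable:
 fixes f :: "'a::euclidean_space => real"
 assumes f: "continuous_on UNIV f" "compact K" "!!z. z ~: K ==> f z = 0"
  and w: "w : borel_fun" "!!z. \<bar>w z\<bar> <= 1"
 shows "integrable lborel (%z. w z * f z)"
proof (rule int_bound)
 show "integrable lborel (%z. indicator K z *. \<bar>f z\<bar>)"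
  by (rule borel_integrable_compact) (use f in \<open>auto intro!: continuous_intros continuous_on_subset[OF f(1)]\<close>)
 have [measurable]: "f : borel_fun" by (rule borel_contI[OF f(1)])
 show "(%z. w z * f z) : borel_measurable lborel" using w(1) by simp
 have "\<bar>w z * f z\<bar> <= indicator K z * \<bar>f z\<bar>" for z
  using f(3)[of z] w(2)[of z] by (cases "z : K") (auto simp: abs_mult mult_left_le_one_le)
 thus "AE z in lborel. norm (w z * f z) <= norm (indicat_real K z *. \<bar>f z\<bar>)" by simp
qed

context boundary_data begin

abbreviation "Acyl \<equiv> closure Om \<times> {0..M}"

lemma compact_Acyl: "compact Acyl" by (intro compact_Times) (auto simp: compact_closure bounded_Om)

lemma side_map_mem: "p : {0..<len} \<times> {0..M} ==> side_map p : Acyl"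
 using gam_mem[of "fst p"] by (auto simp: side_map_def closure_eq)

lemma bottom_mem: "x : Om ==> (x, 0) : Acyl" using M_nonneg by (auto simp: closure_eq)

lemma norm_nrm_le: "norm (nrm t) <= 2"
proof -
 have "norm (nrm t) = norm (tangent t)" by (simp add: norm_eq_sqrt_inner inner_plane nrm_def algebra_simps)
 thus ?thesis using norm_tangent_le_2 by simp
qed

definition side_density :: "(plane \<times> real => plane \<times> real) => real \<times> real => real" where
 "side_density \<phi> p = indicator ({0..<len} \<times> {0..M}) p *. (of_bool (snd p < bu (gam (fst p))) * (fst (\<phi> (side_map p)) @. nrm (fst p)))"

definition bottom_density :: "(plane \<times> real => plane \<times> real) => plane => real" where
 "bottom_density \<phi> x = indicator Om x *. snd (\<phi> (x, 0))"

lemma flux_densities: "flux M bu \<phi> = (LINT p|lborel. side_density \<phi> p) - (LINT x|lborel. bottom_density \<phi> x)"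
 by (simp add: flux_def sli_def side_density_def bottom_density_def)

lemma density_bounds:
 assumes "!!z. z : Acyl ==> norm (\<phi> z) <= S" and S: "0 <= S"
 shows "norm (side_density \<phi> p) <= S * 2 * indicator ({0..<len} \<times> {0..M}) p" "norm (bottom_density \<phi> x) <= S * indicator Om x"
proof -
 show "norm (side_density \<phi> p) <= S * 2 * indicator ({0..<len} \<times> {0..M}) p"
 proof (cases "p : {0..<len} \<times> {0..M}")
  case True
  have "\<bar>fst (\<phi> (side_map p)) @. nrm (fst p)\<bar> <= norm (fst (\<phi> (side_map p))) * norm (nrm (fst p))" by (rule Cauchy_Schwarz_ineq2)
  also have "... <= S * 2" using norm_nrm_le order_trans[OF norm_fst_le[of "fst (\<phi> (side_map p))" "snd (\<phi> (side_map p))"]] assms(1)[OF side_map_mem[OF True]] S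
   by (intro mult_mono) auto
  finally show ?thesis using True S by (simp add: side_density_def)
 qed (simp add: side_density_def)
 show "norm (bottom_density \<phi> x) <= S * indicator Om x"
 proof (cases "x : Om")
  case True
  have "norm (snd (\<phi> (x, 0))) <= norm (\<phi> (x, 0))" using norm_snd_le[of "snd (\<phi> (x, 0))" "fst (\<phi> (x, 0))"] by simp
  thus ?thesis using True assms(1)[OF bottom_mem[OF True]] by (simp add: bottom_density_def)
 qed (simp add: bottom_density_def)
qed

lemma Acyl_borel: "Acyl : sets borel" by (rule borel_compact[OF compact_Acyl])

lemma bounded_on_Acyl:
 fixes \<phi> :: "plane \<times> real => 'b::real_normed_vector"
 assumes "continuous_on Acyl \<phi>"
 obtains S where "0 <= S" "!!z. z : Acyl ==> norm (\<phi> z) <= S"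
proof -
 have "bounded (\<phi> ` Acyl)" using compact_Acyl assms by (intro compact_imp_bounded compact_continuous_image)
 then obtain S where "!!z. z : Acyl ==> norm (\<phi> z) <= S" by (auto simp: bounded_iff)
 hence "!!z. z : Acyl ==> norm (\<phi> z) <= \<bar>S\<bar>" by force
 thus ?thesis using that[of "\<bar>S\<bar>"] by simp
qed

lemma density_borel:
 assumes \<phi>: "continuous_on Acyl \<phi>"
 shows "side_density \<phi> : borel_fun" "bottom_density \<phi> : borel_fun"
proof -
 define \<phi>' where "\<phi>' = (%z. indicator Acyl z *. \<phi> z)"
 have \<phi>m: "\<phi>' : borel_fun" unfolding \<phi>'_def by (rule borel_measurable_continuous_on_indicator[OF Acyl_borel \<phi>])
 have fm: "(%z. fst (\<phi>' z)) : borel_fun" "(%z. snd (\<phi>' z)) : borel_fun"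
  using measurable_compose[OF \<phi>m borel_contI[OF continuous_on_fst[OF continuous_on_id]]]
   measurable_compose[OF \<phi>m borel_contI[OF continuous_on_snd[OF continuous_on_id]]] by auto
 have tr: "bu (gam t) = trace (gam t)" for t using gam_mem by (simp add: trace_def)
 have "side_density \<phi> = (%p. indicator ({0..<len} \<times> {0..M}) p *. (of_bool (snd p < trace (gam (fst p))) * (fst (\<phi>' (side_map p)) @. nrm (fst p))))"
  using side_map_mem by (auto simp: side_density_def \<phi>'_def tr indicator_def fun_eq_iff)
 also have "... : borel_fun"
 proof -
  have "(%p::real \<times> real. of_bool (snd p < trace (gam (fst p))) :: real) : borel_fun"
   unfolding borel_prod[symmetric] by measurable
  moreover have "(%p. fst (\<phi>' (side_map p))) : borel_fun" using measurable_compose[OF side_map_borel fm(1)] .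
  moreover have "(%p::real \<times> real. nrm (fst p)) : borel_fun"
   unfolding borel_prod[symmetric] by measurable
  ultimately show ?thesis using rect_borel
   by (intro borel_measurable_scaleR borel_measurable_times borel_measurable_inner borel_measurable_indicator) auto
 qed
 finally show "side_density \<phi> : borel_fun" .
 have "bottom_density \<phi> = (%x. indicator Om x *. snd (\<phi>' (x, 0)))"
  using bottom_mem by (auto simp: bottom_density_def \<phi>'_def indicator_def fun_eq_iff)
 also have "... : borel_fun"
 proof -
  have "(%x::plane. (x, 0::real)) : borel_fun" by (intro borel_contI continuous_intros)
  from measurable_compose[OF this fm(2)] show ?thesis using open_Om by (intro borel_measurable_scaleR borel_measurable_indicator) auto
 qed
 finally show "bottom_density \<phi> : borel_fun" .
qed

lemma dominators:
 "integrable lborel (%p. c * indicator ({0..<len} \<times> {0..M}) p :: real)" "integrable lborel (%x. c * indicator Om x :: real)"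
 using rect_borel[of M] emeasure_rect[of len M] M_nonneg len_pos emeasure_bounded_finite[OF bounded_Om] open_Om
 by (auto intro!: integrable_mult_right int_ind)

lemma density_integrable:
 assumes \<phi>: "continuous_on Acyl \<phi>"
 shows "integrable lborel (side_density \<phi>)" "integrable lborel (bottom_density \<phi>)"
proof -
 obtain S where S: "0 <= S" "!!z. z : Acyl ==> norm (\<phi> z) <= S" using bounded_on_Acyl[OF \<phi>] by blast
 note b = density_bounds[of \<phi> S, OF S(2) S(1)]
 have "norm (side_density \<phi> p) <= norm (S * 2 * indicator ({0..<len} \<times> {0..M}) p :: real)" for p using b(1)[of p] by simp
 thus "integrable lborel (side_density \<phi>)"
  using density_borel(1)[OF \<phi>] by (intro int_bound[OF dominators(1)[of "S * 2"]]) auto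
 have "norm (bottom_density \<phi> p) <= norm (S * indicator Om p :: real)" for p using b(2)[of p] by simp
 thus "integrable lborel (bottom_density \<phi>)"
  using density_borel(2)[OF \<phi>] by (intro int_bound[OF dominators(2)[of S]]) auto
qed

lemma side_fn_props:
 assumes f: "continuous_on UNIV f" "!!z. \<bar>f z\<bar> <= S"
 shows "side_fn f : borel_fun" "\<bar>side_fn f x\<bar> <= S * M"
proof -
 have [measurable]: "f : borel_fun" by (rule borel_contI[OF f(1)])
 have [measurable]: "f : borel_measurable (borel \<Otimes>\<^sub>M borel)" unfolding borel_prod by measurable
 have "(%x. LINT s|lborel. (%p. of_bool (0 < snd p & snd p < trace (fst p)) * f p) (x, s)) : borel_fun" by measurable
 thus "side_fn f : borel_fun" unfolding side_fn_def by simp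
 have "norm (LINT s|lborel. of_bool (0 < s & s < trace x) * f (x, s)) <= (LINT s|lborel. S * indicator {0..trace x} s)"
 proof (rule lint_norm_le)
  show i: "integrable lborel (%s. S * indicator {0..trace x} s)" by (intro integrable_mult_right int_ind) (auto simp: emeasure_lborel_Icc_eq)
  have S: "0 <= S" using f(2)[of undefined] by linarith
  show "norm (of_bool (0 < s & s < trace x) * f (x, s)) <= S * indicator {0..trace x} s" for s
   using f(2)[of "(x, s)"] S by (auto simp: indicator_def)
  thus "integrable lborel (%s. of_bool (0 < s & s < trace x) * f (x, s))"
   by (intro int_bound[OF i]) (auto simp: S)
 qed
 also have "... = S * trace x" using trace_bounds(1)[of x] by simp
 also have "... <= S * M" using f(2)[of undefined] trace_bounds(2)[of x] by (intro mult_left_mono) auto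
 finally show "\<bar>side_fn f x\<bar> <= S * M" by (simp add: side_fn_def)
qed

lemma nrm_inner: "tangent t @. rot e = nrm t @. e"
 by (simp add: inner_plane nrm_def rot_def)

text \<open>A boundary point belongs to the strips of an interval of lines of length
  \<open>2 * d\<close>. The error of the line estimate, which may be large on single lines, is thus
  of order \<open>d\<close> after integration over the lines.\<close>

lemma strip_integral:
 assumes d: "0 <= d"
 shows "(\<integral>\<^sup>+ y. emeasure tv (strip e d y) \<partial>lborel) = ennreal (2 * d * measure tv UNIV)"
proof -
 have sb: "strip e d y : sets borel" for y unfolding strip_def by measurable
 interpret pair_sigma_finite lborel tv by unfold_locales
 define W where "W = {p :: real \<times> plane. \<bar>snd p @. rot e - fst p\<bar> <= d}"
 have W: "W : sets (lborel \<Otimes>\<^sub>M tv)"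
 proof -
  have "W : sets borel" unfolding W_def by (intro borel_closed closed_Collect_le continuous_intros)
  also have "sets borel = sets (lborel \<Otimes>\<^sub>M tv)" unfolding borel_prod[symmetric] by (intro sets_pair_measure_cong) auto
  finally show ?thesis .
 qed
 have "(\<integral>\<^sup>+ y. emeasure tv (strip e d y) \<partial>lborel) = (\<integral>\<^sup>+ y. \<integral>\<^sup>+ q. indicator W (y, q) \<partial>tv \<partial>lborel)"
 proof (rule nn_integral_cong)
  fix y
  have "(\<integral>\<^sup>+ q. indicator W (y, q) \<partial>tv) = (\<integral>\<^sup>+ q. indicator (strip e d y) q \<partial>tv)"
   by (rule nn_integral_cong) (auto simp: W_def strip_def indicator_def)
  thus "emeasure tv (strip e d y) = (\<integral>\<^sup>+ q. indicator W (y, q) \<partial>tv)" using sb by simp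
 qed
 also have "... = (\<integral>\<^sup>+ q. \<integral>\<^sup>+ y. indicator W (y, q) \<partial>lborel \<partial>tv)"
  using W by (intro Fubini'[symmetric]) auto
 also have "... = (\<integral>\<^sup>+ q. ennreal (2 * d) \<partial>tv)"
 proof (rule nn_integral_cong)
  fix q :: plane
  have "(\<integral>\<^sup>+ y. indicator W (y, q) \<partial>lborel) = (\<integral>\<^sup>+ y. indicator {q @. rot e - d..q @. rot e + d} y \<partial>lborel)"
   by (rule nn_integral_cong) (auto simp: W_def indicator_def)
  thus "(\<integral>\<^sup>+ y. indicator W (y, q) \<partial>lborel) = ennreal (2 * d)" using d by (simp add: emeasure_lborel_Icc_eq)
 qed
 also have "... = ennreal (2 * d * measure tv UNIV)" using d by (simp add: T.emeasure_eq_measure ennreal_mult)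
 finally show ?thesis .
qed

text \<open>Integration of \<open>line_estimate\<close> over all lines parallel to \<open>e\<close>.
  Fubini turns the first term into the volume integral, and \<open>line_integral\<close> turns the
  endpoint terms into the side flux; the error is \<open>4 * S\<close> times the integrated strip
  mass \<open>2 * d * measure tv UNIV\<close>.\<close>

lemma direction_estimate:
 fixes f f' :: "plane \<times> real => real"
 assumes e: "e = axis 1 1 \<or> e = axis 2 1"
  and cont: "continuous_on UNIV f" "continuous_on UNIV f'"
  and der: "!!a y s. ((%a. f (pt e a y, s)) has_real_derivative f' (pt e a y, s)) (at a)"
  and K: "compact K" "!!z. z ~: K ==> f z = 0 & f' z = 0"
  and supp: "!!x s. d < gap x ==> f (x, s) = 0 & f' (x, s) = 0"
  and S: "!!z. \<bar>f z\<bar> <= S" and d: "0 <= d"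
 shows "\<bar>(LINT z|lborel. of_bool (snd z < height (fst z)) * f' z)
   + (LINT t:{0..<len}|lborel. (nrm t @. e) * side_fn f (gam t))\<bar> <= S * (8 * d * measure tv UNIV)"
proof -
 have e1: "norm e = 1" using e by auto
 obtain B where B: "!!z. z : K ==> norm z <= B" using compact_imp_bounded[OF K(1)] by (auto simp: bounded_iff)
 define T where "T = \<bar>B\<bar> + 1"
 have low: "f (x, s) = 0 & f' (x, s) = 0" if "s <= - T" for x s
 proof -
  have "norm (x, s) \<ge> \<bar>s\<bar>" using norm_snd_le[of s x] by simp
  hence "(x, s) ~: K" using B[of "(x, s)"] that by (auto simp: T_def)
  thus ?thesis by (rule K(2))
 qed
 obtain S' where S': "!!z. \<bar>f' z\<bar> <= S'"
 proof -
  have "bounded (f' ` K)" using K(1) by (intro compact_imp_bounded compact_continuous_image continuous_on_subset[OF cont(2)]) auto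
  then obtain C where C: "!!z. z : K ==> norm (f' z) <= C" by (auto simp: bounded_iff)
  have "\<bar>f' z\<bar> <= \<bar>C\<bar>" for z using C[of z] K(2)[of z] by (cases "z : K") auto
  thus ?thesis using that by blast
 qed
 have [measurable]: "f' : borel_fun" by (rule borel_contI[OF cont(2)])
 have [measurable]: "f' : borel_measurable (borel \<Otimes>\<^sub>M borel)" unfolding borel_prod by measurable
 define E where "E = (%z::plane \<times> real. of_bool (snd z < height (fst z)) * f' z)"
 have wm: "(%z::plane \<times> real. of_bool (snd z < height (fst z)) :: real) : borel_fun"
  unfolding borel_prod[symmetric] by measurable
 have Ei: "integrable (lborel \<Otimes>\<^sub>M lborel) E"
  unfolding E_def lborel_prod using K(2) wm by (intro continuous_compact_support_integrable[OF cont(2) K(1)]) auto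
 have Ei': "integrable (lborel \<Otimes>\<^sub>M lborel) (%(x, s). E (x, s))" using Ei by simp
 define h where "h = (%x. LINT s|lborel. E (x, s))"
 have hi: "integrable lborel h" unfolding h_def using lborel_pair.integrable_fst[OF Ei'] by simp
 have Eh: "(LINT z|lborel. E z) = (LINT x|lborel. h x)"
  unfolding h_def using lborel_pair.integral_fst[OF Ei'] by (simp add: lborel_prod)
 define g where "g = side_fn f"
 note sp = side_fn_props[OF cont(1) S]
 have gm [measurable]: "g : borel_fun" and gb: "\<bar>g x\<bar> <= S * M" for x using sp by (simp_all add: g_def)
 have pr: "proj e : sets borel" using open_proj by simp
 have pfin: "emeasure lborel (proj e) < \<infinity>" by (rule emeasure_bounded_finite[OF bounded_proj[OF e1]])
 have end_int: "integrable lborel (%y. indicator (proj e) y * g (pt e (r y) y))" if r: "(%y. if y : proj e then r y else 0) : borel_fun" for r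
 proof -
  have ptm: "(%p. pt e (fst p) (snd p)) : borel_measurable (borel \<Otimes>\<^sub>M borel)"
   unfolding borel_prod by (rule borel_contI[OF pt_cont])
  have "(%y. pt e (if y : proj e then r y else 0) y) : borel_fun"
   using measurable_compose[OF measurable_Pair[OF r measurable_ident] ptm] by simp
  from measurable_compose[OF this gm]
  have "(%y. indicator (proj e) y * g (pt e (if y : proj e then r y else 0) y)) : borel_fun" using pr by simp
  also have "(%y. indicator (proj e) y * g (pt e (if y : proj e then r y else 0) y)) = (%y. indicator (proj e) y * g (pt e (r y) y))"
   by (auto simp: indicator_def)
  finally have m: "(%y. indicator (proj e) y * g (pt e (r y) y)) : borel_fun" .
  show ?thesis
  proof (rule int_bound)
   show "integrable lborel (%y. S * M * indicator (proj e) y)" using pr pfin by (intro integrable_mult_right int_ind) auto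
   have "norm (indicat_real (proj e) y * g (pt e (r y) y)) <= norm (S * M * indicat_real (proj e) y)" for y
    using gb[of "pt e (r y) y"] by (auto simp: indicator_def)
   thus "AE y in lborel. norm (indicat_real (proj e) y * g (pt e (r y) y)) <= norm (S * M * indicat_real (proj e) y)" by simp
  qed (use m in simp)
 qed
 have e1': "norm (- e) = 1" using e1 by simp
 have lom: "(%y. if y : proj e then lo e y else 0) : borel_fun"
 proof -
  have "(%y. if - y : proj (- e) then hi (- e) (- y) else 0) : borel_fun"
   using measurable_compose[OF _ hi_borel[OF e1'], of uminus borel] by simp
  hence "(%y. - (if - y : proj (- e) then hi (- e) (- y) else 0)) : borel_fun" by simp
  also have "(%y. - (if - y : proj (- e) then hi (- e) (- y) else 0)) = (%y. if y : proj e then lo e y else 0)"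
   by (auto simp: proj_uminus lo_def)
  finally show ?thesis .
 qed
 define X where "X = (%y. (LINT a|lborel. h (pt e a y)) + (indicator (proj e) y * g (pt e (hi e y) y) - indicator (proj e) y * g (pt e (lo e y) y)))"
 note ints = plane_fubini(1)[OF hi e] end_int[OF hi_borel[OF e1]] end_int[OF lom]
 have Xi: "integrable lborel X" unfolding X_def by (intro Bochner_Integration.integrable_add Bochner_Integration.integrable_diff ints)
 have Xe: "(LINT y|lborel. X y) = (LINT z|lborel. E z) + (LINT t:{0..<len}|lborel. (nrm t @. e) * g (gam t))"
 proof -
  have "(LINT t:{0..<len}|lborel. (nrm t @. e) * g (gam t)) = (LINT y:proj e|lborel. g (pt e (hi e y) y)) - (LINT y:proj e|lborel. g (pt e (lo e y) y))"
   using line_integral[OF e1 gm gb] by (simp add: nrm_inner)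
  moreover have "(LINT y|lborel. X y) = (LINT y|lborel. LINT a|lborel. h (pt e a y)) + ((LINT y:proj e|lborel. g (pt e (hi e y) y)) - (LINT y:proj e|lborel. g (pt e (lo e y) y)))"
   unfolding X_def sli_def real_scaleR_def using ints by simp
  ultimately show ?thesis using Eh plane_fubini(2)[OF hi e] by simp
 qed
 have S0: "0 <= S" using S[of undefined] by linarith
 have Xb: "norm (X y) <= S * (4 * measure tv (strip e d y))" for y
 proof -
  have "0 <= T" by (simp add: T_def)
  from line_estimate[where T=T and d=d, OF e1 this cont der low supp S S' d, of y]
  show ?thesis by (cases "y : proj e") (simp_all add: X_def h_def E_def g_def)
 qed
 have "ennreal (norm (LINT y|lborel. X y)) <= (\<integral>\<^sup>+ y. ennreal (norm (X y)) \<partial>lborel)" by (rule integral_norm_bound_ennreal[OF Xi])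
 also have "... <= (\<integral>\<^sup>+ y. ennreal (4 * S) * emeasure tv (strip e d y) \<partial>lborel)"
  using Xb S0 by (intro nn_integral_mono) (simp add: T.emeasure_eq_measure ennreal_mult[symmetric] algebra_simps ennreal_leI)
 also have "... = ennreal (4 * S) * ennreal (2 * d * measure tv UNIV)"
 proof (subst nn_integral_cmult)
  show "(%y. emeasure tv (strip e d y)) : borel_measurable lborel"
  proof -
   have "{p :: real \<times> plane. \<bar>snd p @. rot e - fst p\<bar> <= d} : sets borel" by (intro borel_closed closed_Collect_le continuous_intros)
   also have "sets borel = sets (lborel \<Otimes>\<^sub>M tv)" unfolding borel_prod[symmetric] by (intro sets_pair_measure_cong) auto
   finally have "(%y. emeasure tv (Pair y -` {p :: real \<times> plane. \<bar>snd p @. rot e - fst p\<bar> <= d})) : borel_measurable lborel"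
    by (rule T.measurable_emeasure_Pair)
   thus ?thesis by (simp add: strip_def vimage_def)
  qed
 qed (simp add: strip_integral[OF d])
 also have "... = ennreal (S * (8 * d * measure tv UNIV))" using S0 d by (simp add: ennreal_mult[symmetric] algebra_simps)
 finally have "norm (LINT y|lborel. X y) <= S * (8 * d * measure tv UNIV)" using S0 d by (subst (asm) ennreal_le_iff) auto
 thus ?thesis unfolding Xe E_def g_def by simp
qed

lemma divergence_cylinder:
 fixes \<psi> :: "plane \<times> real => plane \<times> real"
 assumes "frechet_derivative \<psi> (at z) = blinfun_apply (D z)"
 shows "dvg \<psi> z = fst (D z (axis 1 1, 0)) @. axis 1 1 + fst (D z (axis 2 1, 0)) @. axis 2 1 + snd (D z (0, 1))"
 using axis_1_ne_2 unfolding divergence_def assms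
 by (simp add: Basis_prod_def plane_cases_Basis sum.union_disjoint inner_prod_def add.commute image_Un sum.insert_if zero_prod_def)

lemma side_inner:
 assumes \<phi>: "continuous_on Acyl \<phi>"
 shows "(LINT s|lborel. side_density \<phi> (t, s)) = indicator {0..<len} t * (integral {0..trace (gam t)} (%s. fst (\<phi> (gam t, s))) @. nrm t)"
proof (cases "t : {0..<len}")
 case True
 define x where "x = gam t"
 have x: "x : closure Om" and tr: "bu x = trace x" using gam_mem[of t] by (simp_all add: trace_def x_def closure_eq)
 note tb = trace_bounds[of x]
 have cx: "continuous_on {0..trace x} (%s. fst (\<phi> (x, s)))"
  by (intro continuous_on_fst continuous_on_compose2[OF \<phi>] continuous_intros) (use x tb in auto)
 have "(LINT s|lborel. side_density \<phi> (t, s)) = (LINT s:{0..trace x}|lborel. fst (\<phi> (x, s)) @. nrm t)"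
  unfolding sli_def
 proof (rule integral_cong_AE)
  show "(%s. side_density \<phi> (t, s)) : borel_measurable lborel"
   using measurable_compose[OF _ density_borel(1)[OF \<phi>], of "%s. (t, s)" lborel] by (simp add: borel_prod[symmetric])
  have "continuous_on {0..trace x} (%s. fst (\<phi> (x, s)) @. nrm t)" by (intro continuous_intros cx)
  hence "(%s. indicat_real {0..trace x} s *. (fst (\<phi> (x, s)) @. nrm t)) : borel_fun"
   by (rule borel_measurable_continuous_on_indicator[rotated]) simp
  thus "(%s. indicat_real {0..trace x} s *. (fst (\<phi> (x, s)) @. nrm t)) : borel_measurable lborel" by simp
  show "AE s in lborel. side_density \<phi> (t, s) = indicat_real {0..trace x} s *. (fst (\<phi> (x, s)) @. nrm t)"
   by (rule AE_mp[OF AE_lborel_singleton[of "trace x"]], rule AE_I2)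
    (use True tb tr in \<open>auto simp: side_density_def side_map_def x_def[symmetric] indicator_def\<close>)
 qed
 also have "... = integral {0..trace x} (%s. fst (\<phi> (x, s)) @. nrm t)"
  by (rule set_lint_eq(2)[OF borel_integrable_atLeastAtMost']) (intro continuous_intros cx)
 also have "... = integral {0..trace x} (%s. fst (\<phi> (x, s))) @. nrm t"
  using integral_linear[OF integrable_continuous_real[OF cx] bounded_linear_inner_left[of "nrm t"]] by (simp add: o_def)
 finally show ?thesis using True by (simp add: x_def)
next
 case False
 hence out: "(t, s) ~: {0..<len} \<times> {0..M}" for s by auto
 have "side_density \<phi> (t, s) = 0" for s unfolding side_density_def indicator_simps(2)[OF out] by simp
 thus ?thesis using False by simp
qed

lemma side_fubini:
 assumes \<phi>: "continuous_on Acyl \<phi>"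
 shows "(LINT p|lborel. side_density \<phi> p) = (LINT t|lborel. LINT s|lborel. side_density \<phi> (t, s))"
  "integrable lborel (%t. LINT s|lborel. side_density \<phi> (t, s))"
proof -
 have i: "integrable (lborel \<Otimes>\<^sub>M lborel) (%(t, s). side_density \<phi> (t, s))"
  using density_integrable(1)[OF \<phi>] by (simp add: lborel_prod)
 show "(LINT p|lborel. side_density \<phi> p) = (LINT t|lborel. LINT s|lborel. side_density \<phi> (t, s))"
  "integrable lborel (%t. LINT s|lborel. side_density \<phi> (t, s))"
  using lborel_pair.integral_fst[OF i] lborel_pair.integrable_fst[OF i] by (simp_all add: lborel_prod)
qed

lemma flux_eq:
 assumes c: "continuous_on UNIV \<psi>" and S: "!!z. norm (\<psi> z) <= S"
 shows "flux M bu \<psi> = (LINT t:{0..<len}|lborel. (nrm t @. axis 1 1) * side_fn (%z. fst (\<psi> z) @. axis 1 1) (gam t))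
   + (LINT t:{0..<len}|lborel. (nrm t @. axis 2 1) * side_fn (%z. fst (\<psi> z) @. axis 2 1) (gam t))
   - (LINT x:Om|lborel. snd (\<psi> (x, 0)))"
proof -
 define F where "F = (%e z. fst (\<psi> z) @. e :: real)"
 have Fc: "continuous_on UNIV (F e)" for e unfolding F_def using c by (intro continuous_intros)
 have Fb: "\<bar>F e z\<bar> <= S" if "norm e = 1" for e z
  using Cauchy_Schwarz_ineq2[of "fst (\<psi> z)" e] norm_fst_le[of "fst (\<psi> z)" "snd (\<psi> z)"] S[of z] that by (simp add: F_def)
 have cA: "continuous_on Acyl \<psi>" by (rule continuous_on_subset[OF c]) simp
 have inner: "(LINT s|lborel. side_density \<psi> (t, s)) = indicator {0..<len} t *. ((nrm t @. axis 1 1) * side_fn (F (axis 1 1)) (gam t) + (nrm t @. axis 2 1) * side_fn (F (axis 2 1)) (gam t))" for t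
 proof -
  define I where "I = integral {0..trace (gam t)} (%s. fst (\<psi> (gam t, s)))"
  have "(%s. fst (\<psi> (gam t, s))) integrable_on {0..trace (gam t)}"
   by (intro integrable_continuous_real continuous_on_fst continuous_on_compose2[OF c] continuous_intros) auto
  hence "side_fn (F e) (gam t) = I @. e" for e
   using integral_linear[OF _ bounded_linear_inner_left[of e]] unfolding I_def side_fn_integral[OF Fc] by (simp add: F_def o_def)
  thus ?thesis unfolding side_inner[OF cA] I_def[symmetric] by (simp add: inner_plane axis_def mult.commute)
 qed
 have si: "set_integrable lborel {0..<len} (%t. (nrm t @. e) * side_fn (F e) (gam t))" if e: "norm e = 1" for e
 proof (rule set_integrable_subset[of _ "{0..len}"])
  note sp = side_fn_props[OF Fc Fb[OF e]]
  have [measurable]: "side_fn (F e) : borel_fun" by (rule sp(1))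
  show "set_integrable lborel {0..len} (%t. (nrm t @. e) * side_fn (F e) (gam t))"
  proof (rule integrable_on_bounded)
   fix t
   have "\<bar>nrm t @. e\<bar> <= 2" using Cauchy_Schwarz_ineq2[of "nrm t" e] norm_nrm_le[of t] e by simp
   thus "\<bar>(nrm t @. e) * side_fn (F e) (gam t)\<bar> <= 2 * (S * M)"
    unfolding abs_mult using sp(2)[of "gam t"] by (intro mult_mono) auto
  qed measurable
 qed auto
 show ?thesis
  unfolding flux_densities side_fubini(1)[OF cA] inner sli_def[symmetric]
   set_integral_add(2)[OF si[of "axis 1 1"] si[of "axis 2 1"], simplified] bottom_density_def[abs_def] by (simp only: F_def)
qed

text \<open>An approximate divergence theorem on the subgraph of the prescribed data. Each of the
  two horizontal directions costs \<open>8 * d\<close> times the mass; the vertical one reduces to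
  the values \<open>snd (\<psi> (x, height x))\<close>, which give the bottom flux over the domain
  and are bounded by the area of the shell elsewhere.\<close>

lemma exterior_estimate:
 assumes \<psi>: "\<psi> : C1c U" and d: "0 <= d"
  and supp: "!!x s. d < gap x ==> \<psi> (x, s) = 0" and S: "!!z. norm (\<psi> z) <= S"
 shows "\<bar>(LINT z|lborel. of_bool (snd z < height (fst z)) * dvg \<psi> z) + flux M bu \<psi>\<bar>
  <= S * (measure lborel {x. x ~: Om & gap x <= d} + 16 * d * measure tv UNIV)"
proof -
 obtain D K where c: "continuous_on UNIV \<psi>" and D: "continuous_on UNIV D" "!!z. (\<psi> has_derivative blinfun_apply (D z)) (at z)"
  "!!z. frechet_derivative \<psi> (at z) = blinfun_apply (D z)" and K: "compact K" "K \<subseteq> U" "!!z. z ~: K ==> \<psi> z = 0"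
  and D0: "!!z V. open V ==> z : V ==> (!!w. w : V ==> \<psi> w = 0) ==> D z = 0" "!!z. z ~: K ==> D z = 0"
  by (rule C1c_derivative[OF \<psi>]) blast
 have Dg: "D (x, s) = 0" if "d < gap x" for x s
 proof (rule D0(1))
  show "open ({x. d < gap x} \<times> (UNIV :: real set))" by (intro open_Times open_Collect_less gap_cont continuous_intros) auto
 qed (use that supp in auto)
 define f where "f = (%e z. fst (\<psi> z) @. e :: real)"
 define f' where "f' = (%e z. fst (D z (e, 0)) @. e :: real)"
 define w where "w = (%z::plane \<times> real. of_bool (snd z < height (fst z)) :: real)"
 have Dc: "continuous_on UNIV (%z. blinfun_apply (D z) b)" for b by (intro continuous_intros D(1))
 have fc: "continuous_on UNIV (f e)" "continuous_on UNIV (f' e)" for e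
  unfolding f_def f'_def by (intro continuous_intros c Dc)+
 have fK: "f e z = 0 & f' e z = 0" if "z ~: K" for e z using K(3)[OF that] D0(2)[OF that] by (simp add: f_def f'_def)
 have Sfst: "norm (fst (\<psi> z)) <= S" "\<bar>snd (\<psi> z)\<bar> <= S" for z
  using S[of z] norm_fst_le[of "fst (\<psi> z)" "snd (\<psi> z)"] norm_snd_le[of "snd (\<psi> z)" "fst (\<psi> z)"] by auto
 have dir: "\<bar>(LINT z|lborel. w z * f' e z) + (LINT t:{0..<len}|lborel. (nrm t @. e) * side_fn (f e) (gam t))\<bar> <= S * (8 * d * measure tv UNIV)"
  if e: "e = axis 1 1 \<or> e = axis 2 1" for e
  unfolding w_def
 proof (rule direction_estimate[OF e fc _ K(1) fK _ _ d])
  show "((%a. f e (pt e a y, s)) has_real_derivative f' e (pt e a y, s)) (at a)" for a y s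
  proof -
   have "((%a. (pt e a y, s)) has_derivative (%h. (h *. e, 0))) (at a)"
    unfolding pt_def by (auto intro!: derivative_eq_intros)
   from has_derivative_compose[OF this D(2)]
   have "((%a. f e (pt e a y, s)) has_derivative (%h. fst (D (pt e a y, s) (h *. e, 0)) @. e)) (at a)"
    unfolding f_def by (auto intro!: derivative_eq_intros)
   moreover have "fst (D (pt e a y, s) (h *. e, 0)) @. e = f' e (pt e a y, s) * h" for h
    using blinfun.scaleR_right[of "D (pt e a y, s)" h "(e, 0)"] by (simp add: f'_def)
   hence "(%h. fst (D (pt e a y, s) (h *. e, 0)) @. e) = (*) (f' e (pt e a y, s))" by (rule ext)
   ultimately show ?thesis unfolding has_field_derivative_def by simp
  qed
  show "f e (x, s) = 0 & f' e (x, s) = 0" if "d < gap x" for x s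
   using supp[OF that] Dg[OF that] by (simp add: f_def f'_def)
  show "\<bar>f e z\<bar> <= S" for z
   using Cauchy_Schwarz_ineq2[of "fst (\<psi> z)" e] Sfst[of z] e by (auto simp: f_def)
 qed
 have wb: "w : borel_fun" "!!z. \<bar>w z\<bar> <= 1"
  unfolding w_def borel_prod[symmetric] by measurable
 define q where "q = (%z. snd (D z (0, 1)))"
 have qc: "continuous_on UNIV q" unfolding q_def by (intro continuous_intros Dc)
 have q0: "q z = 0" if "z ~: K" for z using D0(2)[OF that] by (simp add: q_def)
 have div: "(LINT z|lborel. w z * dvg \<psi> z) = (LINT z|lborel. w z * f' (axis 1 1) z) + (LINT z|lborel. w z * f' (axis 2 1) z) + (LINT z|lborel. w z * q z)"
 proof -
  have i: "integrable lborel (%z. w z * f' e z)" "integrable lborel (%z. w z * q z)" for e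
   using fK q0 by (auto intro!: continuous_compact_support_integrable[OF fc(2) K(1) _ wb] continuous_compact_support_integrable[OF qc K(1) _ wb])
  have "w z * dvg \<psi> z = w z * f' (axis 1 1) z + w z * f' (axis 2 1) z + w z * q z" for z
   by (simp only: divergence_cylinder[where D=D, OF D(3)] f'_def q_def distrib_left)
  thus ?thesis using i by simp
 qed
 \<comment> \<open>Fundamental theorem in the vertical variable, from below the support up to the
   graph of \<open>height\<close>.\<close>
 have vert: "(LINT z|lborel. w z * q z) = (LINT x|lborel. snd (\<psi> (x, height x)))"
 proof -
  have i: "integrable (lborel \<Otimes>\<^sub>M lborel) (%(x, s). w (x, s) * q (x, s))"
   unfolding lborel_prod using continuous_compact_support_integrable[OF qc K(1) q0 wb] by (simp add: case_prod_unfold)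
  obtain B where B: "!!z. z : K ==> norm z <= B" using compact_imp_bounded[OF K(1)] by (auto simp: bounded_iff)
  define T where "T = \<bar>B\<bar> + 1"
  have low: "(x, s) ~: K" if "s <= - T" for x s
   using norm_snd_le[of s x] B[of "(x, s)"] that by (auto simp: T_def)
  have "(LINT s|lborel. w (x, s) * q (x, s)) = snd (\<psi> (x, height x))" for x
  proof -
   have "(LINT s|lborel. w (x, s) * q (x, s)) = integral {-T..height x} (%s. q (x, s))"
    unfolding w_def fst_conv snd_conv
    by (rule integral_below) (use low q0 in \<open>auto intro!: continuous_on_compose2[OF qc] continuous_intros\<close>)
   moreover have "((%s. q (x, s)) has_integral (snd (\<psi> (x, height x)) - snd (\<psi> (x, - T)))) {-T..height x}"
   proof (rule fundamental_theorem_of_calculus)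
    show "- T <= height x" using height_bounds(1)[of x] by (simp add: T_def)
    fix s :: real
    have "((%s. (x, s)) has_derivative (%h. (0, h))) (at s)" by (auto intro!: derivative_eq_intros)
    from has_derivative_compose[OF this D(2)[of "(x, s)"]]
    have "((%s. snd (\<psi> (x, s))) has_derivative (%h. snd (D (x, s) (0, h)))) (at s)" by (auto intro!: derivative_eq_intros)
    moreover have "snd (D (x, s) (0, h)) = h *. q (x, s)" for h
     using blinfun.scaleR_right[of "D (x, s)" h "(0, 1)"] by (simp add: q_def)
    ultimately show "((%s. snd (\<psi> (x, s))) has_vector_derivative q (x, s)) (at s within {-T..height x})"
     by (simp add: has_vector_derivative_def has_derivative_at_withinI)
   qed
   ultimately show ?thesis using K(3)[OF low[of "- T" x]] by (simp add: integral_unique)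
  qed
  thus ?thesis using lborel_pair.integral_fst[OF i] by (simp add: lborel_prod case_prod_unfold)
 qed
 define g where "g = (%x. snd (\<psi> (x, height x)))"
 have gm [measurable]: "g : borel_fun"
 proof -
  have "(%x. (x, height x)) : borel_fun" unfolding borel_prod[symmetric] by measurable
  moreover have "(%z. snd (\<psi> z)) : borel_fun" by (intro borel_contI continuous_intros c)
  ultimately show ?thesis unfolding g_def by (rule measurable_compose)
 qed
 define A where "A = {x. gap x <= d}"
 have Ac: "compact A" unfolding A_def by (rule gap_sublevel_compact)
 have gA: "g x = 0" if "x ~: A" for x using supp[of x] that by (simp add: g_def A_def)
 have gS: "\<bar>g x\<bar> <= S" for x unfolding g_def by (rule Sfst)
 have S0: "0 <= S" using gS[of undefined] by linarith
 have Af: "emeasure lborel A < \<infinity>" by (rule emeasure_bounded_finite[OF compact_imp_bounded[OF Ac]])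
 have Omb [measurable]: "Om : sets borel" "A : sets borel" using open_Om Ac by (auto intro: borel_compact)
 have gi: "integrable lborel g"
 proof (rule int_bound)
  show "integrable lborel (%x. S * indicator A x)" using Af by (intro integrable_mult_right int_ind) auto
  have "norm (g x) <= norm (S * indicator A x)" for x using gA[of x] gS[of x] by (cases "x : A") auto
  thus "AE x in lborel. norm (g x) <= norm (S * indicator A x)" by simp
 qed simp
 define Z where "Z = {x. x ~: Om & gap x <= d}"
 have Z: "Z = A - Om" by (auto simp: Z_def A_def)
 have Zb: "Z : sets borel" unfolding Z by simp
 have "(LINT x|lborel. g x) = (LINT x|lborel. indicator Om x * g x + indicator Z x * g x)"
  using gA by (intro lint_cong) (auto simp: indicator_def Z)
 also have "... = (LINT x|lborel. indicator Om x * g x) + (LINT x|lborel. indicator Z x * g x)"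
  using integrable_mult_indicator[OF _ gi, of Om] integrable_mult_indicator[OF _ gi, of Z] Zb by (intro Bochner_Integration.integral_add) simp_all
 also have "(LINT x|lborel. indicator Om x * g x) = (LINT x:Om|lborel. snd (\<psi> (x, 0)))"
  unfolding sli_def by (intro lint_cong) (auto simp: indicator_def g_def height_def)
 finally have g_split: "(LINT x|lborel. g x) = (LINT x:Om|lborel. snd (\<psi> (x, 0))) + (LINT x|lborel. indicator Z x * g x)" .
 have Zf: "emeasure lborel Z < \<infinity>"
  using Af emeasure_mono[of Z A lborel] by (auto simp: Z intro: le_less_trans)
 have "norm (LINT x|lborel. indicator Z x * g x) <= (LINT x|lborel. S * indicator Z x)"
 proof (rule lint_norm_le)
  show "integrable lborel (%x. indicator Z x * g x)" using integrable_mult_indicator[OF _ gi, of Z] Zb by simp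
  show "integrable lborel (%x. S * indicator Z x)" using Zb Zf by (intro integrable_mult_right int_ind) auto
  show "norm (indicator Z x * g x) <= S * indicator Z x" for x using gS[of x] S0 by (auto simp: indicator_def)
 qed
 also have "... = S * measure lborel Z" using Zb by simp
 finally have "\<bar>LINT x|lborel. indicator Z x * g x\<bar> <= S * measure lborel Z" by simp
 moreover have "flux M bu \<psi> = (LINT t:{0..<len}|lborel. (nrm t @. axis 1 1) * side_fn (f (axis 1 1)) (gam t))
   + (LINT t:{0..<len}|lborel. (nrm t @. axis 2 1) * side_fn (f (axis 2 1)) (gam t)) - (LINT x:Om|lborel. snd (\<psi> (x, 0)))"
  unfolding f_def by (rule flux_eq[OF c S])
 moreover have "S * (measure lborel Z + 16 * d * measure tv UNIV) = S * measure lborel Z + 2 * (S * (8 * d * measure tv UNIV))"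
  by (simp add: algebra_simps)
 moreover have "(LINT z|lborel. of_bool (snd z < height (fst z)) * dvg \<psi> z) = (LINT z|lborel. w z * dvg \<psi> z)"
  by (simp add: w_def)
 ultimately show ?thesis
  using dir[of "axis 1 1", OF disjI1[OF refl]] dir[of "axis 2 1", OF disjI2[OF refl]] div vert g_split
  unfolding Z_def[symmetric] g_def[symmetric] by linarith
qed

end

section \<open>The gradient of a competitor on the closed cylinder\<close>

lemma C1_cutoff_extension:
 fixes g :: "'a::euclidean_space => 'b::euclidean_space" and \<eta> :: "'a => real" and g' :: "'a => 'a \<Rightarrow>\<^sub>L 'b"
 assumes V: "open V" and \<eta>: "\<eta> : C1_upto UNIV" "compact K" "K \<subseteq> V" "!!z. z ~: K ==> \<eta> z = 0"
  and g: "!!z. z : V ==> (g has_derivative blinfun_apply (g' z)) (at z)" "continuous_on V g'"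
 shows "(%z. \<eta> z *. g z) : C1c V"
proof (rule C1c_I[OF _ \<eta>(2,3)])
 obtain e where e: "continuous_on UNIV e" "!!z. (\<eta> has_derivative blinfun_apply (e z)) (at z)" "continuous_on UNIV \<eta>"
  using \<eta>(1) by (rule C1_UNIV_E) blast
 have gc: "continuous_on V g" using g(1) by (intro has_derivative_continuous_on[of V g "%z. blinfun_apply (g' z)"]) (auto intro: has_derivative_at_withinI)
 \<comment> \<open>\<open>g\<close> is controlled only on \<open>V\<close>. The derivative is set to
   0 off \<open>K\<close>, and its continuity is checked on the open sets \<open>V\<close> and
   \<open>- K\<close>, which cover the space.\<close>
 define D where "D = (%z. if z : K then \<eta> z *. g' z + (blinfun_scaleR_left (g z) o\<^sub>L e z) else 0)"
 have e0: "e z = 0" if "z ~: K" for z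
 proof -
  have "((%w. 0) has_derivative blinfun_apply (e z)) (at z)"
   by (rule has_derivative_transform_within_open[OF e(2), of "- K"]) (use \<eta> that compact_imp_closed in auto)
  hence "blinfun_apply (e z) = (%h. 0)" by (rule has_derivative_unique) simp
  thus ?thesis by (intro blinfun_eqI) simp
 qed
 have DV: "D z = \<eta> z *. g' z + (blinfun_scaleR_left (g z) o\<^sub>L e z)" if "z : V" for z
  using e0[of z] \<eta>(4)[of z] by (simp add: D_def)
 have cV: "continuous_on V D"
 proof (subst continuous_on_cong[OF refl DV])
  show "continuous_on V (%z. \<eta> z *. g' z + (blinfun_scaleR_left (g z) o\<^sub>L e z))"
   by (intro continuous_intros g gc continuous_on_subset[OF e(3)] continuous_on_subset[OF e(1)]
    bounded_linear.continuous_on[OF bounded_linear_blinfun_scaleR_left]) auto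
 qed
 have cK: "continuous_on (- K) D"
  by (subst continuous_on_cong[OF refl, of _ _ "%z. 0"]) (auto simp: D_def)
 have "continuous_on (V Un - K) D"
  by (rule continuous_on_open_Un) (use cV cK V \<eta>(2) compact_imp_closed in auto)
 moreover have "V Un - K = UNIV" using \<eta>(3) by blast
 ultimately have cD: "continuous_on UNIV D" by simp
 show "(%z. \<eta> z *. g z) : C1_upto UNIV"
 proof (rule C1_UNIV_I[OF cD])
  show "((%z. \<eta> z *. g z) has_derivative blinfun_apply (D z)) (at z)" for z
  proof (cases "z : V")
   case True
   have "((%z. \<eta> z *. g z) has_derivative (%h. \<eta> z *. g' z h + e z h *. g z)) (at z)"
    by (rule has_derivative_scaleR[OF e(2) g(1)[OF True]])
   moreover have "blinfun_apply (D z) = (%h. \<eta> z *. g' z h + e z h *. g z)"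
    unfolding DV[OF True] by (simp add: fun_eq_iff blinfun.add_left blinfun.scaleR_left)
   ultimately show ?thesis by simp
  next
   case False
   hence zK: "z : - K" using \<eta>(3) by auto
   have "((%z. 0::'b) has_derivative blinfun_apply (D z)) (at z)" using zK by (simp add: D_def zero_blinfun.rep_eq)
   thus ?thesis
    by (rule has_derivative_transform_within_open[of _ _ _ _ "- K"]) (use zK \<eta> compact_imp_closed in auto)
  qed
 qed
qed (use \<eta> in auto)

lemma negligible_lborel_AE:
 assumes "negligible N" "closed N"
 shows "AE x in lborel. x ~: N"
proof (rule AE_not_in)
 show "N : null_sets lborel"
  using assms null_sets_completion_iff[of N lborel] by (simp add: negligible_iff_null_sets)
qed

context boundary_data begin

abbreviation "Ucyl \<equiv> nbhd1 Om \<times> (UNIV :: real set)"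
abbreviation "Qcyl \<equiv> Om \<times> {0<..<M}"

lemma gap_closure: "x : closure Om ==> gap x = 0" by (simp add: gap_0_iff)

lemma open_nbhd1: "open (nbhd1 Om)" unfolding nbhd1_def by auto
lemma open_Ucyl: "open Ucyl" by (intro open_Times open_nbhd1 open_UNIV)
lemma open_Qcyl: "open Qcyl" by (intro open_Times open_Om open_greaterThanLessThan)
lemma closure_nbhd1: "closure Om \<subseteq> nbhd1 Om" by (auto simp: nbhd1_eq gap_closure)
lemma Acyl_subset: "Acyl \<subseteq> Ucyl" using closure_nbhd1 by blast
lemma Qcyl_subset: "Qcyl \<subseteq> Acyl" using closure_subset[of Om] by auto
lemma Qcyl_finite: "emeasure lborel Qcyl < \<infinity>"
 by (rule emeasure_bounded_finite) (auto intro!: bounded_Times simp: bounded_Om)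

lemma AE_frontier: "AE x in lborel. x ~: frontier Om"
 by (rule negligible_lborel_AE) (auto simp: negligible_convex_frontier convex_Om frontier_closed)

lemma AE_cylinder: "AE z in lborel. z : Acyl --> z : Qcyl"
proof -
 have "AE s in (lborel :: real measure). s ~= 0 & s ~= M" using AE_lborel_singleton[of 0] AE_lborel_singleton[of M] by eventually_elim simp
 from AE_lborel_snd[OF this] AE_lborel_fst[OF AE_frontier]
 show ?thesis by eventually_elim (auto simp: closure_eq)
qed

definition below :: "plane \<times> real => real" where "below z = of_bool (snd z < height (fst z))"

lemma below_borel [measurable]: "below : borel_fun"
 unfolding below_def borel_prod[symmetric] by measurable

lemma below_ind: "z : Ucyl - Acyl ==> z ~: frontier Om \<times> UNIV ==> ind_u Om M bu z = below z"
 using height_bounds[of "fst z"] closure_subset[of Om]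
 by (cases z) (auto simp: ind_u_def below_def height_eq closure_eq not_less)

lemma below_Q: "z : Qcyl ==> below z = 0" by (auto simp: below_def height_def)

text \<open>Membership in \<open>C_set\<close> without the existence of a gradient, which for the
  minimiser is established only after integration by parts has been used.\<close>

definition admissible :: "(plane \<times> real => real) => bool" where
 "admissible v \<longleftrightarrow> (ALL K. compact K & K \<subseteq> Ucyl --> set_integrable lebesgue K v) &
   (AE z in lebesgue. z : Ucyl --> v z : {0..1}) &
   (AE z in lebesgue. z : Ucyl - Acyl --> v z = ind_u Om M bu z)"

lemma C_set_iff: "v : C_set Om M bu \<longleftrightarrow> admissible v & (EX m \<sigma>. is_gradient Ucyl v m \<sigma>)"
 by (auto simp: C_set_def BV_loc_def admissible_def)

lemma divergence_props:
 assumes "\<psi> : C1c U"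
 obtains K B where "compact K" "K \<subseteq> U" "!!z. z ~: K ==> dvg \<psi> z = 0" "!!z. \<bar>dvg \<psi> z\<bar> <= B" "continuous_on UNIV (dvg \<psi>)"
proof -
 obtain D K where D: "continuous_on UNIV D" "!!z. frechet_derivative \<psi> (at z) = blinfun_apply (D z)" and K: "compact K" "K \<subseteq> U" "!!z. z ~: K ==> D z = 0"
  by (rule C1c_derivative[OF assms]) blast
 have dv: "dvg \<psi> = (%z. SUM b:Basis. D z b @. b)" unfolding divergence_def D(2) by simp
 have c: "continuous_on UNIV (dvg \<psi>)" unfolding dv by (intro continuous_intros D(1))
 have z: "dvg \<psi> z = 0" if "z ~: K" for z using K(3)[OF that] by (simp add: dv)
 have "bounded (dvg \<psi> ` K)" using K(1) by (intro compact_imp_bounded compact_continuous_image continuous_on_subset[OF c]) auto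
 then obtain B where B: "!!z. z : K ==> norm (dvg \<psi> z) <= B" by (auto simp: bounded_iff)
 have "\<bar>dvg \<psi> z\<bar> <= \<bar>B\<bar>" for z using B[of z] z[of z] by (cases "z : K") auto
 thus ?thesis using that[OF K(1,2) z _ c] by blast
qed

text \<open>The closed cylinder and its interior differ by a null set, and outside the values are
  prescribed; so \<open>v\<close> enters only through the open cylinder.\<close>

lemma interior_split:
 assumes v: "admissible v" and \<psi>: "\<psi> : C1c Ucyl"
 shows "(LINT z|lebesgue. v z * dvg \<psi> z) = (LINT z:Qcyl|lebesgue. v z * dvg \<psi> z) + (LINT z|lborel. below z * dvg \<psi> z)"
  and "set_integrable lebesgue Qcyl (%z. v z * dvg \<psi> z)"
proof -
 obtain K B where K: "compact K" "K \<subseteq> Ucyl" "!!z. z ~: K ==> dvg \<psi> z = 0" "!!z. \<bar>dvg \<psi> z\<bar> <= B" "continuous_on UNIV (dvg \<psi>)"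
  using divergence_props[OF \<psi>] by blast
 have dm: "dvg \<psi> : borel_fun" by (rule borel_contI[OF K(5)])
 hence dm': "dvg \<psi> : borel_measurable lebesgue" by (intro measurable_completion) simp
 have vi: "integrable lebesgue (%z. indicator K z *. v z)" using v K by (auto simp: admissible_def set_integrable_def)
 have J: "integrable lebesgue (%z. v z * dvg \<psi> z)"
 proof (rule int_bound)
  show "integrable lebesgue (%z. B * (indicator K z *. v z))" by (intro integrable_mult_right vi)
  have eq: "v z * dvg \<psi> z = (indicator K z *. v z) * dvg \<psi> z" for z using K(3)[of z] by (cases "z : K") auto
  show "(%z. v z * dvg \<psi> z) : borel_measurable lebesgue"
   unfolding eq by (intro borel_measurable_times dm' borel_measurable_integrable[OF vi])
  have "norm (v z * dvg \<psi> z) <= norm (B * (indicator K z *. v z))" for z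
  proof -
   have "norm (v z * dvg \<psi> z) = \<bar>indicator K z *. v z\<bar> * \<bar>dvg \<psi> z\<bar>" unfolding eq by (simp add: abs_mult)
   also have "... <= \<bar>indicator K z *. v z\<bar> * \<bar>B\<bar>" using K(4)[of z] by (intro mult_left_mono) auto
   finally show ?thesis by (simp add: abs_mult mult.commute)
  qed
  thus "AE z in lebesgue. norm (v z * dvg \<psi> z) <= norm (B * (indicator K z *. v z))" by simp
 qed
 have Qs: "Qcyl : sets lebesgue" using open_Qcyl by (simp add: borel_open)
 show QJ: "set_integrable lebesgue Qcyl (%z. v z * dvg \<psi> z)"
  unfolding set_integrable_def by (rule integrable_mult_indicator[OF Qs J])
 have E: "integrable lborel (%z. below z * dvg \<psi> z)"
  by (rule continuous_compact_support_integrable[OF K(5,1,3) below_borel]) (auto simp: below_def)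
 hence E': "integrable lebesgue (%z. below z * dvg \<psi> z)" "(LINT z|lebesgue. below z * dvg \<psi> z) = (LINT z|lborel. below z * dvg \<psi> z)"
  by (simp_all add: integrable_completion integral_completion)
 have "AE z in lebesgue. z : Ucyl - Acyl --> v z = ind_u Om M bu z" using v by (simp add: admissible_def)
 with AE_completion[OF AE_cylinder] AE_completion[OF AE_lborel_fst[OF AE_frontier]]
 have "AE z in lebesgue. v z * dvg \<psi> z = indicator Qcyl z *. (v z * dvg \<psi> z) + below z * dvg \<psi> z"
 proof eventually_elim
  case (elim z)
  consider "z ~: Ucyl" | "z : Qcyl" | "z : Ucyl - Acyl" using elim(1) by blast
  thus ?case
  proof cases
   case 1
   hence "dvg \<psi> z = 0" using K(2,3) by blast
   thus ?thesis by simp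
  next
   case 2
   thus ?thesis by (simp add: below_Q)
  next
   case 3
   hence "z ~: Qcyl" using Qcyl_subset by blast
   moreover have "v z = below z" using 3 elim(2,3) below_ind[of z] by (cases z) auto
   ultimately show ?thesis by simp
  qed
 qed
 hence "(LINT z|lebesgue. v z * dvg \<psi> z) = (LINT z|lebesgue. indicator Qcyl z *. (v z * dvg \<psi> z) + below z * dvg \<psi> z)"
  using J QJ E'(1) by (intro integral_cong_AE) (auto simp: set_integrable_def intro!: borel_measurable_add)
 also have "... = (LINT z:Qcyl|lebesgue. v z * dvg \<psi> z) + (LINT z|lborel. below z * dvg \<psi> z)"
  using QJ E' by (simp add: set_integrable_def sli_def)
 finally show "(LINT z|lebesgue. v z * dvg \<psi> z) = (LINT z:Qcyl|lebesgue. v z * dvg \<psi> z) + (LINT z|lborel. below z * dvg \<psi> z)" .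
qed

lemma flux_cong:
 assumes "!!z. z : Acyl ==> \<phi> z = \<phi>' z"
 shows "flux M u \<phi> = flux M u \<phi>'"
proof -
 have 1: "\<phi> (side_map p) = \<phi>' (side_map p)" if "p : {0..<len} \<times> {0..M}" for p using assms[OF side_map_mem[OF that]] .
 have 2: "\<phi> (x, 0) = \<phi>' (x, 0)" if "x : Om" for x using assms[OF bottom_mem[OF that]] .
 show ?thesis unfolding flux_def
  by (intro arg_cong2[of _ _ _ _ "(-)"] set_lebesgue_integral_cong) (use 1 2 rect_borel open_Om in \<open>auto\<close>)
qed

text \<open>The shells decrease to the frontier, which is null because the domain is convex.\<close>

lemma thin_shell: "(%k. measure lborel {x. x ~: Om & gap x <= 1 / real (Suc k)}) \<longlonglongrightarrow> 0"
proof -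
 define Z where "Z = (%k. {x. x ~: Om & gap x <= 1 / real (Suc k)})"
 have Zb: "Z k : sets borel" for k
 proof -
  have "Z k = {x. gap x <= 1 / real (Suc k)} - Om" by (auto simp: Z_def)
  thus ?thesis using gap_sublevel_compact[of "1 / real (Suc k)"] open_Om by (simp only:) (intro sets.Diff borel_compact borel_open)
 qed
 have Zf: "emeasure lborel (Z k) ~= \<infinity>" for k
 proof -
  have "emeasure lborel (Z k) <= emeasure lborel {x. gap x <= 1 / real (Suc k)}"
   using gap_sublevel_compact[of "1 / real (Suc k)"] by (intro emeasure_mono) (auto simp: Z_def intro: borel_compact)
  also have "... < \<infinity>" by (intro emeasure_bounded_finite compact_imp_bounded gap_sublevel_compact)
  finally show ?thesis by simp
 qed
 have "(%k. measure lborel (Z k)) \<longlonglongrightarrow> measure lborel (\<Inter>k. Z k)"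
 proof (rule Lim_measure_decseq)
  show "decseq Z"
  proof (rule decseq_SucI)
   fix k
   have "1 / real (Suc (Suc k)) <= 1 / real (Suc k)" by (simp add: frac_le)
   thus "Z (Suc k) \<subseteq> Z k" by (auto simp: Z_def)
  qed
 qed (use Zb Zf in auto)
 moreover have "(\<Inter>k. Z k) = frontier Om"
 proof
  show "(\<Inter>k. Z k) \<subseteq> frontier Om"
  proof
   fix x assume x: "x : (\<Inter>k. Z k)"
   have "gap x <= 0"
   proof (rule ccontr)
    assume "\<not> gap x <= 0"
    then obtain k where "1 / real (Suc k) < gap x" using nat_approx_posE by (metis not_le)
    thus False using x by (auto simp: Z_def not_le[symmetric])
   qed
   hence "x : closure Om" using gap_nonneg[of x] gap_0_iff[of x] by simp
   thus "x : frontier Om" using x by (auto simp: Z_def closure_eq)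
  qed
  show "frontier Om \<subseteq> (\<Inter>k. Z k)"
   using gap_closure frontier_disj by (auto simp: Z_def closure_eq)
 qed
 moreover have "measure lborel (frontier Om) = 0"
  using AE_frontier frontier_closed[of Om] by (subst (asm) AE_iff_measurable[of "frontier Om"]) (auto simp: measure_def)
 ultimately show ?thesis unfolding Z_def by simp
qed

text \<open>The field is multiplied by cutoffs that equal 1 near the closed cylinder and whose
  supports shrink to it. Flux and inner integral do not change, the exterior integral tends to minus
  the flux, and the gradient integral tends to the one over the closed cylinder. Hence jumps of
  \<open>v\<close> across the faces are counted.\<close>

lemma gradient_on_cylinder:
 assumes v: "admissible v" and g: "is_gradient Ucyl v m \<sigma>" and \<psi>: "\<psi> : C1c Ucyl"
 shows "(LINT z:Acyl|m. \<psi> z @. \<sigma> z) = flux M bu \<psi> - (LINT z:Qcyl|lebesgue. v z * dvg \<psi> z)"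
proof -
 have m: "sets m = sets borel" "!!K. compact K ==> K \<subseteq> Ucyl ==> emeasure m K < \<infinity>" "\<sigma> : borel_fun" "AE z in m. norm (\<sigma> z) = 1"
  "!!\<psi>. \<psi> : C1c Ucyl ==> (LINT z|lebesgue. v z * dvg \<psi> z) = - (LINT z|m. \<psi> z @. \<sigma> z)"
  using g unfolding is_gradient_def by auto
 obtain D K where c: "continuous_on UNIV \<psi>" and D: "!!z. (\<psi> has_derivative blinfun_apply (D z)) (at z)" and K: "compact K" "K \<subseteq> Ucyl" "!!z. z ~: K ==> \<psi> z = 0"
  by (rule C1c_derivative[OF \<psi>]) blast
 have C1: "\<psi> : C1_upto UNIV" using \<psi> by (simp add: C1c_def)
 obtain S where S: "0 < S" "!!z. norm (\<psi> z) <= S" using C1c_bounded[OF \<psi>] by blast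
 define A where "A = (%k. {x. gap x < 1 / real (Suc k)} \<times> {- (1 / real (Suc k))<..<M + 1 / real (Suc k)})"
 define P where "P = (%k \<eta> W. \<eta> : C1_upto UNIV & (ALL z. 0 <= \<eta> z & \<eta> z <= (1::real)) & open W & Acyl \<subseteq> W & (ALL z:W. \<eta> z = 1) & (ALL z. z ~: A k --> \<eta> z = 0))"
 have ex: "EX \<eta> W. P k \<eta> W" for k
 proof -
  have "open (A k)" unfolding A_def by (intro open_Times open_Collect_less gap_cont continuous_intros) auto
  moreover have "Acyl \<subseteq> A k"
  proof (intro subsetI)
   fix z assume "z : Acyl"
   have k: "0 < 1 / real (Suc k)" by simp
   from \<open>z : Acyl\<close> have "gap (fst z) = 0" "0 <= snd z" "snd z <= M" by (auto simp: gap_closure)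
   hence "gap (fst z) < 1 / real (Suc k)" "- (1 / real (Suc k)) < snd z" "snd z < M + 1 / real (Suc k)"
    using k by linarith+
   thus "z : A k" by (cases z) (simp add: A_def)
  qed
  ultimately obtain \<eta> W K' where "\<eta> : C1_upto UNIV" "!!z. 0 <= \<eta> z & \<eta> z <= (1::real)" "open W" "Acyl \<subseteq> W" "!!z. z : W ==> \<eta> z = 1"
   "compact K'" "K' \<subseteq> A k" "!!z. z ~: K' ==> \<eta> z = 0" by (rule C1_cutoff[OF compact_Acyl]) blast
  hence "P k \<eta> W" unfolding P_def by (intro conjI allI ballI impI) (assumption | blast)+
  thus ?thesis by blast
 qed
 obtain \<eta> where e: "!!k. EX W. P k (\<eta> k) W" using choice[of "%k \<eta>. EX W. P k \<eta> W"] ex by blast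
 obtain W where PW: "!!k. P k (\<eta> k) (W k)" using choice[of "%k W. P k (\<eta> k) W"] e by blast
 have \<eta>: "!!k. \<eta> k : C1_upto UNIV" "!!k z. 0 <= \<eta> k z & \<eta> k z <= (1::real)" "!!k. open (W k)" "!!k. Acyl \<subseteq> W k"
  "!!k z. z : W k ==> \<eta> k z = 1" "!!k z. z ~: A k ==> \<eta> k z = 0"
  using PW unfolding P_def by auto
 define \<psi>k where "\<psi>k = (%k z. \<eta> k z *. \<psi> z)"
 have mem: "\<psi>k k : C1c Ucyl" for k
  unfolding \<psi>k_def using K by (intro C1c_I[of _ K] C1_scaleR \<eta> C1) auto
 define R where "R = flux M bu \<psi> - (LINT z:Qcyl|lebesgue. v z * dvg \<psi> z)"
 define err where "err = (%k. S * (measure lborel {x. x ~: Om & gap x <= 1 / real (Suc k)} + 16 * (1 / real (Suc k)) * measure tv UNIV))"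
 have est: "\<bar>(LINT z|m. \<psi>k k z @. \<sigma> z) - R\<bar> <= err k" for k
 proof -
  have dv: "dvg (\<psi>k k) z = dvg \<psi> z" if z: "z : Qcyl" for z
  proof -
   have zW: "z : W k" using \<eta>(4)[of k] Qcyl_subset z by blast
   have "(\<psi>k k has_derivative blinfun_apply (D z)) (at z)"
    by (rule has_derivative_transform_within_open[OF D \<eta>(3) zW]) (simp add: \<psi>k_def \<eta>(5))
   hence "frechet_derivative (\<psi>k k) (at z) = frechet_derivative \<psi> (at z)"
    using frechet_derivative_at D by metis
   thus ?thesis by (simp add: divergence_def)
  qed
  have "(LINT z:Qcyl|lebesgue. v z * dvg (\<psi>k k) z) = (LINT z:Qcyl|lebesgue. v z * dvg \<psi> z)"
   unfolding sli_def by (intro lint_cong) (auto simp: dv indicator_def)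
  moreover have "flux M bu (\<psi>k k) = flux M bu \<psi>"
  proof (rule flux_cong)
   fix z assume "z : Acyl"
   hence "z : W k" using \<eta>(4) by blast
   thus "\<psi>k k z = \<psi> z" by (simp add: \<psi>k_def \<eta>(5))
  qed
  moreover have "\<bar>(LINT z|lborel. of_bool (snd z < height (fst z)) * dvg (\<psi>k k) z) + flux M bu (\<psi>k k)\<bar> <= err k"
   unfolding err_def
  proof (rule exterior_estimate[OF mem])
   show "\<psi>k k (x, s) = 0" if "1 / real (Suc k) < gap x" for x s
    using \<eta>(6)[of "(x, s)" k] that by (auto simp: A_def \<psi>k_def)
   show "norm (\<psi>k k z) <= S" for z
    using mult_mono[OF conjunct2[OF \<eta>(2)[of k z]] S(2)[of z]] S(1) \<eta>(2)[of k z] by (simp add: \<psi>k_def)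
  qed simp
  ultimately show ?thesis
   using m(5)[OF mem[of k]] interior_split(1)[OF v mem[of k]] unfolding R_def below_def by linarith
 qed
 have "(%k. 1 / real (Suc k)) \<longlonglongrightarrow> 0" using LIMSEQ_inverse_real_of_nat by (simp add: inverse_eq_divide)
 hence "err \<longlonglongrightarrow> S * (0 + 16 * 0 * measure tv UNIV)"
  unfolding err_def by (intro tendsto_intros thin_shell)
 hence e0: "err \<longlonglongrightarrow> 0" by simp
 have "(%k. (LINT z|m. \<psi>k k z @. \<sigma> z) - R) \<longlonglongrightarrow> 0"
  by (rule Lim_null_comparison[OF _ e0], rule always_eventually, rule allI) (simp only: real_norm_def est)
 hence l1: "(%k. LINT z|m. \<psi>k k z @. \<sigma> z) \<longlonglongrightarrow> R" by (simp add: LIM_zero_iff)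
 have [measurable_cong]: "sets m = sets borel" by (rule m)
 note [measurable] = m(3)
 have [measurable]: "\<psi> : borel_fun" by (rule borel_contI[OF c])
 have [measurable]: "\<eta> k : borel_fun" for k
  using \<eta>(1)[of k] by (intro borel_contI) (auto simp: C1_upto_def)
 note [measurable] = Acyl_borel
 have "(%k. LINT z|m. \<psi>k k z @. \<sigma> z) \<longlonglongrightarrow> (LINT z|m. indicator Acyl z *. (\<psi> z @. \<sigma> z))"
 proof (rule integral_dominated_convergence[where w="%z. S * indicator K z"])
  show "integrable m (%z. S * indicator K z)"
   using m(2)[OF K(1,2)] borel_compact[OF K(1)] by (intro integrable_mult_right int_ind) (simp_all add: m(1))
  show "(%z. \<psi>k k z @. \<sigma> z) : borel_measurable m" for k unfolding \<psi>k_def by measurable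
  show "(%z. indicator Acyl z *. (\<psi> z @. \<sigma> z)) : borel_measurable m" by measurable
  have lim: "(%k. \<eta> k z) \<longlonglongrightarrow> indicator Acyl z" for z
  proof (cases "z : Acyl")
   case True
   hence "\<eta> k z = 1" for k using \<eta>(4,5) by blast
   thus ?thesis using True by simp
  next
   case False
   obtain x s where z: "z = (x, s)" by fastforce
   have "EX d>0. d <= gap x \<or> d <= - s \<or> d <= s - M"
   proof (cases "x : closure Om")
    case True
    hence "s < 0 \<or> M < s" using False z by auto
    thus ?thesis by (metis diff_gt_0_iff_gt neg_0_less_iff_less order_refl)
   next
    case False
    hence "0 < gap x" using gap_0_iff[of x] gap_nonneg[of x] by simp
    thus ?thesis by blast
   qed
   then obtain d where d: "0 < d" "d <= gap x \<or> d <= - s \<or> d <= s - M" by blast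
   obtain n where n: "1 / real (Suc n) < d" using nat_approx_posE[OF d(1)] by blast
   have "\<eta> k z = 0" if "n <= k" for k
   proof (rule \<eta>(6))
    have "1 / real (Suc k) <= 1 / real (Suc n)" using that by (simp add: frac_le)
    hence "1 / real (Suc k) < d" using n by simp
    thus "z ~: A k" using d(2) by (auto simp: A_def z)
   qed
   thus ?thesis using False by (intro tendsto_eventually) (auto simp: eventually_sequentially)
  qed
  show "AE z in m. (%k. \<psi>k k z @. \<sigma> z) \<longlonglongrightarrow> indicator Acyl z *. (\<psi> z @. \<sigma> z)"
  proof (rule AE_I2)
   fix z
   have "(%k. \<eta> k z *. (\<psi> z @. \<sigma> z)) \<longlonglongrightarrow> indicator Acyl z *. (\<psi> z @. \<sigma> z)" by (intro tendsto_intros lim)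
   thus "(%k. \<psi>k k z @. \<sigma> z) \<longlonglongrightarrow> indicator Acyl z *. (\<psi> z @. \<sigma> z)" by (simp add: \<psi>k_def)
  qed
  show "AE z in m. norm (\<psi>k k z @. \<sigma> z) <= S * indicator K z" for k
   using m(4)
  proof eventually_elim
   case (elim z)
   have "\<bar>\<psi>k k z @. \<sigma> z\<bar> <= norm (\<psi>k k z) * norm (\<sigma> z)" by (rule Cauchy_Schwarz_ineq2)
   also have "... = \<eta> k z * norm (\<psi> z)" using elim \<eta>(2)[of k z] by (simp add: \<psi>k_def)
   also have "... <= 1 * norm (\<psi> z)" using \<eta>(2)[of k z] by (intro mult_right_mono) auto
   also have "... <= S * indicator K z" using S(2)[of z] K(3)[of z] by (cases "z : K") auto
   finally show ?case by simp
  qed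
 qed
 hence "R = (LINT z|m. indicator Acyl z *. (\<psi> z @. \<sigma> z))" using l1 LIMSEQ_unique by blast
 thus ?thesis by (simp add: R_def sli_def)
qed

lemma flux_linear:
 assumes "continuous_on Acyl \<phi>" "continuous_on Acyl \<psi>"
 shows "flux M bu (%z. a *. \<phi> z + b *. \<psi> z) = a * flux M bu \<phi> + b * flux M bu \<psi>"
proof -
 have "side_density (%z. a *. \<phi> z + b *. \<psi> z) = (%p. a * side_density \<phi> p + b * side_density \<psi> p)"
  by (simp add: fun_eq_iff side_density_def inner_add_left algebra_simps)
 moreover have "bottom_density (%z. a *. \<phi> z + b *. \<psi> z) = (%x. a * bottom_density \<phi> x + b * bottom_density \<psi> x)"
  by (simp add: fun_eq_iff bottom_density_def algebra_simps)
 ultimately show ?thesis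
  unfolding flux_densities using density_integrable[OF assms(1)] density_integrable[OF assms(2)] by (simp add: algebra_simps)
qed

lemma flux_bound:
 assumes \<phi>: "continuous_on Acyl \<phi>" and S: "0 <= S" "!!z. z : Acyl ==> norm (\<phi> z) <= S"
 shows "flux M bu \<phi> <= S * (2 * len * M + measure lborel Om)"
proof -
 note b = density_bounds[OF S(2,1)]
 have "norm (LINT p|lborel. side_density \<phi> p) <= (LINT p|lborel. S * 2 * indicator ({0..<len} \<times> {0..M}) p)"
  by (rule lint_norm_le[OF density_integrable(1)[OF \<phi>] dominators(1) b(1)])
 moreover have "norm (LINT x|lborel. bottom_density \<phi> x) <= (LINT x|lborel. S * indicator Om x)"
  by (rule lint_norm_le[OF density_integrable(2)[OF \<phi>] dominators(2) b(2)])
 moreover have "measure lborel ({0..<len} \<times> {0..M}) = len * M"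
  using emeasure_rect[of len M] M_nonneg len_pos by (simp add: measure_def)
 ultimately show ?thesis
  unfolding flux_densities using rect_borel[of M] open_Om by (simp add: algebra_simps)
qed

lemma closure_Qcyl: "0 < M ==> closure Qcyl = Acyl" by (simp add: closure_Times)

text \<open>A contraction \<open>\<Lambda>\<close> towards an inner point maps the closed convex
  cylinder into the open one, so \<open>\<phi> (\<Lambda> z)\<close> is C1 in a neighbourhood of the
  closed cylinder although \<open>\<phi>\<close> is only C1 up to the boundary. Uniform continuity
  of the field and of its divergence keeps the change small.\<close>

lemma C1_dilation:
 assumes M: "0 < M" and \<phi>: "\<phi> : C1_upto Qcyl" and eps: "0 < \<epsilon>"
 obtains \<psi> where "\<psi> : C1c Ucyl" "!!z. z : Acyl ==> norm (\<phi> z - \<psi> z) <= \<epsilon>"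
  "!!z. z : Qcyl ==> \<bar>dvg \<phi> z - dvg \<psi> z\<bar> <= \<epsilon>"
proof -
 obtain f' where \<phi>c: "continuous_on Acyl \<phi>" and f': "continuous_on Acyl f'" "!!z. z : Qcyl ==> (\<phi> has_derivative blinfun_apply (f' z)) (at z)"
  using \<phi> closure_Qcyl[OF M] unfolding C1_upto_def by auto
 define \<delta> where "\<delta> = (%z. SUM b:Basis. f' z b @. b)"
 have \<delta>c: "continuous_on Acyl \<delta>" unfolding \<delta>_def by (intro continuous_intros f'(1))
 have dv: "dvg \<phi> z = \<delta> z" if "z : Qcyl" for z
  using frechet_derivative_at[OF f'(2)[OF that]] by (simp add: divergence_def \<delta>_def)
 obtain B where B: "0 <= B" "!!z. z : Acyl ==> norm (\<delta> z) <= B" using bounded_on_Acyl[OF \<delta>c] by blast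
 obtain x0 where x0: "x0 : Om" using ne_Om by blast
 define z0 where "z0 = (x0, M / 2)"
 obtain R where R: "0 <= R" "!!z. z : Acyl ==> norm (z - z0) <= R"
  by (rule bounded_on_Acyl[of "%z. z - z0"]) (intro continuous_intros, rule that)
 obtain r where r: "0 < r" "!!z z'. z : Acyl ==> z' : Acyl ==> dist z' z < r ==> dist (\<phi> z') (\<phi> z) < \<epsilon>"
  using compact_uniformly_continuous[OF \<phi>c compact_Acyl] eps unfolding uniformly_continuous_on_def by metis
 obtain r' where r': "0 < r'" "!!z z'. z : Acyl ==> z' : Acyl ==> dist z' z < r' ==> dist (\<delta> z') (\<delta> z) < \<epsilon> / 2"
  using compact_uniformly_continuous[OF \<delta>c compact_Acyl] half_gt_zero[OF eps] unfolding uniformly_continuous_on_def by metis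
 \<comment> \<open>The quotients make the displacement \<open>e * R\<close> smaller than both moduli
   of uniform continuity, and the loss \<open>e * B\<close> caused by the factor
   \<open>1 - e\<close> of the derivative at most \<open>\<epsilon> / 2\<close>.\<close>
 define e where "e = Min {1, r / (R + 1), r' / (R + 1), \<epsilon> / 2 / (B + 1)}"
 have e: "0 < e" "e <= 1" and le: "e <= r / (R + 1)" "e <= r' / (R + 1)" "e <= \<epsilon> / 2 / (B + 1)"
  using r(1) r'(1) eps R(1) B(1) by (simp_all add: e_def)
 have "e * (R + 1) <= r" "e * (R + 1) <= r'" "e * (B + 1) <= \<epsilon> / 2"
  using le[unfolded pos_le_divide_eq[OF add_nonneg_pos[OF R(1) zero_less_one]] pos_le_divide_eq[OF add_nonneg_pos[OF B(1) zero_less_one]]] .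
 hence eR: "e * R < r" "e * R < r'" "e * B <= \<epsilon> / 2" using e(1) unfolding distrib_left by linarith+
 define \<Lambda> where "\<Lambda> = (%z. z - e *. (z - z0))"
 have \<Lambda>Q: "\<Lambda> z : Qcyl" if "z : Acyl" for z
 proof -
  have "\<Lambda> z : interior Qcyl"
   unfolding \<Lambda>_def
  proof (rule mem_interior_closure_convex_shrink)
   show "convex Qcyl" by (intro convex_Times convex_Om) simp
   show "z0 : interior Qcyl" using x0 M open_Qcyl by (simp add: interior_open z0_def)
   show "z : closure Qcyl" using that closure_Qcyl[OF M] by simp
  qed (use e in auto)
  thus ?thesis using interior_subset by blast
 qed
 have \<Lambda>A: "\<Lambda> z : Acyl" if "z : Acyl" for z by (rule subsetD[OF Qcyl_subset \<Lambda>Q[OF that]])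
 have \<Lambda>d: "dist (\<Lambda> z) z < r" "dist (\<Lambda> z) z < r'" if "z : Acyl" for z
  using le_less_trans[OF mult_left_mono[OF R(2)[OF that] less_imp_le[OF e(1)]] eR(1)]
   le_less_trans[OF mult_left_mono[OF R(2)[OF that] less_imp_le[OF e(1)]] eR(2)] e(1) by (simp_all add: \<Lambda>_def dist_norm)
 have \<Lambda>c: "continuous_on X \<Lambda>" for X unfolding \<Lambda>_def by (intro continuous_intros)
 define V where "V = \<Lambda> -` Qcyl Int Ucyl"
 have Vo: "open V" unfolding V_def by (intro open_Int open_Ucyl open_vimage open_Qcyl \<Lambda>c)
 have AV: "Acyl \<subseteq> V" unfolding V_def using \<Lambda>Q Acyl_subset by auto
 have der: "((%z. \<phi> (\<Lambda> z)) has_derivative blinfun_apply ((1 - e) *. f' (\<Lambda> z))) (at z)" if "\<Lambda> z : Qcyl" for z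
 proof -
  have "(\<Lambda> has_derivative (%h. h - e *. h)) (at z)" unfolding \<Lambda>_def by (auto intro!: derivative_eq_intros)
  from has_derivative_compose[OF this f'(2)[OF that]]
  show ?thesis by (rule has_derivative_eq_rhs) (simp add: fun_eq_iff blinfun.diff_right blinfun.scaleR_right blinfun.scaleR_left blinfun.diff_left scaleR_left_diff_distrib)
 qed
 obtain \<eta> W K' where \<eta>: "\<eta> : C1_upto UNIV" "!!z. 0 <= \<eta> z & \<eta> z <= (1::real)" "open W" "Acyl \<subseteq> W" "!!z. z : W ==> \<eta> z = 1"
  "compact K'" "K' \<subseteq> V" "!!z. z ~: K' ==> \<eta> z = 0" by (rule C1_cutoff[OF compact_Acyl Vo AV]) blast
 define \<psi> where "\<psi> = (%z. \<eta> z *. \<phi> (\<Lambda> z))"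
 show ?thesis
 proof (rule that)
  have "\<psi> : C1c V"
   unfolding \<psi>_def
  proof (rule C1_cutoff_extension[OF Vo \<eta>(1,6,7,8) der])
   show "continuous_on V (%z. (1 - e) *. f' (\<Lambda> z))"
    by (intro continuous_intros continuous_on_compose2[OF f'(1) \<Lambda>c]) (use Qcyl_subset in \<open>auto simp: V_def\<close>)
  qed (auto simp: V_def)
  thus "\<psi> : C1c Ucyl" by (auto simp: C1c_def V_def)
  fix z
  show "norm (\<phi> z - \<psi> z) <= \<epsilon>" if z: "z : Acyl"
  proof -
   have "z : W" using z \<eta>(4) by blast
   thus ?thesis using r(2)[OF z \<Lambda>A[OF z] \<Lambda>d(1)[OF z]] by (simp add: \<psi>_def \<eta>(5) dist_norm norm_minus_commute)
  qed
  show "\<bar>dvg \<phi> z - dvg \<psi> z\<bar> <= \<epsilon>" if "z : Qcyl"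
  proof -
   have z: "z : Acyl" using that Qcyl_subset by blast
   hence "z : W" using \<eta>(4) by blast
   hence "(\<psi> has_derivative blinfun_apply ((1 - e) *. f' (\<Lambda> z))) (at z)"
    using \<eta>(3,5) by (intro has_derivative_transform_within_open[OF der[OF \<Lambda>Q[OF z]]]) (auto simp: \<psi>_def)
   hence "frechet_derivative \<psi> (at z) = blinfun_apply ((1 - e) *. f' (\<Lambda> z))" by (rule frechet_derivative_at[symmetric])
   hence "dvg \<psi> z = \<delta> (\<Lambda> z) - e * \<delta> (\<Lambda> z)"
    unfolding divergence_def \<delta>_def sum_distrib_left sum_subtractf[symmetric]
    by (intro sum.cong) (simp_all add: blinfun.scaleR_left left_diff_distrib)
   moreover have "\<bar>e * \<delta> (\<Lambda> z)\<bar> <= e * B"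
    unfolding abs_mult using B(2)[OF \<Lambda>A[OF z]] e(1) by (simp add: mult_left_mono)
   ultimately show ?thesis using r'(2)[OF z \<Lambda>A[OF z] \<Lambda>d(2)[OF z]] eR(3) unfolding dv[OF that] dist_real_def by linarith
  qed
 qed
qed

end

section \<open>Transportation costs and convexity of the constraint set\<close>

lemma cost_quotient_antimono:
 assumes \<tau>: "transportation_cost \<tau>" and h: "0 < h" "h <= k"
 shows "\<tau> k / k <= \<tau> h / h"
proof -
 have c: "concave_on {0..} \<tau>" and z: "\<tau> 0 = 0" using \<tau> by (auto simp: transportation_cost_def)
 have "(1 - h / k) * \<tau> 0 + (h / k) * \<tau> k <= \<tau> ((1 - h / k) *. 0 + (h / k) *. k)"
  by (rule concave_onD[OF c]) (use h in auto)
 thus ?thesis using h z by (simp add: field_simps)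
qed

text \<open>By concavity the difference quotient increases as \<open>h\<close> decreases, so its
  limit exists in the extended reals and is the supremum, possibly infinite.\<close>

lemma right_deriv0_SUP:
 assumes \<tau>: "transportation_cost \<tau>"
 shows "right_deriv0 \<tau> = (SUP h\<in>{0<..}. ereal (\<tau> h / h))"
proof -
 define s where "s = (SUP h\<in>{0<..}. ereal (\<tau> h / h))"
 have z: "\<tau> 0 = 0" using \<tau> by (auto simp: transportation_cost_def)
 have "((%h. ereal ((\<tau> h - \<tau> 0) / h)) \<longlongrightarrow> s) (at_right 0)"
 proof (rule order_tendstoI)
  fix a assume "a < s"
  then obtain k where k: "0 < k" "a < ereal (\<tau> k / k)" by (auto simp: s_def less_SUP_iff)
  show "eventually (%h. a < ereal ((\<tau> h - \<tau> 0) / h)) (at_right 0)"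
   unfolding eventually_at_right_field
  proof (intro exI[of _ k] conjI k allI impI)
   fix h :: real assume h: "0 < h" "h < k"
   thus "a < ereal ((\<tau> h - \<tau> 0) / h)" using cost_quotient_antimono[OF \<tau> h(1), of k] k z by (simp add: less_le_trans)
  qed
 next
  fix a assume a: "s < a"
  show "eventually (%h. ereal ((\<tau> h - \<tau> 0) / h) < a) (at_right 0)"
   unfolding eventually_at_right_field
  proof (intro exI[of _ 1] conjI allI impI)
   fix h :: real assume h: "0 < h"
   have "ereal (\<tau> h / h) <= s" unfolding s_def using h by (intro SUP_upper) auto
   thus "ereal ((\<tau> h - \<tau> 0) / h) < a" using a z by simp
  qed simp
 qed
 hence "Lim (at_right 0) (%h. ereal ((\<tau> h - \<tau> 0) / h)) = s" by (intro tendsto_Lim) auto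
 thus ?thesis by (simp add: right_deriv0_def s_def)
qed

text \<open>A linear lower bound for the cost on \<open>[0, M]\<close>; it is the room in which
  constraint fields can be perturbed. Up to \<open>h\<close> it follows from concavity, beyond
  \<open>h\<close> from monotonicity.\<close>

lemma cost_slope:
 fixes M :: real
 assumes \<tau>: "transportation_cost \<tau>" and pos: "0 < right_deriv0 \<tau>"
 obtains c where "0 < c" "c <= 1" "ereal c <= right_deriv0 \<tau>" "!!t. 0 <= t ==> t <= M ==> c * t <= \<tau> t"
proof -
 have mono: "mono_on {0..} \<tau>" and z: "\<tau> 0 = 0" using \<tau> by (auto simp: transportation_cost_def)
 obtain h where h: "0 < h" "0 < \<tau> h / h" using pos by (auto simp: right_deriv0_SUP[OF \<tau>] less_SUP_iff)
 hence th: "0 < \<tau> h" by (simp add: zero_less_divide_iff)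
 \<comment> \<open>The bound 1 ensures that \<open>c\<close> times the vertical component of a
   normalised test field is at least -1.\<close>
 define c where "c = min 1 (\<tau> h / max h M)"
 have c1: "c <= \<tau> h / h" "c <= \<tau> h / max h M" using h th by (auto simp: c_def intro!: min.coboundedI2 divide_left_mono)
 show ?thesis
 proof (rule that)
  show "0 < c" "c <= 1" using h th by (auto simp: c_def)
  have "ereal c <= ereal (\<tau> h / h)" using c1 by simp
  also have "... <= right_deriv0 \<tau>" unfolding right_deriv0_SUP[OF \<tau>] using h by (intro SUP_upper) auto
  finally show "ereal c <= right_deriv0 \<tau>" .
  fix t assume t: "0 <= t" "t <= M"
  show "c * t <= \<tau> t"
  proof (cases "t = 0 \<or> h <= t")
   case True
   show ?thesis
   proof (cases "t = 0")
    case False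
    hence ht: "h <= t" using True by simp
    have "c * t <= \<tau> h / max h M * t" using c1 t by (intro mult_right_mono) auto
    also have "... <= \<tau> h / max h M * max h M" using th h t by (intro mult_left_mono) auto
    also have "... = \<tau> h" using h by simp
    also have "... <= \<tau> t" using mono_onD[OF mono, of h t] h t ht by simp
    finally show ?thesis .
   qed (simp add: z)
  next
   case False
   hence "\<tau> h / h <= \<tau> t / t" using t by (intro cost_quotient_antimono[OF \<tau>]) auto
   hence "c <= \<tau> t / t" using c1 by linarith
   thus ?thesis using False t by (simp add: pos_le_divide_eq)
  qed
 qed
qed

lemma divergence_linear:
 assumes "\<phi> : C1_upto UNIV" "\<psi> : C1_upto UNIV"
 shows "dvg (%z. a *. \<phi> z + b *. \<psi> z) z = a * dvg \<phi> z + b * dvg \<psi> z"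
proof -
 obtain f' where f: "!!z. (\<phi> has_derivative blinfun_apply (f' z)) (at z)" using assms(1) by (rule C1_UNIV_E) blast
 obtain g' where g: "!!z. (\<psi> has_derivative blinfun_apply (g' z)) (at z)" using assms(2) by (rule C1_UNIV_E) blast
 have "((%z. a *. \<phi> z + b *. \<psi> z) has_derivative (%h. a *. f' z h + b *. g' z h)) (at z)"
  using f g by (auto intro!: derivative_eq_intros)
 from frechet_derivative_at[OF this] frechet_derivative_at[OF f] frechet_derivative_at[OF g]
 have "frechet_derivative (%z. a *. \<phi> z + b *. \<psi> z) (at z) = (%h. a *. frechet_derivative \<phi> (at z) h + b *. frechet_derivative \<psi> (at z) h)"
  by metis
 thus ?thesis by (simp add: divergence_def inner_add_left sum.distrib sum_distrib_left)
qed

lemma C1_linear: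
 fixes \<phi> \<psi> :: "'a::euclidean_space => 'b::euclidean_space"
 assumes "\<phi> : C1c U" "\<psi> : C1c U"
 shows "(%z. a *. \<phi> z + b *. \<psi> z) : C1c U"
proof -
 obtain K where K: "\<phi> : C1_upto UNIV" "compact K" "K \<subseteq> U" "!!z. z ~: K ==> \<phi> z = 0" using assms(1) by (rule C1c_E) blast
 obtain L where L: "\<psi> : C1_upto UNIV" "compact L" "L \<subseteq> U" "!!z. z ~: L ==> \<psi> z = 0" using assms(2) by (rule C1c_E) blast
 show ?thesis
  by (rule C1c_I[of _ "K Un L"]) (use K L in \<open>auto intro!: C1_add C1_scaleR C1_const\<close>)
qed

lemma integrable_lebesgueI: "integrable lborel f ==> integrable lebesgue f"
 for f :: "'a::euclidean_space => real"
 using integrable_completion[OF borel_measurable_integrable, of lborel f] by blast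

lemma K_set_convex:
 assumes \<phi>: "\<phi> : K_set Om M \<tau>" and \<psi>: "\<psi> : K_set Om M \<tau>" and t: "0 <= t" "t <= 1"
 shows "(%z. (1 - t) *. \<phi> z + t *. \<psi> z) : K_set Om M \<tau>"
 unfolding K_set_def
proof (intro CollectI conjI ballI allI impI)
 have c: "continuous_on (closure Om \<times> {0..M}) \<phi>" "continuous_on (closure Om \<times> {0..M}) \<psi>" using \<phi> \<psi> by (auto simp: K_set_def)
 thus "continuous_on (closure Om \<times> {0..M}) (%z. (1 - t) *. \<phi> z + t *. \<psi> z)" by (intro continuous_intros)
 fix z assume z: "z : closure Om \<times> {0..M}"
 have b: "ereal (norm (fst (\<phi> z))) <= right_deriv0 \<tau>" "ereal (norm (fst (\<psi> z))) <= right_deriv0 \<tau>" "0 <= snd (\<phi> z)" "0 <= snd (\<psi> z)"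
  using \<phi> \<psi> z unfolding K_set_def by blast+
 thus "0 <= snd ((1 - t) *. \<phi> z + t *. \<psi> z)" using t by simp
 have "norm (fst ((1 - t) *. \<phi> z + t *. \<psi> z)) <= (1 - t) * norm (fst (\<phi> z)) + t * norm (fst (\<psi> z))"
  using norm_triangle_ineq[of "(1 - t) *. fst (\<phi> z)" "t *. fst (\<psi> z)"] t by simp
 also have "... <= max (norm (fst (\<phi> z))) (norm (fst (\<psi> z)))"
  by (rule convex_bound_le) (use t in auto)
 finally have "ereal (norm (fst ((1 - t) *. \<phi> z + t *. \<psi> z))) <= max (ereal (norm (fst (\<phi> z)))) (ereal (norm (fst (\<psi> z))))"
  by (simp add: ereal_max[symmetric] del: ereal_max)
 also have "... <= right_deriv0 \<tau>" using b by simp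
 finally show "ereal (norm (fst ((1 - t) *. \<phi> z + t *. \<psi> z))) <= right_deriv0 \<tau>" .
next
 fix x s1 s2 assume x: "x : closure Om" and s: "0 <= s1 & s1 < s2 & s2 <= M"
 have b: "norm (integral {s1..s2} (%s. fst (\<phi> (x, s)))) <= \<tau> (s2 - s1)" "norm (integral {s1..s2} (%s. fst (\<psi> (x, s)))) <= \<tau> (s2 - s1)"
  using \<phi> \<psi> x s unfolding K_set_def by blast+
 have i: "(%s. fst (f (x, s))) integrable_on {s1..s2}" if "f : K_set Om M \<tau>" for f
 proof (rule integrable_continuous_real)
  have cf: "continuous_on (closure Om \<times> {0..M}) f" using that by (simp add: K_set_def)
  show "continuous_on {s1..s2} (%s. fst (f (x, s)))"
   by (rule continuous_on_fst, rule continuous_on_compose2[OF cf], intro continuous_intros) (use x s in auto)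
 qed
 have "integral {s1..s2} (%s. fst ((1 - t) *. \<phi> (x, s) + t *. \<psi> (x, s)))
   = (1 - t) *. integral {s1..s2} (%s. fst (\<phi> (x, s))) + t *. integral {s1..s2} (%s. fst (\<psi> (x, s)))"
  using i[OF \<phi>] i[OF \<psi>] by (simp add: Henstock_Kurzweil_Integration.integral_add integrable_cmul)
 hence "norm (integral {s1..s2} (%s. fst ((1 - t) *. \<phi> (x, s) + t *. \<psi> (x, s))))
   <= (1 - t) * norm (integral {s1..s2} (%s. fst (\<phi> (x, s)))) + t * norm (integral {s1..s2} (%s. fst (\<psi> (x, s))))"
  using norm_triangle_ineq[of "(1 - t) *. integral {s1..s2} (%s. fst (\<phi> (x, s)))" "t *. integral {s1..s2} (%s. fst (\<psi> (x, s)))"] t by simp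
 also have "... <= \<tau> (s2 - s1)" by (rule convex_bound_le) (use t b in auto)
 finally show "norm (integral {s1..s2} (%s. fst ((1 - t) *. \<phi> (x, s) + t *. \<psi> (x, s)))) <= \<tau> (s2 - s1)" .
qed

context boundary_data begin

section \<open>Duality\<close>

text \<open>The value that integration by parts assigns to the pairing. It is available for profiles
  without a gradient, and \<open>pairing_C1\<close> identifies it with the pairing once a gradient
  exists.\<close>

definition dual_value :: "(plane \<times> real => real) => (plane \<times> real => plane \<times> real) => real" where
 "dual_value v \<phi> = flux M bu \<phi> - (LINT z:Qcyl|lebesgue. v z * dvg \<phi> z)"

text \<open>The bounds hold everywhere instead of almost everywhere, so that convex combinations and
  limits need no exceptional sets.\<close>

definition profile :: "(plane \<times> real => real) => bool" where
 "profile v \<longleftrightarrow> v : borel_fun & (ALL z. 0 <= v z & v z <= 1)"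

lemma profileD:
 assumes "profile v" shows "v : borel_fun" "0 <= v z" "v z <= 1"
 using assms by (simp_all add: profile_def del: split_paired_All)

lemma profile_integrable:
 assumes v: "profile v" and \<psi>: "\<psi> : C1c Ucyl"
 shows "set_integrable lebesgue Qcyl (%z. v z * dvg \<psi> z)"
proof -
 obtain K B where K: "!!z. \<bar>dvg \<psi> z\<bar> <= B" "continuous_on UNIV (dvg \<psi>)"
  by (rule divergence_props[OF \<psi>]) (rule that)
 have "(%z. v z * dvg \<psi> z) : borel_measurable lborel"
  using profileD(1)[OF v] borel_contI[OF K(2)] by simp
 moreover have "norm (v z * dvg \<psi> z) <= B" for z
 proof -
  have "\<bar>v z\<bar> * \<bar>dvg \<psi> z\<bar> <= 1 * B" using profileD(2,3)[OF v, of z] K(1)[of z] by (intro mult_mono) auto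
  thus ?thesis by (simp add: abs_mult)
 qed
 ultimately have "set_integrable lborel Qcyl (%z. v z * dvg \<psi> z)"
  unfolding set_integrable_def using open_Qcyl Qcyl_finite by (intro int_bdd_ind[of _ _ _ B]) auto
 thus ?thesis unfolding set_integrable_def by (rule integrable_lebesgueI)
qed

lemma C1_continuous: "\<psi> : C1c U ==> continuous_on X \<psi>"
 by (auto simp: C1c_def C1_upto_def intro: continuous_on_subset)

lemma dual_value_linear:
 assumes v: "profile v" and \<phi>: "\<phi> : C1c Ucyl" and \<psi>: "\<psi> : C1c Ucyl"
 shows "dual_value v (%z. a *. \<phi> z + b *. \<psi> z) = a * dual_value v \<phi> + b * dual_value v \<psi>"
proof -
 have C1: "\<phi> : C1_upto UNIV" "\<psi> : C1_upto UNIV" using \<phi> \<psi> by (auto simp: C1c_def)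
 have "(LINT z:Qcyl|lebesgue. v z * dvg (%z. a *. \<phi> z + b *. \<psi> z) z)
   = (LINT z:Qcyl|lebesgue. a * (v z * dvg \<phi> z) + b * (v z * dvg \<psi> z))"
  by (simp add: divergence_linear[OF C1] algebra_simps)
 also have "... = a * (LINT z:Qcyl|lebesgue. v z * dvg \<phi> z) + b * (LINT z:Qcyl|lebesgue. v z * dvg \<psi> z)"
  using profile_integrable[OF v \<phi>] profile_integrable[OF v \<psi>] by simp
 finally show ?thesis
  unfolding dual_value_def by (simp add: flux_linear[OF C1_continuous[OF \<phi>] C1_continuous[OF \<psi>]] algebra_simps)
qed

definition glue :: "(plane \<times> real => real) => plane \<times> real => real" where
 "glue v z = (if z : Qcyl then v z else below z)"

lemma glue_admissible:
 assumes v: "profile v" shows "admissible (glue v)" "glue v : borel_fun"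
proof -
 show m: "glue v : borel_fun"
  unfolding glue_def using profileD(1)[OF v] open_Qcyl by (intro measurable_If_set) auto
 have b: "0 <= glue v z & glue v z <= 1" for z using profileD(2,3)[OF v] by (auto simp: glue_def below_def)
 show "admissible (glue v)"
  unfolding admissible_def
 proof (intro conjI allI impI)
  fix K assume K: "compact K & K \<subseteq> Ucyl"
  hence Kb: "K : sets borel" by (auto intro: borel_compact)
  have "integrable lborel (%z. indicator K z *. glue v z)"
   using K Kb b m emeasure_bounded_finite[OF compact_imp_bounded, of K]
   by (intro int_bdd_ind[of _ _ _ 1]) auto
  thus "set_integrable lebesgue K (glue v)"
   unfolding set_integrable_def by (rule integrable_lebesgueI)
 next
  show "AE z in lebesgue. z : Ucyl --> glue v z : {0..1}" using b by simp
  show "AE z in lebesgue. z : Ucyl - Acyl --> glue v z = ind_u Om M bu z"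
   using AE_completion[OF AE_lborel_fst[OF AE_frontier]]
  proof eventually_elim
   case (elim z)
   show ?case
   proof
    assume z: "z : Ucyl - Acyl"
    hence "z ~: Qcyl" using Qcyl_subset by blast
    hence "glue v z = below z" by (simp only: glue_def if_False)
    moreover have "z ~: frontier Om \<times> UNIV" using elim by (simp add: mem_Times_iff)
    ultimately show "glue v z = ind_u Om M bu z" using below_ind[OF z] by simp
   qed
  qed
 qed
qed

lemma dual_value_glue: "dual_value (glue v) \<phi> = dual_value v \<phi>"
 unfolding dual_value_def sli_def
 by (intro arg_cong2[of _ _ _ _ "(-)"] refl lint_cong) (auto simp: glue_def indicator_def)

text \<open>If the horizontal part has norm at most \<open>c\<close>, both horizontal constraints
  follow from the linear lower bound of the cost.\<close>

lemma small_field_in_K: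
 assumes c: "ereal c <= right_deriv0 \<tau>" "!!t. 0 <= t ==> t <= M ==> c * t <= \<tau> t"
  and \<xi>: "continuous_on Acyl \<xi>" "!!z. z : Acyl ==> norm (fst (\<xi> z)) <= c" "!!z. z : Acyl ==> 0 <= snd (\<xi> z)"
 shows "\<xi> : K_set Om M \<tau>"
 unfolding K_set_def
proof (intro CollectI conjI ballI allI impI \<xi>)
 show "ereal (norm (fst (\<xi> z))) <= right_deriv0 \<tau>" if "z : Acyl" for z using \<xi>(2)[OF that] by (intro order_trans[OF _ c(1)]) simp
next
 fix x s1 s2 assume x: "x : closure Om" and s: "0 <= s1 & s1 < s2 & s2 <= M"
 have mem: "(x, t) : Acyl" if "t : {s1..s2}" for t using x s that by auto
 have "norm (integral {s1..s2} (%s. fst (\<xi> (x, s)))) <= c * (s2 - s1)"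
  by (rule integral_bound) (use s mem in \<open>auto intro!: continuous_on_fst continuous_on_compose2[OF \<xi>(1)] continuous_intros \<xi>(2)\<close>)
 also have "... <= \<tau> (s2 - s1)" using s by (intro c(2)) auto
 finally show "norm (integral {s1..s2} (%s. fst (\<xi> (x, s)))) <= \<tau> (s2 - s1)" .
qed

text \<open>The competitor \<open>c \<psi> + (0, \<zeta>)\<close> with a cutoff \<open>\<zeta>\<close> makes the vertical component nonnegative, so that
 the bound on the constraint set controls every test field.\<close>

lemma glue_in_C_set:
 assumes \<tau>: "transportation_cost \<tau>" "0 < right_deriv0 \<tau>" and v: "profile v"
  and d: "!!\<xi>. \<xi> : C1c Ucyl ==> \<xi> : K_set Om M \<tau> ==> dual_value v \<xi> <= d"
 shows "glue v : C_set Om M bu"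
proof -
 obtain c where c: "0 < c" "c <= 1" "ereal c <= right_deriv0 \<tau>" "!!t. 0 <= t ==> t <= M ==> c * t <= \<tau> t"
  by (rule cost_slope[OF \<tau>, of M]) blast
 obtain \<eta> W K' where \<eta>: "\<eta> : C1_upto UNIV" "!!z. 0 <= \<eta> z & \<eta> z <= (1::real)" "open W" "Acyl \<subseteq> W" "!!z. z : W ==> \<eta> z = 1"
  "compact K'" "K' \<subseteq> Ucyl" "!!z. z ~: K' ==> \<eta> z = 0" by (rule C1_cutoff[OF compact_Acyl open_Ucyl Acyl_subset]) blast
 define \<zeta> where "\<zeta> = (%z. \<eta> z *. (0::plane, 1::real))"
 have \<zeta>: "\<zeta> : C1c Ucyl"
  unfolding \<zeta>_def
 proof (rule C1c_I[OF _ \<eta>(6,7)])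
  show "(%z. \<eta> z *. (0::plane, 1::real)) : C1_upto UNIV" by (rule C1_scaleR[OF \<eta>(1) C1_const])
  show "\<eta> z *. (0::plane, 1::real) = 0" if "z ~: K'" for z unfolding \<eta>(8)[OF that] by (rule scaleR_zero_left)
 qed
 have \<zeta>1: "\<zeta> z = (0, 1)" if "z : Acyl" for z
 proof -
  have "z : W" using that \<eta>(4) by blast
  thus ?thesis by (simp add: \<zeta>_def \<eta>(5))
 qed
 \<comment> \<open>Solves \<open>c * dual_value v \<psi> + dual_value v \<zeta> \<le> d\<close> for
   the value at \<open>\<psi>\<close>.\<close>
 define C where "C = (d - dual_value v \<zeta>) / c"
 have up: "dual_value v \<psi> <= C" if \<psi>: "\<psi> : C1c Ucyl" and n: "!!z. norm (\<psi> z) <= 1" for \<psi>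
 proof -
  define \<xi> where "\<xi> = (%z. c *. \<psi> z + 1 *. \<zeta> z)"
  have \<xi>: "\<xi> : C1c Ucyl" unfolding \<xi>_def by (rule C1_linear[OF \<psi> \<zeta>])
  have fs: "fst (\<xi> z) = c *. fst (\<psi> z)" "snd (\<xi> z) = c * snd (\<psi> z) + 1" if "z : Acyl" for z
   using \<zeta>1[OF that] by (simp_all add: \<xi>_def)
  have n1: "norm (fst (\<psi> z)) <= 1" "\<bar>snd (\<psi> z)\<bar> <= 1" for z
   using n[of z] norm_fst_le[of "fst (\<psi> z)" "snd (\<psi> z)"] norm_snd_le[of "snd (\<psi> z)" "fst (\<psi> z)"] by auto
  have "\<xi> : K_set Om M \<tau>"
  proof (rule small_field_in_K[OF c(3,4)])
   fix z assume z: "z : Acyl"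
   show "norm (fst (\<xi> z)) <= c" using n1(1)[of z] c(1) by (simp add: fs[OF z] mult_left_le)
   have "\<bar>c * snd (\<psi> z)\<bar> <= 1 * 1" unfolding abs_mult using c n1(2)[of z] by (intro mult_mono) auto
   thus "0 <= snd (\<xi> z)" by (simp add: fs[OF z])
  qed (assumption | rule C1_continuous[OF \<xi>])+
  hence "dual_value v \<xi> <= d" by (rule d[OF \<xi>])
  hence "c * dual_value v \<psi> + 1 * dual_value v \<zeta> <= d" unfolding \<xi>_def by (simp only: dual_value_linear[OF v \<psi> \<zeta>])
  thus ?thesis using c(1) by (simp add: C_def field_simps)
 qed
 define w where "w = glue v"
 note wa = glue_admissible[OF v, folded w_def]
 define L where "L = (%\<psi>. - (LINT z|lebesgue. w z * dvg \<psi> z))"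
 \<comment> \<open>The neighbourhood has width one, so the exterior estimate with shell width one
   applies to every test field; this bounds the part of the gradient outside the cylinder.\<close>
 define C1 where "C1 = measure lborel {x. x ~: Om & gap x <= 1} + 16 * measure tv UNIV"
 have Lup: "L \<psi> <= C + C1" if \<psi>: "\<psi> : C1c Ucyl" and n: "!!z. norm (\<psi> z) <= 1" for \<psi>
 proof -
  obtain K where K: "K \<subseteq> Ucyl" "!!z. z ~: K ==> \<psi> z = 0" using \<psi> by (rule C1c_E) blast
  have "\<bar>(LINT z|lborel. of_bool (snd z < height (fst z)) * dvg \<psi> z) + flux M bu \<psi>\<bar>
   <= 1 * (measure lborel {x. x ~: Om & gap x <= 1} + 16 * 1 * measure tv UNIV)"
  proof (rule exterior_estimate[OF \<psi>])
   show "\<psi> (x, s) = 0" if "1 < gap x" for x s using K that by (intro K(2)) (auto simp: nbhd1_eq)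
  qed (use n in auto)
  moreover have "(LINT z:Qcyl|lebesgue. w z * dvg \<psi> z) = flux M bu \<psi> - dual_value v \<psi>"
   using dual_value_glue[of v \<psi>] by (simp add: dual_value_def w_def)
  ultimately show ?thesis using up[OF \<psi> n] interior_split(1)[OF wa(1) \<psi>] by (simp add: L_def C1_def below_def)
 qed
 have Li: "integrable lebesgue (%z. w z * dvg \<psi> z)" if \<psi>: "\<psi> : C1c Ucyl" for \<psi>
 proof -
  obtain K B where K: "compact K" "K \<subseteq> Ucyl" "!!z. z ~: K ==> dvg \<psi> z = 0" "!!z. \<bar>dvg \<psi> z\<bar> <= B" "continuous_on UNIV (dvg \<psi>)"
   using divergence_props[OF \<psi>] by blast
  have b: "\<bar>w z\<bar> <= 1" for z using profileD(2,3)[OF v, of z] by (auto simp: w_def glue_def below_def)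
  have "integrable lborel (%z. w z * dvg \<psi> z)" by (rule continuous_compact_support_integrable[OF K(5,1,3) wa(2) b])
  thus ?thesis by (rule integrable_lebesgueI)
 qed
 have Llin: "L (%z. a *. f z + b *. g z) = a * L f + b * L g" if f: "f : C1c Ucyl" and g: "g : C1c Ucyl" for f g a b
 proof -
  have C1: "f : C1_upto UNIV" "g : C1_upto UNIV" using f g by (auto simp: C1c_def)
  have "(LINT z|lebesgue. w z * dvg (%z. a *. f z + b *. g z) z) = (LINT z|lebesgue. a * (w z * dvg f z) + b * (w z * dvg g z))"
   by (simp add: divergence_linear[OF C1] algebra_simps)
  also have "... = a * (LINT z|lebesgue. w z * dvg f z) + b * (LINT z|lebesgue. w z * dvg g z)"
   using Li[OF f] Li[OF g] by simp
  finally show ?thesis by (simp add: L_def)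
 qed
 obtain m \<sigma> where m: "sets m = sets borel" "finite_measure m" "emeasure m (- Ucyl) = 0" "\<sigma> : borel_fun"
  "AE z in m. norm (\<sigma> z) = 1" "!!\<psi>. \<psi> : C1c Ucyl ==> L \<psi> = (LINT z|m. \<psi> z @. \<sigma> z)"
 proof (rule riesz_vector_measure[OF open_Ucyl, of L "C + C1"])
  show "L (%z. f z + g z) = L f + L g" if "f : C1c Ucyl" "g : C1c Ucyl" for f g
   using Llin[OF that, of 1 1] by simp
  show sc: "L (%z. c *. f z) = c * L f" if "f : C1c Ucyl" for f c
   using Llin[OF that that, of c 0] by simp
  show "\<bar>L f\<bar> <= C + C1" if f: "f : C1c Ucyl" "!!z. norm (f z) <= 1" for f
  proof -
   have "L (%z. (-1) *. f z) <= C + C1"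
   proof (rule Lup)
    show "(%z. (-1) *. f z) : C1c Ucyl" using C1_linear[OF f(1) f(1), of "-1" 0] by simp
   qed (use f in simp)
   thus ?thesis using Lup[OF f] sc[OF f(1), of "-1"] by simp
  qed
 qed blast
 interpret m: finite_measure m by fact
 have "is_gradient Ucyl w m \<sigma>"
  unfolding is_gradient_def using m by (auto simp: L_def m.emeasure_eq_measure minus_equation_iff)
 thus ?thesis using wa(1) by (auto simp: C_set_iff w_def)
qed

end

lemma C1_real_polynomial_function:
 fixes p :: "'a::euclidean_space => real"
 shows "real_polynomial_function p ==> p : C1_upto UNIV"
proof (induction rule: real_polynomial_function.induct)
 case (linear f)
 thus ?case using C1_bounded_linear[OF linear C1_ident] by simp
qed (auto intro: C1_add C1_mult)

lemma C1_polynomial_function: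
 fixes p :: "'a::euclidean_space => 'b::euclidean_space"
 assumes "polynomial_function p" shows "p : C1_upto UNIV"
proof -
 have "(%z. p z @. b) : C1_upto UNIV" for b
  using assms bounded_linear_inner_left[of b] by (intro C1_real_polynomial_function) (auto simp: polynomial_function_def o_def)
 hence "(%z. SUM b:Basis. (p z @. b) *. b) : C1_upto UNIV" by (intro C1_sum C1_scaleR C1_const)
 thus ?thesis by (simp add: euclidean_representation)
qed

lemma le_of_forall_eps:
 fixes a b c :: real
 assumes c: "0 <= c" and le: "!!\<epsilon>. 0 < \<epsilon> ==> a <= b + \<epsilon> * c"
 shows "a <= b"
proof (rule field_le_epsilon)
 fix e :: real assume e: "0 < e"
 have "e / (c + 1) * c <= e" using c e by (simp add: field_simps)
 thus "a <= b + e" using le[of "e / (c + 1)"] c e by simp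
qed

lemma norm_fst_snd_le: "norm (fst z) <= norm z" "norm (snd z) <= norm z"
 using norm_fst_le[of "fst z" "snd z"] norm_snd_le[of "snd z" "fst z"] by simp_all

context boundary_data begin

text \<open>A polynomial with error \<open>l c\<close>, scaled by \<open>1 - l\<close> and shifted vertically by \<open>l c\<close>, is a convex
 combination of \<open>\<phi>\<close> with weight \<open>1 - l\<close> and a field of slope at most \<open>c\<close>, where \<open>c h \<le> \<tau> h\<close>.\<close>

lemma K_set_dense:
 assumes \<tau>: "transportation_cost \<tau>" "0 < right_deriv0 \<tau>" and \<phi>: "\<phi> : K_set Om M \<tau>" and eps: "0 < \<epsilon>"
 obtains \<psi> where "\<psi> : C1c Ucyl" "\<psi> : K_set Om M \<tau>" "!!z. z : Acyl ==> norm (\<phi> z - \<psi> z) <= \<epsilon>"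
proof -
 have \<phi>c: "continuous_on Acyl \<phi>" using \<phi> by (simp add: K_set_def)
 obtain c where c: "0 < c" "c <= 1" "ereal c <= right_deriv0 \<tau>" "!!t. 0 <= t ==> t <= M ==> c * t <= \<tau> t"
  by (rule cost_slope[OF \<tau>, of M]) blast
 obtain S where S: "0 <= S" "!!z. z : Acyl ==> norm (\<phi> z) <= S" using bounded_on_Acyl[OF \<phi>c] by blast
 \<comment> \<open>The total error is \<open>l * S\<close> from the convex combination and at most
   \<open>2 * l\<close> from the polynomial and the vertical shift.\<close>
 define l where "l = min (1/2) (\<epsilon> / (S + 2))"
 have l: "0 < l" "l <= 1" "l * (S + 2) <= \<epsilon>"
 proof -
  have "l <= \<epsilon> / (S + 2)" by (simp add: l_def)
  thus "l * (S + 2) <= \<epsilon>" using S(1) by (simp add: pos_le_divide_eq)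
 qed (use eps S(1) in \<open>auto simp: l_def\<close>)
 define e where "e = l * c"
 have e: "0 < e" "e <= l" using l c by (auto simp: e_def mult_left_le)
 obtain p where p: "polynomial_function p" "!!z. z : Acyl ==> norm (\<phi> z - p z) < e"
  using Stone_Weierstrass_polynomial_function[OF compact_Acyl \<phi>c e(1)] by blast
 obtain \<eta> W K' where \<eta>: "\<eta> : C1_upto UNIV" "!!z. 0 <= \<eta> z & \<eta> z <= (1::real)" "open W" "Acyl \<subseteq> W" "!!z. z : W ==> \<eta> z = 1"
  "compact K'" "K' \<subseteq> Ucyl" "!!z. z ~: K' ==> \<eta> z = 0" by (rule C1_cutoff[OF compact_Acyl open_Ucyl Acyl_subset]) blast
 define \<psi> where "\<psi> = (%z. \<eta> z *. ((1 - l) *. p z + (0, e)))"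
 have pC: "p : C1_upto UNIV" by (rule C1_polynomial_function[OF p(1)])
 hence pc: "continuous_on X p" for X by (auto simp: C1_upto_def intro: continuous_on_subset)
 have \<psi>A: "\<psi> z = (1 - l) *. p z + (0, e)" if "z : Acyl" for z
 proof -
  have "z : W" using that \<eta>(4) by blast
  thus ?thesis by (simp add: \<psi>_def \<eta>(5))
 qed
 have mem: "\<psi> : C1c Ucyl"
  unfolding \<psi>_def
 proof (rule C1c_I[OF _ \<eta>(6,7)])
  show "(%z. \<eta> z *. ((1 - l) *. p z + (0, e))) : C1_upto UNIV"
   by (intro C1_scaleR[OF \<eta>(1)] C1_add C1_scaleR[OF C1_const pC] C1_const)
  show "\<eta> z *. ((1 - l) *. p z + (0, e)) = 0" if "z ~: K'" for z unfolding \<eta>(8)[OF that] by (rule scaleR_zero_left)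
 qed
 have near: "norm (fst (p z) - fst (\<phi> z)) <= e" "\<bar>snd (p z) - snd (\<phi> z)\<bar> <= e" if "z : Acyl" for z
  using p(2)[OF that] norm_fst_snd_le[of "p z - \<phi> z"] by (auto simp: norm_minus_commute)
 define \<xi> where "\<xi> = (%z. inverse l *. (\<psi> z - (1 - l) *. \<phi> z))"
 have \<xi>A: "fst (\<xi> z) = inverse l *. ((1 - l) *. (fst (p z) - fst (\<phi> z)))"
  "snd (\<xi> z) = inverse l * ((1 - l) * (snd (p z) - snd (\<phi> z)) + e)" if "z : Acyl" for z
  by (simp_all add: \<xi>_def \<psi>A[OF that] algebra_simps)
 have le: "(1 - l) * r <= e" if "r <= e" "0 <= r" for r using mult_mono[of "1 - l" 1 r e] l that by simp
 have "\<xi> : K_set Om M \<tau>"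
 proof (rule small_field_in_K[OF c(3,4)])
  show "continuous_on Acyl \<xi>" unfolding \<xi>_def by (intro continuous_intros C1_continuous[OF mem] \<phi>c)
  fix z assume z: "z : Acyl"
  show "norm (fst (\<xi> z)) <= c"
   unfolding \<xi>A[OF z] norm_scaleR using le[OF near(1)[OF z] norm_ge_zero] l by (simp add: e_def field_simps)
  have "(1 - l) * \<bar>snd (p z) - snd (\<phi> z)\<bar> <= e" by (rule le[OF near(2)[OF z]]) simp
  moreover have "\<bar>(1 - l) * (snd (p z) - snd (\<phi> z))\<bar> = (1 - l) * \<bar>snd (p z) - snd (\<phi> z)\<bar>" using l by (simp add: abs_mult)
  ultimately have "0 <= (1 - l) * (snd (p z) - snd (\<phi> z)) + e" by linarith
  thus "0 <= snd (\<xi> z)" unfolding \<xi>A[OF z] using l by simp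
 qed
 moreover have "\<psi> = (%z. (1 - l) *. \<phi> z + l *. \<xi> z)" using l by (simp add: \<xi>_def fun_eq_iff)
 ultimately have "\<psi> : K_set Om M \<tau>" using K_set_convex[OF \<phi>, of \<xi> l] l by simp
 moreover have "norm (\<phi> z - \<psi> z) <= \<epsilon>" if z: "z : Acyl" for z
 proof -
  have "\<phi> z - \<psi> z = l *. \<phi> z + (1 - l) *. (\<phi> z - p z) - (0, e)" by (simp add: \<psi>A[OF z] algebra_simps)
  hence "norm (\<phi> z - \<psi> z) <= norm (l *. \<phi> z + (1 - l) *. (\<phi> z - p z)) + norm ((0, e) :: plane \<times> real)" by (metis norm_triangle_ineq4)
  also have "... <= l * norm (\<phi> z) + (1 - l) * norm (\<phi> z - p z) + e"
   using norm_triangle_ineq[of "l *. \<phi> z" "(1 - l) *. (\<phi> z - p z)"] l e by (simp add: norm_Pair)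
  also have "... <= l * S + 1 * e + e" using S(2)[OF z] p(2)[OF z] l by (intro add_mono mult_left_mono mult_mono) auto
  also have "... <= l * (S + 2)" using e by (simp add: algebra_simps)
  finally show ?thesis using l(3) by simp
 qed
 ultimately show ?thesis using mem that by blast
qed

text \<open>The pointwise slope may be unbounded, so the estimate uses the integral constraint on
  the vertical segments from 0 to \<open>trace x\<close>. The bottom flux has the favourable sign
  because the vertical component is nonnegative. The factor 2 is the bound on \<open>nrm\<close>
  that is valid for every parameter.\<close>

lemma flux_K_bound:
 assumes \<tau>: "transportation_cost \<tau>" and \<phi>: "\<phi> : K_set Om M \<tau>"
 shows "flux M bu \<phi> <= 2 * \<tau> M * len"
proof -
 have \<phi>c: "continuous_on Acyl \<phi>" and \<phi>b: "!!z. z : Acyl ==> 0 <= snd (\<phi> z)"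
  and \<phi>i: "!!x s1 s2. x : closure Om ==> 0 <= s1 & s1 < s2 & s2 <= M ==> norm (integral {s1..s2} (%s. fst (\<phi> (x, s)))) <= \<tau> (s2 - s1)"
  using \<phi> unfolding K_set_def by blast+
 have \<tau>0: "0 <= \<tau> M" and mono: "mono_on {0..} \<tau>" using \<tau> M_nonneg by (auto simp: transportation_cost_def)
 have inner: "(LINT s|lborel. side_density \<phi> (t, s)) <= 2 * \<tau> M * indicator {0..<len} t" for t
 proof (cases "t : {0..<len}")
  case True
  define x where "x = gam t"
  have x: "x : closure Om" using gam_mem[of t] by (simp add: x_def closure_eq)
  note tb = trace_bounds[of x]
  have "(LINT s|lborel. side_density \<phi> (t, s)) = integral {0..trace x} (%s. fst (\<phi> (x, s))) @. nrm t"
   using True by (simp add: side_inner[OF \<phi>c] x_def)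
  also have "... <= norm (integral {0..trace x} (%s. fst (\<phi> (x, s)))) * norm (nrm t)" by (rule norm_cauchy_schwarz)
  also have "... <= \<tau> M * 2"
  proof (intro mult_mono norm_nrm_le)
   show "norm (integral {0..trace x} (%s. fst (\<phi> (x, s)))) <= \<tau> M"
   proof (cases "trace x = 0")
    case False
    hence "norm (integral {0..trace x} (%s. fst (\<phi> (x, s)))) <= \<tau> (trace x - 0)" using tb by (intro \<phi>i x) auto
    also have "... <= \<tau> M" using mono_onD[OF mono, of "trace x" M] tb M_nonneg by simp
    finally show ?thesis .
   qed (simp add: \<tau>0)
  qed (use \<tau>0 in auto)
  finally show ?thesis using True by simp
 qed (simp add: side_inner[OF \<phi>c])
 have "(LINT p|lborel. side_density \<phi> p) = (LINT t|lborel. LINT s|lborel. side_density \<phi> (t, s))"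
  by (rule side_fubini(1)[OF \<phi>c])
 also have "... <= (LINT t|lborel. 2 * \<tau> M * indicator {0..<len} t)"
 proof (rule integral_mono)
  show "integrable lborel (%t. LINT s|lborel. side_density \<phi> (t, s))" by (rule side_fubini(2)[OF \<phi>c])
  show "integrable lborel (%t. 2 * \<tau> M * indicator {0..<len} t :: real)"
   using len_pos by (intro integrable_mult_right int_ind) auto
 qed (rule inner)
 also have "... = 2 * \<tau> M * len" using len_pos by simp
 finally have "(LINT p|lborel. side_density \<phi> p) <= 2 * \<tau> M * len" .
 moreover have "0 <= (LINT x|lborel. bottom_density \<phi> x)"
  using \<phi>b bottom_mem by (intro Bochner_Integration.integral_nonneg) (auto simp: bottom_density_def indicator_def)
 ultimately show ?thesis unfolding flux_densities by linarith
qed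

text \<open>Fixes the polar pair chosen by \<open>gradient_integral\<close> once and for all, so
  that the pairing becomes an integral against one measure for all fields.\<close>

lemma pairing_representation:
 assumes "w : C_set Om M bu"
 obtains m \<sigma> where "is_gradient Ucyl w m \<sigma>" "!!\<phi>. pairing Om M \<phi> w = (LINT z:Acyl|m. \<phi> z @. \<sigma> z)"
proof -
 define g where "g = (SOME (m, \<sigma>). is_gradient Ucyl w m \<sigma>)"
 have "EX x. case x of (m, \<sigma>) => is_gradient Ucyl w m \<sigma>" using assms by (auto simp: C_set_iff)
 hence "case g of (m, \<sigma>) => is_gradient Ucyl w m \<sigma>" unfolding g_def by (rule someI_ex)
 hence "is_gradient Ucyl w (fst g) (snd g)" by (simp add: case_prod_unfold)
 moreover have "pairing Om M \<phi> w = (LINT z:Acyl|fst g. \<phi> z @. snd g z)" for \<phi>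
  by (simp add: pairing_def gradient_integral_def g_def case_prod_unfold)
 ultimately show ?thesis using that by blast
qed

lemma pairing_C1:
 assumes w: "w : C_set Om M bu" and \<psi>: "\<psi> : C1c Ucyl"
 shows "pairing Om M \<psi> w = dual_value w \<psi>"
proof -
 obtain m \<sigma> where m: "is_gradient Ucyl w m \<sigma>" "!!\<phi>. pairing Om M \<phi> w = (LINT z:Acyl|m. \<phi> z @. \<sigma> z)"
  by (rule pairing_representation[OF w]) blast
 have "admissible w" using w by (simp add: C_set_iff)
 from gradient_on_cylinder[OF this m(1) \<psi>] show ?thesis by (simp add: m(2) dual_value_def)
qed

lemma zero_K_set:
 assumes "transportation_cost \<tau>" "0 < right_deriv0 \<tau>" shows "(%z. 0) : K_set Om M \<tau>"
 using assms by (auto simp: K_set_def transportation_cost_def zero_ereal_def[symmetric] intro: less_imp_le)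

text \<open>The constant is the total variation of the gradient on the closed cylinder, finite
  because this is a compact subset of the neighbourhood.\<close>

lemma pairing_lipschitz:
 assumes w: "w : C_set Om M bu"
 obtains c where "0 <= c" "!!\<phi> \<psi> \<epsilon>. continuous_on Acyl \<phi> ==> continuous_on Acyl \<psi> ==> (!!z. z : Acyl ==> norm (\<phi> z - \<psi> z) <= \<epsilon>)
  ==> pairing Om M \<phi> w <= pairing Om M \<psi> w + \<epsilon> * c"
proof -
 obtain m \<sigma> where g: "is_gradient Ucyl w m \<sigma>" and pr: "!!\<phi>. pairing Om M \<phi> w = (LINT z:Acyl|m. \<phi> z @. \<sigma> z)"
  by (rule pairing_representation[OF w]) blast
 have m: "sets m = sets borel" "emeasure m Acyl < \<infinity>" "\<sigma> : borel_fun" "AE z in m. norm (\<sigma> z) = 1"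
  using g compact_Acyl Acyl_subset unfolding is_gradient_def by auto
 have Am: "Acyl : sets m" using Acyl_borel m(1) by simp
 have int: "integrable m (%z. indicator Acyl z *. (f z @. \<sigma> z))" if f: "continuous_on Acyl f" for f :: "plane \<times> real => plane \<times> real"
 proof -
  obtain S where S: "0 <= S" "!!z. z : Acyl ==> norm (f z) <= S" using bounded_on_Acyl[OF f] by blast
  have [measurable_cong]: "sets m = sets borel" by (rule m)
  note [measurable] = m(3)
  have [measurable]: "(%z. indicator Acyl z *. f z) : borel_fun" by (rule borel_measurable_continuous_on_indicator[OF Acyl_borel f])
  have "(%z. (indicator Acyl z *. f z) @. \<sigma> z) : borel_measurable m" by measurable
  hence meas: "(%z. indicator Acyl z *. (f z @. \<sigma> z)) : borel_measurable m" by simp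
  show ?thesis
  proof (rule int_bound[OF _ meas])
   show "integrable m (%z. S * indicator Acyl z)" using Am m(2) by (intro integrable_mult_right int_ind) auto
   show "AE z in m. norm (indicator Acyl z *. (f z @. \<sigma> z)) <= norm (S * indicator Acyl z)"
    using m(4)
   proof eventually_elim
    case (elim z)
    show ?case
    proof (cases "z : Acyl")
     case True
     have "\<bar>f z @. \<sigma> z\<bar> <= norm (f z) * norm (\<sigma> z)" by (rule Cauchy_Schwarz_ineq2)
     thus ?thesis using elim S(2)[OF True] S(1) True by simp
    qed simp
   qed
  qed
 qed
 show ?thesis
 proof (rule that[of "measure m Acyl"])
  fix \<phi> \<psi> :: "plane \<times> real => plane \<times> real" and \<epsilon>
  assume c: "continuous_on Acyl \<phi>" "continuous_on Acyl \<psi>" and n: "!!z. z : Acyl ==> norm (\<phi> z - \<psi> z) <= \<epsilon>"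
  have "pairing Om M \<phi> w - pairing Om M \<psi> w = (LINT z|m. indicator Acyl z *. (\<phi> z @. \<sigma> z) - indicator Acyl z *. (\<psi> z @. \<sigma> z))"
   unfolding pr sli_def using int[OF c(1)] int[OF c(2)] by simp
  also have "... <= (LINT z|m. \<epsilon> * indicator Acyl z)"
  proof (rule integral_mono_AE)
   show "integrable m (%z. indicator Acyl z *. (\<phi> z @. \<sigma> z) - indicator Acyl z *. (\<psi> z @. \<sigma> z))"
    using int[OF c(1)] int[OF c(2)] by simp
   show "integrable m (%z. \<epsilon> * indicator Acyl z :: real)" using Am m(2) by (intro integrable_mult_right int_ind) auto
   show "AE z in m. indicator Acyl z *. (\<phi> z @. \<sigma> z) - indicator Acyl z *. (\<psi> z @. \<sigma> z) <= \<epsilon> * indicator Acyl z"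
    using m(4)
   proof eventually_elim
    case (elim z)
    show ?case
    proof (cases "z : Acyl")
     case True
     have "(\<phi> z - \<psi> z) @. \<sigma> z <= norm (\<phi> z - \<psi> z) * norm (\<sigma> z)" by (rule norm_cauchy_schwarz)
     thus ?thesis using elim n[OF True] True by (simp add: inner_diff_left)
    qed simp
   qed
  qed
  also have "... = \<epsilon> * measure m Acyl" using Am by simp
  finally show "pairing Om M \<phi> w <= pairing Om M \<psi> w + \<epsilon> * measure m Acyl" by linarith
 qed simp
qed

lemma pairing_le_of_dense:
 assumes \<tau>: "transportation_cost \<tau>" "0 < right_deriv0 \<tau>" and w: "w : C_set Om M bu"
  and d: "!!\<psi>. \<psi> : C1c Ucyl ==> \<psi> : K_set Om M \<tau> ==> dual_value w \<psi> <= d" and \<phi>: "\<phi> : K_set Om M \<tau>"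
 shows "pairing Om M \<phi> w <= d"
proof -
 obtain c where c: "0 <= c" "!!\<phi> \<psi> \<epsilon>. continuous_on Acyl \<phi> ==> continuous_on Acyl \<psi> ==> (!!z. z : Acyl ==> norm (\<phi> z - \<psi> z) <= \<epsilon>)
  ==> pairing Om M \<phi> w <= pairing Om M \<psi> w + \<epsilon> * c" by (rule pairing_lipschitz[OF w]) blast
 show ?thesis
 proof (rule le_of_forall_eps[OF c(1)])
  fix \<epsilon> :: real assume "0 < \<epsilon>"
  then obtain \<psi> where \<psi>: "\<psi> : C1c Ucyl" "\<psi> : K_set Om M \<tau>" "!!z. z : Acyl ==> norm (\<phi> z - \<psi> z) <= \<epsilon>"
   by (rule K_set_dense[OF \<tau> \<phi>]) blast
  have "continuous_on Acyl \<phi>" "continuous_on Acyl \<psi>" using \<phi> \<psi>(2) by (auto simp: K_set_def)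
  from c(2)[OF this \<psi>(3)] show "pairing Om M \<phi> w <= d + \<epsilon> * c" using pairing_C1[OF w \<psi>(1)] d[OF \<psi>(1,2)] by simp
 qed
qed

lemma divergence_C1:
 assumes M: "0 < M" and \<phi>: "\<phi> : C1_upto Qcyl"
 obtains \<delta> where "continuous_on Acyl \<delta>" "!!z. z : Qcyl ==> dvg \<phi> z = \<delta> z"
proof -
 obtain f' where f': "continuous_on Acyl f'" "!!z. z : Qcyl ==> (\<phi> has_derivative blinfun_apply (f' z)) (at z)"
  using \<phi> closure_Qcyl[OF M] unfolding C1_upto_def by auto
 show ?thesis
 proof (rule that)
  show "continuous_on Acyl (%z. SUM b:Basis. f' z b @. b)" by (intro continuous_intros f'(1))
  show "dvg \<phi> z = (SUM b:Basis. f' z b @. b)" if "z : Qcyl" for z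
   using frechet_derivative_at[OF f'(2)[OF that]] by (simp add: divergence_def)
 qed
qed

lemma D_fun_eq:
 assumes M: "0 < M" and \<phi>: "continuous_on Acyl \<phi>"
 shows "D_fun Om M bu \<phi> = flux M bu \<phi> - (LINT z:Qcyl|lborel. max 0 (dvg \<phi> z))"
proof -
 have "(%x. if x : Om then 0 else bu x) = height" by (simp add: height_eq fun_eq_iff)
 hence "(%x. if x : Om then 0 else bu x) : borel_fun" by simp
 from boundary_integral_eq_flux[OF M \<phi> this] show ?thesis by (simp add: D_fun_def)
qed

text \<open>Weak duality. For compactly supported C1 fields it is the pointwise bound of
  \<open>w * dvg \<psi>\<close> by the positive part of the divergence. A field that is only C1 up
  to the boundary is first replaced by its dilation; flux, volume term and pairing then change by at
  most multiples of \<open>\<epsilon>\<close>.\<close>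

lemma D_fun_le_pairing:
 assumes M: "0 < M" and \<phi>: "\<phi> : C1_upto Qcyl" and w: "w : C_set Om M bu"
 shows "D_fun Om M bu \<phi> <= pairing Om M \<phi> w"
proof -
 have \<phi>c: "continuous_on Acyl \<phi>" using \<phi> closure_Qcyl[OF M] by (auto simp: C1_upto_def)
 have adm: "admissible w" using w by (simp add: C_set_iff)
 obtain \<delta> where \<delta>: "continuous_on Acyl \<delta>" "!!z. z : Qcyl ==> dvg \<phi> z = \<delta> z" by (rule divergence_C1[OF M \<phi>]) blast
 obtain B where B: "0 <= B" "!!z. z : Acyl ==> norm (\<delta> z) <= B" using bounded_on_Acyl[OF \<delta>(1)] by blast
 define f where "f = (%z. indicator Qcyl z *. max 0 (dvg \<phi> z))"
 have fe: "f = (%z. indicator Qcyl z *. (max 0 (indicator Acyl z *. \<delta> z)))"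
 proof (rule ext)
  fix z
  show "f z = indicator Qcyl z *. (max 0 (indicator Acyl z *. \<delta> z))"
  proof (cases "z : Qcyl")
   case True
   hence "z : Acyl" using Qcyl_subset by blast
   thus ?thesis by (simp only: f_def \<delta>(2)[OF True]) simp
  next
   case False
   show ?thesis unfolding f_def indicator_simps(2)[OF False] by simp
  qed
 qed
 have [measurable]: "(%z. indicator Acyl z *. \<delta> z) : borel_fun" by (rule borel_measurable_continuous_on_indicator[OF Acyl_borel \<delta>(1)])
 have Qb [measurable]: "Qcyl : sets borel" using open_Qcyl by (rule borel_open)
 have fi: "integrable lborel f"
  unfolding fe
 proof (rule int_bdd_ind[of _ _ _ B])
  have "norm (max 0 (indicator Acyl z *. \<delta> z)) <= B" for z using B(2)[of z] B(1) by (cases "z : Acyl") auto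
  thus "AE z in lborel. z : Qcyl --> norm (max 0 (indicator Acyl z *. \<delta> z)) <= B" by simp
  show "(%z. max 0 (indicator Acyl z *. \<delta> z)) : borel_measurable lborel" by measurable
 qed (use Qb Qcyl_finite in auto)
 have Qm: "Qcyl : sets lebesgue" "emeasure lebesgue Qcyl < \<infinity>" using Qb Qcyl_finite by auto
 have fc: "(LINT z|lebesgue. f z) = (LINT z|lborel. f z)" by (rule integral_completion) (use fi in auto)
 obtain c where c: "0 <= c" "!!\<phi> \<psi> \<epsilon>. continuous_on Acyl \<phi> ==> continuous_on Acyl \<psi> ==> (!!z. z : Acyl ==> norm (\<phi> z - \<psi> z) <= \<epsilon>)
  ==> pairing Om M \<phi> w <= pairing Om M \<psi> w + \<epsilon> * c" by (rule pairing_lipschitz[OF w]) blast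
 define b where "b = 2 * len * M + measure lborel Om"
 show ?thesis
 proof (rule le_of_forall_eps)
  show "0 <= b + c + measure lebesgue Qcyl" using c(1) M len_pos by (simp add: b_def)
  fix \<epsilon> :: real assume eps: "0 < \<epsilon>"
  obtain \<psi> where \<psi>: "\<psi> : C1c Ucyl" "!!z. z : Acyl ==> norm (\<phi> z - \<psi> z) <= \<epsilon>"
   "!!z. z : Qcyl ==> \<bar>dvg \<phi> z - dvg \<psi> z\<bar> <= \<epsilon>" by (rule C1_dilation[OF M \<phi> eps]) blast
  have \<psi>c: "continuous_on Acyl \<psi>" by (rule C1_continuous[OF \<psi>(1)])
  have "flux M bu (%z. 1 *. \<phi> z + (-1) *. \<psi> z) <= \<epsilon> * b"
   unfolding b_def by (rule flux_bound) (use eps \<psi>(2) in \<open>auto intro!: continuous_intros \<phi>c \<psi>c\<close>)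
  hence 1: "flux M bu \<phi> <= flux M bu \<psi> + \<epsilon> * b" unfolding flux_linear[OF \<phi>c \<psi>c] by simp
  have 2: "pairing Om M \<psi> w <= pairing Om M \<phi> w + \<epsilon> * c"
   by (rule c(2)[OF \<psi>c \<phi>c]) (use \<psi>(2) in \<open>simp add: norm_minus_commute\<close>)
  have "(LINT z:Qcyl|lebesgue. w z * dvg \<psi> z) <= (LINT z|lebesgue. f z + \<epsilon> * indicator Qcyl z)"
   unfolding sli_def
  proof (rule integral_mono_AE')
   show "integrable lebesgue (%z. f z + \<epsilon> * indicator Qcyl z)"
    using Qm by (intro Bochner_Integration.integrable_add integrable_lebesgueI[OF fi] integrable_mult_right int_ind)
   have "AE z in lebesgue. z : Ucyl --> w z : {0..1}" using adm by (simp add: admissible_def)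
   thus "AE z in lebesgue. indicator Qcyl z *. (w z * dvg \<psi> z) <= f z + \<epsilon> * indicator Qcyl z"
   proof eventually_elim
    case (elim z)
    show ?case
    proof (cases "z : Qcyl")
     case True
     hence "z : Ucyl" using Qcyl_subset Acyl_subset by blast
     hence w1: "0 <= w z" "w z <= 1" using elim by auto
     have "w z * dvg \<psi> z <= w z * (max 0 (dvg \<phi> z) + \<epsilon>)" using w1 \<psi>(3)[OF True] by (intro mult_left_mono) auto
     also have "... <= 1 * (max 0 (dvg \<phi> z) + \<epsilon>)" using w1 eps by (intro mult_right_mono) auto
     finally show ?thesis using True by (simp add: f_def)
    next
     case False
     show ?thesis unfolding f_def indicator_simps(2)[OF False] by simp
    qed
   qed
   show "AE z in lebesgue. 0 <= f z + \<epsilon> * indicator Qcyl z" using eps by (simp add: f_def)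
  qed
  also have "... = (LINT z|lborel. f z) + \<epsilon> * measure lebesgue Qcyl"
   using Qm integrable_lebesgueI[OF fi] by (simp add: fc)
  finally show "D_fun Om M bu \<phi> <= pairing Om M \<phi> w + \<epsilon> * (b + c + measure lebesgue Qcyl)"
   using 1 2 unfolding D_fun_eq[OF M \<phi>c] pairing_C1[OF w \<psi>(1)] dual_value_def
   by (simp add: f_def sli_def algebra_simps)
 qed
qed

end

lemma C1_upto_subset: "\<phi> : C1_upto UNIV ==> \<phi> : C1_upto U"
 unfolding C1_upto_def by (auto intro: continuous_on_subset)

context boundary_data begin

text \<open>A convex set on which \<open>dual_value\<close> computes the pairing, and which is dense
  in the constraint set for the uniform norm on the closed cylinder.\<close>

definition fields :: "(real => real) => (plane \<times> real => plane \<times> real) set" where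
 "fields \<tau> = C1c Ucyl Int K_set Om M \<tau>"

lemma Qcyl_borel: "Qcyl : sets borel" using open_Qcyl by (rule borel_open)

lemma interior_integral_lborel:
 assumes "profile v" "p : C1c Ucyl"
 shows "set_integrable lborel Qcyl (%z. v z * dvg p z)"
  "(LINT z:Qcyl|lebesgue. v z * dvg p z) = (LINT z:Qcyl|lborel. v z * dvg p z)"
proof -
 obtain K B where d: "continuous_on UNIV (dvg p)" by (rule divergence_props[OF assms(2)]) (rule that)
 have m: "(%z. indicator Qcyl z *. (v z * dvg p z)) : borel_measurable lborel"
  using profileD(1)[OF assms(1)] borel_contI[OF d] Qcyl_borel by simp
 show "set_integrable lborel Qcyl (%z. v z * dvg p z)"
  using profile_integrable[OF assms] integrable_completion[OF m] by (simp add: set_integrable_def)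
 show "(LINT z:Qcyl|lebesgue. v z * dvg p z) = (LINT z:Qcyl|lborel. v z * dvg p z)"
  unfolding sli_def by (rule integral_completion[OF m])
qed

lemma dual_value_mix:
 assumes v: "profile v" "profile w" and p: "p : C1c Ucyl"
 shows "dual_value (%z. (1 - t) * v z + t * w z) p = (1 - t) * dual_value v p + t * dual_value w p"
proof -
 have "(LINT z:Qcyl|lebesgue. ((1 - t) * v z + t * w z) * dvg p z)
   = (LINT z:Qcyl|lebesgue. (1 - t) * (v z * dvg p z) + t * (w z * dvg p z))"
  by (simp add: algebra_simps)
 also have "... = (1 - t) * (LINT z:Qcyl|lebesgue. v z * dvg p z) + t * (LINT z:Qcyl|lebesgue. w z * dvg p z)"
  using profile_integrable[OF v(1) p] profile_integrable[OF v(2) p] by simp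
 finally show ?thesis by (simp add: dual_value_def algebra_simps)
qed

lemma profile_mix:
 assumes "profile v" "profile w" "0 <= t" "t <= 1"
 shows "profile (%z. (1 - t) * v z + t * w z)"
proof -
 have "0 <= (1 - t) * v z + t * w z & (1 - t) * v z + t * w z <= 1" for z
  using assms(3,4) profileD(2,3)[OF assms(1), of z] profileD(2,3)[OF assms(2), of z]
   convex_bound_le[of "v z" 1 "w z" "1 - t" t] by simp
 thus ?thesis using profileD(1)[OF assms(1)] profileD(1)[OF assms(2)] unfolding profile_def by (intro conjI allI) simp_all
qed

text \<open>Each constraint is continuous for the \<open>L^1\<close> distance on the cylinder
  because the divergence is bounded; this is what strong convergence of profiles is used
  for.\<close>

lemma dual_value_diff:
 assumes v: "profile v" "profile w" and p: "p : C1c Ucyl" and B: "!!z. \<bar>dvg p z\<bar> <= B"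
 shows "\<bar>dual_value v p - dual_value w p\<bar> <= B * (LINT z:Qcyl|lborel. \<bar>w z - v z\<bar>)"
proof -
 note i = interior_integral_lborel[OF v(1) p] interior_integral_lborel[OF v(2) p]
 have B0: "0 <= B" using B[of undefined] by linarith
 have di: "set_integrable lborel Qcyl (%z. \<bar>w z - v z\<bar>)"
  unfolding set_integrable_def
 proof (rule int_bdd_ind[of _ _ _ 1])
  have "norm \<bar>w z - v z\<bar> <= 1" for z using profileD(2,3)[OF v(1), of z] profileD(2,3)[OF v(2), of z] by simp
  thus "AE z in lborel. z : Qcyl --> norm \<bar>w z - v z\<bar> <= 1" by simp
 qed (use Qcyl_borel Qcyl_finite profileD(1)[OF v(1)] profileD(1)[OF v(2)] in auto)
 have "dual_value v p - dual_value w p = (LINT z:Qcyl|lborel. w z * dvg p z - v z * dvg p z)"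
  using i by (simp add: dual_value_def)
 also have "\<bar>...\<bar> <= (LINT z:Qcyl|lborel. B * \<bar>w z - v z\<bar>)"
  unfolding sli_def real_norm_def[symmetric]
 proof (rule lint_norm_le)
  show "integrable lborel (%z. indicator Qcyl z *. (w z * dvg p z - v z * dvg p z))"
   using set_integral_diff(1)[OF i(3) i(1)] by (simp add: set_integrable_def)
  show "integrable lborel (%z. indicator Qcyl z *. (B * norm (w z - v z)))"
   using set_integrable_mult_right[of B lborel Qcyl "%z. \<bar>w z - v z\<bar>"] di by (simp add: set_integrable_def)
  show "norm (indicator Qcyl z *. (w z * dvg p z - v z * dvg p z)) <= indicator Qcyl z *. (B * norm (w z - v z))" for z
  proof -
   have "w z * dvg p z - v z * dvg p z = dvg p z * (w z - v z)" by (simp add: algebra_simps)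
   hence "norm (w z * dvg p z - v z * dvg p z) <= B * norm (w z - v z)"
    using mult_right_mono[OF B[of z], of "\<bar>w z - v z\<bar>"] by (simp add: abs_mult)
   hence le: "norm (r *. (w z * dvg p z - v z * dvg p z)) <= r *. (B * norm (w z - v z))" if "0 <= r" for r
    unfolding norm_scaleR using that by (simp add: mult_left_mono)
   show ?thesis by (rule le) simp
  qed
 qed
 also have "... = B * (LINT z:Qcyl|lborel. \<bar>w z - v z\<bar>)" by simp
 finally show ?thesis .
qed

text \<open>For finitely many fields the minimax theorem reaches every level above \<open>d\<close>,
  but not \<open>d\<close> itself. Constraints are therefore indexed by a field together with a
  slack \<open>1 / (n + 1)\<close>, and the limit profile satisfies all of them.\<close>

lemma optimal_profile:
 assumes le: "!!p. p : fields \<tau> ==> EX v. profile v & dual_value v p <= d"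
 shows "EX v. profile v & (ALL p:fields \<tau>. dual_value v p <= d)"
proof -
 have Y: "p : C1c Ucyl" "p : K_set Om M \<tau>" if "p : fields \<tau>" for p using that by (auto simp: fields_def)
 have p0: "profile (%z. 0)" by (simp add: profile_def)
 have fin: "EX v. profile v & (ALL p:F. dual_value v p <= c)" if F: "finite F" "F \<subseteq> fields \<tau>" and c: "d < c" for F c
 proof -
  have "EX v:{v. profile v}. ALL p:F. dual_value v p <= c"
  proof (rule finite_minimax[OF F, where mixX="%t v w z. (1 - t) * v z + t * w z" and mixY="%t p q z. (1 - t) *. p z + t *. q z" and d=d])
   show "{v. profile v} ~= {}" using p0 by blast
   show "(%z. (1 - t) *. p z + t *. q z) : fields \<tau>" if "p : fields \<tau>" "q : fields \<tau>" "0 <= t" "t <= 1" for p q t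
    using C1_linear[OF Y(1)[OF that(1)] Y(1)[OF that(2)]] K_set_convex[OF Y(2)[OF that(1)] Y(2)[OF that(2)] that(3,4)] by (simp add: fields_def)
   show "dual_value v (%z. (1 - t) *. p z + t *. q z) = (1 - t) * dual_value v p + t * dual_value v q"
    if "v : {v. profile v}" "p : fields \<tau>" "q : fields \<tau>" for v p q t
    using that(1) by (intro dual_value_linear Y that) simp
   show "dual_value (%z. (1 - t) * v z + t * w z) p = (1 - t) * dual_value v p + t * dual_value w p"
    if "v : {v. profile v}" "w : {v. profile v}" "p : fields \<tau>" for v w p t
    using that(1,2) by (intro dual_value_mix Y that) simp_all
   show "EX v:{v. profile v}. dual_value v p <= d" if "p : fields \<tau>" for p using le[OF that] by simp
  qed (use profile_mix c in auto)
  thus ?thesis by simp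
 qed
 define m where "m = density lborel (%z. ennreal (indicator Qcyl z))"
 have sm: "sets m = sets borel" by (simp add: m_def)
 have fm: "finite_measure m"
 proof
  have "emeasure m (space m) = emeasure lborel Qcyl"
   unfolding m_def using Qcyl_borel by (subst emeasure_density) (auto simp: ennreal_indicator)
  thus "emeasure m (space m) ~= \<infinity>" using Qcyl_finite by simp
 qed
 define T where "T = (%F :: ((plane \<times> real => plane \<times> real) \<times> nat) set. {v. profile v & (ALL i:F. fst i : fields \<tau> --> dual_value v (fst i) <= d + 1 / real (Suc (snd i)))})"
 obtain v where v: "v : borel_measurable m" "!!z. 0 <= v z & v z <= 1"
  "!!i. EX w. (ALL n. w n : T {i}) & (%n. \<integral>z. \<bar>w n z - v z\<bar> \<partial>m) \<longlonglongrightarrow> 0"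
 proof (rule directed_L2_limit[OF fm, of T])
  show "w : borel_measurable m" if "w : T F" for F w
   using that profileD(1)[of w] by (simp add: T_def measurable_cong_sets[OF sm refl])
  show "0 <= w z & w z <= 1" if "w : T F" for F w z using that profileD(2,3)[of w z] by (simp add: T_def)
  show "(%z. (w z + w' z) / 2) : T F" if "w : T F" "w' : T F" for F w w'
  proof -
   have pw: "profile w" "profile w'" using that by (auto simp: T_def)
   have eq: "(%z. (w z + w' z) / 2) = (%z. (1 - 1/2) * w z + (1/2) * w' z)" by (simp add: add_divide_distrib)
   have "dual_value (%z. (1 - 1/2) * w z + (1/2) * w' z) (fst i) <= d + 1 / real (Suc (snd i))" if i: "i : F" "fst i : fields \<tau>" for i
    unfolding dual_value_mix[OF pw Y(1)[OF i(2)]]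
    by (rule convex_bound_le) (use i \<open>w : T F\<close> \<open>w' : T F\<close> in \<open>auto simp: T_def\<close>)
   moreover have "profile (%z. (1 - 1/2) * w z + (1/2) * w' z)" by (rule profile_mix[OF pw]) auto
   ultimately show ?thesis unfolding eq by (simp add: T_def)
  qed
  show "T F ~= {}" if "finite F" for F
  proof -
   \<comment> \<open>The smallest slack that occurs in \<open>F\<close> serves for all of its
     constraints; the inserted 0 covers the empty family.\<close>
   define N where "N = Max (insert 0 (snd ` F))"
   have N: "snd i <= N" if "i : F" for i using that \<open>finite F\<close> by (auto simp: N_def)
   obtain w where w: "profile w" "!!p. p : fst ` F Int fields \<tau> ==> dual_value w p <= d + 1 / real (Suc N)"
    using fin[of "fst ` F Int fields \<tau>" "d + 1 / real (Suc N)"] \<open>finite F\<close> by auto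
   have "dual_value w (fst i) <= d + 1 / real (Suc (snd i))" if "i : F" "fst i : fields \<tau>" for i
   proof -
    have "dual_value w (fst i) <= d + 1 / real (Suc N)" using that by (intro w(2)) auto
    also have "1 / real (Suc N) <= 1 / real (Suc (snd i))" using N[OF that(1)] by (simp add: frac_le)
    finally show ?thesis by simp
   qed
   thus ?thesis using w(1) by (auto simp: T_def)
  qed
  show "T G \<subseteq> T F" if "F \<subseteq> G" for F G using that by (auto simp: T_def)
 qed blast
 have vb: "v : borel_fun" using v(1) by (simp add: measurable_cong_sets[OF sm refl])
 have pv: "profile v" unfolding profile_def using vb v(2) by (intro conjI allI) auto
 have "dual_value v p <= d" if p: "p : fields \<tau>" for p
 proof (rule field_le_epsilon)
  fix e :: real assume "0 < e"
  then obtain n where n: "1 / real (Suc n) < e" using nat_approx_posE by blast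
  obtain w where w: "!!k. w k : T {(p, n)}" "(%k. \<integral>z. \<bar>w k z - v z\<bar> \<partial>m) \<longlonglongrightarrow> 0" using v(3)[of "(p, n)"] by blast
  obtain K B where B: "!!z. \<bar>dvg p z\<bar> <= B" by (rule divergence_props[OF Y(1)[OF p]]) (rule that)
  have pw: "profile (w k)" "dual_value (w k) p <= d + 1 / real (Suc n)" for k using w(1)[of k] p by (auto simp: T_def)
  have wm: "(%z. \<bar>w k z - v z\<bar>) : borel_fun" for k using profileD(1)[OF pw(1)[of k]] vb by simp
  have eq: "(LINT z|m. \<bar>w k z - v z\<bar>) = (LINT z:Qcyl|lborel. \<bar>w k z - v z\<bar>)" for k
   unfolding m_def sli_def using wm[of k] Qcyl_borel by (subst integral_density) auto
  have "dual_value v p <= d + 1 / real (Suc n) + B * (LINT z|m. \<bar>w k z - v z\<bar>)" for k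
   using dual_value_diff[OF pv pw(1) Y(1)[OF p] B, of k] pw(2)[of k] by (simp add: eq)
  moreover have "(%k. d + 1 / real (Suc n) + B * (LINT z|m. \<bar>w k z - v z\<bar>)) \<longlonglongrightarrow> d + 1 / real (Suc n) + B * 0" by (intro tendsto_intros w(2))
  ultimately have "dual_value v p <= d + 1 / real (Suc n) + B * 0" by (intro LIMSEQ_le_const) auto
  thus "dual_value v p <= d + e" using n by simp
 qed
 thus ?thesis using pv by blast
qed

text \<open>The indicator of positive divergence makes \<open>v * dvg p\<close> pointwise as large
  as possible, which gives \<open>dual_value\<close> its least value over profiles.\<close>

lemma dual_maximizer:
 assumes M: "0 < M" and p: "p : C1c Ucyl"
 shows "EX v. profile v & dual_value v p = D_fun Om M bu p"
proof -
 define v where "v = (%z. of_bool (0 < dvg p z) :: real)"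
 obtain K B where d: "continuous_on UNIV (dvg p)" by (rule divergence_props[OF p]) (rule that)
 have "v : borel_fun" unfolding v_def using borel_contI[OF d] by measurable
 hence pv: "profile v" by (auto simp: profile_def v_def)
 have "v z * dvg p z = max 0 (dvg p z)" for z by (cases "0 < dvg p z") (auto simp: v_def)
 hence "dual_value v p = D_fun Om M bu p"
  using interior_integral_lborel(2)[OF pv p] by (simp add: dual_value_def D_fun_eq[OF M C1_continuous[OF p]])
 thus ?thesis using pv by blast
qed

lemma pairing_zero: "w : C_set Om M bu ==> pairing Om M (%z. 0) w = 0"
 by (rule pairing_representation) (auto simp: sli_def)

text \<open>\<open>S \<le> I\<close> is weak duality, and \<open>I\<close> is at most every value of
  \<open>G_fun\<close> by exchange of supremum and infimum. The optimal profile, glued to the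
  prescribed data, has \<open>G_fun\<close> at most \<open>S\<close>, so the three values
  coincide.\<close>

lemma strong_duality:
 assumes \<tau>: "transportation_cost \<tau>" "0 < right_deriv0 \<tau>"
 shows "EX v:C_set Om M bu.
   (ALL w:C_set Om M bu. G_fun Om M \<tau> v <= G_fun Om M \<tau> w) &
   G_fun Om M \<tau> v = (SUP \<phi> \<in> K_set Om M \<tau>. INF w \<in> C_set Om M bu. ereal (pairing Om M \<phi> w)) &
   (SUP \<phi> \<in> K_set Om M \<tau>. INF w \<in> C_set Om M bu. ereal (pairing Om M \<phi> w)) =
    (SUP \<phi> \<in> K_set Om M \<tau> Int C1_upto Qcyl. ereal (D_fun Om M bu \<phi>))"
proof -
 define I where "I = (SUP \<phi> \<in> K_set Om M \<tau>. INF w \<in> C_set Om M bu. ereal (pairing Om M \<phi> w))"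
 define S where "S = (SUP \<phi> \<in> K_set Om M \<tau> Int C1_upto Qcyl. ereal (D_fun Om M bu \<phi>))"
 have z: "(%z. 0) : K_set Om M \<tau> Int C1_upto Qcyl" using zero_K_set[OF \<tau>] C1_upto_subset[OF C1_const] by blast
 have IG: "I <= G_fun Om M \<tau> w" if "w : C_set Om M bu" for w
  unfolding I_def G_fun_def by (intro SUP_mono') (use that in \<open>auto intro: INF_lower\<close>)
 have "EX d. S = ereal d & ereal d <= I & (ALL p:fields \<tau>. EX v. profile v & dual_value v p <= d)"
 proof (cases "0 < M")
  case True
  have "S <= ereal (2 * \<tau> M * len)"
   unfolding S_def
  proof (rule SUP_least)
   fix \<phi> assume \<phi>: "\<phi> : K_set Om M \<tau> Int C1_upto Qcyl"
   hence "continuous_on Acyl \<phi>" by (simp add: K_set_def)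
   moreover have "0 <= (LINT z:Qcyl|lborel. max 0 (dvg \<phi> z))"
    unfolding sli_def by (intro Bochner_Integration.integral_nonneg) simp
   ultimately have "D_fun Om M bu \<phi> <= 2 * \<tau> M * len" using D_fun_eq[OF True] flux_K_bound[OF \<tau>(1), of \<phi>] \<phi> by simp
   thus "ereal (D_fun Om M bu \<phi>) <= ereal (2 * \<tau> M * len)" by simp
  qed
  moreover have up: "ereal (D_fun Om M bu \<phi>) <= S" if "\<phi> : K_set Om M \<tau> Int C1_upto Qcyl" for \<phi>
   unfolding S_def using that by (rule SUP_upper)
  hence "ereal (D_fun Om M bu (%z. 0)) <= S" using z by blast
  ultimately obtain d where d: "S = ereal d" by (cases S) auto
  have "S <= I"
   unfolding S_def I_def
  proof (rule SUP_least)
   fix \<phi> assume \<phi>: "\<phi> : K_set Om M \<tau> Int C1_upto Qcyl"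
   have "ereal (D_fun Om M bu \<phi>) <= (INF w \<in> C_set Om M bu. ereal (pairing Om M \<phi> w))"
    using D_fun_le_pairing[OF True, of \<phi>] \<phi> by (intro INF_greatest) simp
   also have "... <= (SUP \<phi> \<in> K_set Om M \<tau>. INF w \<in> C_set Om M bu. ereal (pairing Om M \<phi> w))" using \<phi> by (intro SUP_upper) simp
   finally show "ereal (D_fun Om M bu \<phi>) <= (SUP \<phi> \<in> K_set Om M \<tau>. INF w \<in> C_set Om M bu. ereal (pairing Om M \<phi> w))" .
  qed
  moreover have "EX v. profile v & dual_value v p <= d" if p: "p : fields \<tau>" for p
  proof -
   have pc: "p : C1c Ucyl" "p : K_set Om M \<tau>" using p by (auto simp: fields_def)
   have "p : C1_upto UNIV" by (rule C1c_E[OF pc(1)])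
   hence "p : C1_upto Qcyl" by (rule C1_upto_subset)
   hence "D_fun Om M bu p <= d" using up[of p] pc d by simp
   thus ?thesis using dual_maximizer[OF True pc(1)] by auto
  qed
  ultimately show ?thesis using d by auto
 next
  case False
  \<comment> \<open>The open cylinder is empty, so both integrals in \<open>D_fun\<close> vanish,
    and \<open>\<tau> 0 = 0\<close> makes the flux of every constraint field nonpositive; the zero
    profile then satisfies all constraints with level 0.\<close>
  hence M: "M = 0" using M_nonneg by simp
  have "D_fun Om M bu \<phi> = 0" for \<phi> by (simp add: D_fun_def M sli_def)
  hence "S = ereal 0" unfolding S_def using z by (auto intro!: SUP_eqI)
  moreover have "ereal 0 <= I"
  proof -
   have "ereal 0 <= (INF w \<in> C_set Om M bu. ereal (pairing Om M (%z. 0) w))" by (intro INF_greatest) (simp add: pairing_zero)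
   also have "... <= I" unfolding I_def using z by (intro SUP_upper) simp
   finally show ?thesis .
  qed
  moreover have "EX v. profile v & dual_value v p <= 0" if p: "p : fields \<tau>" for p
  proof (intro exI conjI)
   show "profile (%z. 0)" by (simp add: profile_def)
   have "\<tau> M = 0" using \<tau>(1) by (simp add: transportation_cost_def M)
   moreover have "flux M bu p <= 2 * \<tau> M * len" using p by (intro flux_K_bound[OF \<tau>(1)]) (simp add: fields_def)
   ultimately show "dual_value (%z. 0) p <= 0" by (simp add: dual_value_def)
  qed
  ultimately show ?thesis by blast
 qed
 then obtain d where d: "S = ereal d" "ereal d <= I" "!!p. p : fields \<tau> ==> EX v. profile v & dual_value v p <= d" by blast
 obtain v where v: "profile v" "!!p. p : fields \<tau> ==> dual_value v p <= d" using optimal_profile[of \<tau> d] d(3) by blast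
 have wC: "glue v : C_set Om M bu"
  by (rule glue_in_C_set[OF \<tau> v(1)]) (auto intro!: v(2) simp: fields_def)
 have Gd: "G_fun Om M \<tau> (glue v) <= ereal d"
  unfolding G_fun_def
 proof (rule SUP_least)
  fix \<phi> assume \<phi>: "\<phi> : K_set Om M \<tau>"
  have "pairing Om M \<phi> (glue v) <= d"
   by (rule pairing_le_of_dense[OF \<tau> wC _ \<phi>]) (auto intro!: v(2) simp: dual_value_glue fields_def)
  thus "ereal (pairing Om M \<phi> (glue v)) <= ereal d" by simp
 qed
 have "G_fun Om M \<tau> (glue v) = I" using Gd d(2) IG[OF wC] by (metis order_antisym order_trans)
 moreover have "I = S" using Gd d(1,2) IG[OF wC] by (metis order_antisym order_trans)
 ultimately show ?thesis using wC IG unfolding I_def[symmetric] S_def[symmetric] by (intro bexI[of _ "glue v"]) auto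
qed

end

theorem theorem2p3:
  fixes \<Omega> :: "(real^2) set" and \<tau> :: "real \<Rightarrow> real" and \<gamma> :: "real \<Rightarrow> real^2"
    and \<mu>p \<mu>m :: "(real^2) measure" and M :: real
  assumes "open \<Omega>" and "bounded \<Omega>" and "convex \<Omega>" and "\<Omega> \<noteq> {}"
    and "transportation_cost \<tau>" and "0 < right_deriv0 \<tau>"
    and "ccw_arclength_param \<Omega> \<gamma>"
    and "finite_radon_on (frontier \<Omega>) \<mu>p" and "finite_radon_on (frontier \<Omega>) \<mu>m"
    and "measure \<mu>p (frontier \<Omega>) = measure \<mu>m (frontier \<Omega>)"
    and "\<forall>x \<in> nbhd1 \<Omega> - \<Omega>. 0 \<le> bdry_u \<Omega> \<gamma> \<mu>p \<mu>m x \<and> bdry_u \<Omega> \<gamma> \<mu>p \<mu>m x \<le> M"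
    and "\<exists>x \<in> nbhd1 \<Omega> - \<Omega>. bdry_u \<Omega> \<gamma> \<mu>p \<mu>m x = 0"
    and "\<exists>x \<in> nbhd1 \<Omega> - \<Omega>. bdry_u \<Omega> \<gamma> \<mu>p \<mu>m x = M"
    and "M \<le> measure \<mu>p (frontier \<Omega>)"
  shows "\<exists>v \<in> C_set \<Omega> M (bdry_u \<Omega> \<gamma> \<mu>p \<mu>m).
      (\<forall>w \<in> C_set \<Omega> M (bdry_u \<Omega> \<gamma> \<mu>p \<mu>m). G_fun \<Omega> M \<tau> v \<le> G_fun \<Omega> M \<tau> w) \<and>
      G_fun \<Omega> M \<tau> v =
        (SUP \<phi> \<in> K_set \<Omega> M \<tau>. INF w \<in> C_set \<Omega> M (bdry_u \<Omega> \<gamma> \<mu>p \<mu>m). ereal (pairing \<Omega> M \<phi> w)) \<and>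
      (SUP \<phi> \<in> K_set \<Omega> M \<tau>. INF w \<in> C_set \<Omega> M (bdry_u \<Omega> \<gamma> \<mu>p \<mu>m). ereal (pairing \<Omega> M \<phi> w)) =
        (SUP \<phi> \<in> K_set \<Omega> M \<tau> \<inter> C1_upto (\<Omega> \<times> {0<..<M}). ereal (D_fun \<Omega> M (bdry_u \<Omega> \<gamma> \<mu>p \<mu>m) \<phi>))"
proof -
 interpret boundary_data \<Omega> \<gamma> \<mu>p \<mu>m M
  by unfold_locales (use assms in auto)
 show ?thesis by (rule strong_duality[OF assms(5,6)])
qed

end
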